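(* Let $R$ be a principal ideal domain and let $\mathbf{grA}$ denote the category of graded algebras over $R$. The functor $\mathrm{Cotor}$ restricts and corestricts to functors $$\mathrm{Cotor}^{(-)}(R;-):\mathbf{CA}^\ell\to\mathbf{grA}\qquad\text{and}\qquad\mathrm{Cotor}^{(-)}(-;R):\mathbf{CA}^r\to\mathbf{grA},$$ sending $(H;B)$ to $\mathrm{Cotor}^H(R,B)$ and to $\mathrm{Cotor}^H(B,R)$, respectively.
   Context: Chain complexes are over $R$, with $R$-free underlying graded modules for all chain (co)algebras; the Koszul sign convention is used. $V_+=V_{>0}$; $s^{-1}$ is desuspension, $s^{-1}1:=0$. A chain Hopf algebra $H$ is a chain algebra with a coassociative counital comultiplication that is a chain algebra map; those considered are simply connected ($H$ non-negatively graded, $H_0=R$, $H_1=0$). $\Omega H=(T(s^{-1}H_+),d_\Omega)$ with $d_\Omega(s^{-1}c)=-s^{-1}(dc)+\sum(-1)^{|c_i|}s^{-1}c_i\,s^{-1}c^i$, $\overline\Delta(c)=\sum c_i\otimes c^i$ the reduced comultiplication. A left (right) $H$-comodule algebra is a chain algebra $B$ with a left (right) $H$-coaction that is a chain algebra map. Objects of $\mathbf{CA}^\ell$ are pairs $(H;B)$ with $H$ a chain Hopf algebra and $B$ a left $H$-comodule algebra; a morphism $(H;B)\to(H';B')$ is a pair $(f;g)$ with $f:H\to H'$ a morphism of chain Hopf algebras and $g:B\to B'$ a chain algebra map with $(f\otimes g)\nu=\nu'g$, $\nu,\nu'$ the coactions. $\mathbf{CA}^r$ is the analogous category of right comodule algebras.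 For a right comodule $M$ and left comodule $N$ over a coalgebra $H$, $\mathrm{Cotor}^H(M,N)$ is the derived functor of the cotensor product, $\mathrm{Cotor}^H(M,N)=\mathrm H_*\big((M\otimes_{t_\Omega}\Omega H)\otimes_{\Omega H}(\Omega H\otimes_{t_\Omega}N)\big)$, natural also in the coalgebra; in particular $\mathrm{Cotor}^H(R,B)=\mathrm H_*(\Omega H\otimes_{t_\Omega}B)$ and $\mathrm{Cotor}^H(B,R)=\mathrm H_*(B\otimes_{t_\Omega}\Omega H)$. Here $\Omega H\otimes_{t_\Omega}B$ is $\Omega H\otimes B$ with $D_\Omega(w\otimes b)=d_\Omega w\otimes b+(-1)^{|w|}w\otimes db+(-1)^{|w|}\sum w\,s^{-1}h_i\otimes b^i$ where $\nu(b)=\sum h_i\otimes b^i$, and $B\otimes_{t_\Omega}\Omega H$ is $B\otimes\Omega H$ with $D_\Omega(b\otimes w)=db\otimes w+(-1)^{|b|}b\otimes d_\Omega w-\sum(-1)^{|b_i|}b_i\otimes s^{-1}h^i\,w$ where $\nu(b)=\sum b_i\otimes h^i$. The graded algebra structures are those induced in homology by the chain algebra structures in which $\Omega H$ and $B$ are subalgebras and: on $\Omega H\otimes_{t_\Omega}B$, $(w\otimes1)(1\otimes b)=w\otimes b$ and $(1\otimes b)(s^{-1}a\otimes1)=\sum(-1)^{|h_i|+(|a|+1)|b^i|}s^{-1}(h_ia)\otimes b^i$; on $B\otimes_{t_\Omega}\Omega H$, $(b\otimes1)(1\otimes w)=b\otimes w$ and $(1\otimes s^{-1}a)(b\otimes1)=\sum(-1)^{(|a|-1)|b_i|}b_i\otimes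 s^{-1}(a h^i)$, for $a\in H_+$. *)

theory Defs
  imports "HOL-Algebra.QuotRing" "HOL-Algebra.Ring_Divisibility" "HOL-Algebra.Module"
    "HOL-Library.Function_Algebras"
begin

section \<open>Graded modules and graded algebras\<close>

text \<open>The ground ring is a type \<open>'r\<close>, seen as a ring record so that the notions of HOL-Algebra apply.\<close>

definition scalars :: "'r::comm_ring_1 ring" where
  "scalars = \<lparr>carrier = UNIV, mult = (*), one = 1, zero = 0, add = (+)\<rparr>"

text \<open>Gradings are internal: \<open>hcomp A n\<close> is the submodule of elements of degree \<open>n\<close>, and the
  carrier is the direct sum of these.  A graded module uses the same record; its multiplicative
  fields are then irrelevant.\<close>

record ('r, 'a) gralg = "('r, 'a) module" +
  hcomp :: "int \<Rightarrow> 'a set"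

definition decomposition :: "('r, 'a, 'm) gralg_scheme \<Rightarrow> 'a \<Rightarrow> (int \<Rightarrow> 'a) \<Rightarrow> bool" where
  "decomposition M x c \<longleftrightarrow> (\<forall>n. c n \<in> hcomp M n) \<and> finite {n. c n \<noteq> \<zero>\<^bsub>M\<^esub>} \<and>
     x = (\<Oplus>\<^bsub>M\<^esub>n\<in>{n. c n \<noteq> \<zero>\<^bsub>M\<^esub>}. c n)"

definition graded_module :: "('r::comm_ring_1, 'a, 'm) gralg_scheme \<Rightarrow> bool" where
  "graded_module M \<longleftrightarrow> module scalars M \<and> (\<forall>n. submodule (hcomp M n) scalars M) \<and>
     (\<forall>x\<in>carrier M. \<exists>!c. decomposition M x c)"

definition graded_algebra :: "('r::comm_ring_1, 'a, 'm) gralg_scheme \<Rightarrow> bool" where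
  "graded_algebra A \<longleftrightarrow> graded_module A \<and> ring A \<and>
     (\<forall>r. \<forall>x\<in>carrier A. \<forall>y\<in>carrier A.
        (r \<odot>\<^bsub>A\<^esub> x) \<otimes>\<^bsub>A\<^esub> y = r \<odot>\<^bsub>A\<^esub> (x \<otimes>\<^bsub>A\<^esub> y) \<and>
        x \<otimes>\<^bsub>A\<^esub> (r \<odot>\<^bsub>A\<^esub> y) = r \<odot>\<^bsub>A\<^esub> (x \<otimes>\<^bsub>A\<^esub> y)) \<and>
     \<one>\<^bsub>A\<^esub> \<in> hcomp A 0 \<and>
     (\<forall>m n. \<forall>x\<in>hcomp A m. \<forall>y\<in>hcomp A n. x \<otimes>\<^bsub>A\<^esub> y \<in> hcomp A (m + n))"

definition graded_linear ::
  "int \<Rightarrow> ('r, 'a, 'm) gralg_scheme \<Rightarrow> ('r, 'b, 'n) gralg_scheme \<Rightarrow> ('a \<Rightarrow> 'b) \<Rightarrow> bool" where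
  "graded_linear k M N f \<longleftrightarrow> f \<in> carrier M \<rightarrow> carrier N \<and>
     (\<forall>x\<in>carrier M. \<forall>y\<in>carrier M. f (x \<oplus>\<^bsub>M\<^esub> y) = f x \<oplus>\<^bsub>N\<^esub> f y) \<and>
     (\<forall>r. \<forall>x\<in>carrier M. f (r \<odot>\<^bsub>M\<^esub> x) = r \<odot>\<^bsub>N\<^esub> f x) \<and>
     (\<forall>n. \<forall>x\<in>hcomp M n. f x \<in> hcomp N (n + k))"

definition gralg_hom ::
  "('r, 'a, 'm) gralg_scheme \<Rightarrow> ('r, 'b, 'n) gralg_scheme \<Rightarrow> ('a \<Rightarrow> 'b) \<Rightarrow> bool" where
  "gralg_hom A B f \<longleftrightarrow> graded_linear 0 A B f \<and> f \<in> ring_hom A B"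

definition homogeneous_basis :: "('r::comm_ring_1, 'a, 'm) gralg_scheme \<Rightarrow> 'a set \<Rightarrow> bool" where
  "homogeneous_basis M X \<longleftrightarrow> X \<subseteq> (\<Union>n. hcomp M n) \<and>
     (\<forall>v\<in>carrier M. \<exists>!c :: 'a \<Rightarrow> 'r. {x. c x \<noteq> 0} \<subseteq> X \<and> finite {x. c x \<noteq> 0} \<and>
        v = (\<Oplus>\<^bsub>M\<^esub>x\<in>{x. c x \<noteq> 0}. c x \<odot>\<^bsub>M\<^esub> x))"

definition graded_free :: "('r::comm_ring_1, 'a, 'm) gralg_scheme \<Rightarrow> bool" where
  "graded_free M \<longleftrightarrow> (\<exists>X. homogeneous_basis M X)"

text \<open>Only meaningful for nonzero homogeneous elements, whose degree is unique.\<close>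

definition gdeg :: "('r, 'a, 'm) gralg_scheme \<Rightarrow> 'a \<Rightarrow> int" where
  "gdeg M x = (THE n. x \<in> hcomp M n)"

definition ksign :: "int \<Rightarrow> 'r::comm_ring_1" where
  "ksign n = (if even n then 1 else - 1)"

section \<open>Chain algebras\<close>

record ('r, 'a) chalg = "('r, 'a) gralg" +
  dif :: "'a \<Rightarrow> 'a"

text \<open>Underlying graded modules of chain algebras are free by convention.  Degrees may be negative.\<close>

definition chain_algebra :: "('r::comm_ring_1, 'a, 'm) chalg_scheme \<Rightarrow> bool" where
  "chain_algebra A \<longleftrightarrow> graded_algebra A \<and> graded_free A \<and> graded_linear (- 1) A A (dif A) \<and>
     (\<forall>x\<in>carrier A. dif A (dif A x) = \<zero>\<^bsub>A\<^esub>) \<and>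
     (\<forall>n. \<forall>x\<in>hcomp A n. \<forall>y\<in>carrier A.
        dif A (x \<otimes>\<^bsub>A\<^esub> y) = dif A x \<otimes>\<^bsub>A\<^esub> y \<oplus>\<^bsub>A\<^esub> ksign n \<odot>\<^bsub>A\<^esub> (x \<otimes>\<^bsub>A\<^esub> dif A y))"

definition chain_algebra_hom ::
  "('r, 'a, 'm) chalg_scheme \<Rightarrow> ('r, 'b, 'n) chalg_scheme \<Rightarrow> ('a \<Rightarrow> 'b) \<Rightarrow> bool" where
  "chain_algebra_hom A B f \<longleftrightarrow> gralg_hom A B f \<and> (\<forall>x\<in>carrier A. f (dif A x) = dif B (f x))"

subsection \<open>Homology\<close>

definition cycles :: "('r, 'a, 'm) chalg_scheme \<Rightarrow> 'a set" where
  "cycles A = {x \<in> carrier A. dif A x = \<zero>\<^bsub>A\<^esub>}"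

definition boundaries :: "('r, 'a, 'm) chalg_scheme \<Rightarrow> 'a set" where
  "boundaries A = dif A ` carrier A"

text \<open>The quotient of the ring of cycles by the ideal of boundaries; scalars act on cosets in the
  same way as cosets are multiplied in \<^const>\<open>rcoset_mult\<close>.\<close>

definition homology :: "('r, 'a, 'm) chalg_scheme \<Rightarrow> ('r, 'a set) gralg" where
  "homology A = (let Q = A\<lparr>carrier := cycles A\<rparr> Quot boundaries A in
     \<lparr>carrier = carrier Q, mult = mult Q, one = one Q, zero = zero Q, add = add Q,
      smult = (\<lambda>r X. \<Union>x\<in>X. boundaries A +>\<^bsub>A\<^esub> (r \<odot>\<^bsub>A\<^esub> x)),
      hcomp = (\<lambda>n. {boundaries A +>\<^bsub>A\<^esub> z | z. z \<in> cycles A \<inter> hcomp A n})\<rparr>)"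

text \<open>The map sending the class of a cycle \<open>x\<close> to the class of \<open>f x\<close>.\<close>

definition homology_map :: "('r, 'b, 'n) chalg_scheme \<Rightarrow> ('a \<Rightarrow> 'b) \<Rightarrow> 'a set \<Rightarrow> 'b set" where
  "homology_map B f X = (\<Union>x\<in>X. boundaries B +>\<^bsub>B\<^esub> f x)"

section \<open>Tensor products of free graded modules\<close>

text \<open>All modules being free, \<open>M \<otimes> N\<close> is realised as the free module on \<open>X \<times> Y\<close> for homogeneous
  bases \<open>X\<close> of \<open>M\<close> and \<open>Y\<close> of \<open>N\<close>, that is, as the finitely supported functions on \<open>X \<times> Y\<close>.
  The universal bilinear map is \<open>tens M N\<close>.  The choice of bases is immaterial.\<close>

definition hbasis :: "('r::comm_ring_1, 'a, 'm) gralg_scheme \<Rightarrow> 'a set" where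
  "hbasis M = (SOME X. homogeneous_basis M X)"

definition coord :: "('r::comm_ring_1, 'a, 'm) gralg_scheme \<Rightarrow> 'a \<Rightarrow> 'a \<Rightarrow> 'r" where
  "coord M v = (if v \<in> carrier M
     then THE c. {x. c x \<noteq> 0} \<subseteq> hbasis M \<and> finite {x. c x \<noteq> 0} \<and>
            v = (\<Oplus>\<^bsub>M\<^esub>x\<in>{x. c x \<noteq> 0}. c x \<odot>\<^bsub>M\<^esub> x)
     else (\<lambda>x. 0))"

definition tens ::
  "('r::comm_ring_1, 'a, 'm) gralg_scheme \<Rightarrow> ('r, 'b, 'n) gralg_scheme \<Rightarrow> 'a \<Rightarrow> 'b \<Rightarrow> 'a \<times> 'b \<Rightarrow> 'r" where
  "tens M N a b = (\<lambda>(x, y). coord M a x * coord N b y)"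

definition fscale :: "'r::comm_ring_1 \<Rightarrow> ('p \<Rightarrow> 'r) \<Rightarrow> 'p \<Rightarrow> 'r" (infixr \<open>\<cdot>\<close> 75) where
  "r \<cdot> f = (\<lambda>p. r * f p)"

text \<open>\<open>lext \<beta>\<close> is the linear extension of a map \<open>\<beta>\<close> given on basis elements.  On a tensor product
  it renders Sweedler notation: if \<open>z = \<Sum> x\<^sub>i \<otimes> y\<^sub>i\<close> is the expansion of \<open>z\<close> in the homogeneous
  basis (coefficients included), then \<open>lext (\<lambda>(x, y). \<beta> x y) z\<close> is \<open>\<Sum> \<beta> x\<^sub>i y\<^sub>i\<close>.  As the \<open>x\<^sub>i\<close> and
  \<open>y\<^sub>i\<close> are homogeneous, \<open>\<beta>\<close> may involve signs depending on their degrees.\<close>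

definition lext :: "('p \<Rightarrow> 'q \<Rightarrow> 'r::comm_ring_1) \<Rightarrow> ('p \<Rightarrow> 'r) \<Rightarrow> 'q \<Rightarrow> 'r" where
  "lext \<beta> z = (\<lambda>q. \<Sum>p\<in>{p. z p \<noteq> 0}. z p * \<beta> p q)"

definition tensor ::
  "('r::comm_ring_1, 'a, 'm) chalg_scheme \<Rightarrow> ('r, 'b, 'n) chalg_scheme \<Rightarrow> ('r, 'a \<times> 'b \<Rightarrow> 'r) chalg" where
  "tensor A B =
     (let C = {z. finite {p. z p \<noteq> 0} \<and> {p. z p \<noteq> 0} \<subseteq> hbasis A \<times> hbasis B} in
     \<lparr>carrier = C,
      mult = (\<lambda>z z'. lext (\<lambda>(x, y). lext (\<lambda>(x', y').
         ksign (gdeg B y * gdeg A x') \<cdot> tens A B (x \<otimes>\<^bsub>A\<^esub> x') (y \<otimes>\<^bsub>B\<^esub> y')) z') z),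
      one = tens A B \<one>\<^bsub>A\<^esub> \<one>\<^bsub>B\<^esub>,
      zero = 0,
      add = (+),
      smult = (\<cdot>),
      hcomp = (\<lambda>n. {z \<in> C. \<forall>x y. z (x, y) \<noteq> 0 \<longrightarrow> gdeg A x + gdeg B y = n}),
      dif = lext (\<lambda>(x, y). tens A B (dif A x) y + ksign (gdeg A x) \<cdot> tens A B x (dif B y))\<rparr>)"

definition tensor_map ::
  "('r::comm_ring_1, 'c, 'm) gralg_scheme \<Rightarrow> ('r, 'd, 'n) gralg_scheme \<Rightarrow>
     ('a \<Rightarrow> 'c) \<Rightarrow> ('b \<Rightarrow> 'd) \<Rightarrow> ('a \<times> 'b \<Rightarrow> 'r) \<Rightarrow> 'c \<times> 'd \<Rightarrow> 'r" where
  "tensor_map A' B' f g = lext (\<lambda>(x, y). tens A' B' (f x) (g y))"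

section \<open>Chain Hopf algebras and comodule algebras\<close>

record ('r, 'h) chopf = "('r, 'h) chalg" +
  comult :: "'h \<Rightarrow> 'h \<times> 'h \<Rightarrow> 'r"
  counit :: "'h \<Rightarrow> 'r"

text \<open>Coassociativity is stated in \<open>H \<otimes> (H \<otimes> H)\<close>, with \<open>(x\<^sub>1 \<otimes> x\<^sub>2) \<otimes> y\<close> identified with
  \<open>x\<^sub>1 \<otimes> (x\<^sub>2 \<otimes> y)\<close>; likewise for coactions below.  The last three conditions say that \<open>H\<close> is simply
  connected.\<close>

definition chain_hopf_algebra :: "('r::comm_ring_1, 'h, 'm) chopf_scheme \<Rightarrow> bool" where
  "chain_hopf_algebra H \<longleftrightarrow> chain_algebra H \<and>
     chain_algebra_hom H (tensor H H) (comult H) \<and>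
     (\<forall>c\<in>carrier H.
        lext (\<lambda>(x, y). lext (\<lambda>(x\<^sub>1, x\<^sub>2). tens H (tensor H H) x\<^sub>1 (tens H H x\<^sub>2 y)) (comult H x)) (comult H c) =
        lext (\<lambda>(x, y). tens H (tensor H H) x (comult H y)) (comult H c)) \<and>
     (\<forall>x\<in>carrier H. \<forall>y\<in>carrier H. counit H (x \<oplus>\<^bsub>H\<^esub> y) = counit H x + counit H y) \<and>
     (\<forall>r. \<forall>x\<in>carrier H. counit H (r \<odot>\<^bsub>H\<^esub> x) = r * counit H x) \<and>
     (\<forall>n. \<forall>x\<in>hcomp H n. n \<noteq> 0 \<longrightarrow> counit H x = 0) \<and>
     (\<forall>c\<in>carrier H.
        (\<Oplus>\<^bsub>H\<^esub>p\<in>{p. comult H c p \<noteq> 0}. (comult H c p * counit H (fst p)) \<odot>\<^bsub>H\<^esub> snd p) = c \<and>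
        (\<Oplus>\<^bsub>H\<^esub>p\<in>{p. comult H c p \<noteq> 0}. (comult H c p * counit H (snd p)) \<odot>\<^bsub>H\<^esub> fst p) = c) \<and>
     (\<forall>n<0. hcomp H n = {\<zero>\<^bsub>H\<^esub>}) \<and>
     bij_betw (\<lambda>r. r \<odot>\<^bsub>H\<^esub> \<one>\<^bsub>H\<^esub>) UNIV (hcomp H 0) \<and>
     hcomp H 1 = {\<zero>\<^bsub>H\<^esub>}"

definition chain_hopf_algebra_hom ::
  "('r::comm_ring_1, 'h, 'm) chopf_scheme \<Rightarrow> ('r, 'k, 'n) chopf_scheme \<Rightarrow> ('h \<Rightarrow> 'k) \<Rightarrow> bool" where
  "chain_hopf_algebra_hom H H' f \<longleftrightarrow> chain_algebra_hom H H' f \<and>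
     (\<forall>c\<in>carrier H. tensor_map H' H' f f (comult H c) = comult H' (f c)) \<and>
     (\<forall>c\<in>carrier H. counit H' (f c) = counit H c)"

record ('r, 'b, 'h) lcomodalg = "('r, 'b) chalg" +
  lcoact :: "'b \<Rightarrow> 'h \<times> 'b \<Rightarrow> 'r"

record ('r, 'b, 'h) rcomodalg = "('r, 'b) chalg" +
  rcoact :: "'b \<Rightarrow> 'b \<times> 'h \<Rightarrow> 'r"

definition left_comodule_algebra ::
  "('r::comm_ring_1, 'h) chopf \<Rightarrow> ('r, 'b, 'h) lcomodalg \<Rightarrow> bool" where
  "left_comodule_algebra H B \<longleftrightarrow> chain_algebra B \<and>
     chain_algebra_hom B (tensor H B) (lcoact B) \<and>
     (\<forall>b\<in>carrier B.
        lext (\<lambda>(h, b'). lext (\<lambda>(h\<^sub>1, h\<^sub>2). tens H (tensor H B) h\<^sub>1 (tens H B h\<^sub>2 b')) (comult H h)) (lcoact B b) =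
        lext (\<lambda>(h, b'). tens H (tensor H B) h (lcoact B b')) (lcoact B b)) \<and>
     (\<forall>b\<in>carrier B.
        (\<Oplus>\<^bsub>B\<^esub>p\<in>{p. lcoact B b p \<noteq> 0}. (lcoact B b p * counit H (fst p)) \<odot>\<^bsub>B\<^esub> snd p) = b)"

definition right_comodule_algebra ::
  "('r::comm_ring_1, 'h) chopf \<Rightarrow> ('r, 'b, 'h) rcomodalg \<Rightarrow> bool" where
  "right_comodule_algebra H B \<longleftrightarrow> chain_algebra B \<and>
     chain_algebra_hom B (tensor B H) (rcoact B) \<and>
     (\<forall>b\<in>carrier B.
        lext (\<lambda>(b', h). lext (\<lambda>(b'', h'). tens B (tensor H H) b'' (tens H H h' h)) (rcoact B b')) (rcoact B b) =
        lext (\<lambda>(b', h). tens B (tensor H H) b' (comult H h)) (rcoact B b)) \<and>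
     (\<forall>b\<in>carrier B.
        (\<Oplus>\<^bsub>B\<^esub>p\<in>{p. rcoact B b p \<noteq> 0}. (rcoact B b p * counit H (snd p)) \<odot>\<^bsub>B\<^esub> fst p) = b)"

subsection \<open>The categories \<open>CA\<^sup>l\<close> and \<open>CA\<^sup>r\<close>\<close>

definition CAl_obj :: "('r::comm_ring_1, 'h) chopf \<times> ('r, 'b, 'h) lcomodalg \<Rightarrow> bool" where
  "CAl_obj = (\<lambda>(H, B). chain_hopf_algebra H \<and> left_comodule_algebra H B)"

definition CAr_obj :: "('r::comm_ring_1, 'h) chopf \<times> ('r, 'b, 'h) rcomodalg \<Rightarrow> bool" where
  "CAr_obj = (\<lambda>(H, B). chain_hopf_algebra H \<and> right_comodule_algebra H B)"

definition CAl_hom ::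
  "('r::comm_ring_1, 'h) chopf \<times> ('r, 'b, 'h) lcomodalg \<Rightarrow>
   ('r, 'k) chopf \<times> ('r, 'c, 'k) lcomodalg \<Rightarrow> ('h \<Rightarrow> 'k) \<times> ('b \<Rightarrow> 'c) \<Rightarrow> bool" where
  "CAl_hom = (\<lambda>(H, B) (H', B') (f, g).
     CAl_obj (H, B) \<and> CAl_obj (H', B') \<and>
     chain_hopf_algebra_hom H H' f \<and> chain_algebra_hom B B' g \<and>
     (\<forall>b\<in>carrier B. tensor_map H' B' f g (lcoact B b) = lcoact B' (g b)))"

definition CAr_hom ::
  "('r::comm_ring_1, 'h) chopf \<times> ('r, 'b, 'h) rcomodalg \<Rightarrow>
   ('r, 'k) chopf \<times> ('r, 'c, 'k) rcomodalg \<Rightarrow> ('h \<Rightarrow> 'k) \<times> ('b \<Rightarrow> 'c) \<Rightarrow> bool" where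
  "CAr_hom = (\<lambda>(H, B) (H', B') (f, g).
     CAr_obj (H, B) \<and> CAr_obj (H', B') \<and>
     chain_hopf_algebra_hom H H' f \<and> chain_algebra_hom B B' g \<and>
     (\<forall>b\<in>carrier B. tensor_map B' H' g f (rcoact B b) = rcoact B' (g b)))"

definition CA_id :: "('h \<Rightarrow> 'h) \<times> ('b \<Rightarrow> 'b)" where
  "CA_id = (id, id)"

definition CA_comp ::
  "('k \<Rightarrow> 'l) \<times> ('c \<Rightarrow> 'd) \<Rightarrow> ('h \<Rightarrow> 'k) \<times> ('b \<Rightarrow> 'c) \<Rightarrow> ('h \<Rightarrow> 'l) \<times> ('b \<Rightarrow> 'd)" where
  "CA_comp = (\<lambda>(f', g') (f, g). (f' \<circ> f, g' \<circ> g))"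

section \<open>The cobar construction\<close>

text \<open>\<open>desusp H\<close> is the graded module \<open>s\<^sup>-\<^sup>1H\<^sub>+\<close>: its elements are those of \<open>H\<^sub>+\<close>, with degrees lowered
  by one.\<close>

definition desusp :: "('r, 'h, 'm) gralg_scheme \<Rightarrow> ('r, 'h, 'm) gralg_scheme" where
  "desusp H = H\<lparr>carrier := {x \<in> carrier H. \<forall>n\<le>0. (THE c. decomposition H x c) n = \<zero>\<^bsub>H\<^esub>},
     hcomp := (\<lambda>n. if n \<ge> 0 then hcomp H (n + 1) else {\<zero>\<^bsub>H\<^esub>})\<rparr>"

text \<open>The tensor algebra on \<open>s\<^sup>-\<^sup>1H\<^sub>+\<close> consists of the finitely supported functions on the words in a
  homogeneous basis of \<open>s\<^sup>-\<^sup>1H\<^sub>+\<close>; the product is induced by concatenation of words.\<close>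

definition tword :: "'h list \<Rightarrow> 'h list \<Rightarrow> 'r::comm_ring_1" where
  "tword ws = (\<lambda>us. if us = ws then 1 else 0)"

definition tmult :: "('h list \<Rightarrow> 'r::comm_ring_1) \<Rightarrow> ('h list \<Rightarrow> 'r) \<Rightarrow> 'h list \<Rightarrow> 'r"
    (infixl \<open>\<star>\<close> 76) where
  "z \<star> z' = (\<lambda>ws. \<Sum>i\<le>length ws. z (take i ws) * z' (drop i ws))"

text \<open>\<open>sinv H h\<close> is \<open>s\<^sup>-\<^sup>1h\<close> for homogeneous \<open>h\<close>.  As \<^const>\<open>coord\<close> vanishes outside the carrier, it is
  \<open>0\<close> for \<open>h\<close> of degree \<open>0\<close>, in accordance with \<open>s\<^sup>-\<^sup>11 = 0\<close>.\<close>

definition sinv :: "('r::comm_ring_1, 'h, 'm) gralg_scheme \<Rightarrow> 'h \<Rightarrow> 'h list \<Rightarrow> 'r" where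
  "sinv H h = (\<lambda>ws. case ws of [x] \<Rightarrow> coord (desusp H) h x | _ \<Rightarrow> 0)"

definition reduced_comult :: "('r::comm_ring_1, 'h, 'm) chopf_scheme \<Rightarrow> 'h \<Rightarrow> 'h \<times> 'h \<Rightarrow> 'r" where
  "reduced_comult H c = comult H c - tens H H c \<one>\<^bsub>H\<^esub> - tens H H \<one>\<^bsub>H\<^esub> c"

definition cobar_gen :: "('r::comm_ring_1, 'h, 'm) chopf_scheme \<Rightarrow> 'h \<Rightarrow> 'h list \<Rightarrow> 'r" where
  "cobar_gen H c = - sinv H (dif H c) +
     lext (\<lambda>(x, y). ksign (gdeg H x) \<cdot> (sinv H x \<star> sinv H y)) (reduced_comult H c)"

text \<open>The derivation \<open>d\<^sub>\<Omega>\<close> on words, determined by its values \<^const>\<open>cobar_gen\<close> on generators.\<close>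

primrec cobar_word :: "('r::comm_ring_1, 'h, 'm) chopf_scheme \<Rightarrow> 'h list \<Rightarrow> 'h list \<Rightarrow> 'r" where
  "cobar_word H [] = 0"
| "cobar_word H (a # as) =
     cobar_gen H a \<star> tword as + ksign (gdeg H a - 1) \<cdot> (sinv H a \<star> cobar_word H as)"

definition cobar :: "('r::comm_ring_1, 'h, 'm) chopf_scheme \<Rightarrow> ('r, 'h list \<Rightarrow> 'r) chalg" where
  "cobar H =
     (let C = {z. finite {ws. z ws \<noteq> 0} \<and> {ws. z ws \<noteq> 0} \<subseteq> lists (hbasis (desusp H))} in
     \<lparr>carrier = C,
      mult = (\<star>),
      one = tword [],
      zero = 0,
      add = (+),
      smult = (\<cdot>),
      hcomp = (\<lambda>n. {z \<in> C. \<forall>ws. z ws \<noteq> 0 \<longrightarrow> (\<Sum>x\<leftarrow>ws. gdeg H x - 1) = n}),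
      dif = lext (cobar_word H)\<rparr>)"

text \<open>\<open>\<Omega>f\<close> for \<open>f : H \<rightarrow> H'\<close>; only the target enters, as the domain is given by the words.\<close>

definition cobar_map ::
  "('r::comm_ring_1, 'k, 'n) chopf_scheme \<Rightarrow> ('h \<Rightarrow> 'k) \<Rightarrow> ('h list \<Rightarrow> 'r) \<Rightarrow> 'k list \<Rightarrow> 'r" where
  "cobar_map H' f = lext (\<lambda>ws. foldr (\<lambda>a u. sinv H' (f a) \<star> u) ws (tword []))"

section \<open>The twisted tensor products\<close>

subsection \<open>\<open>\<Omega>H \<otimes> B\<close> for a left comodule algebra \<open>B\<close>\<close>

definition left_dif ::
  "('r::comm_ring_1, 'h) chopf \<Rightarrow> ('r, 'b, 'h) lcomodalg \<Rightarrow>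
     (('h list \<Rightarrow> 'r) \<times> 'b \<Rightarrow> 'r) \<Rightarrow> ('h list \<Rightarrow> 'r) \<times> 'b \<Rightarrow> 'r" where
  "left_dif H B = lext (\<lambda>(w, b).
     tens (cobar H) B (dif (cobar H) w) b
     + ksign (gdeg (cobar H) w) \<cdot> tens (cobar H) B w (dif B b)
     + ksign (gdeg (cobar H) w) \<cdot> lext (\<lambda>(h, b'). tens (cobar H) B (w \<star> sinv H h) b') (lcoact B b))"

text \<open>\<open>left_swap H B as b\<close> is the product \<open>(1 \<otimes> b)(w \<otimes> 1)\<close> for the word \<open>w\<close> in the letters \<open>as\<close>,
  computed from the formula for \<open>(1 \<otimes> b)(s\<^sup>-\<^sup>1a \<otimes> 1)\<close> by moving \<open>b\<close> past one letter at a time.\<close>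

primrec left_swap ::
  "('r::comm_ring_1, 'h) chopf \<Rightarrow> ('r, 'b, 'h) lcomodalg \<Rightarrow> 'h list \<Rightarrow> 'b \<Rightarrow>
     ('h list \<Rightarrow> 'r) \<times> 'b \<Rightarrow> 'r" where
  "left_swap H B [] = (\<lambda>b. tens (cobar H) B \<one>\<^bsub>cobar H\<^esub> b)"
| "left_swap H B (a # as) = (\<lambda>b. lext (\<lambda>(h, b').
     ksign (gdeg H h + (gdeg H a + 1) * gdeg B b') \<cdot>
     lext (\<lambda>(u, c). tens (cobar H) B (sinv H (h \<otimes>\<^bsub>H\<^esub> a) \<star> u) c) (left_swap H B as b')) (lcoact B b))"

text \<open>\<open>(w \<otimes> b)(w' \<otimes> b') = w \<cdot> (1 \<otimes> b)(w' \<otimes> 1) \<cdot> b'\<close>\<close>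

definition left_mult ::
  "('r::comm_ring_1, 'h) chopf \<Rightarrow> ('r, 'b, 'h) lcomodalg \<Rightarrow>
     (('h list \<Rightarrow> 'r) \<times> 'b \<Rightarrow> 'r) \<Rightarrow> (('h list \<Rightarrow> 'r) \<times> 'b \<Rightarrow> 'r) \<Rightarrow> ('h list \<Rightarrow> 'r) \<times> 'b \<Rightarrow> 'r" where
  "left_mult H B z z' = lext (\<lambda>(w, b). lext (\<lambda>(w', b').
     lext (\<lambda>(u, c). tens (cobar H) B (w \<star> u) (c \<otimes>\<^bsub>B\<^esub> b')) (lext (\<lambda>as. left_swap H B as b) w')) z') z"

definition left_cobar ::
  "('r::comm_ring_1, 'h) chopf \<times> ('r, 'b, 'h) lcomodalg \<Rightarrow> ('r, ('h list \<Rightarrow> 'r) \<times> 'b \<Rightarrow> 'r) chalg" where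
  "left_cobar = (\<lambda>(H, B). (tensor (cobar H) B)\<lparr>mult := left_mult H B, dif := left_dif H B\<rparr>)"

text \<open>These properties determine the multiplication.  Injectivity of \<open>w \<mapsto> w \<otimes> 1\<close> is not required, as
  it fails for \<open>B = 0\<close>.\<close>

definition left_cobar_laws ::
  "('r::comm_ring_1, 'h) chopf \<times> ('r, 'b, 'h) lcomodalg \<Rightarrow>
     ('r, ('h list \<Rightarrow> 'r) \<times> 'b \<Rightarrow> 'r) chalg \<Rightarrow> bool" where
  "left_cobar_laws = (\<lambda>(H, B) A. chain_algebra A \<and>
     gralg_hom (cobar H) A (\<lambda>w. tens (cobar H) B w \<one>\<^bsub>B\<^esub>) \<and>
     gralg_hom B A (\<lambda>b. tens (cobar H) B \<one>\<^bsub>cobar H\<^esub> b) \<and>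
     (\<forall>w\<in>carrier (cobar H). \<forall>b\<in>carrier B.
        tens (cobar H) B w \<one>\<^bsub>B\<^esub> \<otimes>\<^bsub>A\<^esub> tens (cobar H) B \<one>\<^bsub>cobar H\<^esub> b = tens (cobar H) B w b) \<and>
     (\<forall>n>0. \<forall>a\<in>hcomp H n. \<forall>b\<in>carrier B.
        tens (cobar H) B \<one>\<^bsub>cobar H\<^esub> b \<otimes>\<^bsub>A\<^esub> tens (cobar H) B (sinv H a) \<one>\<^bsub>B\<^esub> =
        lext (\<lambda>(h, b'). ksign (gdeg H h + (n + 1) * gdeg B b') \<cdot>
          tens (cobar H) B (sinv H (h \<otimes>\<^bsub>H\<^esub> a)) b') (lcoact B b)))"

definition left_cobar_map ::
  "('r::comm_ring_1, 'k) chopf \<times> ('r, 'c, 'k) lcomodalg \<Rightarrow> ('h \<Rightarrow> 'k) \<times> ('b \<Rightarrow> 'c) \<Rightarrow>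
     (('h list \<Rightarrow> 'r) \<times> 'b \<Rightarrow> 'r) \<Rightarrow> ('k list \<Rightarrow> 'r) \<times> 'c \<Rightarrow> 'r" where
  "left_cobar_map = (\<lambda>(H', B') (f, g). tensor_map (cobar H') B' (cobar_map H' f) g)"

subsection \<open>\<open>B \<otimes> \<Omega>H\<close> for a right comodule algebra \<open>B\<close>\<close>

definition right_dif ::
  "('r::comm_ring_1, 'h) chopf \<Rightarrow> ('r, 'b, 'h) rcomodalg \<Rightarrow>
     ('b \<times> ('h list \<Rightarrow> 'r) \<Rightarrow> 'r) \<Rightarrow> 'b \<times> ('h list \<Rightarrow> 'r) \<Rightarrow> 'r" where
  "right_dif H B = lext (\<lambda>(b, w).
     tens B (cobar H) (dif B b) w
     + ksign (gdeg B b) \<cdot> tens B (cobar H) b (dif (cobar H) w)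
     - lext (\<lambda>(b', h). ksign (gdeg B b') \<cdot> tens B (cobar H) b' (sinv H h \<star> w)) (rcoact B b))"

text \<open>\<open>right_swap H B as b\<close> is the product \<open>(1 \<otimes> w)(b \<otimes> 1)\<close> for the word \<open>w\<close> in the letters \<open>as\<close>.\<close>

primrec right_swap ::
  "('r::comm_ring_1, 'h) chopf \<Rightarrow> ('r, 'b, 'h) rcomodalg \<Rightarrow> 'h list \<Rightarrow> 'b \<Rightarrow>
     'b \<times> ('h list \<Rightarrow> 'r) \<Rightarrow> 'r" where
  "right_swap H B [] = (\<lambda>b. tens B (cobar H) b \<one>\<^bsub>cobar H\<^esub>)"
| "right_swap H B (a # as) = (\<lambda>b. lext (\<lambda>(c, u). lext (\<lambda>(c', h).
     ksign ((gdeg H a - 1) * gdeg B c') \<cdot> tens B (cobar H) c' (sinv H (a \<otimes>\<^bsub>H\<^esub> h) \<star> u))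
       (rcoact B c)) (right_swap H B as b))"

text \<open>\<open>(b \<otimes> w)(b' \<otimes> w') = b \<cdot> (1 \<otimes> w)(b' \<otimes> 1) \<cdot> w'\<close>\<close>

definition right_mult ::
  "('r::comm_ring_1, 'h) chopf \<Rightarrow> ('r, 'b, 'h) rcomodalg \<Rightarrow>
     ('b \<times> ('h list \<Rightarrow> 'r) \<Rightarrow> 'r) \<Rightarrow> ('b \<times> ('h list \<Rightarrow> 'r) \<Rightarrow> 'r) \<Rightarrow> 'b \<times> ('h list \<Rightarrow> 'r) \<Rightarrow> 'r" where
  "right_mult H B z z' = lext (\<lambda>(b, w). lext (\<lambda>(b', w').
     lext (\<lambda>(c, u). tens B (cobar H) (b \<otimes>\<^bsub>B\<^esub> c) (u \<star> w')) (lext (\<lambda>as. right_swap H B as b') w)) z') z"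

definition right_cobar ::
  "('r::comm_ring_1, 'h) chopf \<times> ('r, 'b, 'h) rcomodalg \<Rightarrow> ('r, 'b \<times> ('h list \<Rightarrow> 'r) \<Rightarrow> 'r) chalg" where
  "right_cobar = (\<lambda>(H, B). (tensor B (cobar H))\<lparr>mult := right_mult H B, dif := right_dif H B\<rparr>)"

definition right_cobar_laws ::
  "('r::comm_ring_1, 'h) chopf \<times> ('r, 'b, 'h) rcomodalg \<Rightarrow>
     ('r, 'b \<times> ('h list \<Rightarrow> 'r) \<Rightarrow> 'r) chalg \<Rightarrow> bool" where
  "right_cobar_laws = (\<lambda>(H, B) A. chain_algebra A \<and>
     gralg_hom (cobar H) A (\<lambda>w. tens B (cobar H) \<one>\<^bsub>B\<^esub> w) \<and>
     gralg_hom B A (\<lambda>b. tens B (cobar H) b \<one>\<^bsub>cobar H\<^esub>) \<and>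
     (\<forall>b\<in>carrier B. \<forall>w\<in>carrier (cobar H).
        tens B (cobar H) b \<one>\<^bsub>cobar H\<^esub> \<otimes>\<^bsub>A\<^esub> tens B (cobar H) \<one>\<^bsub>B\<^esub> w = tens B (cobar H) b w) \<and>
     (\<forall>n>0. \<forall>a\<in>hcomp H n. \<forall>b\<in>carrier B.
        tens B (cobar H) \<one>\<^bsub>B\<^esub> (sinv H a) \<otimes>\<^bsub>A\<^esub> tens B (cobar H) b \<one>\<^bsub>cobar H\<^esub> =
        lext (\<lambda>(b', h). ksign ((n - 1) * gdeg B b') \<cdot>
          tens B (cobar H) b' (sinv H (a \<otimes>\<^bsub>H\<^esub> h))) (rcoact B b)))"

definition right_cobar_map ::
  "('r::comm_ring_1, 'k) chopf \<times> ('r, 'c, 'k) rcomodalg \<Rightarrow> ('h \<Rightarrow> 'k) \<times> ('b \<Rightarrow> 'c) \<Rightarrow>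
     ('b \<times> ('h list \<Rightarrow> 'r) \<Rightarrow> 'r) \<Rightarrow> 'c \<times> ('k list \<Rightarrow> 'r) \<Rightarrow> 'r" where
  "right_cobar_map = (\<lambda>(H', B') (f, g). tensor_map B' (cobar H') g (cobar_map H' f))"

section \<open>Cotor\<close>

text \<open>\<open>Cotor_l (H, B)\<close> is \<open>Cotor\<^sup>H(R, B)\<close> and \<open>Cotor_r (H, B)\<close> is \<open>Cotor\<^sup>H(B, R)\<close>, with the induced
  multiplications; a morphism \<open>(f, g)\<close> induces the homology of \<open>\<Omega>f \<otimes> g\<close>, respectively \<open>g \<otimes> \<Omega>f\<close>.
  The morphism parts take the target object as first argument.\<close>

definition Cotor_l ::
  "('r::comm_ring_1, 'h) chopf \<times> ('r, 'b, 'h) lcomodalg \<Rightarrow> ('r, (('h list \<Rightarrow> 'r) \<times> 'b \<Rightarrow> 'r) set) gralg" where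
  "Cotor_l X = homology (left_cobar X)"

definition Cotor_l_map ::
  "('r::comm_ring_1, 'k) chopf \<times> ('r, 'c, 'k) lcomodalg \<Rightarrow> ('h \<Rightarrow> 'k) \<times> ('b \<Rightarrow> 'c) \<Rightarrow>
     (('h list \<Rightarrow> 'r) \<times> 'b \<Rightarrow> 'r) set \<Rightarrow> (('k list \<Rightarrow> 'r) \<times> 'c \<Rightarrow> 'r) set" where
  "Cotor_l_map X' \<phi> = homology_map (left_cobar X') (left_cobar_map X' \<phi>)"

definition Cotor_r ::
  "('r::comm_ring_1, 'h) chopf \<times> ('r, 'b, 'h) rcomodalg \<Rightarrow> ('r, ('b \<times> ('h list \<Rightarrow> 'r) \<Rightarrow> 'r) set) gralg" where
  "Cotor_r X = homology (right_cobar X)"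

definition Cotor_r_map ::
  "('r::comm_ring_1, 'k) chopf \<times> ('r, 'c, 'k) rcomodalg \<Rightarrow> ('h \<Rightarrow> 'k) \<times> ('b \<Rightarrow> 'c) \<Rightarrow>
     ('b \<times> ('h list \<Rightarrow> 'r) \<Rightarrow> 'r) set \<Rightarrow> ('c \<times> ('k list \<Rightarrow> 'r) \<Rightarrow> 'r) set" where
  "Cotor_r_map X' \<phi> = homology_map (right_cobar X') (right_cobar_map X' \<phi>)"

end

theory Submission
  imports Defs
begin

text \<open>A multiplication on \<open>U \<otimes> V\<close> extending those of \<open>U\<close> and \<open>V\<close>, with \<open>(u \<otimes> 1)(1 \<otimes> v) = u \<otimes> v\<close>, amounts
  to a distributive law \<open>\<tau> v u = (1 \<otimes> v)(u \<otimes> 1)\<close>, compatible with both multiplications.  For \<open>\<Omega>H\<close> and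
  \<open>B\<close> the law is defined letter by letter; its compatibility with the product of \<open>B\<close> reduces to one
  letter, where it holds because the coaction is multiplicative.

  The differential of \<open>U \<otimes> V\<close> is determined by its restrictions to \<open>U\<close> and \<open>V\<close>, and it is a derivation
  as soon as the Leibniz rule holds for the products \<open>(1 \<otimes> v)(u \<otimes> 1)\<close> with \<open>u\<close> and \<open>v\<close> among the
  generators.  For the products of \<open>b \<in> B\<close> with a letter \<open>s\<^sup>-\<^sup>1a\<close>, the terms that are linear in letters
  agree because the coaction commutes with the differentials.  The quadratic terms agree because the
  coaction is coassociative and the comultiplication of \<open>H\<close> is multiplicative.  Coassociativity also
  gives \<open>D\<^sup>2 = 0\<close>.  In the same way, \<open>\<Omega>f \<otimes> g\<close> and \<open>g \<otimes> \<Omega>f\<close> are multiplicative because they respect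
  the law on letters, and all that is left is to pass to homology.\<close>

section \<open>Linear extensions\<close>

text \<open>The signs depend on degrees, so formulas containing them are bilinear only once the
  degrees are fixed. Identities are therefore checked on homogeneous basis elements, where
  \<open>nu_supp\<close> ties together the degrees in a Sweedler sum, or stated with a linear sign
  involution (\<open>invol\<close>, \<open>sg\<close>, \<open>csg\<close>). The bases are arbitrary
  choices: a basis element of \<open>cobar H\<close> need not be a word, a letter need not be a
  basis element of \<open>H\<close>, and a basis element of degree 0 need not be 1. Linear extension
  bridges the first two gaps. For the third, the counit law collects the terms of degree 0 in a
  coproduct or coaction into 1 \<otimes> c or 1 \<otimes> b. These terms must be isolated because
  the formula for (1 \<otimes> b)(s^-1 a \<otimes> 1) does not extend to a = 1: its left side
  vanishes there, its right side need not. The proof of the Leibniz rule on a letter s^-1 a applies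
  that formula to da as well, so da must have positive degree, and H_1 = 0 ensures this.\<close>

lemma ksign_add: "ksign (m + n) = ksign m * (ksign n :: 'r::comm_ring_1)"
  by (auto simp: ksign_def)

lemma ksign_0 [simp]: "ksign 0 = 1"
  by (simp add: ksign_def)

lemma ksign_square [simp]: "ksign n * ksign n = (1 :: 'r::comm_ring_1)"
  by (simp add: ksign_def)

lemma ksign_cancel [simp]: "ksign n * (ksign n * x) = (x :: 'r::comm_ring_1)"
  by (simp add: ksign_def)

lemma ksign_cong: "(even m \<longleftrightarrow> even n) \<Longrightarrow> ksign m = ksign n"
  by (simp add: ksign_def)

lemma ksign_neg: "(even m \<longleftrightarrow> odd n) \<Longrightarrow> ksign m = - ksign n"
  by (simp add: ksign_def)

lemma fscale_apply [simp]: "(r \<cdot> f) p = r * f p"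
  by (simp add: fscale_def)

lemma fscale_fscale [simp]: "r \<cdot> s \<cdot> f = (r * s) \<cdot> f"
  by (simp add: fun_eq_iff mult.assoc)

lemma fscale_one [simp]: "1 \<cdot> f = f"
  by (simp add: fun_eq_iff)

lemma fscale_zero [simp]: "0 \<cdot> f = 0" "r \<cdot> 0 = 0"
  by (simp_all add: fun_eq_iff)

lemma fscale_add: "r \<cdot> (f + g) = r \<cdot> f + r \<cdot> g"
  by (simp add: fun_eq_iff algebra_simps)

lemma fscale_add_left: "(r + s) \<cdot> f = r \<cdot> f + s \<cdot> f"
  by (simp add: fun_eq_iff algebra_simps)

lemma fscale_minus [simp]: "r \<cdot> (- f) = - (r \<cdot> f)" "(- r) \<cdot> f = - (r \<cdot> f)"
  by (simp_all add: fun_eq_iff)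

lemma fscale_diff: "r \<cdot> (f - g) = r \<cdot> f - r \<cdot> g"
  by (simp add: fun_eq_iff algebra_simps)

lemma sum_fun_apply: "(\<Sum>i\<in>I. f i) q = (\<Sum>i\<in>I. f i q)"
  by (induction I rule: infinite_finite_induct) auto

lemma fscale_sum: "r \<cdot> (\<Sum>i\<in>I. f i) = (\<Sum>i\<in>I. r \<cdot> f i)"
  by (simp add: fun_eq_iff sum_fun_apply sum_distrib_left)

text \<open>The free module on \<open>X\<close>, cut out of the full function space. Tensor
  products, the cobar construction and the twisted products all have carriers of this form, so their
  elements can be treated uniformly.\<close>

definition fsupp :: "'p set \<Rightarrow> ('p \<Rightarrow> 'r::comm_ring_1) set" where
  "fsupp X = {z. finite {p. z p \<noteq> 0} \<and> {p. z p \<noteq> 0} \<subseteq> X}"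

lemma fsuppI: "finite S \<Longrightarrow> S \<subseteq> X \<Longrightarrow> (\<And>p. z p \<noteq> 0 \<Longrightarrow> p \<in> S) \<Longrightarrow> z \<in> fsupp X"
  unfolding fsupp_def by (auto intro: finite_subset[of _ S])

lemma fsupp_finite: "z \<in> fsupp X \<Longrightarrow> finite {p. z p \<noteq> 0}"
  by (simp add: fsupp_def)

lemma fsupp_in: "z \<in> fsupp X \<Longrightarrow> z p \<noteq> 0 \<Longrightarrow> p \<in> X"
  by (auto simp: fsupp_def)

lemma fsupp_zero [simp, intro]: "0 \<in> fsupp X"
  by (simp add: fsupp_def)

lemma fsupp_add [simp, intro]: "z \<in> fsupp X \<Longrightarrow> z' \<in> fsupp X \<Longrightarrow> z + z' \<in> fsupp X"
  by (rule fsuppI[of "{p. z p \<noteq> 0} \<union> {p. z' p \<noteq> 0}"]) (auto simp: fsupp_def)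

lemma fsupp_scale [simp, intro]: "z \<in> fsupp X \<Longrightarrow> r \<cdot> z \<in> fsupp X"
  by (rule fsuppI[of "{p. z p \<noteq> 0}"]) (auto simp: fsupp_def)

lemma fsupp_minus [simp, intro]: "z \<in> fsupp X \<Longrightarrow> - z \<in> fsupp X"
  by (simp add: fsupp_def)

lemma fsupp_diff [simp, intro]: "z \<in> fsupp X \<Longrightarrow> z' \<in> fsupp X \<Longrightarrow> z - z' \<in> fsupp X"
  using fsupp_add[of z X "- z'"] by (simp del: add_uminus_conv_diff add: diff_conv_add_uminus)

lemma fsupp_sum: "(\<And>i. i \<in> I \<Longrightarrow> f i \<in> fsupp X) \<Longrightarrow> (\<Sum>i\<in>I. f i) \<in> fsupp X"
  by (induction I rule: infinite_finite_induct) auto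

lemma lext_alt:
  assumes "finite S" "\<And>p. z p \<noteq> 0 \<Longrightarrow> p \<in> S"
  shows "lext \<beta> z = (\<Sum>p\<in>S. z p \<cdot> \<beta> p)"
  using assms by (auto simp: lext_def fun_eq_iff sum_fun_apply intro!: sum.mono_neutral_left)

lemma lext_cong: "(\<And>p. z p \<noteq> 0 \<Longrightarrow> \<beta> p = \<gamma> p) \<Longrightarrow> lext \<beta> z = lext \<gamma> z"
  by (simp add: lext_def)

lemma lext_fsupp:
  assumes "\<And>p. z p \<noteq> 0 \<Longrightarrow> \<beta> p \<in> fsupp Y"
  shows "lext \<beta> z \<in> fsupp Y"
proof -
  have "lext \<beta> z = (\<Sum>p\<in>{p. z p \<noteq> 0}. z p \<cdot> \<beta> p)"
    by (simp add: lext_def fun_eq_iff sum_fun_apply)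
  also have "\<dots> \<in> fsupp Y"
    using assms by (intro fsupp_sum) auto
  finally show ?thesis .
qed

lemma lext_nonzeroE:
  assumes "lext \<beta> z q \<noteq> 0"
  obtains p where "z p \<noteq> 0" "\<beta> p q \<noteq> 0"
proof -
  have "\<exists>p\<in>{p. z p \<noteq> 0}. z p * \<beta> p q \<noteq> 0"
    using assms unfolding lext_def by (meson sum.not_neutral_contains_not_neutral)
  then show thesis
    using that by fastforce
qed

text \<open>Finite support is what makes this true: a sum over an infinite set is \<open>0\<close>
  by convention, and the support of a sum can be finite although those of the summands are
  not.\<close>

lemma lext_add:
  assumes "z \<in> fsupp X" "z' \<in> fsupp X'"
  shows "lext \<beta> (z + z') = lext \<beta> z + lext \<beta> z'"
proof -
  let ?S = "{p. z p \<noteq> 0} \<union> {p. z' p \<noteq> 0}"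
  have "finite ?S"
    using assms by (simp add: fsupp_def)
  then show ?thesis
    by (subst (1 2 3) lext_alt[of ?S]) (auto simp: fscale_add_left sum.distrib)
qed

text \<open>Multiplication by \<open>r\<close> can shrink the support, so both sides are summed over
  the support of \<open>z\<close>.\<close>

lemma lext_scale:
  assumes "z \<in> fsupp X"
  shows "lext \<beta> (r \<cdot> z) = r \<cdot> lext \<beta> z"
  using assms
  by (subst (1 2) lext_alt[of "{p. z p \<noteq> 0}"]) (auto simp: fsupp_def fscale_sum)

lemma lext_zero [simp]: "lext \<beta> 0 = 0"
  by (simp add: lext_def fun_eq_iff)

lemma lext_minus: "z \<in> fsupp X \<Longrightarrow> lext \<beta> (- z) = - lext \<beta> z"
  by (simp add: lext_def fun_eq_iff sum_negf)

lemma lext_diff: "z \<in> fsupp X \<Longrightarrow> z' \<in> fsupp X' \<Longrightarrow> lext \<beta> (z - z') = lext \<beta> z - lext \<beta> z'"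
  using lext_add[of z X "- z'" X' \<beta>] by (simp add: lext_minus)

lemma lext_fun_add: "lext (\<lambda>p. \<beta> p + \<gamma> p) z = lext \<beta> z + lext \<gamma> z"
  by (simp add: lext_def fun_eq_iff algebra_simps sum.distrib)

lemma lext_fun_scale: "lext (\<lambda>p. r \<cdot> \<beta> p) z = r \<cdot> lext \<beta> z"
  by (simp add: lext_def fun_eq_iff algebra_simps sum_distrib_left)

lemma lext_fun_minus: "lext (\<lambda>p. - \<beta> p) z = - lext \<beta> z"
  by (simp add: lext_def fun_eq_iff sum_negf)

lemma lext_fun_zero [simp]: "lext (\<lambda>p. 0) z = 0"
  by (simp add: lext_def fun_eq_iff)

lemma lext_sum:
  assumes "finite I" "\<And>i. i \<in> I \<Longrightarrow> f i \<in> fsupp X"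
  shows "lext \<beta> (\<Sum>i\<in>I. f i) = (\<Sum>i\<in>I. lext \<beta> (f i))"
  using assms
proof (induction I rule: finite_induct)
  case (insert i I)
  then show ?case
    using lext_add[of "f i" X "sum f I" X \<beta>] fsupp_sum[of I f X]
    by (simp only: sum.insert[OF insert(1,2)] insertI1 insertI2)
qed (simp only: sum.empty lext_zero)

text \<open>Substitution of one Sweedler sum into another. The later rules that push an operation
  through a sum (\<open>lmul_lext\<close>, \<open>tau_lext\<close>, \<open>DD_lext\<close>,
  \<open>TT_lext\<close>) are instances.\<close>

lemma lext_lext:
  assumes "z \<in> fsupp X" "\<And>p. p \<in> X \<Longrightarrow> \<gamma> p \<in> fsupp Y"
  shows "lext \<beta> (lext \<gamma> z) = lext (\<lambda>p. lext \<beta> (\<gamma> p)) z"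
proof -
  let ?S = "{p. z p \<noteq> 0}"
  have *: "finite ?S" and "\<And>p. p \<in> ?S \<Longrightarrow> p \<in> X"
    using assms(1) by (auto simp: fsupp_def)
  then have "lext \<beta> (\<Sum>p\<in>?S. z p \<cdot> \<gamma> p) = (\<Sum>p\<in>?S. lext \<beta> (z p \<cdot> \<gamma> p))"
    using assms(2) by (intro lext_sum) auto
  also have "\<dots> = (\<Sum>p\<in>?S. z p \<cdot> lext \<beta> (\<gamma> p))"
    using assms(2) \<open>\<And>p. p \<in> ?S \<Longrightarrow> p \<in> X\<close> by (intro sum.cong refl lext_scale) auto
  finally show ?thesis
    using * by (simp add: lext_alt[of ?S])
qed

text \<open>Exchange of two independent Sweedler sums. It is needed whenever the two sides of an
  identity are naturally expanded in different orders, as in associativity of the twisted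
  product.\<close>

lemma lext_swap: "lext (\<lambda>p. lext (F p) z') z = lext (\<lambda>q. lext (\<lambda>p. F p q) z) z'"
proof (rule ext)
  fix x
  have "lext (\<lambda>p. lext (F p) z') z x =
    (\<Sum>p\<in>{p. z p \<noteq> 0}. \<Sum>q\<in>{q. z' q \<noteq> 0}. z p * (z' q * F p q x))"
    by (simp add: lext_def sum_distrib_left)
  also have "\<dots> = (\<Sum>q\<in>{q. z' q \<noteq> 0}. \<Sum>p\<in>{p. z p \<noteq> 0}. z p * (z' q * F p q x))"
    by (rule sum.swap)
  also have "\<dots> = lext (\<lambda>q. lext (\<lambda>p. F p q) z) z' x"
    by (simp add: lext_def sum_distrib_left algebra_simps)
  finally show "lext (\<lambda>p. lext (F p) z') z x = lext (\<lambda>q. lext (\<lambda>p. F p q) z) z' x" .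
qed

definition delta :: "'p \<Rightarrow> 'p \<Rightarrow> 'r::comm_ring_1" where
  "delta p = (\<lambda>q. if q = p then 1 else 0)"

lemma delta_eq_0_iff [simp]: "delta p q = (0 :: 'r::comm_ring_1) \<longleftrightarrow> q \<noteq> p"
  by (simp add: delta_def)

lemma delta_fsupp [simp]: "p \<in> X \<Longrightarrow> delta p \<in> fsupp X"
  by (rule fsuppI[of "{p}"]) (auto simp: delta_def split: if_splits)

lemma lext_delta [simp]: "lext \<beta> (delta p) = \<beta> p"
  by (subst lext_alt[of "{p}"]) (auto simp: delta_def split: if_splits)

lemma lext_delta_id: "z \<in> fsupp X \<Longrightarrow> lext delta z = z"
  by (auto simp: lext_def fun_eq_iff delta_def fsupp_def if_distrib[of "\<lambda>x. _ * x"] cong: if_cong)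

text \<open>Linear identities need only be verified on basis functions. The cases carry membership
  in \<open>fsupp X\<close>, since that is where \<open>lext\<close> is known to be linear.\<close>

lemma fsupp_induct [consumes 1, case_names zero add scale base]:
  assumes "z \<in> fsupp X"
    and "P 0"
    and "\<And>z z'. z \<in> fsupp X \<Longrightarrow> z' \<in> fsupp X \<Longrightarrow> P z \<Longrightarrow> P z' \<Longrightarrow> P (z + z')"
    and "\<And>r z. z \<in> fsupp X \<Longrightarrow> P z \<Longrightarrow> P (r \<cdot> z)"
    and "\<And>p. p \<in> X \<Longrightarrow> P (delta p)"
  shows "P z"
proof -
  let ?S = "{p. z p \<noteq> 0}"
  have S: "finite ?S" "?S \<subseteq> X"
    using assms(1) by (auto simp: fsupp_def)
  have "(\<Sum>p\<in>T. z p \<cdot> delta p) \<in> fsupp X \<and> P (\<Sum>p\<in>T. z p \<cdot> delta p)" if "finite T" "T \<subseteq> X" for T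
    using that by (induction T rule: finite_induct) (auto intro!: assms(2-5))
  from this[OF S] have "P (lext delta z)"
    using S by (simp add: lext_alt[of ?S])
  then show ?thesis
    using lext_delta_id[OF assms(1)] by simp
qed

section \<open>Graded free modules\<close>

lemma scalars_simps [simp]:
  "carrier scalars = UNIV" "\<one>\<^bsub>scalars\<^esub> = 1" "\<zero>\<^bsub>scalars\<^esub> = 0"
  "x \<otimes>\<^bsub>scalars\<^esub> y = x * y" "x \<oplus>\<^bsub>scalars\<^esub> y = x + y"
  by (simp_all add: scalars_def)

lemma scalars_cring: "cring (scalars :: 'r::comm_ring_1 ring)"
proof (rule cringI)
  show "abelian_group (scalars :: 'r ring)"
  proof (rule abelian_groupI)
    show "\<exists>y\<in>carrier scalars. y \<oplus>\<^bsub>scalars\<^esub> x = \<zero>\<^bsub>scalars\<^esub>" for x :: 'r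
      by (auto intro!: exI[of _ "- x"])
  qed (auto simp: add_ac)
  show "comm_monoid (scalars :: 'r ring)"
    by (rule comm_monoidI) (auto simp: mult_ac)
qed (auto simp: algebra_simps)

locale graded_mod =
  fixes M :: "('r::comm_ring_1, 'a, 'm) gralg_scheme" (structure)
  assumes graded_module: "graded_module M"
begin

sublocale module scalars M
  using graded_module by (simp add: graded_module_def)

lemma smult_simps [simp]:
  "x \<in> carrier M \<Longrightarrow> r \<odot> x \<in> carrier M"
  "x \<in> carrier M \<Longrightarrow> 0 \<odot> x = \<zero>"
  "x \<in> carrier M \<Longrightarrow> 1 \<odot> x = x"
  "r \<odot> \<zero> = \<zero>"
  using smult_closed smult_l_null smult_one smult_r_null by auto

lemma smult_add_left: "x \<in> carrier M \<Longrightarrow> (r + s) \<odot> x = r \<odot> x \<oplus> s \<odot> x"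
  using smult_l_distr by auto

lemma smult_add_right: "x \<in> carrier M \<Longrightarrow> y \<in> carrier M \<Longrightarrow> r \<odot> (x \<oplus> y) = r \<odot> x \<oplus> r \<odot> y"
  using smult_r_distr by auto

lemma smult_smult: "x \<in> carrier M \<Longrightarrow> r \<odot> (s \<odot> x) = (r * s) \<odot> x"
  using smult_assoc1 by auto

lemma minus_eq_smult: "x \<in> carrier M \<Longrightarrow> \<ominus> x = (- 1) \<odot> x"
  using smult_add_left[of x "- 1" 1] by (simp add: M.minus_equality)

lemma hcomp_submodule: "submodule (hcomp M n) scalars M"
  using graded_module by (simp add: graded_module_def)

lemma hcomp_carrier: "x \<in> hcomp M n \<Longrightarrow> x \<in> carrier M"
  using submoduleE(1)[OF hcomp_submodule] by blast

lemma hcomp_add: "x \<in> hcomp M n \<Longrightarrow> y \<in> hcomp M n \<Longrightarrow> x \<oplus> y \<in> hcomp M n"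
  using submoduleE(5)[OF hcomp_submodule] by blast

lemma hcomp_smult: "x \<in> hcomp M n \<Longrightarrow> r \<odot> x \<in> hcomp M n"
  using submoduleE(4)[OF hcomp_submodule] by simp

lemma hcomp_zero [simp]: "\<zero> \<in> hcomp M n"
proof -
  obtain x where x: "x \<in> hcomp M n"
    using submoduleE(2)[OF hcomp_submodule[of n]] by blast
  then show ?thesis
    using hcomp_smult[OF x, of 0] hcomp_carrier[OF x] by simp
qed

lemma hcomp_finsum: "(\<And>i. i \<in> I \<Longrightarrow> f i \<in> hcomp M n) \<Longrightarrow> (\<Oplus>i\<in>I. f i) \<in> hcomp M n"
proof (induction I rule: infinite_finite_induct)
  case (insert i I)
  then show ?case
    by (subst finsum_insert) (auto intro!: hcomp_add intro: hcomp_carrier)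
qed auto

lemma decomposition_unique: "decomposition M x c \<Longrightarrow> decomposition M x c' \<Longrightarrow> x \<in> carrier M \<Longrightarrow> c = c'"
  using graded_module unfolding graded_module_def by blast

lemma decomposition_hcomp:
  assumes "x \<in> hcomp M n"
  shows "decomposition M x (\<lambda>k. if k = n then x else \<zero>)"
proof (cases "x = \<zero>")
  case True
  then show ?thesis
    by (simp add: decomposition_def if_distrib cong: if_cong)
next
  case False
  then have "{k. (if k = n then x else \<zero>) \<noteq> \<zero>} = {n}"
    by auto
  then show ?thesis
    using assms hcomp_carrier[OF assms] by (simp add: decomposition_def finsum_insert)
qed

lemma degree_unique:
  assumes "x \<in> hcomp M m" "x \<in> hcomp M n" "x \<noteq> \<zero>"
  shows "m = n"
proof (rule ccontr)
  assume "m \<noteq> n"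
  have "(\<lambda>k. if k = m then x else \<zero>) = (\<lambda>k. if k = n then x else \<zero>)"
    using decomposition_unique[OF decomposition_hcomp[OF assms(1)] decomposition_hcomp[OF assms(2)]]
      hcomp_carrier[OF assms(1)] by simp
  from fun_cong[OF this, of m] show False
    using \<open>m \<noteq> n\<close> assms(3) by simp
qed

lemma gdeg_eq: "x \<in> hcomp M n \<Longrightarrow> x \<noteq> \<zero> \<Longrightarrow> gdeg M x = n"
  unfolding gdeg_def using degree_unique by blast

end

locale graded_free_mod = graded_mod M for M :: "('r::comm_ring_1, 'a, 'm) gralg_scheme" (structure) +
  assumes graded_free: "graded_free M"
begin

lemma hbasis: "homogeneous_basis M (hbasis M)"
  using graded_free unfolding graded_free_def hbasis_def by (rule someI_ex)

lemma hbasis_hcomp_ex: "x \<in> hbasis M \<Longrightarrow> \<exists>n. x \<in> hcomp M n"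
  using hbasis unfolding homogeneous_basis_def by blast

lemma hbasis_carrier [simp]: "x \<in> hbasis M \<Longrightarrow> x \<in> carrier M"
  using hbasis_hcomp_ex hcomp_carrier by blast

text \<open>The inverse of \<open>coord M\<close>. Its linearity is a computation with finite sums,
  and linearity of \<open>coord M\<close> is then deduced from the uniqueness of
  coordinates.\<close>

definition asm :: "('a \<Rightarrow> 'r) \<Rightarrow> 'a" where
  "asm c = (\<Oplus>x\<in>{x. c x \<noteq> 0}. c x \<odot> x)"

lemma asm_alt:
  assumes "finite S" "S \<subseteq> carrier M" "\<And>x. c x \<noteq> 0 \<Longrightarrow> x \<in> S"
  shows "asm c = (\<Oplus>x\<in>S. c x \<odot> x)"
  unfolding asm_def using assms
  by (intro add.finprod_mono_neutral_cong_left) (auto simp: Pi_def subset_iff)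

lemma asm_zero: "asm 0 = \<zero>"
  by (simp add: asm_def)

lemma asm_closed: "c \<in> fsupp (hbasis M) \<Longrightarrow> asm c \<in> carrier M"
  unfolding asm_def fsupp_def by (intro finsum_closed) auto

lemma asm_add:
  assumes "c \<in> fsupp (hbasis M)" "c' \<in> fsupp (hbasis M)"
  shows "asm (c + c') = asm c \<oplus> asm c'"
proof -
  let ?S = "{x. c x \<noteq> 0} \<union> {x. c' x \<noteq> 0}"
  have S: "finite ?S" "?S \<subseteq> carrier M"
    using assms hbasis_carrier unfolding fsupp_def by auto
  have "asm (c + c') = (\<Oplus>x\<in>?S. (c + c') x \<odot> x)" "asm c = (\<Oplus>x\<in>?S. c x \<odot> x)"
    "asm c' = (\<Oplus>x\<in>?S. c' x \<odot> x)"
    by (rule asm_alt; use S in auto)+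
  moreover have "(\<Oplus>x\<in>?S. (c + c') x \<odot> x) = (\<Oplus>x\<in>?S. c x \<odot> x \<oplus> c' x \<odot> x)"
    using S by (intro finsum_cong) (auto simp: smult_add_left subset_iff simp_implies_def)
  moreover have "\<dots> = (\<Oplus>x\<in>?S. c x \<odot> x) \<oplus> (\<Oplus>x\<in>?S. c' x \<odot> x)"
    using S by (intro finsum_addf) auto
  ultimately show ?thesis
    by simp
qed

lemma asm_scale:
  assumes "c \<in> fsupp (hbasis M)"
  shows "asm (r \<cdot> c) = r \<odot> asm c"
proof -
  let ?S = "{x. c x \<noteq> 0}"
  have S: "finite ?S" "?S \<subseteq> carrier M"
    using assms hbasis_carrier unfolding fsupp_def by auto
  have "asm (r \<cdot> c) = (\<Oplus>x\<in>?S. (r \<cdot> c) x \<odot> x)" "asm c = (\<Oplus>x\<in>?S. c x \<odot> x)"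
    by (rule asm_alt; use S in auto)+
  moreover have "(\<Oplus>x\<in>?S. (r \<cdot> c) x \<odot> x) = (\<Oplus>x\<in>?S. r \<odot> (c x \<odot> x))"
    using S by (intro finsum_cong) (auto simp: smult_smult subset_iff simp_implies_def)
  moreover have "\<dots> = r \<odot> (\<Oplus>x\<in>?S. c x \<odot> x)"
    using S by (intro finsum_smult_ldistr[symmetric]) auto
  ultimately show ?thesis
    by simp
qed

lemma asm_delta: "x \<in> carrier M \<Longrightarrow> asm (delta x) = x"
  by (subst asm_alt[of "{x}"]) (auto simp: delta_def finsum_insert split: if_splits)

lemma coord_ex1: "v \<in> carrier M \<Longrightarrow> \<exists>!c. c \<in> fsupp (hbasis M) \<and> v = asm c"
  using hbasis unfolding homogeneous_basis_def fsupp_def asm_def by (simp add: conj_ac)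

lemma coord_alt: "v \<in> carrier M \<Longrightarrow> coord M v = (THE c. c \<in> fsupp (hbasis M) \<and> v = asm c)"
  by (simp add: coord_def fsupp_def asm_def conj_ac)

lemma coord_fsupp [simp]: "coord M v \<in> fsupp (hbasis M)"
proof (cases "v \<in> carrier M")
  case True
  then show ?thesis
    using theI'[OF coord_ex1[OF True]] by (simp add: coord_alt)
qed (simp add: coord_def fsupp_def)

lemma asm_coord: "v \<in> carrier M \<Longrightarrow> asm (coord M v) = v"
  using theI'[OF coord_ex1[of v]] by (simp add: coord_alt)

lemma coord_asm:
  assumes "c \<in> fsupp (hbasis M)"
  shows "coord M (asm c) = c"
  using coord_ex1[OF asm_closed[OF assms]] assms asm_coord[OF asm_closed[OF assms]] coord_fsupp
  by metis

lemma coord_add: "v \<in> carrier M \<Longrightarrow> w \<in> carrier M \<Longrightarrow> coord M (v \<oplus> w) = coord M v + coord M w"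
  using coord_asm[of "coord M v + coord M w"] by (simp add: asm_add asm_coord)

lemma coord_smult: "v \<in> carrier M \<Longrightarrow> coord M (r \<odot> v) = r \<cdot> coord M v"
  using coord_asm[of "r \<cdot> coord M v"] by (simp add: asm_scale asm_coord)

lemma coord_hbasis: "x \<in> hbasis M \<Longrightarrow> coord M x = delta x"
  using coord_asm[of "delta x"] by (simp add: asm_delta)

lemma coord_zero: "coord M \<zero> = 0"
  using coord_smult[of \<zero> 0] by simp

lemma coord_inject: "v \<in> carrier M \<Longrightarrow> w \<in> carrier M \<Longrightarrow> coord M v = coord M w \<Longrightarrow> v = w"
  using asm_coord by metis

lemma hbasis_nonzero: "x \<in> hbasis M \<Longrightarrow> x \<noteq> \<zero>"
proof
  assume "x \<in> hbasis M" "x = \<zero>"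
  then have "(delta x :: 'a \<Rightarrow> 'r) x = 0"
    using coord_hbasis[of x] coord_zero by simp
  then show False
    by (simp add: delta_def)
qed

lemma hbasis_hcomp: "x \<in> hbasis M \<Longrightarrow> x \<in> hcomp M (gdeg M x)"
  using hbasis_hcomp_ex gdeg_eq hbasis_nonzero by metis

text \<open>A homogeneous basis sorts an expansion by degree: the terms with basis elements of
  degree \<open>n\<close> add up to the component of degree \<open>n\<close>.\<close>

lemma asm_decomposition:
  assumes "c \<in> fsupp (hbasis M)"
  shows "decomposition M (asm c) (\<lambda>n. asm (\<lambda>x. if gdeg M x = n then c x else 0))"
proof -
  let ?d = "\<lambda>n. asm (\<lambda>x. if gdeg M x = n then c x else 0)"
  let ?S = "{x. c x \<noteq> 0}"
  have S: "finite ?S" "?S \<subseteq> hbasis M" "?S \<subseteq> carrier M"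
    using assms unfolding fsupp_def by auto
  have d: "?d n = (\<Oplus>x\<in>{x \<in> ?S. gdeg M x = n}. c x \<odot> x)" for n
  proof -
    have "?d n = (\<Oplus>x\<in>{x \<in> ?S. gdeg M x = n}. (if gdeg M x = n then c x else 0) \<odot> x)"
      using S by (intro asm_alt) (auto split: if_splits)
    also have "\<dots> = (\<Oplus>x\<in>{x \<in> ?S. gdeg M x = n}. c x \<odot> x)"
      using S by (intro finsum_cong) (auto simp: simp_implies_def)
    finally show ?thesis .
  qed
  have h: "?d n \<in> hcomp M n" for n
    unfolding d using S(2) hbasis_hcomp by (intro hcomp_finsum hcomp_smult) auto
  have sub: "{n. ?d n \<noteq> \<zero>} \<subseteq> gdeg M ` ?S"
  proof
    fix n assume n: "n \<in> {n. ?d n \<noteq> \<zero>}"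
    have "{x \<in> ?S. gdeg M x = n} \<noteq> {}"
    proof
      assume *: "{x \<in> ?S. gdeg M x = n} = {}"
      have "?d n = \<zero>"
        unfolding d * by simp
      then show False
        using n by simp
    qed
    then show "n \<in> gdeg M ` ?S"
      by auto
  qed
  have "asm c = (\<Oplus>x\<in>(\<Union>n\<in>gdeg M ` ?S. {x \<in> ?S. gdeg M x = n}). c x \<odot> x)"
    unfolding asm_def by (rule arg_cong[where f = "finsum M _"]) auto
  also have "\<dots> = (\<Oplus>n\<in>gdeg M ` ?S. \<Oplus>x\<in>{x \<in> ?S. gdeg M x = n}. c x \<odot> x)"
    using S by (intro add.finprod_UN_disjoint) (auto simp: pairwise_def disjnt_def)
  also have "\<dots> = (\<Oplus>n\<in>gdeg M ` ?S. ?d n)"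
    using h hcomp_carrier by (intro finsum_cong) (auto simp: d simp_implies_def)
  also have "\<dots> = (\<Oplus>n\<in>{n. ?d n \<noteq> \<zero>}. ?d n)"
    using S sub hcomp_carrier[OF h]
    by (intro add.finprod_mono_neutral_cong_right) (auto simp: Pi_def subset_iff)
  finally show ?thesis
    using h finite_subset[OF sub] S(1) by (simp add: decomposition_def)
qed

text \<open>The decomposition of \<open>v\<close> with \<open>v\<close> itself as its only component
  and the one obtained by sorting the expansion of \<open>v\<close> by degree must coincide;
  uniqueness of coordinates then excludes basis elements of other degrees. This is what fixes the
  signs in later expansions.\<close>

lemma coord_hcomp:
  assumes "v \<in> hcomp M n" "coord M v x \<noteq> 0"
  shows "x \<in> hbasis M" "gdeg M x = n"
proof -
  show "x \<in> hbasis M"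
    using assms(2) fsupp_in[OF coord_fsupp] by blast
  note v = hcomp_carrier[OF assms(1)]
  let ?c = "\<lambda>x. if gdeg M x = n then coord M v x else 0"
  have c: "?c \<in> fsupp (hbasis M)"
    using coord_fsupp[of v]
    by (intro fsuppI[of "{x. coord M v x \<noteq> 0}"]) (auto simp: fsupp_def split: if_splits)
  have "(\<lambda>n. asm (\<lambda>x. if gdeg M x = n then coord M v x else 0)) = (\<lambda>k. if k = n then v else \<zero>)"
    using asm_decomposition[OF coord_fsupp, of v] decomposition_hcomp[OF assms(1)] v asm_coord[OF v]
    by (intro decomposition_unique) auto
  from fun_cong[OF this, of n] have "asm ?c = v"
    by simp
  then have "coord M v = ?c"
    using coord_asm[OF c] by simp
  then show "gdeg M x = n"
    using assms(2) by (metis (full_types))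
qed

end

section \<open>Linear maps into function modules\<close>

lemmas fun_apply = plus_fun_apply zero_fun_apply uminus_apply minus_apply fscale_apply

declare fun_apply [simp del]

text \<open>Linearity is demanded on the carrier only, since functions are total and their values
  elsewhere are arbitrary. The target is always a module of finitely supported functions, so its
  operations are the pointwise ones.\<close>

definition mlin :: "('r::comm_ring_1, 'a, 'm) gralg_scheme \<Rightarrow> 'q set \<Rightarrow> ('a \<Rightarrow> 'q \<Rightarrow> 'r) \<Rightarrow> bool" where
  "mlin M Y F \<longleftrightarrow> (\<forall>x\<in>carrier M. F x \<in> fsupp Y) \<and>
     (\<forall>x\<in>carrier M. \<forall>y\<in>carrier M. F (x \<oplus>\<^bsub>M\<^esub> y) = F x + F y) \<and>
     (\<forall>r. \<forall>x\<in>carrier M. F (r \<odot>\<^bsub>M\<^esub> x) = r \<cdot> F x)"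

definition mbil :: "('r::comm_ring_1, 'a, 'm) gralg_scheme \<Rightarrow> ('r, 'b, 'n) gralg_scheme \<Rightarrow> 'q set \<Rightarrow>
    ('a \<Rightarrow> 'b \<Rightarrow> 'q \<Rightarrow> 'r) \<Rightarrow> bool" where
  "mbil M N Y G \<longleftrightarrow>
     (\<forall>y\<in>carrier N. mlin M Y (\<lambda>x. G x y)) \<and> (\<forall>x\<in>carrier M. mlin N Y (G x))"

lemma mlinI:
  assumes "\<And>x. x \<in> carrier M \<Longrightarrow> F x \<in> fsupp Y"
    "\<And>x y. x \<in> carrier M \<Longrightarrow> y \<in> carrier M \<Longrightarrow> F (x \<oplus>\<^bsub>M\<^esub> y) = F x + F y"
    "\<And>r x. x \<in> carrier M \<Longrightarrow> F (r \<odot>\<^bsub>M\<^esub> x) = r \<cdot> F x"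
  shows "mlin M Y F"
  using assms unfolding mlin_def by blast

lemma mlinD:
  assumes "mlin M Y F"
  shows "x \<in> carrier M \<Longrightarrow> F x \<in> fsupp Y"
    "x \<in> carrier M \<Longrightarrow> y \<in> carrier M \<Longrightarrow> F (x \<oplus>\<^bsub>M\<^esub> y) = F x + F y"
    "x \<in> carrier M \<Longrightarrow> F (r \<odot>\<^bsub>M\<^esub> x) = r \<cdot> F x"
  using assms unfolding mlin_def by blast+

lemma mbilD:
  assumes "mbil M N Y G"
  shows "y \<in> carrier N \<Longrightarrow> mlin M Y (\<lambda>x. G x y)" "x \<in> carrier M \<Longrightarrow> mlin N Y (G x)"
  using assms unfolding mbil_def by blast+

lemma mbilI:
  assumes "\<And>y. y \<in> carrier N \<Longrightarrow> mlin M Y (\<lambda>x. G x y)" "\<And>x. x \<in> carrier M \<Longrightarrow> mlin N Y (G x)"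
  shows "mbil M N Y G"
  using assms unfolding mbil_def by blast

lemma mbil_fsupp: "mbil M N Y G \<Longrightarrow> x \<in> carrier M \<Longrightarrow> y \<in> carrier N \<Longrightarrow> G x y \<in> fsupp Y"
  using mbilD(2) mlinD(1) by metis

lemma mlin_lext:
  assumes "mlin M X F" "\<And>p. p \<in> X \<Longrightarrow> \<beta> p \<in> fsupp Y"
  shows "mlin M Y (\<lambda>v. lext \<beta> (F v))"
proof (rule mlinI)
  show "lext \<beta> (F x) \<in> fsupp Y" if "x \<in> carrier M" for x
    using assms that by (intro lext_fsupp) (metis mlinD(1) fsupp_in)
qed (use assms(1) in \<open>auto simp: mlinD(2,3) intro: lext_add lext_scale dest: mlinD(1)\<close>)

lemma mlin_add: "mlin M Y F \<Longrightarrow> mlin M Y G \<Longrightarrow> mlin M Y (\<lambda>v. F v + G v)"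
  unfolding mlin_def by (auto simp: algebra_simps fscale_add)

lemma mlin_scale: "mlin M Y F \<Longrightarrow> mlin M Y (\<lambda>v. r \<cdot> F v)"
  unfolding mlin_def by (auto simp: algebra_simps fscale_add)

lemma mlin_minus: "mlin M Y F \<Longrightarrow> mlin M Y (\<lambda>v. - F v)"
  unfolding mlin_def by (auto simp: algebra_simps)

lemma mlin_lext_fun:
  assumes "\<And>p. z p \<noteq> 0 \<Longrightarrow> mlin M Y (F p)"
  shows "mlin M Y (\<lambda>v. lext (\<lambda>p. F p v) z)"
proof (rule mlinI)
  show "lext (\<lambda>p. F p x) z \<in> fsupp Y" if "x \<in> carrier M" for x
    using assms that by (intro lext_fsupp) (auto dest: mlinD(1))
  show "lext (\<lambda>p. F p (x \<oplus>\<^bsub>M\<^esub> y)) z = lext (\<lambda>p. F p x) z + lext (\<lambda>p. F p y) z"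
    if "x \<in> carrier M" "y \<in> carrier M" for x y
    unfolding lext_fun_add[symmetric] using that assms by (intro lext_cong) (metis mlinD(2))
  show "lext (\<lambda>p. F p (r \<odot>\<^bsub>M\<^esub> x)) z = r \<cdot> lext (\<lambda>p. F p x) z" if "x \<in> carrier M" for r x
    unfolding lext_fun_scale[symmetric] using that assms by (intro lext_cong) (metis mlinD(3))
qed

lemma mlin_comp:
  assumes "mlin N Y G" "\<And>x. x \<in> carrier M \<Longrightarrow> f x \<in> carrier N"
    "\<And>x y. x \<in> carrier M \<Longrightarrow> y \<in> carrier M \<Longrightarrow> f (x \<oplus>\<^bsub>M\<^esub> y) = f x \<oplus>\<^bsub>N\<^esub> f y"
    "\<And>r x. x \<in> carrier M \<Longrightarrow> f (r \<odot>\<^bsub>M\<^esub> x) = r \<odot>\<^bsub>N\<^esub> f x"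
  shows "mlin M Y (\<lambda>x. G (f x))"
  using assms unfolding mlin_def by simp

lemma mlin_comp_graded:
  assumes "mlin N Y G" "graded_linear k M N f"
  shows "mlin M Y (\<lambda>x. G (f x))"
  using assms(2) by (intro mlin_comp[OF assms(1)]) (auto simp: graded_linear_def)

context graded_free_mod
begin

lemma mlin_coord: "mlin M (hbasis M) (coord M)"
  by (intro mlinI) (simp_all add: coord_add coord_smult)

lemma mlin_0:
  assumes "mlin M Y F"
  shows "F \<zero> = 0"
  using mlinD(3)[OF assms, of \<zero> 0] by simp

text \<open>The universal property of a free module. Every \<open>v\<close> is \<open>asm\<close> of
  its coordinates, so the claim reduces to an induction on coordinate functions.\<close>

lemma mlin_eq_lext:
  assumes F: "mlin M Y F" and v: "v \<in> carrier M"
  shows "F v = lext F (coord M v)"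
proof -
  have "F (asm c) = lext F c" if "c \<in> fsupp (hbasis M)" for c
    using that
  proof (induction rule: fsupp_induct)
    case zero
    then show ?case
      by (simp add: asm_zero mlin_0[OF F])
  next
    case (add c c')
    then show ?case
      by (simp only: asm_add mlinD(2)[OF F] asm_closed lext_add)
  next
    case (scale r c)
    then show ?case
      by (simp only: asm_scale mlinD(3)[OF F] asm_closed lext_scale)
  qed (simp add: asm_delta)
  from this[OF coord_fsupp, of v] show ?thesis
    using asm_coord[OF v] by simp
qed

lemma mlin_extend:
  assumes "\<And>p. p \<in> hbasis M \<Longrightarrow> \<beta> p \<in> fsupp Y"
  shows "mlin M Y (\<lambda>v. lext \<beta> (coord M v))"
  using assms by (rule mlin_lext[OF mlin_coord])

text \<open>Here \<open>\<beta>\<close> need not be linear: it may contain a sign such as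
  \<open>ksign (gdeg M x)\<close>. Only basis elements of degree \<open>n\<close> contribute to
  \<open>v\<close>, so agreement with a linear map on those suffices.\<close>

lemma lext_coord_hcomp:
  assumes "mlin M Y F" "v \<in> hcomp M n"
    and "\<And>x. x \<in> hbasis M \<Longrightarrow> x \<in> hcomp M n \<Longrightarrow> gdeg M x = n \<Longrightarrow> \<beta> x = F x"
  shows "lext \<beta> (coord M v) = F v"
proof -
  have "lext \<beta> (coord M v) = lext F (coord M v)"
    using assms(3) coord_hcomp[OF assms(2)] hbasis_hcomp by (intro lext_cong) metis
  then show ?thesis
    using mlin_eq_lext[OF assms(1) hcomp_carrier[OF assms(2)]] by simp
qed

lemma mlin_eqI:
  assumes "mlin M Y F" "mlin M Z G" "v \<in> carrier M"
    and "\<And>x. x \<in> hbasis M \<Longrightarrow> x \<in> hcomp M (gdeg M x) \<Longrightarrow> F x = G x"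
  shows "F v = G v"
proof -
  have "lext F (coord M v) = lext G (coord M v)"
    using assms(4) hbasis_hcomp fsupp_in[OF coord_fsupp] by (intro lext_cong) metis
  then show ?thesis
    using mlin_eq_lext[OF assms(1,3)] mlin_eq_lext[OF assms(2,3)] by simp
qed

end

section \<open>Tensors\<close>

lemma prod_fsupp:
  assumes "c \<in> fsupp X" "d \<in> fsupp Y"
  shows "(\<lambda>(x, y). c x * d y) \<in> fsupp (X \<times> Y)"
  using assms
  by (intro fsuppI[of "{x. c x \<noteq> 0} \<times> {y. d y \<noteq> 0}"]) (auto simp: fsupp_def)

lemma lext_prod:
  assumes "c \<in> fsupp X" "d \<in> fsupp Y"
  shows "lext \<beta> (\<lambda>(x, y). c x * d y) = lext (\<lambda>x. lext (\<lambda>y. \<beta> (x, y)) d) c"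
proof -
  let ?S = "{x. c x \<noteq> 0}" and ?T = "{y. d y \<noteq> 0}"
  have fin: "finite ?S" "finite ?T"
    using assms by (auto simp: fsupp_def)
  have "lext \<beta> (\<lambda>(x, y). c x * d y) = (\<Sum>p\<in>?S \<times> ?T. (case p of (x, y) \<Rightarrow> c x * d y) \<cdot> \<beta> p)"
    using fin by (intro lext_alt) auto
  also have "\<dots> = (\<Sum>x\<in>?S. \<Sum>y\<in>?T. (c x * d y) \<cdot> \<beta> (x, y))"
    by (simp add: sum.cartesian_product split_def)
  also have "\<dots> = lext (\<lambda>x. lext (\<lambda>y. \<beta> (x, y)) d) c"
    using fin by (simp add: lext_alt[of ?S] lext_alt[of ?T] fscale_sum)
  finally show ?thesis .
qed

locale tensor_mod = M: graded_free_mod M + N: graded_free_mod N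
  for M :: "('r::comm_ring_1, 'a, 'm) gralg_scheme" and N :: "('r, 'b, 'n) gralg_scheme"
begin

lemma tens_fsupp [simp]: "tens M N a b \<in> fsupp (hbasis M \<times> hbasis N)"
  unfolding tens_def by (rule prod_fsupp[OF M.coord_fsupp N.coord_fsupp])

lemma tens_hbasis: "x \<in> hbasis M \<Longrightarrow> y \<in> hbasis N \<Longrightarrow> tens M N x y = delta (x, y)"
  by (auto simp: tens_def M.coord_hbasis N.coord_hbasis delta_def fun_eq_iff)

lemma lext_tens_iter:
  "lext \<beta> (tens M N a b) = lext (\<lambda>x. lext (\<lambda>y. \<beta> (x, y)) (coord N b)) (coord M a)"
  unfolding tens_def by (rule lext_prod[OF M.coord_fsupp N.coord_fsupp])

lemma tens_add:
  "a \<in> carrier M \<Longrightarrow> a' \<in> carrier M \<Longrightarrow> tens M N (a \<oplus>\<^bsub>M\<^esub> a') b = tens M N a b + tens M N a' b"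
  "b \<in> carrier N \<Longrightarrow> b' \<in> carrier N \<Longrightarrow> tens M N a (b \<oplus>\<^bsub>N\<^esub> b') = tens M N a b + tens M N a b'"
  by (auto simp: tens_def M.coord_add N.coord_add algebra_simps fun_eq_iff fun_apply)

lemma tens_smult:
  "a \<in> carrier M \<Longrightarrow> tens M N (r \<odot>\<^bsub>M\<^esub> a) b = r \<cdot> tens M N a b"
  "b \<in> carrier N \<Longrightarrow> tens M N a (r \<odot>\<^bsub>N\<^esub> b) = r \<cdot> tens M N a b"
  by (auto simp: tens_def M.coord_smult N.coord_smult algebra_simps fun_eq_iff fun_apply)

lemma tens_zero [simp]: "tens M N \<zero>\<^bsub>M\<^esub> b = 0" "tens M N a \<zero>\<^bsub>N\<^esub> = 0"
  by (auto simp: tens_def M.coord_zero N.coord_zero fun_eq_iff fun_apply)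

lemma tens_supp_hcomp:
  assumes "a \<in> hcomp M m" "b \<in> hcomp N n" "tens M N a b (x, y) \<noteq> 0"
  shows "x \<in> hbasis M" "y \<in> hbasis N" "gdeg M x = m" "gdeg N y = n"
proof -
  have "coord M a x \<noteq> 0" "coord N b y \<noteq> 0"
    using assms(3) unfolding tens_def by auto
  then show "x \<in> hbasis M" "y \<in> hbasis N" "gdeg M x = m" "gdeg N y = n"
    using M.coord_hcomp[OF assms(1)] N.coord_hcomp[OF assms(2)] by auto
qed

text \<open>The universal property of the tensor product. Expanding first in the second variable and
  then in the first evaluates the bilinear \<open>G\<close> at \<open>a\<close> and \<open>b\<close>
  themselves, so the result does not depend on the chosen bases.\<close>

lemma lext_tens:
  assumes G: "mbil M N Y G" and a: "a \<in> carrier M" and b: "b \<in> carrier N"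
  shows "lext (\<lambda>(x, y). G x y) (tens M N a b) = G a b"
proof -
  have "lext (\<lambda>(x, y). G x y) (tens M N a b) = lext (\<lambda>x. lext (G x) (coord N b)) (coord M a)"
    by (simp add: lext_tens_iter)
  also have "\<dots> = lext (\<lambda>x. G x b) (coord M a)"
    using fsupp_in[OF M.coord_fsupp] N.mlin_eq_lext[OF mbilD(2)[OF G] b] M.hbasis_carrier
    by (intro lext_cong) metis
  also have "\<dots> = G a b"
    using M.mlin_eq_lext[OF mbilD(1)[OF G b] a] by simp
  finally show ?thesis .
qed

text \<open>The signed version of \<open>lext_tens\<close>. A \<open>\<beta>\<close> that depends on
  the degrees of basis elements is not bilinear, but on pairs of degrees \<open>m\<close> and
  \<open>n\<close> its signs are constant and it may agree with a bilinear \<open>G\<close>. Most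
  sign computations below pass through this lemma.\<close>

lemma lext_tens_hcomp:
  assumes G: "mbil M N Y G" and a: "a \<in> hcomp M m" and b: "b \<in> hcomp N n"
    and eq: "\<And>x y. x \<in> hbasis M \<Longrightarrow> y \<in> hbasis N \<Longrightarrow> x \<in> hcomp M m \<Longrightarrow> y \<in> hcomp N n \<Longrightarrow>
      gdeg M x = m \<Longrightarrow> gdeg N y = n \<Longrightarrow> \<beta> (x, y) = G x y"
  shows "lext \<beta> (tens M N a b) = G a b"
proof -
  have "lext \<beta> (tens M N a b) = lext (\<lambda>(x, y). G x y) (tens M N a b)"
  proof (rule lext_cong)
    fix p assume *: "tens M N a b p \<noteq> 0"
    obtain x y where p: "p = (x, y)"
      by (cases p)
    note s = tens_supp_hcomp[OF a b *[unfolded p]]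
    show "\<beta> p = (case p of (x, y) \<Rightarrow> G x y)"
      unfolding p using eq s M.hbasis_hcomp[OF s(1)] N.hbasis_hcomp[OF s(2)] by simp
  qed
  then show ?thesis
    using lext_tens[OF G M.hcomp_carrier[OF a] N.hcomp_carrier[OF b]] by simp
qed

text \<open>The first argument is a basis element and \<open>\<beta>\<close> is linear only in the
  second; this is the situation met when an iterated tensor product is evaluated in
  \<open>coassoc_lext\<close>.\<close>

lemma lext_tens_hbasis:
  assumes "x \<in> hbasis M" "mlin N Y (\<lambda>y. \<beta> (x, y))" "b \<in> carrier N"
  shows "lext \<beta> (tens M N x b) = \<beta> (x, b)"
  using assms N.mlin_eq_lext[OF assms(2,3)] by (simp add: lext_tens_iter M.coord_hbasis)

lemma fsupp_tens_induct [consumes 1, case_names zero add scale base]: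
  assumes "z \<in> fsupp (hbasis M \<times> hbasis N)"
    and "P 0"
    and "\<And>z z'. z \<in> fsupp (hbasis M \<times> hbasis N) \<Longrightarrow> z' \<in> fsupp (hbasis M \<times> hbasis N) \<Longrightarrow>
      P z \<Longrightarrow> P z' \<Longrightarrow> P (z + z')"
    and "\<And>r z. z \<in> fsupp (hbasis M \<times> hbasis N) \<Longrightarrow> P z \<Longrightarrow> P (r \<cdot> z)"
    and "\<And>x y. x \<in> hbasis M \<Longrightarrow> y \<in> hbasis N \<Longrightarrow> x \<in> hcomp M (gdeg M x) \<Longrightarrow> y \<in> hcomp N (gdeg N y) \<Longrightarrow>
      P (tens M N x y)"
  shows "P z"
  using assms(1)
proof (induction rule: fsupp_induct)
  case (base p)
  then show ?case
    using assms(5) M.hbasis_hcomp N.hbasis_hcomp by (cases p) (auto simp: tens_hbasis)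
qed (use assms in blast)+

end

section \<open>Modules of finitely supported functions\<close>

text \<open>Free graded modules whose elements are functions, with a degree attached to each point
  of \<open>X\<close>. The points are pairs of basis elements for a tensor product and words for the
  cobar construction.\<close>

locale fun_mod =
  fixes M :: "('r::comm_ring_1, 'p \<Rightarrow> 'r, 'm) gralg_scheme" and X :: "'p set" and deg :: "'p \<Rightarrow> int"
  assumes carrier_eq: "carrier M = fsupp X"
    and add_eq: "add M = (+)" and zero_eq: "zero M = 0" and smult_eq: "smult M = (\<cdot>)"
    and hcomp_eq: "\<And>n. hcomp M n = {z \<in> fsupp X. \<forall>p. z p \<noteq> 0 \<longrightarrow> deg p = n}"
begin

lemmas fun_eqs = carrier_eq add_eq zero_eq smult_eq

lemma fun_module: "module scalars M"
proof (rule moduleI)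
  show "abelian_group M"
  proof (rule abelian_groupI)
    show "\<exists>y\<in>carrier M. y \<oplus>\<^bsub>M\<^esub> x = \<zero>\<^bsub>M\<^esub>" if "x \<in> carrier M" for x
      using that unfolding fun_eqs by (intro bexI[of _ "- x"]) auto
  qed (auto simp: fun_eqs add_ac)
qed (auto simp: fun_eqs scalars_cring fscale_add fscale_add_left)

lemma fun_finsum:
  assumes "f \<in> I \<rightarrow> fsupp X"
  shows "finsum M f I = (\<Sum>i\<in>I. f i)"
proof -
  interpret module scalars M
    by (rule fun_module)
  show ?thesis
    using assms
  proof (induction I rule: infinite_finite_induct)
    case (insert i I)
    then have "finsum M f (insert i I) = f i + finsum M f I"
      by (subst finsum_insert) (auto simp: fun_eqs)
    also have "finsum M f I = (\<Sum>i\<in>I. f i)"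
      using insert by auto
    finally show ?case
      using sum.insert[OF insert(1,2), of f] by (simp del: sum.insert)
  qed (auto simp: fun_eqs zero_eq)
qed

text \<open>At a point \<open>p\<close> only the component with index \<open>deg p\<close> can be
  nonzero, so evaluating the sum of the components at \<open>p\<close> determines all of
  them.\<close>

lemma fun_decomposition:
  "decomposition M x c \<longleftrightarrow> x \<in> fsupp X \<and> c = (\<lambda>n p. if deg p = n then x p else 0)"
proof
  assume *: "decomposition M x c"
  define T where "T = {n. c n \<noteq> 0}"
  have c: "c n \<in> fsupp X" "\<And>p. c n p \<noteq> 0 \<Longrightarrow> deg p = n" for n
    using * unfolding decomposition_def hcomp_eq by blast+
  have T: "finite T" "x = (\<Sum>n\<in>T. c n)"
    using * c(1) unfolding decomposition_def T_def zero_eq by (auto simp: fun_finsum)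
  have "c n p = (if deg p = n then x p else 0)" for n p
  proof -
    have "x p = (\<Sum>k\<in>T. if k = deg p then c (deg p) p else 0)"
      unfolding T(2) sum_fun_apply using c(2) by (intro sum.cong) auto
    also have "\<dots> = c (deg p) p"
      using T(1) by (auto simp: T_def zero_fun_apply)
    finally show ?thesis
      using c(2)[of n p] by auto
  qed
  then show "x \<in> fsupp X \<and> c = (\<lambda>n p. if deg p = n then x p else 0)"
    using T(2) c(1) fsupp_sum[of T c X] by auto
next
  assume *: "x \<in> fsupp X \<and> c = (\<lambda>n p. if deg p = n then x p else 0)"
  let ?S = "{p. x p \<noteq> 0}"
  have fin: "finite ?S" "?S \<subseteq> X" and c: "c = (\<lambda>n p. if deg p = n then x p else 0)"
    using * by (auto simp: fsupp_def)
  have cX: "c n \<in> fsupp X" for n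
    unfolding c using fin by (intro fsuppI[of ?S]) (auto split: if_splits)
  have h: "c n \<in> hcomp M n" for n
    using cX unfolding hcomp_eq c by auto
  define T where "T = {n. c n \<noteq> 0}"
  have sub: "T \<subseteq> deg ` ?S"
    unfolding T_def c by (auto simp: fun_eq_iff fun_apply split: if_splits)
  then have T: "finite T"
    using fin(1) finite_subset by blast
  have "x p = (\<Sum>n\<in>T. c n p)" for p
  proof -
    have "(\<Sum>n\<in>T. c n p) = (\<Sum>n\<in>T. if n = deg p then x p else 0)"
      unfolding c by (intro sum.cong) auto
    also have "\<dots> = x p"
      using T by (auto simp: T_def c fun_eq_iff fun_apply)
    finally show ?thesis
      by simp
  qed
  then have "x = (\<Sum>n\<in>T. c n)"
    by (simp add: fun_eq_iff sum_fun_apply)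
  then show "decomposition M x c"
    using h T cX unfolding decomposition_def zero_eq T_def by (auto simp: fun_finsum)
qed

lemma fun_graded_module: "graded_module M"
proof -
  interpret module scalars M
    by (rule fun_module)
  have neg: "\<ominus>\<^bsub>M\<^esub> x = - x" if "x \<in> fsupp X" for x
    using that by (intro M.minus_equality) (auto simp: fun_eqs)
  have "submodule (hcomp M n) scalars M" for n
  proof (rule submoduleI)
    show "x \<oplus>\<^bsub>M\<^esub> y \<in> hcomp M n" if "x \<in> hcomp M n" "y \<in> hcomp M n" for x y
    proof -
      have "deg p = n" if "x p + y p \<noteq> 0" for p
        using that \<open>x \<in> hcomp M n\<close> \<open>y \<in> hcomp M n\<close> unfolding hcomp_eq by (cases "x p = 0") auto
      then show ?thesis
        using that by (auto simp: hcomp_eq fun_eqs fun_apply)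
    qed
    show "a \<odot>\<^bsub>M\<^esub> x \<in> hcomp M n" if "x \<in> hcomp M n" for a x
    proof -
      have "deg p = n" if "a * x p \<noteq> 0" for p
        using that \<open>x \<in> hcomp M n\<close> unfolding hcomp_eq by (cases "x p = 0") auto
      then show ?thesis
        using that by (auto simp: hcomp_eq fun_eqs fun_apply)
    qed
  qed (auto simp: fun_eqs hcomp_eq neg fun_apply)
  then show ?thesis
    unfolding graded_module_def fun_decomposition carrier_eq using fun_module by auto
qed

text \<open>This shows that a homogeneous basis exists. The basis \<open>hbasis M\<close>, selected
  by choice, may be a different one; expansions in the functions \<open>delta p\<close>
  (\<open>mlin_eq_lext_delta\<close>) therefore have to be kept apart from expansions in
  \<open>hbasis M\<close>.\<close>

lemma fun_homogeneous_basis: "homogeneous_basis M (delta ` X)"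
  unfolding homogeneous_basis_def
proof (intro conjI ballI)
  show "delta ` X \<subseteq> (\<Union>n. hcomp M n)"
  proof
    fix d :: "'p \<Rightarrow> 'r" assume "d \<in> delta ` X"
    then obtain p where "d = (delta p :: 'p \<Rightarrow> 'r)" "p \<in> X"
      by blast
    then have "d \<in> hcomp M (deg p)"
      by (simp add: hcomp_eq)
    then show "d \<in> (\<Union>n. hcomp M n)"
      by blast
  qed
  fix v :: "'p \<Rightarrow> 'r" assume "v \<in> carrier M"
  then have v: "v \<in> fsupp X"
    by (simp add: carrier_eq)
  have inj: "delta p = (delta q :: 'p \<Rightarrow> 'r) \<longleftrightarrow> p = q" for p q
    by (metis delta_def zero_neq_one)
  have fins: "(\<Oplus>\<^bsub>M\<^esub>x\<in>{x. c x \<noteq> 0}. c x \<odot>\<^bsub>M\<^esub> x) = (\<Sum>x\<in>{x. c x \<noteq> 0}. c x \<cdot> x)"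
    if "{x. c x \<noteq> 0} \<subseteq> delta ` X" for c :: "('p \<Rightarrow> 'r) \<Rightarrow> 'r"
    using that unfolding smult_eq by (intro fun_finsum) (auto 0 3)
  show "\<exists>!c. {x. c x \<noteq> 0} \<subseteq> delta ` X \<and> finite {x. c x \<noteq> 0} \<and>
      v = (\<Oplus>\<^bsub>M\<^esub>x\<in>{x. c x \<noteq> 0}. c x \<odot>\<^bsub>M\<^esub> x)"
  proof (rule ex1I)
    \<comment> \<open>Coordinates are indexed by functions rather than points. The sum inverts
      \<open>delta\<close>, which is injective because \<open>0 \<noteq> 1\<close>, and takes the
      value \<open>0\<close> off its image.\<close>
    let ?c = "\<lambda>x :: 'p \<Rightarrow> 'r. \<Sum>p\<in>{p. v p \<noteq> 0}. if x = delta p then v p else 0"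
    have fin: "finite {p. v p \<noteq> 0}" "{p. v p \<noteq> 0} \<subseteq> X"
      using v by (auto simp: fsupp_def)
    have cd: "?c (delta p) = v p" for p
      using fin(1) by (simp add: inj)
    have c0: "x \<in> delta ` {p. v p \<noteq> 0}" if "?c x \<noteq> 0" for x
    proof (rule ccontr)
      assume "x \<notin> delta ` {p. v p \<noteq> 0}"
      then have "?c x = 0"
        by (intro sum.neutral) auto
      then show False
        using that by simp
    qed
    have supp: "{x. ?c x \<noteq> 0} = delta ` {p. v p \<noteq> 0}"
      using c0 cd by (auto simp del: sum.delta sum.delta')
    have "(\<Sum>x\<in>{x. ?c x \<noteq> 0}. ?c x \<cdot> x) = (\<Sum>p\<in>{p. v p \<noteq> 0}. v p \<cdot> delta p)"
      unfolding supp using fin(1) by (subst sum.reindex) (auto simp: inj_on_def inj intro!: sum.cong)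
    also have "\<dots> = lext delta v"
      using fin by (intro lext_alt[symmetric]) auto
    also have "\<dots> = v"
      by (rule lext_delta_id[OF v])
    finally have "v = (\<Sum>x\<in>{x. ?c x \<noteq> 0}. ?c x \<cdot> x)" ..
    moreover have "{x. ?c x \<noteq> 0} \<subseteq> delta ` X" "finite {x. ?c x \<noteq> 0}"
      unfolding supp using fin by auto
    ultimately show "{x. ?c x \<noteq> 0} \<subseteq> delta ` X \<and> finite {x. ?c x \<noteq> 0} \<and>
        v = (\<Oplus>\<^bsub>M\<^esub>x\<in>{x. ?c x \<noteq> 0}. ?c x \<odot>\<^bsub>M\<^esub> x)"
      using fins[of ?c] by auto
    fix d assume d: "{x. d x \<noteq> 0} \<subseteq> delta ` X \<and> finite {x. d x \<noteq> 0} \<and>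
      v = (\<Oplus>\<^bsub>M\<^esub>x\<in>{x. d x \<noteq> 0}. d x \<odot>\<^bsub>M\<^esub> x)"
    have vd: "v = (\<Sum>x\<in>{x. d x \<noteq> 0}. d x \<cdot> x)"
      using d fins[of d] by simp
    have dd: "v p = d (delta p)" for p
    proof -
      have "v p = (\<Sum>x\<in>{x. d x \<noteq> 0}. d x * x p)"
        by (subst vd) (simp add: sum_fun_apply fun_apply)
      also have "\<dots> = (\<Sum>x\<in>{x. d x \<noteq> 0}. if x = delta p then d x else 0)"
        using d by (intro sum.cong) (auto simp: delta_def fun_eq_iff split: if_splits)
      also have "\<dots> = d (delta p)"
        using d by (subst sum.delta) auto
      finally show ?thesis .
    qed
    show "d = ?c"
    proof (rule ext)
      fix x
      show "d x = ?c x"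
      proof (cases "x \<in> range delta")
        case True
        then show ?thesis
          using dd cd by (auto simp del: sum.delta sum.delta')
      next
        case False
        then have "d x = 0" "?c x = 0"
          using d c0 by blast+
        then show ?thesis
          by simp
      qed
    qed
  qed
qed

sublocale graded_free_mod M
  using fun_graded_module fun_homogeneous_basis
  by unfold_locales (auto simp: graded_free_def)

lemma hcompI: "z \<in> fsupp X \<Longrightarrow> (\<And>p. z p \<noteq> 0 \<Longrightarrow> deg p = n) \<Longrightarrow> z \<in> hcomp M n"
  by (simp add: hcomp_eq)

lemma delta_hcomp: "p \<in> X \<Longrightarrow> delta p \<in> hcomp M (deg p)"
  by (intro hcompI) auto

lemma lext_hcomp:
  assumes "\<And>p. z p \<noteq> 0 \<Longrightarrow> \<beta> p \<in> hcomp M n"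
  shows "lext \<beta> z \<in> hcomp M n"
proof (rule hcompI)
  show "lext \<beta> z \<in> fsupp X"
    using assms by (intro lext_fsupp) (auto simp: hcomp_eq)
  show "deg q = n" if "lext \<beta> z q \<noteq> 0" for q
    using that assms by (elim lext_nonzeroE) (auto simp: hcomp_eq)
qed

lemma mlin_lext_id: "(\<And>p. p \<in> X \<Longrightarrow> \<beta> p \<in> fsupp Y) \<Longrightarrow> mlin M Y (lext \<beta>)"
proof (rule mlinI)
  show "lext \<beta> x \<in> fsupp Y" if "\<And>p. p \<in> X \<Longrightarrow> \<beta> p \<in> fsupp Y" "x \<in> carrier M" for x
    using that by (intro lext_fsupp) (auto simp: carrier_eq dest: fsupp_in)
qed (auto simp: fun_eqs lext_add lext_scale)

lemma mlin_eq_lext_delta: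
  assumes F: "mlin M Y F" and z: "z \<in> fsupp X"
  shows "F z = lext (\<lambda>p. F (delta p)) z"
  using z
proof (induction rule: fsupp_induct)
  case zero
  then show ?case
    using mlin_0[OF F] by (simp add: zero_eq)
next
  case (add z z')
  then show ?case
    using mlinD(2)[OF F, of z z'] by (simp add: fun_eqs lext_add)
next
  case (scale r z)
  then show ?case
    using mlinD(3)[OF F, of z r] by (simp add: fun_eqs lext_scale)
qed simp

end

lemma tensor_simps:
  "carrier (tensor A B) = fsupp (hbasis A \<times> hbasis B)"
  "add (tensor A B) = (+)" "zero (tensor A B) = 0" "smult (tensor A B) = (\<cdot>)"
  "one (tensor A B) = tens A B \<one>\<^bsub>A\<^esub> \<one>\<^bsub>B\<^esub>"
  by (simp_all add: tensor_def fsupp_def Let_def)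

lemma tensor_hcomp:
  "hcomp (tensor A B) n = {z \<in> fsupp (hbasis A \<times> hbasis B).
     \<forall>p. z p \<noteq> 0 \<longrightarrow> (case p of (x, y) \<Rightarrow> gdeg A x + gdeg B y) = n}"
  by (auto simp: tensor_def fsupp_def Let_def)

lemma tensor_fun_mod:
  "fun_mod (tensor A B) (hbasis A \<times> hbasis B) (\<lambda>(x, y). gdeg A x + gdeg B y)"
  by unfold_locales (auto simp: tensor_simps tensor_hcomp)

section \<open>Chain algebras and their homology\<close>

context graded_free_mod
begin

definition proj :: "int \<Rightarrow> 'a \<Rightarrow> 'a" where
  "proj n v = asm (\<lambda>x. if gdeg M x = n then coord M v x else 0)"

text \<open>The linear involution that multiplies elements of degree n by (-1)^n. With it the
  Leibniz rule can be stated for elements that are not homogeneous.\<close>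

definition invol :: "'a \<Rightarrow> 'a" where
  "invol v = asm (\<lambda>x. ksign (gdeg M x) * coord M v x)"

lemma proj_coord: "(\<lambda>x. if gdeg M x = n then coord M v x else 0) \<in> fsupp (hbasis M)"
  by (rule fsuppI[OF fsupp_finite[OF coord_fsupp[of v]]])
    (auto split: if_splits dest: fsupp_in[OF coord_fsupp])

lemma invol_coord: "(\<lambda>x. ksign (gdeg M x) * coord M v x) \<in> fsupp (hbasis M)"
  by (rule fsuppI[OF fsupp_finite[OF coord_fsupp[of v]]])
    (auto dest: fsupp_in[OF coord_fsupp])

lemma decomposition_proj: "v \<in> carrier M \<Longrightarrow> decomposition M v (\<lambda>n. proj n v)"
  using asm_decomposition[OF coord_fsupp, of v] unfolding proj_def by (simp add: asm_coord)

lemma proj_closed [simp]: "proj n v \<in> carrier M"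
  unfolding proj_def by (rule asm_closed[OF proj_coord])

lemma proj_in_hcomp: "v \<in> carrier M \<Longrightarrow> proj n v \<in> hcomp M n"
  using decomposition_proj[of v] by (simp add: decomposition_def)

lemma proj_hcomp: "v \<in> hcomp M m \<Longrightarrow> proj n v = (if n = m then v else \<zero>)"
  using decomposition_unique[OF decomposition_proj decomposition_hcomp] hcomp_carrier
  by (metis (mono_tags, lifting))

lemma proj_add: "v \<in> carrier M \<Longrightarrow> w \<in> carrier M \<Longrightarrow> proj n (v \<oplus> w) = proj n v \<oplus> proj n w"
  unfolding proj_def asm_add[OF proj_coord proj_coord, symmetric]
  by (rule arg_cong[where f = asm]) (auto simp: coord_add fun_apply)

lemma proj_zero [simp]: "proj n \<zero> = \<zero>"
  using proj_hcomp[OF hcomp_zero[of n], of n] by simp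

lemma proj_finsum:
  "finite I \<Longrightarrow> f \<in> I \<rightarrow> carrier M \<Longrightarrow> proj n (\<Oplus>i\<in>I. f i) = (\<Oplus>i\<in>I. proj n (f i))"
  by (induction I rule: finite_induct) (auto simp: finsum_insert proj_add)

lemma finsum_single:
  assumes "finite I" "\<And>i. i \<in> I \<Longrightarrow> f i \<in> carrier M"
  shows "(\<Oplus>i\<in>I. if k = i then f i else \<zero>) = (if k \<in> I then f k else \<zero>)"
proof (cases "k \<in> I")
  case True
  then show ?thesis
    using assms finsum_singleton[of k I f] by (simp add: Pi_def)
next
  case False
  then have "(\<Oplus>i\<in>I. if k = i then f i else \<zero>) = (\<Oplus>i\<in>I. \<zero>)"
    by (intro finsum_cong) (auto simp: simp_implies_def)
  then show ?thesis
    using False by simp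
qed

lemma invol_closed [simp]: "invol v \<in> carrier M"
  unfolding invol_def by (rule asm_closed[OF invol_coord])

lemma invol_add: "v \<in> carrier M \<Longrightarrow> w \<in> carrier M \<Longrightarrow> invol (v \<oplus> w) = invol v \<oplus> invol w"
  unfolding invol_def asm_add[OF invol_coord invol_coord, symmetric]
  by (rule arg_cong[where f = asm]) (auto simp: coord_add fun_apply algebra_simps)

lemma invol_hcomp:
  assumes "v \<in> hcomp M n"
  shows "invol v = ksign n \<odot> v"
proof -
  have "(\<lambda>x. ksign (gdeg M x) * coord M v x) = ksign n \<cdot> coord M v"
    using coord_hcomp(2)[OF assms] by (force simp: fun_eq_iff fun_apply)
  then show ?thesis
    unfolding invol_def using assms hcomp_carrier by (simp add: asm_scale asm_coord)
qed

text \<open>Every element is the sum of its finitely many components, so additive statements reduce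
  to homogeneous elements. The empty sum is covered because \<open>\<zero>\<close> belongs to every
  component.\<close>

lemma carrier_induct [consumes 1, case_names add hcomp]:
  assumes "v \<in> carrier M"
    and "\<And>x y. x \<in> carrier M \<Longrightarrow> y \<in> carrier M \<Longrightarrow> P x \<Longrightarrow> P y \<Longrightarrow> P (x \<oplus> y)"
    and "\<And>n x. x \<in> hcomp M n \<Longrightarrow> P x"
  shows "P v"
proof -
  have "P (\<Oplus>n\<in>I. proj n v)" if "finite I" for I
    using that by (induction I rule: finite_induct)
      (auto simp: finsum_insert intro: assms(2) assms(3)[OF hcomp_zero] assms(3)[OF proj_in_hcomp[OF assms(1)]])
  then show ?thesis
    using decomposition_proj[OF assms(1)] unfolding decomposition_def by metis
qed

end

locale graded_free_alg =
  fixes A :: "('r::comm_ring_1, 'a, 'm) gralg_scheme" (structure)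
  assumes graded_algebra: "graded_algebra A" and free: "graded_free A"
begin

sublocale graded_free_mod A
  using graded_algebra free by unfold_locales (auto simp: graded_algebra_def)

sublocale ring A
  using graded_algebra by (simp add: graded_algebra_def)

lemma smult_mult:
  "x \<in> carrier A \<Longrightarrow> y \<in> carrier A \<Longrightarrow> (r \<odot> x) \<otimes> y = r \<odot> (x \<otimes> y)"
  "x \<in> carrier A \<Longrightarrow> y \<in> carrier A \<Longrightarrow> x \<otimes> (r \<odot> y) = r \<odot> (x \<otimes> y)"
  using graded_algebra unfolding graded_algebra_def by blast+

lemma one_hcomp: "\<one> \<in> hcomp A 0"
  using graded_algebra unfolding graded_algebra_def by blast

lemma mult_hcomp: "x \<in> hcomp A m \<Longrightarrow> y \<in> hcomp A n \<Longrightarrow> x \<otimes> y \<in> hcomp A (m + n)"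
  using graded_algebra unfolding graded_algebra_def by blast

end

locale chain_alg =
  fixes A :: "('r::comm_ring_1, 'a, 'm) chalg_scheme" (structure)
  assumes chain_algebra: "chain_algebra A"
begin

sublocale graded_free_alg A
  using chain_algebra by unfold_locales (auto simp: chain_algebra_def graded_algebra_def)

lemma dif_graded: "graded_linear (- 1) A A (dif A)"
  using chain_algebra by (simp add: chain_algebra_def)

lemma dif_closed [simp]: "x \<in> carrier A \<Longrightarrow> dif A x \<in> carrier A"
  and dif_add: "x \<in> carrier A \<Longrightarrow> y \<in> carrier A \<Longrightarrow> dif A (x \<oplus> y) = dif A x \<oplus> dif A y"
  and dif_smult: "x \<in> carrier A \<Longrightarrow> dif A (r \<odot> x) = r \<odot> dif A x"
  and dif_hcomp: "x \<in> hcomp A n \<Longrightarrow> dif A x \<in> hcomp A (n - 1)"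
  using dif_graded unfolding graded_linear_def by auto

lemma dif_dif [simp]: "x \<in> carrier A \<Longrightarrow> dif A (dif A x) = \<zero>"
  using chain_algebra unfolding chain_algebra_def by blast

lemma dif_zero [simp]: "dif A \<zero> = \<zero>"
  using dif_smult[of \<zero> 0] by simp

lemma dif_leibniz:
  "x \<in> hcomp A n \<Longrightarrow> y \<in> carrier A \<Longrightarrow> dif A (x \<otimes> y) = dif A x \<otimes> y \<oplus> ksign n \<odot> (x \<otimes> dif A y)"
  using chain_algebra unfolding chain_algebra_def by blast

lemma dif_mult:
  assumes "x \<in> carrier A" "y \<in> carrier A"
  shows "dif A (x \<otimes> y) = dif A x \<otimes> y \<oplus> invol x \<otimes> dif A y"
  using assms(1)
proof (induction rule: carrier_induct)
  case (add x x')
  then show ?case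
    using assms(2) by (simp add: dif_add l_distr invol_add a_ac)
next
  case (hcomp n x)
  then show ?case
    using assms(2) hcomp_carrier by (simp add: dif_leibniz invol_hcomp smult_mult)
qed

lemma invol_invol: "x \<in> carrier A \<Longrightarrow> invol (invol x) = x"
proof (induction rule: carrier_induct)
  case (hcomp n x)
  then show ?case
    using hcomp_carrier hcomp_smult[OF hcomp, of "ksign n"] by (simp add: invol_hcomp smult_smult)
qed (simp add: invol_add)

lemma dif_invol: "x \<in> carrier A \<Longrightarrow> dif A (invol x) = \<ominus> invol (dif A x)"
proof (induction rule: carrier_induct)
  case (hcomp n x)
  have "(- ksign (n - 1) :: 'r) = ksign n"
    by (simp add: ksign_def)
  then show ?case
    using hcomp hcomp_carrier dif_hcomp[OF hcomp]
    by (simp add: invol_hcomp dif_smult minus_eq_smult smult_smult)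
qed (simp add: invol_add dif_add minus_add)

lemma dif_proj: "x \<in> carrier A \<Longrightarrow> dif A (proj n x) = proj (n - 1) (dif A x)"
proof (induction rule: carrier_induct)
  case (hcomp m x)
  then show ?case
    using dif_hcomp[OF hcomp] by (simp add: proj_hcomp)
qed (simp add: proj_add dif_add)

section \<open>Cycles, boundaries and the homology algebra\<close>

lemma cycles_closed:
  "x \<in> cycles A \<Longrightarrow> x \<in> carrier A"
  "\<zero> \<in> cycles A" "\<one> \<in> cycles A"
  "x \<in> cycles A \<Longrightarrow> y \<in> cycles A \<Longrightarrow> x \<oplus> y \<in> cycles A"
  "x \<in> cycles A \<Longrightarrow> y \<in> cycles A \<Longrightarrow> x \<otimes> y \<in> cycles A"
  "x \<in> cycles A \<Longrightarrow> r \<odot> x \<in> cycles A"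
  "x \<in> cycles A \<Longrightarrow> proj n x \<in> cycles A"
  "x \<in> cycles A \<Longrightarrow> \<ominus> x \<in> cycles A"
proof -
  \<comment> \<open>The Leibniz rule for 1 = 1 \<cdot> 1 gives d1 = d1 + d1.\<close>
  have "dif A \<one> = \<zero>"
  proof -
    have "dif A (\<one> \<otimes> \<one>) = dif A \<one> \<otimes> \<one> \<oplus> ksign 0 \<odot> (\<one> \<otimes> dif A \<one>)"
      by (rule dif_leibniz[OF one_hcomp]) simp
    then have "dif A \<one> = dif A \<one> \<oplus> dif A \<one>"
      by simp
    then show ?thesis
      by (metis M.add.l_cancel_one dif_closed one_closed)
  qed
  then show "\<one> \<in> cycles A"
    by (simp add: cycles_def)
qed (auto simp: cycles_def dif_add dif_smult dif_mult dif_proj minus_eq_smult)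

lemma boundaries_closed:
  "b \<in> boundaries A \<Longrightarrow> b \<in> cycles A"
  "\<zero> \<in> boundaries A"
  "b \<in> boundaries A \<Longrightarrow> c \<in> boundaries A \<Longrightarrow> b \<oplus> c \<in> boundaries A"
  "b \<in> boundaries A \<Longrightarrow> r \<odot> b \<in> boundaries A"
  "b \<in> boundaries A \<Longrightarrow> \<ominus> b \<in> boundaries A"
  "b \<in> boundaries A \<Longrightarrow> proj n b \<in> boundaries A"
  "b \<in> boundaries A \<Longrightarrow> x \<in> cycles A \<Longrightarrow> b \<otimes> x \<in> boundaries A"
  "b \<in> boundaries A \<Longrightarrow> x \<in> cycles A \<Longrightarrow> x \<otimes> b \<in> boundaries A"
proof -
  show "b \<otimes> x \<in> boundaries A" if bx: "b \<in> boundaries A" "x \<in> cycles A"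
  proof -
    obtain c where c: "c \<in> carrier A" "b = dif A c"
      using bx(1) by (auto simp: boundaries_def)
    then have "b \<otimes> x = dif A (c \<otimes> x)"
      using bx(2) by (simp add: cycles_def dif_mult)
    then show ?thesis
      using c bx(2) by (auto simp: boundaries_def cycles_def)
  qed
  show "x \<otimes> b \<in> boundaries A" if bx: "b \<in> boundaries A" "x \<in> cycles A"
  proof -
    obtain c where c: "c \<in> carrier A" "b = dif A c"
      using bx(1) by (auto simp: boundaries_def)
    have "invol \<zero> = \<zero>"
      using invol_hcomp[OF hcomp_zero[of 0]] by simp
    \<comment> \<open>In the Leibniz rule for \<open>invol x \<otimes> c\<close> the first term
      vanishes, as \<open>x\<close> is a cycle and \<open>invol\<close> anticommutes with the
      differential; the second contains \<open>invol (invol x)\<close>, which is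
      \<open>x\<close>.\<close>
    then have "x \<otimes> b = dif A (invol x \<otimes> c)"
      using bx(2) c by (simp add: cycles_def dif_mult dif_invol invol_invol)
    then show ?thesis
      using c bx(2) by (auto simp: boundaries_def cycles_def)
  qed
  have sm: "r \<odot> b \<in> boundaries A" if b: "b \<in> boundaries A" for r b
    using b unfolding boundaries_def by (force simp flip: dif_smult)
  then show "r \<odot> b \<in> boundaries A" if "b \<in> boundaries A"
    using that by blast
  show "\<ominus> b \<in> boundaries A" if b: "b \<in> boundaries A"
    using b sm[OF b, of "- 1"] by (auto simp: boundaries_def minus_eq_smult)
  show "b \<oplus> c \<in> boundaries A" if "b \<in> boundaries A" "c \<in> boundaries A"
    using that unfolding boundaries_def by (force simp flip: dif_add)
  show "\<zero> \<in> boundaries A"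
    unfolding boundaries_def by (rule image_eqI[of _ _ \<zero>]) auto
  show "proj n b \<in> boundaries A" if "b \<in> boundaries A"
  proof -
    obtain c where "c \<in> carrier A" "b = dif A c"
      using \<open>b \<in> boundaries A\<close> by (auto simp: boundaries_def)
    then have "proj n b = dif A (proj (n + 1) c)"
      by (simp add: dif_proj)
    then show ?thesis
      by (auto simp: boundaries_def)
  qed
qed (auto simp: boundaries_def cycles_def)

abbreviation Z where "Z \<equiv> A\<lparr>carrier := cycles A\<rparr>"

lemma cycles_ring: "ring Z"
proof (rule ringI)
  show "abelian_group Z"
  proof (rule abelian_groupI)
    show "\<exists>y\<in>carrier Z. y \<oplus>\<^bsub>Z\<^esub> x = \<zero>\<^bsub>Z\<^esub>" if "x \<in> carrier Z" for x
      using that cycles_closed(1,8) by (auto intro!: bexI[of _ "\<ominus> x"] simp: l_neg)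
  qed (auto simp: cycles_closed a_ac)
  show "Group.monoid Z"
    by (rule monoidI) (auto simp: cycles_closed m_assoc)
qed (auto simp: cycles_closed l_distr r_distr)

lemma boundaries_ideal: "ideal (boundaries A) Z"
proof (rule idealI[OF cycles_ring])
  interpret Z: ring Z
    by (rule cycles_ring)
  have neg: "\<ominus>\<^bsub>Z\<^esub> b = \<ominus> b" if "b \<in> boundaries A" for b
    using that cycles_closed(1,8) boundaries_closed(1)
    by (intro Z.minus_equality) (auto simp: l_neg)
  show "subgroup (boundaries A) (add_monoid Z)"
  proof (rule Z.add.subgroupI)
    show "boundaries A \<noteq> {}"
      using boundaries_closed(2) by blast
    show "\<ominus>\<^bsub>Z\<^esub> b \<in> boundaries A" if "b \<in> boundaries A" for b
      using neg[OF that] boundaries_closed(5)[OF that] by simp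
  qed (auto simp: boundaries_closed)
qed (auto simp: boundaries_closed)

sublocale Z: ideal "boundaries A" Z
  by (rule boundaries_ideal)

definition cl :: "'a \<Rightarrow> 'a set" where
  "cl x = boundaries A +> x"

lemma Z_coset: "boundaries A +>\<^bsub>Z\<^esub> x = cl x"
  by (simp add: cl_def a_r_coset_def r_coset_def)

lemma cl_eq_iff:
  assumes "x \<in> cycles A" "y \<in> cycles A"
  shows "cl x = cl y \<longleftrightarrow> x \<ominus> y \<in> boundaries A"
proof -
  have "\<ominus>\<^bsub>Z\<^esub> y = \<ominus> y"
    using assms(2) cycles_closed(1,8) by (intro Z.minus_equality) (auto simp: l_neg)
  then show ?thesis
    using ring.quotient_eq_iff_same_a_r_cos[OF cycles_ring boundaries_ideal, of x y] assms by (simp add: Z_coset a_minus_def)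
qed

lemma cl_mem: "x \<in> cycles A \<Longrightarrow> y \<in> cl x \<Longrightarrow> y \<in> cycles A \<and> cl y = cl x"
  using Z.a_repr_independence'[of y x] Z.a_elemrcos_carrier[of x y]
  by (auto simp: Z_coset)

lemma cl_self: "x \<in> cycles A \<Longrightarrow> x \<in> cl x"
  using Z.a_rcos_self[of x] by (simp add: Z_coset)

text \<open>The scalar action on homology and the induced maps are defined as unions over all
  representatives of a class. Such a union collapses once its members are shown to be equal.\<close>

lemma UN_cl:
  assumes "x \<in> cycles A" "\<And>y. y \<in> cycles A \<Longrightarrow> cl y = cl x \<Longrightarrow> F y = F x"
  shows "(\<Union>y\<in>cl x. F y) = F x"
  using assms cl_mem cl_self by blast

lemma homology_carrier: "carrier (homology A) = cl ` cycles A"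
  by (auto simp: homology_def Let_def FactRing_def A_RCOSETS_def' Z_coset)

lemma homology_zero: "\<zero>\<^bsub>homology A\<^esub> = cl \<zero>"
  using Z.a_rcos_zero[of] Z.a_coset_add_zero[OF Z.a_subset]
  by (simp add: homology_def Let_def FactRing_def Z_coset)

lemma homology_one: "\<one>\<^bsub>homology A\<^esub> = cl \<one>"
  by (simp add: homology_def Let_def FactRing_def Z_coset)

lemma homology_add: "x \<in> cycles A \<Longrightarrow> y \<in> cycles A \<Longrightarrow> cl x \<oplus>\<^bsub>homology A\<^esub> cl y = cl (x \<oplus> y)"
  using Z.a_rcos_sum[of x y] by (simp add: homology_def Let_def FactRing_def Z_coset)

lemma homology_mult: "x \<in> cycles A \<Longrightarrow> y \<in> cycles A \<Longrightarrow> cl x \<otimes>\<^bsub>homology A\<^esub> cl y = cl (x \<otimes> y)"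
  using Z.rcoset_mult_add[of x y] by (simp add: homology_def Let_def FactRing_def Z_coset)

lemma homology_smult:
  assumes x: "x \<in> cycles A"
  shows "r \<odot>\<^bsub>homology A\<^esub> cl x = cl (r \<odot> x)"
proof -
  have "r \<odot>\<^bsub>homology A\<^esub> cl x = (\<Union>y\<in>cl x. cl (r \<odot> y))"
    by (simp add: homology_def Let_def cl_def)
  also have "\<dots> = cl (r \<odot> x)"
  proof (rule UN_cl[OF x])
    fix y assume y: "y \<in> cycles A" "cl y = cl x"
    then have "r \<odot> (y \<ominus> x) \<in> boundaries A"
      using x by (simp add: cl_eq_iff boundaries_closed)
    also have "r \<odot> (y \<ominus> x) = (r \<odot> y) \<ominus> (r \<odot> x)"
      using x y cycles_closed(1)
      by (simp add: a_minus_def smult_add_right minus_eq_smult smult_smult mult.commute)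
    finally show "cl (r \<odot> y) = cl (r \<odot> x)"
      using x y by (simp add: cl_eq_iff cycles_closed)
  qed
  finally show ?thesis .
qed

lemma homology_hcomp: "hcomp (homology A) n = cl ` (cycles A \<inter> hcomp A n)"
  by (auto simp: homology_def Let_def cl_def)

lemmas homology_ops = homology_zero homology_one homology_add homology_mult homology_smult

lemma homology_ring: "ring (homology A)"
proof -
  show ?thesis
  proof (rule ringI)
    show "abelian_group (homology A)"
    proof (rule abelian_groupI)
      show "\<exists>y\<in>carrier (homology A). y \<oplus>\<^bsub>homology A\<^esub> x = \<zero>\<^bsub>homology A\<^esub>"
        if "x \<in> carrier (homology A)" for x
      proof -
        obtain z where z: "z \<in> cycles A" "x = cl z"
          using \<open>x \<in> carrier (homology A)\<close> by (auto simp: homology_carrier)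
        then have "cl (\<ominus> z) \<oplus>\<^bsub>homology A\<^esub> x = \<zero>\<^bsub>homology A\<^esub>"
          using cycles_closed(1)[OF z(1)] by (simp add: homology_ops cycles_closed l_neg)
        then show ?thesis
          using z by (auto simp: homology_carrier cycles_closed)
      qed
    qed (auto simp: homology_carrier homology_ops cycles_closed a_ac)
    show "Group.monoid (homology A)"
      by (rule monoidI) (auto simp: homology_carrier homology_ops cycles_closed m_assoc)
  qed (auto simp: homology_carrier homology_ops cycles_closed l_distr r_distr)
qed

lemma homology_module: "module scalars (homology A)"
proof -
  interpret Q: ring "homology A"
    by (rule homology_ring)
  show ?thesis
    by (rule moduleI[OF scalars_cring Q.is_abelian_group])
      (auto simp: homology_carrier homology_ops cycles_closed smult_add_left smult_add_right smult_smult)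
qed

lemma homology_finsum:
  assumes "finite I" "\<And>i. i \<in> I \<Longrightarrow> f i \<in> cycles A"
  shows "(\<Oplus>\<^bsub>homology A\<^esub>i\<in>I. cl (f i)) = cl (\<Oplus>i\<in>I. f i) \<and> (\<Oplus>i\<in>I. f i) \<in> cycles A"
  using assms
proof (induction I rule: finite_induct)
  case empty
  interpret Q: ring "homology A"
    by (rule homology_ring)
  show ?case
    by (simp add: homology_zero cycles_closed)
next
  case (insert i I)
  interpret Q: ring "homology A"
    by (rule homology_ring)
  have "(\<Oplus>\<^bsub>homology A\<^esub>i\<in>insert i I. cl (f i)) = cl (f i) \<oplus>\<^bsub>homology A\<^esub> (\<Oplus>\<^bsub>homology A\<^esub>i\<in>I. cl (f i))"
    using insert by (subst Q.finsum_insert) (auto simp: homology_carrier)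
  moreover have "(\<Oplus>i\<in>insert i I. f i) = f i \<oplus> (\<Oplus>i\<in>I. f i)"
    using insert cycles_closed(1) by (subst finsum_insert) auto
  ultimately show ?case
    using insert by (simp add: homology_add cycles_closed)
qed

text \<open>For existence, project a representing cycle: the differential lowers degrees by exactly
  one, so projections of cycles are cycles. For uniqueness, represent given components by
  homogeneous cycles; their sum differs from \<open>z\<close> by a boundary, and projections of
  boundaries are boundaries, so the classes agree degree by degree.\<close>

lemma homology_decomposition:
  assumes "X \<in> carrier (homology A)"
  shows "\<exists>!c. decomposition (homology A) X c"
proof -
  obtain z where z: "z \<in> cycles A" "X = cl z"
    using assms by (auto simp: homology_carrier)
  note zc = cycles_closed(1)[OF z(1)]
  have dz: "finite {n. proj n z \<noteq> \<zero>}" "z = (\<Oplus>n\<in>{n. proj n z \<noteq> \<zero>}. proj n z)"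
    using decomposition_proj[OF zc] unfolding decomposition_def by auto
  let ?N = "\<lambda>c. {n. c n \<noteq> \<zero>\<^bsub>homology A\<^esub>}"
  let ?c = "\<lambda>n. cl (proj n z)"
  interpret Q: ring "homology A"
    by (rule homology_ring)
  have sub: "?N ?c \<subseteq> {n. proj n z \<noteq> \<zero>}"
    by (auto simp: homology_zero)
  have "X = (\<Oplus>\<^bsub>homology A\<^esub>n\<in>{n. proj n z \<noteq> \<zero>}. ?c n)"
    using homology_finsum[of "{n. proj n z \<noteq> \<zero>}" "\<lambda>n. proj n z"] dz z by (simp add: cycles_closed)
  also have "\<dots> = (\<Oplus>\<^bsub>homology A\<^esub>n\<in>?N ?c. ?c n)"
    using sub dz(1) z(1)
    by (intro Q.add.finprod_mono_neutral_cong_right) (auto simp: homology_carrier cycles_closed)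
  finally have "decomposition (homology A) X ?c"
    using finite_subset[OF sub dz(1)] z zc
    by (auto simp: decomposition_def homology_hcomp cycles_closed proj_in_hcomp)
  moreover have "c n = ?c n" if c: "decomposition (homology A) X c" for c n
  proof -
    have "\<exists>w. \<forall>n. c n = cl (w n) \<and> w n \<in> cycles A \<inter> hcomp A n"
      using c unfolding decomposition_def homology_hcomp by (intro choice) blast
    then obtain w where w: "\<And>n. c n = cl (w n)" "\<And>n. w n \<in> cycles A" "\<And>n. w n \<in> hcomp A n"
      by blast
    have fin: "finite (?N c)"
      using c by (simp add: decomposition_def)
    let ?W = "\<Oplus>n\<in>?N c. w n"
    have W: "X = cl ?W" "?W \<in> cycles A"
      using homology_finsum[OF fin, of w] w c by (auto simp: decomposition_def)
    have b: "proj n (z \<ominus> ?W) \<in> boundaries A"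
      using W z by (intro boundaries_closed) (simp flip: cl_eq_iff)
    have eq: "proj n (z \<ominus> ?W) = proj n z \<ominus> proj n ?W"
    proof -
      have "proj n (\<ominus> ?W) = \<ominus> proj n ?W"
        using proj_add[of ?W "\<ominus> ?W" n] cycles_closed(1)[OF W(2)]
        by (simp add: r_neg M.minus_equality M.a_comm[of "proj n ?W"])
      then show ?thesis
        using zc cycles_closed(1)[OF W(2)] by (simp add: a_minus_def proj_add)
    qed
    have pW: "proj n ?W = (if n \<in> ?N c then w n else \<zero>)"
    proof -
      have "proj n ?W = (\<Oplus>k\<in>?N c. proj n (w k))"
        by (intro proj_finsum fin funcsetI cycles_closed(1) w(2))
      also have "\<dots> = (\<Oplus>k\<in>?N c. if n = k then w k else \<zero>)"
        by (simp only: proj_hcomp[OF w(3)])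
      also have "\<dots> = (if n \<in> ?N c then w n else \<zero>)"
        by (intro finsum_single fin cycles_closed(1) w(2))
      finally show ?thesis .
    qed
    have "cl (proj n ?W) = c n"
    proof (cases "n \<in> ?N c")
      case True
      show ?thesis
        unfolding pW if_P[OF True] by (rule w(1)[symmetric])
    next
      case False
      then have "c n = \<zero>\<^bsub>homology A\<^esub>"
        by simp
      then show ?thesis
        unfolding pW if_not_P[OF False] by (simp only: homology_zero)
    qed
    moreover have "cl (proj n z) = cl (proj n ?W)"
      using b[unfolded eq] cl_eq_iff[OF cycles_closed(7)[OF z(1)] cycles_closed(7)[OF W(2)]] by blast
    ultimately show ?thesis
      by (simp only:)
  qed
  ultimately show ?thesis
    by (intro ex1I[of _ ?c] ext)
qed

theorem homology_graded_algebra: "graded_algebra (homology A)"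
proof -
  interpret HA: module scalars "homology A"
    by (rule homology_module)
  have neg: "\<ominus>\<^bsub>homology A\<^esub> cl z = cl (\<ominus> z)" if "z \<in> cycles A" for z
    using that cycles_closed(1)[OF that]
    by (intro HA.M.minus_equality) (auto simp: homology_carrier homology_ops cycles_closed l_neg)
  have hinv: "\<ominus> z \<in> hcomp A n" if "z \<in> hcomp A n" for z n
    using that hcomp_carrier hcomp_smult by (simp add: minus_eq_smult)
  have "submodule (hcomp (homology A) n) scalars (homology A)" for n
  proof (rule HA.submoduleI)
    show "\<zero>\<^bsub>homology A\<^esub> \<in> hcomp (homology A) n"
      by (auto simp: homology_hcomp homology_zero cycles_closed)
    show "\<ominus>\<^bsub>homology A\<^esub> a \<in> hcomp (homology A) n" if "a \<in> hcomp (homology A) n" for a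
      using that hinv by (auto simp: homology_hcomp neg cycles_closed)
  qed (auto simp: homology_hcomp homology_carrier homology_ops cycles_closed hcomp_add hcomp_smult)
  then have "graded_module (homology A)"
    unfolding graded_module_def using homology_module homology_decomposition by blast
  moreover have "\<one>\<^bsub>homology A\<^esub> \<in> hcomp (homology A) 0"
    using one_hcomp by (auto simp: homology_hcomp homology_one cycles_closed)
  moreover have "x \<otimes>\<^bsub>homology A\<^esub> y \<in> hcomp (homology A) (m + n)"
    if "x \<in> hcomp (homology A) m" "y \<in> hcomp (homology A) n" for x y m n
    using that mult_hcomp by (fastforce simp: homology_hcomp homology_ops cycles_closed)
  ultimately show ?thesis
    unfolding graded_algebra_def
    using homology_ring by (auto simp: homology_carrier homology_ops cycles_closed smult_mult)
qed

end

section \<open>Maps induced in homology\<close>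

locale chain_alg_hom = A: chain_alg A + B: chain_alg B
  for A :: "('r::comm_ring_1, 'a, 'm) chalg_scheme" and B :: "('r, 'b, 'n) chalg_scheme" +
  fixes f :: "'a \<Rightarrow> 'b"
  assumes chain_algebra_hom: "chain_algebra_hom A B f"
begin

lemma hom_closed: "x \<in> carrier A \<Longrightarrow> f x \<in> carrier B"
  and hom_add: "x \<in> carrier A \<Longrightarrow> y \<in> carrier A \<Longrightarrow> f (x \<oplus>\<^bsub>A\<^esub> y) = f x \<oplus>\<^bsub>B\<^esub> f y"
  and hom_smult: "x \<in> carrier A \<Longrightarrow> f (r \<odot>\<^bsub>A\<^esub> x) = r \<odot>\<^bsub>B\<^esub> f x"
  and hom_hcomp: "x \<in> hcomp A n \<Longrightarrow> f x \<in> hcomp B n"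
  and hom_mult: "x \<in> carrier A \<Longrightarrow> y \<in> carrier A \<Longrightarrow> f (x \<otimes>\<^bsub>A\<^esub> y) = f x \<otimes>\<^bsub>B\<^esub> f y"
  and hom_one: "f \<one>\<^bsub>A\<^esub> = \<one>\<^bsub>B\<^esub>"
  and hom_dif: "x \<in> carrier A \<Longrightarrow> f (dif A x) = dif B (f x)"
  using chain_algebra_hom
  unfolding chain_algebra_hom_def gralg_hom_def graded_linear_def ring_hom_def by auto

lemma hom_cycles: "x \<in> cycles A \<Longrightarrow> f x \<in> cycles B"
proof -
  assume x: "x \<in> cycles A"
  have "f \<zero>\<^bsub>A\<^esub> = \<zero>\<^bsub>B\<^esub>"
    using hom_smult[of "\<zero>\<^bsub>A\<^esub>" 0] hom_closed[of "\<zero>\<^bsub>A\<^esub>"] by simp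
  then show ?thesis
    using x hom_dif[of x] by (auto simp: cycles_def hom_closed)
qed

lemma homology_map_cl:
  assumes x: "x \<in> cycles A"
  shows "homology_map B f (A.cl x) = B.cl (f x)"
proof -
  have "homology_map B f (A.cl x) = (\<Union>y\<in>A.cl x. B.cl (f y))"
    by (simp add: homology_map_def B.cl_def)
  also have "\<dots> = B.cl (f x)"
  proof (rule A.UN_cl[OF x])
    fix y assume y: "y \<in> cycles A" "A.cl y = A.cl x"
    note c = A.cycles_closed(1)[OF x] A.cycles_closed(1)[OF y(1)]
    have "y \<ominus>\<^bsub>A\<^esub> x \<in> boundaries A"
      using x y by (simp add: A.cl_eq_iff)
    then obtain b where b: "b \<in> carrier A" "y \<ominus>\<^bsub>A\<^esub> x = dif A b"
      by (auto simp: boundaries_def)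
    have "f (y \<ominus>\<^bsub>A\<^esub> x) = f y \<ominus>\<^bsub>B\<^esub> f x"
      using c by (simp add: a_minus_def hom_add A.minus_eq_smult B.minus_eq_smult hom_smult hom_closed)
    then have "f y \<ominus>\<^bsub>B\<^esub> f x = dif B (f b)"
      using b hom_dif by simp
    then have "f y \<ominus>\<^bsub>B\<^esub> f x \<in> boundaries B"
      using b hom_closed by (auto simp: boundaries_def)
    then show "B.cl (f y) = B.cl (f x)"
      using x y hom_cycles by (simp add: B.cl_eq_iff)
  qed
  finally show ?thesis .
qed

theorem homology_map_gralg_hom: "gralg_hom (homology A) (homology B) (homology_map B f)"
  unfolding gralg_hom_def graded_linear_def ring_hom_def
  using hom_cycles A.cycles_closed(1) hom_hcomp
  by (auto simp: A.homology_carrier B.homology_carrier A.homology_ops B.homology_ops A.homology_hcomp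
      B.homology_hcomp homology_map_cl A.cycles_closed hom_add hom_smult hom_mult hom_one)

end

lemma homology_map_id:
  assumes "chain_algebra A" "\<And>x. x \<in> carrier A \<Longrightarrow> f x = x" "X \<in> carrier (homology A)"
  shows "homology_map A f X = X"
proof -
  interpret chain_alg A
    by unfold_locales fact
  interpret chain_alg_hom A A f
    using assms(2) by unfold_locales
      (auto simp: chain_algebra_hom_def gralg_hom_def graded_linear_def ring_hom_def hcomp_carrier)
  show ?thesis
    using assms(2,3) by (auto simp: homology_carrier homology_map_cl cycles_def)
qed

lemma homology_map_comp:
  assumes "chain_algebra A" "chain_algebra B" "chain_algebra C"
    and f: "chain_algebra_hom A B f" and g: "chain_algebra_hom B C g"
    and h: "\<And>x. x \<in> carrier A \<Longrightarrow> h x = g (f x)"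
    and X: "X \<in> carrier (homology A)"
  shows "homology_map C h X = homology_map C g (homology_map B f X)"
proof -
  interpret f: chain_alg_hom A B f
    by unfold_locales fact+
  interpret g: chain_alg_hom B C g
    by unfold_locales fact+
  interpret h: chain_alg_hom A C h
  proof
    show "chain_algebra_hom A C h"
      using f g unfolding chain_algebra_hom_def gralg_hom_def graded_linear_def ring_hom_def
      by (auto simp: h f.A.hcomp_carrier Pi_iff)
  qed
  obtain x where x: "x \<in> cycles A" "X = f.A.cl x"
    using X by (auto simp: f.A.homology_carrier)
  then show ?thesis
    using h[OF f.A.cycles_closed(1)[OF x(1)]]
    by (simp add: f.homology_map_cl g.homology_map_cl h.homology_map_cl f.hom_cycles)
qed

section \<open>Twisted tensor products of graded algebras\<close>

text \<open>Together with \<open>rmul\<close>, the action of U from the left and of V from the right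
  on U \<otimes> V. These actions exist before U \<otimes> V has a product and are used to formulate
  the distributive law.\<close>

definition lmul where
  "lmul U V u = lext (\<lambda>(c, d). tens U V (u \<otimes>\<^bsub>U\<^esub> c) d)"

definition rmul where
  "rmul U V z v = lext (\<lambda>(c, d). tens U V c (d \<otimes>\<^bsub>V\<^esub> v)) z"

text \<open>The product u \<cdot> (1 \<otimes> v)(u' \<otimes> 1) \<cdot> v', with the middle factor
  supplied by \<open>\<tau>\<close>. Both \<open>left_mult\<close> and \<open>right_mult\<close>
  unfold to this shape.\<close>

definition tmul where
  "tmul U V \<tau> z z' = lext (\<lambda>(u, v). lext (\<lambda>(u', v').
     lext (\<lambda>(c, d). tens U V (u \<otimes>\<^bsub>U\<^esub> c) (d \<otimes>\<^bsub>V\<^esub> v')) (\<tau> v u')) z') z"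

locale alg_tensor = U: graded_free_alg U + V: graded_free_alg V
  for U :: "('r::comm_ring_1, 'u, 'm) chalg_scheme" and V :: "('r, 'v, 'n) chalg_scheme"
begin

sublocale tensor_mod U V
  by unfold_locales

sublocale T: fun_mod "tensor U V" "hbasis U \<times> hbasis V" "\<lambda>(x, y). gdeg U x + gdeg V y"
  by (rule tensor_fun_mod)

abbreviation K where "K \<equiv> fsupp (hbasis U \<times> hbasis V)"
abbreviation tn (infixr \<open>\<boxtimes>\<close> 70) where "u \<boxtimes> v \<equiv> tens U V u v"

lemma tens_expand: "z \<in> K \<Longrightarrow> lext (\<lambda>(u, v). u \<boxtimes> v) z = z"
proof -
  assume z: "z \<in> K"
  have "lext (\<lambda>(u, v). u \<boxtimes> v) z = lext delta z"
    using z by (intro lext_cong) (auto simp: tens_hbasis dest: fsupp_in)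
  then show ?thesis
    using lext_delta_id[OF z] by simp
qed

lemma tens_hcomp: "u \<in> hcomp U m \<Longrightarrow> v \<in> hcomp V n \<Longrightarrow> u \<boxtimes> v \<in> hcomp (tensor U V) (m + n)"
  by (intro T.hcompI) (auto dest: tens_supp_hcomp)

lemma mlin_tens_mult_left: "u \<in> carrier U \<Longrightarrow> mlin U (hbasis U \<times> hbasis V) (\<lambda>c. (u \<otimes>\<^bsub>U\<^esub> c) \<boxtimes> d)"
  by (intro mlinI) (auto simp: U.r_distr tens_add U.smult_mult tens_smult)

lemma mlin_tens_mult_right: "v \<in> carrier V \<Longrightarrow> mlin V (hbasis U \<times> hbasis V) (\<lambda>d. c \<boxtimes> (d \<otimes>\<^bsub>V\<^esub> v))"
  by (intro mlinI) (auto simp: V.l_distr tens_add V.smult_mult tens_smult)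

lemma mlin_tens: "mlin U (hbasis U \<times> hbasis V) (\<lambda>c. c \<boxtimes> d)" "mlin V (hbasis U \<times> hbasis V) (\<lambda>d. c \<boxtimes> d)"
  by (auto intro!: mlinI simp: tens_add tens_smult)

lemma lmul_K [simp]: "lmul U V u z \<in> K"
  unfolding lmul_def by (intro lext_fsupp) (auto split: prod.split)

lemma rmul_K [simp]: "rmul U V z v \<in> K"
  unfolding rmul_def by (intro lext_fsupp) (auto split: prod.split)

lemma lmul_tens:
  "u \<in> carrier U \<Longrightarrow> c \<in> carrier U \<Longrightarrow> d \<in> carrier V \<Longrightarrow> lmul U V u (c \<boxtimes> d) = (u \<otimes>\<^bsub>U\<^esub> c) \<boxtimes> d"
  unfolding lmul_def
  by (rule lext_tens[where Y = "hbasis U \<times> hbasis V"]) (auto intro!: mbilI mlin_tens_mult_left mlin_tens)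

lemma rmul_tens:
  "v \<in> carrier V \<Longrightarrow> c \<in> carrier U \<Longrightarrow> d \<in> carrier V \<Longrightarrow> rmul U V (c \<boxtimes> d) v = c \<boxtimes> (d \<otimes>\<^bsub>V\<^esub> v)"
  unfolding rmul_def
  by (rule lext_tens[where Y = "hbasis U \<times> hbasis V"]) (auto intro!: mbilI mlin_tens_mult_right mlin_tens)

lemma lmul_linear:
  "lmul U V u 0 = 0"
  "z \<in> K \<Longrightarrow> z' \<in> K \<Longrightarrow> lmul U V u (z + z') = lmul U V u z + lmul U V u z'"
  "z \<in> K \<Longrightarrow> lmul U V u (r \<cdot> z) = r \<cdot> lmul U V u z"
  unfolding lmul_def by (auto intro: lext_add lext_scale)

lemma rmul_linear:
  "rmul U V 0 v = 0"
  "z \<in> K \<Longrightarrow> z' \<in> K \<Longrightarrow> rmul U V (z + z') v = rmul U V z v + rmul U V z' v"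
  "z \<in> K \<Longrightarrow> rmul U V (r \<cdot> z) v = r \<cdot> rmul U V z v"
  unfolding rmul_def by (auto intro: lext_add lext_scale)

lemma lmul_lext:
  "z \<in> fsupp X \<Longrightarrow> (\<And>p. p \<in> X \<Longrightarrow> \<beta> p \<in> K) \<Longrightarrow> lmul U V u (lext \<beta> z) = lext (\<lambda>p. lmul U V u (\<beta> p)) z"
  unfolding lmul_def by (rule lext_lext)

lemma rmul_lext:
  "z \<in> fsupp X \<Longrightarrow> (\<And>p. p \<in> X \<Longrightarrow> \<beta> p \<in> K) \<Longrightarrow> rmul U V (lext \<beta> z) v = lext (\<lambda>p. rmul U V (\<beta> p) v) z"
  unfolding rmul_def by (rule lext_lext)

lemma lmul_lmul:
  "z \<in> K \<Longrightarrow> u \<in> carrier U \<Longrightarrow> u' \<in> carrier U \<Longrightarrow>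
    lmul U V u (lmul U V u' z) = lmul U V (u \<otimes>\<^bsub>U\<^esub> u') z"
  by (induction rule: fsupp_tens_induct) (simp_all add: lmul_linear lmul_tens U.m_assoc)

lemma rmul_rmul:
  "z \<in> K \<Longrightarrow> v \<in> carrier V \<Longrightarrow> v' \<in> carrier V \<Longrightarrow>
    rmul U V (rmul U V z v) v' = rmul U V z (v \<otimes>\<^bsub>V\<^esub> v')"
  by (induction rule: fsupp_tens_induct) (simp_all add: rmul_linear rmul_tens V.m_assoc)

lemma lmul_rmul:
  "z \<in> K \<Longrightarrow> u \<in> carrier U \<Longrightarrow> v \<in> carrier V \<Longrightarrow>
    lmul U V u (rmul U V z v) = rmul U V (lmul U V u z) v"
  by (induction rule: fsupp_tens_induct) (simp_all add: rmul_linear lmul_linear rmul_tens lmul_tens)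

lemma lmul_one: "z \<in> K \<Longrightarrow> lmul U V \<one>\<^bsub>U\<^esub> z = z"
  by (induction rule: fsupp_tens_induct) (simp_all add: lmul_linear lmul_tens)

lemma rmul_one: "z \<in> K \<Longrightarrow> rmul U V z \<one>\<^bsub>V\<^esub> = z"
  by (induction rule: fsupp_tens_induct) (simp_all add: rmul_linear rmul_tens)

lemma mlin_lmul1: "z \<in> K \<Longrightarrow> mlin U (hbasis U \<times> hbasis V) (\<lambda>u. lmul U V u z)"
  unfolding lmul_def
proof (intro mlin_lext_fun, clarify)
  fix c d assume "z \<in> K" "z (c, d) \<noteq> 0"
  then have "c \<in> carrier U"
    using fsupp_in by fastforce
  then show "mlin U (hbasis U \<times> hbasis V) (\<lambda>u. (u \<otimes>\<^bsub>U\<^esub> c) \<boxtimes> d)"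
    by (intro mlinI) (auto simp: U.l_distr tens_add U.smult_mult tens_smult)
qed

lemma mlin_rmul2: "z \<in> K \<Longrightarrow> mlin V (hbasis U \<times> hbasis V) (\<lambda>v. rmul U V z v)"
  unfolding rmul_def
proof (intro mlin_lext_fun, clarify)
  fix c d assume "z \<in> K" "z (c, d) \<noteq> 0"
  then have "d \<in> carrier V"
    using fsupp_in by fastforce
  then show "mlin V (hbasis U \<times> hbasis V) (\<lambda>v. c \<boxtimes> (d \<otimes>\<^bsub>V\<^esub> v))"
    by (intro mlinI) (auto simp: V.r_distr tens_add V.smult_mult tens_smult)
qed

lemma mlin_lmul:
  "mlin M (hbasis U \<times> hbasis V) F \<Longrightarrow> mlin M (hbasis U \<times> hbasis V) (\<lambda>x. lmul U V u (F x))"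
  unfolding lmul_def by (rule mlin_lext) (auto split: prod.split)

lemma mlin_rmul:
  "mlin M (hbasis U \<times> hbasis V) F \<Longrightarrow> mlin M (hbasis U \<times> hbasis V) (\<lambda>x. rmul U V (F x) v)"
  unfolding rmul_def by (rule mlin_lext) (auto split: prod.split)

lemma lmul_hcomp:
  assumes "u \<in> hcomp U m" "z \<in> hcomp (tensor U V) n"
  shows "lmul U V u z \<in> hcomp (tensor U V) (m + n)"
  unfolding lmul_def
proof (rule T.lext_hcomp, clarify)
  fix c d assume "z (c, d) \<noteq> 0"
  then have *: "c \<in> hbasis U" "d \<in> hbasis V" "gdeg U c + gdeg V d = n"
    using assms(2) by (auto simp: tensor_hcomp dest: fsupp_in)
  then have "(u \<otimes>\<^bsub>U\<^esub> c) \<boxtimes> d \<in> hcomp (tensor U V) ((m + gdeg U c) + gdeg V d)"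
    by (intro tens_hcomp U.mult_hcomp assms(1) U.hbasis_hcomp V.hbasis_hcomp)
  then show "(u \<otimes>\<^bsub>U\<^esub> c) \<boxtimes> d \<in> hcomp (tensor U V) (m + n)"
    using *(3) by (simp add: algebra_simps)
qed

lemma rmul_hcomp:
  assumes "v \<in> hcomp V m" "z \<in> hcomp (tensor U V) n"
  shows "rmul U V z v \<in> hcomp (tensor U V) (n + m)"
  unfolding rmul_def
proof (rule T.lext_hcomp, clarify)
  fix c d assume "z (c, d) \<noteq> 0"
  then have *: "c \<in> hbasis U" "d \<in> hbasis V" "gdeg U c + gdeg V d = n"
    using assms(2) by (auto simp: tensor_hcomp dest: fsupp_in)
  then have "c \<boxtimes> (d \<otimes>\<^bsub>V\<^esub> v) \<in> hcomp (tensor U V) (gdeg U c + (gdeg V d + m))"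
    by (intro tens_hcomp V.mult_hcomp assms(1) U.hbasis_hcomp V.hbasis_hcomp)
  then show "c \<boxtimes> (d \<otimes>\<^bsub>V\<^esub> v) \<in> hcomp (tensor U V) (n + m)"
    using *(3) by (simp add: algebra_simps)
qed

abbreviation iU where "iU u \<equiv> u \<boxtimes> \<one>\<^bsub>V\<^esub>"
abbreviation iV where "iV v \<equiv> \<one>\<^bsub>U\<^esub> \<boxtimes> v"

text \<open>The sign involution of U \<otimes> V. Writing \<open>sg z\<close> in place of (-1)^|z|
  makes both sides of the Leibniz rule bilinear, so that it can be proved by induction on basis
  tensors.\<close>

definition sg :: "('u \<times> 'v \<Rightarrow> 'r) \<Rightarrow> 'u \<times> 'v \<Rightarrow> 'r" where
  "sg z = (\<lambda>p. ksign (case p of (x, y) \<Rightarrow> gdeg U x + gdeg V y) * z p)"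

lemma K_hbasis: "z \<in> K \<Longrightarrow> z (x, y) \<noteq> 0 \<Longrightarrow> x \<in> hbasis U \<and> y \<in> hbasis V"
  by (auto dest: fsupp_in)

lemma sg_K [simp]: "z \<in> K \<Longrightarrow> sg z \<in> K"
  by (rule fsuppI[of "{p. z p \<noteq> 0}"]) (auto simp: sg_def fsupp_def)

lemma sg_linear: "sg 0 = 0" "sg (z + z') = sg z + sg z'" "sg (r \<cdot> z) = r \<cdot> sg z" "sg (- z) = - sg z"
  by (auto simp: sg_def fun_eq_iff fun_apply algebra_simps)

lemma sg_hcomp: "z \<in> hcomp (tensor U V) n \<Longrightarrow> sg z = ksign n \<cdot> z"
  by (force simp: sg_def tensor_hcomp fun_eq_iff fun_apply)

lemma sg_tens: "u \<in> hcomp U m \<Longrightarrow> v \<in> hcomp V n \<Longrightarrow> sg (u \<boxtimes> v) = ksign (m + n) \<cdot> (u \<boxtimes> v)"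
  by (intro sg_hcomp tens_hcomp)

lemma mlin_sg: "mlin M (hbasis U \<times> hbasis V) F \<Longrightarrow> mlin M (hbasis U \<times> hbasis V) (\<lambda>x. sg (F x))"
  unfolding mlin_def by (auto simp: sg_linear)

end

text \<open>The map \<open>\<tau>\<close> encodes the products \<open>(1 \<otimes> v)(u \<otimes> 1)\<close>, and the last two assumptions
  say that it is a distributive law.\<close>

locale twisted_tensor = alg_tensor U V
  for U :: "('r::comm_ring_1, 'u, 'm) chalg_scheme" and V :: "('r, 'v, 'n) chalg_scheme" +
  fixes \<tau> :: "'v \<Rightarrow> 'u \<Rightarrow> 'u \<times> 'v \<Rightarrow> 'r"
  assumes tau_bil: "mbil V U (hbasis U \<times> hbasis V) \<tau>"
    and tau_hcomp: "v \<in> hcomp V m \<Longrightarrow> u \<in> hcomp U n \<Longrightarrow> \<tau> v u \<in> hcomp (tensor U V) (m + n)"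
    and tau_one_left: "u \<in> carrier U \<Longrightarrow> \<tau> \<one>\<^bsub>V\<^esub> u = iU u"
    and tau_one_right: "v \<in> carrier V \<Longrightarrow> \<tau> v \<one>\<^bsub>U\<^esub> = iV v"
    and tau_mult_right: "v \<in> carrier V \<Longrightarrow> u \<in> carrier U \<Longrightarrow> u' \<in> carrier U \<Longrightarrow>
      \<tau> v (u \<otimes>\<^bsub>U\<^esub> u') = lext (\<lambda>(c, d). lmul U V c (\<tau> d u')) (\<tau> v u)"
    and tau_mult_left: "v \<in> carrier V \<Longrightarrow> v' \<in> carrier V \<Longrightarrow> u \<in> carrier U \<Longrightarrow>
      \<tau> (v \<otimes>\<^bsub>V\<^esub> v') u = lext (\<lambda>(c, d). rmul U V (\<tau> v c) d) (\<tau> v' u)"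
begin

abbreviation mm (infixl \<open>\<diamondop>\<close> 72) where "z \<diamondop> z' \<equiv> tmul U V \<tau> z z'"

lemma tau_K [simp]: "v \<in> carrier V \<Longrightarrow> u \<in> carrier U \<Longrightarrow> \<tau> v u \<in> K"
  using mbil_fsupp[OF tau_bil] .

text \<open>Trades the nested expansion for the two outer actions, which are linear and commute with
  each other.\<close>

lemma tmul_alt:
  assumes "z \<in> K" "z' \<in> K"
  shows "z \<diamondop> z' = lext (\<lambda>(u, v). lext (\<lambda>(u', v'). lmul U V u (rmul U V (\<tau> v u') v')) z') z"
proof -
  have "lext (\<lambda>(c, d). (u \<otimes>\<^bsub>U\<^esub> c) \<boxtimes> (d \<otimes>\<^bsub>V\<^esub> v')) (\<tau> v u') = lmul U V u (rmul U V (\<tau> v u') v')"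
    if "u \<in> carrier U" "v \<in> carrier V" "u' \<in> carrier U" "v' \<in> carrier V" for u v u' v'
  proof -
    have "lmul U V u (rmul U V (\<tau> v u') v') = lext (\<lambda>p. lmul U V u (case p of (c, d) \<Rightarrow> c \<boxtimes> (d \<otimes>\<^bsub>V\<^esub> v'))) (\<tau> v u')"
      unfolding rmul_def using that by (intro lmul_lext[of _ "hbasis U \<times> hbasis V"]) auto
    also have "\<dots> = lext (\<lambda>(c, d). (u \<otimes>\<^bsub>U\<^esub> c) \<boxtimes> (d \<otimes>\<^bsub>V\<^esub> v')) (\<tau> v u')"
      using that by (intro lext_cong) (auto simp: lmul_tens dest!: K_hbasis[OF tau_K[OF that(2,3)]])
    finally show ?thesis ..
  qed
  then show ?thesis
    unfolding tmul_def using assms by (intro lext_cong) (auto intro!: lext_cong dest!: fsupp_in)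
qed

lemma mlin_tau: "u \<in> carrier U \<Longrightarrow> mlin V (hbasis U \<times> hbasis V) (\<lambda>v. \<tau> v u)"
  "v \<in> carrier V \<Longrightarrow> mlin U (hbasis U \<times> hbasis V) (\<tau> v)"
  using mbilD[OF tau_bil] by auto

lemma tmul_tens:
  assumes "u \<in> carrier U" "v \<in> carrier V" "u' \<in> carrier U" "v' \<in> carrier V"
  shows "(u \<boxtimes> v) \<diamondop> (u' \<boxtimes> v') = lmul U V u (rmul U V (\<tau> v u') v')"
proof -
  have "(u \<boxtimes> v) \<diamondop> (u' \<boxtimes> v') =
    lext (\<lambda>(u, v). lext (\<lambda>(u', v'). lmul U V u (rmul U V (\<tau> v u') v')) (u' \<boxtimes> v')) (u \<boxtimes> v)"
    by (rule tmul_alt) auto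
  also have "\<dots> = lext (\<lambda>(u', v'). lmul U V u (rmul U V (\<tau> v u') v')) (u' \<boxtimes> v')"
    using assms
    by (intro lext_tens mbilI mlin_lext_fun)
      (auto split: prod.split intro!: mlin_lmul1 mlin_lmul mlin_rmul mlin_tau dest!: fsupp_in[OF tens_fsupp])
  also have "\<dots> = lmul U V u (rmul U V (\<tau> v u') v')"
    using assms by (intro lext_tens mbilI) (auto intro!: mlin_lmul mlin_rmul mlin_rmul2 mlin_tau)
  finally show ?thesis .
qed

lemma tmul_K [simp]: "z \<diamondop> z' \<in> K"
  unfolding tmul_def by (intro lext_fsupp) (auto intro!: lext_fsupp split: prod.split)

lemma tmul_linear_left:
  "0 \<diamondop> y = 0"
  "z \<in> K \<Longrightarrow> z' \<in> K \<Longrightarrow> (z + z') \<diamondop> y = z \<diamondop> y + z' \<diamondop> y"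
  "z \<in> K \<Longrightarrow> (r \<cdot> z) \<diamondop> y = r \<cdot> (z \<diamondop> y)"
  "z \<in> K \<Longrightarrow> (- z) \<diamondop> y = - (z \<diamondop> y)"
  unfolding tmul_def by (auto intro: lext_add lext_scale lext_minus)

lemma tmul_linear_right:
  "y \<diamondop> 0 = 0"
  "z \<in> K \<Longrightarrow> z' \<in> K \<Longrightarrow> y \<diamondop> (z + z') = y \<diamondop> z + y \<diamondop> z'"
  "z \<in> K \<Longrightarrow> y \<diamondop> (r \<cdot> z) = r \<cdot> (y \<diamondop> z)"
  "z \<in> K \<Longrightarrow> y \<diamondop> (- z) = - (y \<diamondop> z)"
  unfolding tmul_def
  by (auto simp: lext_add lext_scale lext_minus split_def lext_fun_add lext_fun_scale lext_fun_minus)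

lemmas tmul_linear = tmul_linear_left tmul_linear_right

lemma tmul_lext_left:
  "z \<in> fsupp X \<Longrightarrow> (\<And>p. p \<in> X \<Longrightarrow> \<beta> p \<in> K) \<Longrightarrow> lext \<beta> z \<diamondop> y = lext (\<lambda>p. \<beta> p \<diamondop> y) z"
  unfolding tmul_def by (rule lext_lext)

lemma tmul_lext_right:
  assumes "z \<in> fsupp X" "\<And>p. p \<in> X \<Longrightarrow> \<beta> p \<in> K"
  shows "y \<diamondop> lext \<beta> z = lext (\<lambda>p. y \<diamondop> \<beta> p) z"
proof -
  have "y \<diamondop> lext \<beta> z = lext (\<lambda>q. lext (\<lambda>p. case q of (u, v) \<Rightarrow> lext (\<lambda>(u', v').
     lext (\<lambda>(c, d). (u \<otimes>\<^bsub>U\<^esub> c) \<boxtimes> (d \<otimes>\<^bsub>V\<^esub> v')) (\<tau> v u')) (\<beta> p)) z) y"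
    unfolding tmul_def split_def using assms by (subst lext_lext) auto
  also have "\<dots> = lext (\<lambda>p. y \<diamondop> \<beta> p) z"
    unfolding tmul_def by (rule lext_swap)
  finally show ?thesis .
qed

lemma mlin_tmul_left:
  "mlin M (hbasis U \<times> hbasis V) F \<Longrightarrow> mlin M (hbasis U \<times> hbasis V) (\<lambda>x. F x \<diamondop> y)"
  unfolding mlin_def by (auto simp: tmul_linear)

lemma mlin_tmul_right:
  "mlin M (hbasis U \<times> hbasis V) F \<Longrightarrow> mlin M (hbasis U \<times> hbasis V) (\<lambda>x. y \<diamondop> F x)"
  unfolding mlin_def by (auto simp: tmul_linear)

lemma tmul_lmul:
  assumes "z \<in> K" "y \<in> K" "u \<in> carrier U"
  shows "lmul U V u z \<diamondop> y = lmul U V u (z \<diamondop> y)"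
  using assms(1)
proof (induction rule: fsupp_tens_induct)
  case (base c d)
  show ?case
    using assms(2)
  proof (induction rule: fsupp_tens_induct)
    case (base c' d')
    then show ?case
      using \<open>c \<in> hbasis U\<close> \<open>d \<in> hbasis V\<close> assms(3) by (simp add: lmul_tens tmul_tens lmul_lmul)
  qed (simp_all add: tmul_linear lmul_linear)
qed (simp_all add: tmul_linear lmul_linear)

lemma tmul_rmul:
  assumes "z \<in> K" "y \<in> K" "v \<in> carrier V"
  shows "z \<diamondop> rmul U V y v = rmul U V (z \<diamondop> y) v"
  using assms(1)
proof (induction rule: fsupp_tens_induct)
  case (base c d)
  show ?case
    using assms(2)
  proof (induction rule: fsupp_tens_induct)
    case (base c' d')
    then show ?case
      using \<open>c \<in> hbasis U\<close> \<open>d \<in> hbasis V\<close> assms(3)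
      by (simp add: rmul_tens tmul_tens rmul_rmul flip: lmul_rmul)
  qed (simp_all add: tmul_linear rmul_linear)
qed (simp_all add: tmul_linear rmul_linear)

text \<open>By the unit law for \<open>\<tau>\<close>, the action of U is multiplication by elements
  of U; \<open>rmul_eq\<close> is the counterpart for V. From here on computations can take place
  inside the product.\<close>

lemma lmul_eq: "z \<in> K \<Longrightarrow> u \<in> carrier U \<Longrightarrow> lmul U V u z = iU u \<diamondop> z"
proof (induction rule: fsupp_tens_induct)
  case (base c d)
  then show ?case
    by (simp add: tmul_tens lmul_tens rmul_tens tau_one_left)
qed (simp_all add: tmul_linear lmul_linear)

lemma rmul_eq: "z \<in> K \<Longrightarrow> v \<in> carrier V \<Longrightarrow> rmul U V z v = z \<diamondop> iV v"
proof (induction rule: fsupp_tens_induct)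
  case (base c d)
  then show ?case
    by (simp add: tmul_tens lmul_tens rmul_tens tau_one_right)
qed (simp_all add: tmul_linear rmul_linear)

lemma tau_eq: "v \<in> carrier V \<Longrightarrow> u \<in> carrier U \<Longrightarrow> iV v \<diamondop> iU u = \<tau> v u"
  by (simp add: tmul_tens rmul_one lmul_one)

lemma tens_eq: "v \<in> carrier V \<Longrightarrow> u \<in> carrier U \<Longrightarrow> iU u \<diamondop> iV v = u \<boxtimes> v"
  by (simp add: lmul_tens flip: lmul_eq)

text \<open>The part of associativity that involves \<open>\<tau>\<close>: ((v u') v') u'' = v (u'
  (v' u'')). Expand \<tau> v u' into terms c \<otimes> d and \<tau> v' u'' into terms e \<otimes> f.
  The law for products in V turns the left side, and the law for products in U the right side, into
  the same double sum of c \<cdot> \<tau> d e \<cdot> f.\<close>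

lemma tmul_assoc_core:
  assumes v: "v \<in> carrier V" and u': "u' \<in> carrier U" and v': "v' \<in> carrier V" and u'': "u'' \<in> carrier U"
  shows "rmul U V (\<tau> v u') v' \<diamondop> iU u'' = iV v \<diamondop> lmul U V u' (\<tau> v' u'')"
proof -
  let ?X = "hbasis U \<times> hbasis V" and ?t = "\<tau> v u'" and ?s = "\<tau> v' u''"
  have K: "?t \<in> K" "?s \<in> K"
    using assms by auto
  have "rmul U V ?t v' \<diamondop> iU u'' = lext (\<lambda>p. (case p of (c, d) \<Rightarrow> c \<boxtimes> (d \<otimes>\<^bsub>V\<^esub> v')) \<diamondop> iU u'') ?t"
    unfolding rmul_def using K by (intro tmul_lext_left[of _ ?X]) auto
  also have "\<dots> = lext (\<lambda>(c, d). lext (\<lambda>(e, f). lmul U V c (rmul U V (\<tau> d e) f)) ?s) ?t"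
  proof (intro lext_cong, clarify)
    fix c d assume "?t (c, d) \<noteq> 0"
    then have cd: "c \<in> hbasis U" "d \<in> hbasis V"
      using K fsupp_in by fastforce+
    then have "(c \<boxtimes> (d \<otimes>\<^bsub>V\<^esub> v')) \<diamondop> iU u'' = lmul U V c (lext (\<lambda>(e, f). rmul U V (\<tau> d e) f) ?s)"
      using assms by (simp add: tmul_tens rmul_one[OF tau_K] flip: tau_mult_left)
    also have "\<dots> = lext (\<lambda>p. lmul U V c (case p of (e, f) \<Rightarrow> rmul U V (\<tau> d e) f)) ?s"
      using K by (intro lmul_lext[of _ ?X]) auto
    finally show "(c \<boxtimes> (d \<otimes>\<^bsub>V\<^esub> v')) \<diamondop> iU u'' = lext (\<lambda>(e, f). lmul U V c (rmul U V (\<tau> d e) f)) ?s"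
      by (simp add: split_def)
  qed
  also have "\<dots> = lext (\<lambda>(e, f). lext (\<lambda>(c, d). lmul U V c (rmul U V (\<tau> d e) f)) ?t) ?s"
    unfolding split_def by (rule lext_swap)
  also have "\<dots> = lext (\<lambda>p. iV v \<diamondop> (case p of (e, f) \<Rightarrow> (u' \<otimes>\<^bsub>U\<^esub> e) \<boxtimes> f)) ?s"
  proof (intro lext_cong, clarify)
    fix e f assume "?s (e, f) \<noteq> 0"
    then have ef: "e \<in> hbasis U" "f \<in> hbasis V"
      using K fsupp_in by fastforce+
    then have "iV v \<diamondop> ((u' \<otimes>\<^bsub>U\<^esub> e) \<boxtimes> f) = rmul U V (lext (\<lambda>(c, d). lmul U V c (\<tau> d e)) ?t) f"
      using assms by (simp add: tmul_tens lmul_one tau_mult_right)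
    also have "\<dots> = lext (\<lambda>p. rmul U V (case p of (c, d) \<Rightarrow> lmul U V c (\<tau> d e)) f) ?t"
      using K by (intro rmul_lext[of _ ?X]) auto
    also have "\<dots> = lext (\<lambda>(c, d). lmul U V c (rmul U V (\<tau> d e) f)) ?t"
      using K ef by (intro lext_cong) (auto simp: lmul_rmul dest!: fsupp_in)
    finally show "lext (\<lambda>(c, d). lmul U V c (rmul U V (\<tau> d e) f)) ?t = iV v \<diamondop> ((u' \<otimes>\<^bsub>U\<^esub> e) \<boxtimes> f)" ..
  qed
  also have "\<dots> = iV v \<diamondop> lmul U V u' ?s"
    unfolding lmul_def using K by (intro tmul_lext_right[symmetric, of _ ?X]) auto
  finally show ?thesis .
qed

text \<open>The outer factors \<open>u\<close> and \<open>v''\<close> pass through both products by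
  \<open>tmul_lmul\<close> and \<open>tmul_rmul\<close>, which leaves exactly
  \<open>tmul_assoc_core\<close>.\<close>

lemma tmul_assoc:
  assumes "x \<in> K" "y \<in> K" "z \<in> K"
  shows "(x \<diamondop> y) \<diamondop> z = x \<diamondop> (y \<diamondop> z)"
  using assms(1)
proof (induction rule: fsupp_tens_induct)
  case (base u v)
  then have uv: "u \<in> carrier U" "v \<in> carrier V"
    by auto
  show ?case
    using assms(2)
  proof (induction rule: fsupp_tens_induct)
    case (base u' v')
    then have uv': "u' \<in> carrier U" "v' \<in> carrier V"
      by auto
    show ?case
      using assms(3)
    proof (induction rule: fsupp_tens_induct)
      case (base u'' v'')
      then have uv'': "u'' \<in> carrier U" "v'' \<in> carrier V"
        by auto
      have "((u \<boxtimes> v) \<diamondop> (u' \<boxtimes> v')) \<diamondop> (u'' \<boxtimes> v'') =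
          lmul U V u (rmul U V (\<tau> v u') v') \<diamondop> rmul U V (iU u'') v''"
        using uv uv' uv'' by (simp add: tmul_tens rmul_tens)
      also have "\<dots> = lmul U V u (rmul U V (rmul U V (\<tau> v u') v' \<diamondop> iU u'') v'')"
        using uv uv' uv'' by (simp add: tmul_lmul tmul_rmul) (simp add: lmul_rmul)
      also have "\<dots> = lmul U V u (rmul U V (iV v \<diamondop> lmul U V u' (\<tau> v' u'')) v'')"
        using uv uv' uv'' by (simp add: tmul_assoc_core)
      also have "\<dots> = lmul U V u (iV v) \<diamondop> lmul U V u' (rmul U V (\<tau> v' u'') v'')"
        using uv uv' uv'' by (simp add: tmul_lmul tmul_rmul lmul_rmul)
      also have "\<dots> = (u \<boxtimes> v) \<diamondop> ((u' \<boxtimes> v') \<diamondop> (u'' \<boxtimes> v''))"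
        using uv uv' uv'' by (simp add: tmul_tens lmul_tens)
      finally show ?case .
    qed (simp_all add: tmul_linear)
  qed (simp_all add: tmul_linear)
qed (simp_all add: tmul_linear)

lemma tmul_one_left: "z \<in> K \<Longrightarrow> (\<one>\<^bsub>U\<^esub> \<boxtimes> \<one>\<^bsub>V\<^esub>) \<diamondop> z = z"
  using lmul_eq[of z "\<one>\<^bsub>U\<^esub>"] lmul_one[of z] by simp

lemma tmul_one_right: "z \<in> K \<Longrightarrow> z \<diamondop> (\<one>\<^bsub>U\<^esub> \<boxtimes> \<one>\<^bsub>V\<^esub>) = z"
  using rmul_eq[of z "\<one>\<^bsub>V\<^esub>"] rmul_one[of z] by simp

lemma tmul_hcomp:
  assumes "z \<in> hcomp (tensor U V) m" "z' \<in> hcomp (tensor U V) n"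
  shows "z \<diamondop> z' \<in> hcomp (tensor U V) (m + n)"
proof -
  have K: "z \<in> K" "z' \<in> K"
    using assms by (auto simp: tensor_hcomp)
  show ?thesis
    unfolding tmul_alt[OF K]
  proof (intro T.lext_hcomp, clarify, intro T.lext_hcomp, clarify)
    fix u v u' v' assume "z (u, v) \<noteq> 0" "z' (u', v') \<noteq> 0"
    then have *: "u \<in> hbasis U" "v \<in> hbasis V" "gdeg U u + gdeg V v = m"
      "u' \<in> hbasis U" "v' \<in> hbasis V" "gdeg U u' + gdeg V v' = n"
      using assms by (auto simp: tensor_hcomp dest: fsupp_in)
    then have "lmul U V u (rmul U V (\<tau> v u') v') \<in>
        hcomp (tensor U V) (gdeg U u + ((gdeg V v + gdeg U u') + gdeg V v'))"
      by (intro lmul_hcomp rmul_hcomp tau_hcomp U.hbasis_hcomp V.hbasis_hcomp)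
    moreover have "gdeg U u + ((gdeg V v + gdeg U u') + gdeg V v') = m + n"
      using * by simp
    ultimately show "lmul U V u (rmul U V (\<tau> v u') v') \<in> hcomp (tensor U V) (m + n)"
      by metis
  qed
qed

lemma sg_tmul:
  assumes "x \<in> K" "y \<in> K"
  shows "sg (x \<diamondop> y) = sg x \<diamondop> sg y"
  using assms(1)
proof (induction rule: fsupp_tens_induct)
  case (base u v)
  note x = tens_hcomp[OF base(3,4)]
  show ?case
    using assms(2)
  proof (induction rule: fsupp_tens_induct)
    case (base u' v')
    note y = tens_hcomp[OF base(3,4)]
    show ?case
      by (simp add: sg_hcomp[OF x] sg_hcomp[OF y] sg_hcomp[OF tmul_hcomp[OF x y]] tmul_linear ksign_add
          mult_ac)
  qed (simp_all add: tmul_linear sg_linear)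
qed (simp_all add: tmul_linear sg_linear)

lemma iU_mult: "u \<in> carrier U \<Longrightarrow> u' \<in> carrier U \<Longrightarrow> iU (u \<otimes>\<^bsub>U\<^esub> u') = iU u \<diamondop> iU u'"
  by (simp add: lmul_tens flip: lmul_eq)

lemma iV_mult: "v \<in> carrier V \<Longrightarrow> v' \<in> carrier V \<Longrightarrow> iV (v \<otimes>\<^bsub>V\<^esub> v') = iV v \<diamondop> iV v'"
  by (simp add: rmul_tens flip: rmul_eq)

text \<open>Inside the algebra the distributive law becomes an instance of associativity, free of
  Sweedler sums.\<close>

lemma tau_mult_right': "v \<in> carrier V \<Longrightarrow> u \<in> carrier U \<Longrightarrow> u' \<in> carrier U \<Longrightarrow>
    \<tau> v (u \<otimes>\<^bsub>U\<^esub> u') = \<tau> v u \<diamondop> iU u'"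
  by (simp add: iU_mult tmul_assoc flip: tau_eq)

lemma tau_mult_left': "v \<in> carrier V \<Longrightarrow> v' \<in> carrier V \<Longrightarrow> u \<in> carrier U \<Longrightarrow>
    \<tau> (v \<otimes>\<^bsub>V\<^esub> v') u = iV v \<diamondop> \<tau> v' u"
  by (simp add: iV_mult tmul_assoc flip: tau_eq)

end

text \<open>The record \<open>A\<close> is a parameter so that the results apply to
  \<open>left_cobar\<close> and \<open>right_cobar\<close> as they stand; only the fields of a
  graded algebra are prescribed here.\<close>

locale twisted_alg = twisted_tensor U V \<tau>
  for U :: "('r::comm_ring_1, 'u, 'm) chalg_scheme" and V :: "('r, 'v, 'n) chalg_scheme" and \<tau> +
  fixes A :: "('r, 'u \<times> 'v \<Rightarrow> 'r, 'k) gralg_scheme"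
  assumes A_module: "carrier A = carrier (tensor U V)" "add A = (+)" "zero A = 0" "smult A = (\<cdot>)"
      "hcomp A = hcomp (tensor U V)"
    and A_one: "one A = \<one>\<^bsub>U\<^esub> \<boxtimes> \<one>\<^bsub>V\<^esub>" and A_mult: "mult A = tmul U V \<tau>"
begin

lemma A_carrier: "carrier A = K"
  by (simp add: A_module tensor_simps)

sublocale A: fun_mod A "hbasis U \<times> hbasis V" "\<lambda>(x, y). gdeg U x + gdeg V y"
  by unfold_locales (simp_all add: A_module tensor_simps tensor_hcomp)

lemma A_graded_algebra: "graded_algebra A"
proof -
  have "ring A"
  proof (rule ringI)
    show "Group.monoid A"
      by (rule monoidI) (auto simp: A_carrier A_one A_mult tmul_assoc tmul_one_left tmul_one_right)
  qed (auto simp: A_carrier A_module A_mult tmul_linear A.M.abelian_group_axioms)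
  moreover have "\<one>\<^bsub>A\<^esub> \<in> hcomp A 0"
    unfolding A_one A_module using tens_hcomp[OF U.one_hcomp V.one_hcomp] by simp
  ultimately show ?thesis
    using A.graded_module tmul_hcomp
    by (auto simp: graded_algebra_def A_carrier A_mult A_module tmul_linear)
qed

sublocale A: graded_free_alg A
  using A_graded_algebra A.graded_free by unfold_locales

lemma iU_gralg_hom: "gralg_hom U A iU"
  using tens_hcomp[OF _ V.one_hcomp] by (auto simp: gralg_hom_def graded_linear_def ring_hom_def A_carrier A_module A_one A_mult
      tens_add tens_smult iU_mult)

lemma iV_gralg_hom: "gralg_hom V A iV"
  using tens_hcomp[OF U.one_hcomp] by (auto simp: gralg_hom_def graded_linear_def ring_hom_def A_carrier A_module A_one A_mult
      tens_add tens_smult iV_mult)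

end

section \<open>Differentials on twisted tensor products\<close>

text \<open>The only candidate for a derivation with restrictions \<open>DU\<close> and
  \<open>DV\<close>, because u \<otimes> v is the product of u \<otimes> 1 and 1 \<otimes> v. Both
  restrictions take values in all of U \<otimes> V, as the twisting can lead out of a
  factor.\<close>

definition tdif where
  "tdif U V DU DV = lext (\<lambda>(u, v). rmul U V (DU u) v + ksign (gdeg U u) \<cdot> lmul U V u (DV v))"

locale twisted_dif = twisted_alg U V \<tau> A
  for U :: "('r::comm_ring_1, 'u, 'm) chalg_scheme" and V :: "('r, 'v, 'n) chalg_scheme" and \<tau>
    and A :: "('r, 'u \<times> 'v \<Rightarrow> 'r, 'k) chalg_scheme" +
  fixes DU :: "'u \<Rightarrow> 'u \<times> 'v \<Rightarrow> 'r" and DV :: "'v \<Rightarrow> 'u \<times> 'v \<Rightarrow> 'r"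
  assumes DU: "mlin U (hbasis U \<times> hbasis V) DU" and DV: "mlin V (hbasis U \<times> hbasis V) DV"
    and DU_hcomp: "u \<in> hcomp U n \<Longrightarrow> DU u \<in> hcomp (tensor U V) (n - 1)"
    and DV_hcomp: "v \<in> hcomp V n \<Longrightarrow> DV v \<in> hcomp (tensor U V) (n - 1)"
    and DU_mult: "u \<in> carrier U \<Longrightarrow> u' \<in> carrier U \<Longrightarrow>
      DU (u \<otimes>\<^bsub>U\<^esub> u') = DU u \<diamondop> iU u' + sg (iU u) \<diamondop> DU u'"
    and DV_mult: "v \<in> carrier V \<Longrightarrow> v' \<in> carrier V \<Longrightarrow>
      DV (v \<otimes>\<^bsub>V\<^esub> v') = DV v \<diamondop> iV v' + sg (iV v) \<diamondop> DV v'"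
begin

abbreviation DD where "DD \<equiv> tdif U V DU DV"

lemma D_K [simp]: "u \<in> carrier U \<Longrightarrow> DU u \<in> K" "v \<in> carrier V \<Longrightarrow> DV v \<in> K"
  using mlinD(1)[OF DU] mlinD(1)[OF DV] by auto

lemma sg_iU: "u \<in> hcomp U m \<Longrightarrow> sg (iU u) = ksign m \<cdot> iU u"
  using sg_tens[OF _ V.one_hcomp, of u m] by simp

lemma sg_iV: "v \<in> hcomp V m \<Longrightarrow> sg (iV v) = ksign m \<cdot> iV v"
  using sg_tens[OF U.one_hcomp, of v m] by simp

lemma DD_alt:
  assumes "z \<in> K"
  shows "DD z = lext (\<lambda>(u, v). DU u \<diamondop> iV v + sg (iU u) \<diamondop> DV v) z"
  unfolding tdif_def using assms
  by (intro lext_cong)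
    (auto simp: sg_iU[OF U.hbasis_hcomp] lmul_eq rmul_eq tmul_linear dest!: K_hbasis)

lemma DD_K [simp]: "z \<in> K \<Longrightarrow> DD z \<in> K"
  unfolding DD_alt by (rule lext_fsupp) (auto dest!: K_hbasis)

lemma DD_linear:
  "DD 0 = 0"
  "z \<in> K \<Longrightarrow> z' \<in> K \<Longrightarrow> DD (z + z') = DD z + DD z'"
  "z \<in> K \<Longrightarrow> DD (r \<cdot> z) = r \<cdot> DD z"
  "z \<in> K \<Longrightarrow> DD (- z) = - DD z"
  unfolding tdif_def by (auto intro: lext_add lext_scale lext_minus)

lemma DD_lext:
  "z \<in> fsupp X \<Longrightarrow> (\<And>p. p \<in> X \<Longrightarrow> \<beta> p \<in> K) \<Longrightarrow> DD (lext \<beta> z) = lext (\<lambda>p. DD (\<beta> p)) z"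
  unfolding tdif_def by (rule lext_lext)

lemma DD_tens:
  assumes "u \<in> carrier U" "v \<in> carrier V"
  shows "DD (u \<boxtimes> v) = DU u \<diamondop> iV v + sg (iU u) \<diamondop> DV v"
  unfolding DD_alt[OF tens_fsupp] using assms
  by (intro lext_tens[where Y = "hbasis U \<times> hbasis V"] mbilI)
    (auto intro!: mlin_add mlin_tmul_left mlin_tmul_right mlin_sg mlin_tens DU DV)

lemma DV_one: "DV \<one>\<^bsub>V\<^esub> = 0"
  using DV_mult[of "\<one>\<^bsub>V\<^esub>" "\<one>\<^bsub>V\<^esub>"] by (simp add: sg_iV[OF V.one_hcomp] tmul_one_left tmul_one_right)

lemma DU_one: "DU \<one>\<^bsub>U\<^esub> = 0"
  using DU_mult[of "\<one>\<^bsub>U\<^esub>" "\<one>\<^bsub>U\<^esub>"] by (simp add: sg_iU[OF U.one_hcomp] tmul_one_left tmul_one_right)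

lemma DD_iU: "u \<in> carrier U \<Longrightarrow> DD (iU u) = DU u"
  by (simp add: DD_tens DV_one tmul_linear tmul_one_right)

lemma DD_iV: "v \<in> carrier V \<Longrightarrow> DD (iV v) = DV v"
  by (simp add: DD_tens DU_one tmul_linear tmul_one_left sg_iU[OF U.one_hcomp])

lemma tmul_tens_left:
  "u \<in> carrier U \<Longrightarrow> c \<in> carrier U \<Longrightarrow> d \<in> carrier V \<Longrightarrow> iU u \<diamondop> (c \<boxtimes> d) = (u \<otimes>\<^bsub>U\<^esub> c) \<boxtimes> d"
  by (simp add: lmul_tens flip: lmul_eq)

lemma tmul_tens_right:
  "v \<in> carrier V \<Longrightarrow> c \<in> carrier U \<Longrightarrow> d \<in> carrier V \<Longrightarrow> (c \<boxtimes> d) \<diamondop> iV v = c \<boxtimes> (d \<otimes>\<^bsub>V\<^esub> v)"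
  by (simp add: rmul_tens flip: rmul_eq)

lemma DD_lmul:
  assumes "z \<in> K" "u \<in> carrier U"
  shows "DD (iU u \<diamondop> z) = DU u \<diamondop> z + sg (iU u) \<diamondop> DD z"
  using assms(1)
proof (induction rule: fsupp_tens_induct)
  case (base c d)
  then have cd: "c \<in> carrier U" "d \<in> carrier V"
    by auto
  then have "DD (iU u \<diamondop> (c \<boxtimes> d)) = DU (u \<otimes>\<^bsub>U\<^esub> c) \<diamondop> iV d + sg (iU (u \<otimes>\<^bsub>U\<^esub> c)) \<diamondop> DV d"
    using assms(2) by (simp add: tmul_tens_left DD_tens)
  also have "\<dots> = DU u \<diamondop> (iU c \<diamondop> iV d) + sg (iU u) \<diamondop> (DU c \<diamondop> iV d + sg (iU c) \<diamondop> DV d)"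
    using cd assms(2) by (simp add: DU_mult iU_mult sg_tmul tmul_linear tmul_assoc add.assoc)
  finally show ?case
    using cd by (simp add: DD_tens tens_eq)
qed (simp_all add: tmul_linear DD_linear algebra_simps fscale_add)

lemma DD_rmul:
  assumes "z \<in> K" "v \<in> carrier V"
  shows "DD (z \<diamondop> iV v) = DD z \<diamondop> iV v + sg z \<diamondop> DV v"
  using assms(1)
proof (induction rule: fsupp_tens_induct)
  case (base c d)
  then have cd: "c \<in> carrier U" "d \<in> carrier V"
    by auto
  then have "DD ((c \<boxtimes> d) \<diamondop> iV v) = DU c \<diamondop> iV (d \<otimes>\<^bsub>V\<^esub> v) + sg (iU c) \<diamondop> DV (d \<otimes>\<^bsub>V\<^esub> v)"
    using assms(2) by (simp add: tmul_tens_right DD_tens)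
  also have "\<dots> = (DU c \<diamondop> iV d + sg (iU c) \<diamondop> DV d) \<diamondop> iV v + sg (iU c \<diamondop> iV d) \<diamondop> DV v"
    using cd assms(2) by (simp add: DV_mult iV_mult sg_tmul tmul_linear tmul_assoc add.assoc)
  finally show ?case
    using cd by (simp add: DD_tens tens_eq)
qed (simp_all add: tmul_linear DD_linear sg_linear algebra_simps fscale_add)

text \<open>The Leibniz rule for \<open>(1 \<otimes> v)(u \<otimes> 1)\<close>.  It is inherited by products in \<open>u\<close> and in \<open>v\<close>, so
  that it only has to be verified on generators.\<close>

definition swap_ok :: "'v \<Rightarrow> 'u \<Rightarrow> bool" where
  "swap_ok v u \<longleftrightarrow> DD (\<tau> v u) = DV v \<diamondop> iU u + sg (iV v) \<diamondop> DU u"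

text \<open>Since (c \<otimes> d) u = c \<cdot> \<tau> d u, the rule follows from
  \<open>DD_lmul\<close> and from the rule for the pair \<open>d\<close>, \<open>u\<close>. It is
  required for all \<open>v\<close> because arbitrary \<open>d\<close> occur in
  \<open>z\<close>.\<close>

lemma swap_ok_right:
  assumes u: "u \<in> carrier U" and ok: "\<And>v. v \<in> carrier V \<Longrightarrow> swap_ok v u" and z: "z \<in> K"
  shows "DD (z \<diamondop> iU u) = DD z \<diamondop> iU u + sg z \<diamondop> DU u"
  using z
proof (induction rule: fsupp_tens_induct)
  case (base c d)
  then have cd: "c \<in> carrier U" "d \<in> carrier V"
    by auto
  have "DD ((c \<boxtimes> d) \<diamondop> iU u) = DD (iU c \<diamondop> \<tau> d u)"
    using cd u by (simp add: tmul_assoc flip: tens_eq[of d c] tau_eq)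
  also have "\<dots> = DU c \<diamondop> \<tau> d u + sg (iU c) \<diamondop> (DV d \<diamondop> iU u + sg (iV d) \<diamondop> DU u)"
    using cd u ok[OF cd(2)] by (simp add: DD_lmul swap_ok_def)
  also have "\<dots> = (DU c \<diamondop> iV d + sg (iU c) \<diamondop> DV d) \<diamondop> iU u + sg (iU c \<diamondop> iV d) \<diamondop> DU u"
    using cd u by (simp add: sg_tmul tmul_linear tmul_assoc add.assoc flip: tau_eq)
  finally show ?case
    using cd by (simp add: DD_tens tens_eq)
qed (simp_all add: tmul_linear DD_linear sg_linear algebra_simps fscale_add)

lemma swap_ok_left:
  assumes v: "v \<in> carrier V" and ok: "\<And>u. u \<in> carrier U \<Longrightarrow> swap_ok v u" and z: "z \<in> K"
  shows "DD (iV v \<diamondop> z) = DV v \<diamondop> z + sg (iV v) \<diamondop> DD z"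
  using z
proof (induction rule: fsupp_tens_induct)
  case (base c d)
  then have cd: "c \<in> carrier U" "d \<in> carrier V"
    by auto
  have "DD (iV v \<diamondop> (c \<boxtimes> d)) = DD (\<tau> v c \<diamondop> iV d)"
    using cd v by (simp add: tmul_assoc flip: tens_eq[of d c] tau_eq)
  also have "\<dots> = (DV v \<diamondop> iU c + sg (iV v) \<diamondop> DU c) \<diamondop> iV d + sg (\<tau> v c) \<diamondop> DV d"
    using cd v ok[OF cd(1)] by (simp add: DD_rmul swap_ok_def)
  also have "\<dots> = DV v \<diamondop> (iU c \<diamondop> iV d) + sg (iV v) \<diamondop> (DU c \<diamondop> iV d + sg (iU c) \<diamondop> DV d)"
    using cd v by (simp add: sg_tmul tmul_linear tmul_assoc add.assoc flip: tau_eq)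
  finally show ?case
    using cd by (simp add: DD_tens tens_eq)
qed (simp_all add: tmul_linear DD_linear sg_linear algebra_simps fscale_add)

text \<open>The hypotheses on \<open>u\<close> and \<open>u'\<close> differ: \<tau> v u involves
  elements of V other than \<open>v\<close>, and these have to be moved past \<open>u'\<close>. For
  this reason the inductions over words below are uniform in the other factor.\<close>

lemma swap_ok_mult_right:
  assumes u: "u \<in> carrier U" "u' \<in> carrier U" and v: "v \<in> carrier V"
    and ok: "swap_ok v u" "\<And>v. v \<in> carrier V \<Longrightarrow> swap_ok v u'"
  shows "swap_ok v (u \<otimes>\<^bsub>U\<^esub> u')"
proof -
  have "DD (\<tau> v (u \<otimes>\<^bsub>U\<^esub> u')) = DD (\<tau> v u) \<diamondop> iU u' + sg (\<tau> v u) \<diamondop> DU u'"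
    using swap_ok_right[OF u(2) ok(2), of "\<tau> v u"] u v by (simp add: tau_mult_right')
  also have "\<dots> = (DV v \<diamondop> iU u + sg (iV v) \<diamondop> DU u) \<diamondop> iU u' + sg (iV v \<diamondop> iU u) \<diamondop> DU u'"
    using ok(1) u v by (simp add: swap_ok_def tau_eq)
  also have "\<dots> = DV v \<diamondop> iU (u \<otimes>\<^bsub>U\<^esub> u') + sg (iV v) \<diamondop> DU (u \<otimes>\<^bsub>U\<^esub> u')"
    using u v by (simp add: sg_tmul tmul_linear tmul_assoc add.assoc DU_mult iU_mult)
  finally show ?thesis
    by (simp add: swap_ok_def)
qed

lemma swap_ok_mult_left:
  assumes v: "v \<in> carrier V" "v' \<in> carrier V" and u: "u \<in> carrier U"
    and ok: "\<And>u. u \<in> carrier U \<Longrightarrow> swap_ok v u" "swap_ok v' u"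
  shows "swap_ok (v \<otimes>\<^bsub>V\<^esub> v') u"
proof -
  have "DD (\<tau> (v \<otimes>\<^bsub>V\<^esub> v') u) = DV v \<diamondop> \<tau> v' u + sg (iV v) \<diamondop> DD (\<tau> v' u)"
    using swap_ok_left[OF v(1) ok(1), of "\<tau> v' u"] u v by (simp add: tau_mult_left')
  also have "\<dots> = DV v \<diamondop> (iV v' \<diamondop> iU u) + sg (iV v) \<diamondop> (DV v' \<diamondop> iU u + sg (iV v') \<diamondop> DU u)"
    using ok(2) u v by (simp add: swap_ok_def tau_eq)
  also have "\<dots> = DV (v \<otimes>\<^bsub>V\<^esub> v') \<diamondop> iU u + sg (iV (v \<otimes>\<^bsub>V\<^esub> v')) \<diamondop> DU u"
    using u v by (simp add: sg_tmul tmul_linear tmul_assoc add.assoc DV_mult iV_mult)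
  finally show ?thesis
    by (simp add: swap_ok_def)
qed

lemma swap_ok_one: "v \<in> carrier V \<Longrightarrow> swap_ok v \<one>\<^bsub>U\<^esub>" "u \<in> carrier U \<Longrightarrow> swap_ok \<one>\<^bsub>V\<^esub> u"
  by (simp_all add: swap_ok_def tau_one_right tau_one_left DD_iV DD_iU DU_one DV_one tmul_linear
      tmul_one_right tmul_one_left sg_iV[OF V.one_hcomp])

lemma swap_ok_linear:
  assumes "v \<in> carrier V" "u \<in> carrier U" "u' \<in> carrier U" "swap_ok v u"
  shows "swap_ok v u' \<Longrightarrow> swap_ok v (u \<oplus>\<^bsub>U\<^esub> u')" "swap_ok v (r \<odot>\<^bsub>U\<^esub> u)"
  using assms
  by (simp_all add: swap_ok_def mlinD[OF DU] mlinD[OF mlin_tau(2)] tens_add tens_smult DD_linear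
      tmul_linear algebra_simps fscale_add)

lemma swap_ok_linear_left:
  assumes "v \<in> carrier V" "v' \<in> carrier V" "u \<in> carrier U" "swap_ok v u"
  shows "swap_ok v' u \<Longrightarrow> swap_ok (v \<oplus>\<^bsub>V\<^esub> v') u" "swap_ok (r \<odot>\<^bsub>V\<^esub> v) u"
  using assms
  by (simp_all add: swap_ok_def mlinD[OF DV] mlinD[OF mlin_tau(1)] tens_add tens_smult DD_linear
      tmul_linear sg_linear algebra_simps fscale_add)

lemma DD_hcomp:
  assumes "z \<in> hcomp (tensor U V) n"
  shows "DD z \<in> hcomp (tensor U V) (n - 1)"
  unfolding tdif_def
proof (rule T.lext_hcomp, clarify)
  fix u v assume "z (u, v) \<noteq> 0"
  then have *: "u \<in> hbasis U" "v \<in> hbasis V" "gdeg U u + gdeg V v = n"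
    using assms by (auto simp: tensor_hcomp dest: K_hbasis)
  have "rmul U V (DU u) v \<in> hcomp (tensor U V) ((gdeg U u - 1) + gdeg V v)"
    using * by (intro rmul_hcomp DU_hcomp U.hbasis_hcomp V.hbasis_hcomp)
  moreover have "lmul U V u (DV v) \<in> hcomp (tensor U V) (gdeg U u + (gdeg V v - 1))"
    using * by (intro lmul_hcomp DV_hcomp U.hbasis_hcomp V.hbasis_hcomp)
  ultimately show "rmul U V (DU u) v + ksign (gdeg U u) \<cdot> lmul U V u (DV v) \<in> hcomp (tensor U V) (n - 1)"
    using *(3) T.hcomp_add T.hcomp_smult unfolding T.add_eq T.smult_eq by (simp add: algebra_simps)
qed

text \<open>Multiplying from the right by u and then by v gives the Leibniz rule for u \<otimes> v.
  In D^2(u \<otimes> v) the terms with D^2 on one factor vanish by assumption, and the two mixed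
  terms DU u \<cdot> DV v cancel because DU u has one degree less than u.\<close>

theorem A_chain_algebra:
  assumes ok: "\<And>v u. v \<in> carrier V \<Longrightarrow> u \<in> carrier U \<Longrightarrow> swap_ok v u"
    and DU_DU: "\<And>u. u \<in> carrier U \<Longrightarrow> DD (DU u) = 0"
    and DV_DV: "\<And>v. v \<in> carrier V \<Longrightarrow> DD (DV v) = 0"
    and dif: "\<And>z. z \<in> K \<Longrightarrow> dif A z = DD z"
  shows "chain_algebra A"
proof -
  have leibniz: "DD (x \<diamondop> y) = DD x \<diamondop> y + sg x \<diamondop> DD y" if x: "x \<in> K" and y: "y \<in> K" for x y
    using y
  proof (induction rule: fsupp_tens_induct)
    case (base u v)
    then have uv: "u \<in> carrier U" "v \<in> carrier V"
      by auto
    have "DD (x \<diamondop> (iU u \<diamondop> iV v)) = DD ((x \<diamondop> iU u) \<diamondop> iV v)"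
      using x uv by (simp add: tmul_assoc)
    also have "\<dots> = (DD x \<diamondop> iU u + sg x \<diamondop> DU u) \<diamondop> iV v + sg (x \<diamondop> iU u) \<diamondop> DV v"
      using x uv by (simp add: DD_rmul swap_ok_right[OF uv(1) ok])
    also have "\<dots> = DD x \<diamondop> (iU u \<diamondop> iV v) + sg x \<diamondop> (DU u \<diamondop> iV v + sg (iU u) \<diamondop> DV v)"
      using x uv by (simp add: sg_tmul tmul_linear tmul_assoc add.assoc)
    finally show ?case
      using uv by (simp add: DD_tens tens_eq)
  qed (use x in \<open>simp_all add: tmul_linear DD_linear sg_linear algebra_simps fscale_add\<close>)
  have sgDU: "sg (DU u) = - (ksign m \<cdot> DU u)" if "u \<in> hcomp U m" for u m
  proof -
    have "(ksign (m - 1) :: 'r) = - ksign m"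
      by (rule ksign_neg) simp
    then show ?thesis
      using sg_hcomp[OF DU_hcomp[OF that]] by simp
  qed
  have DDDD: "DD (DD z) = 0" if "z \<in> K" for z
    using that
  proof (induction rule: fsupp_tens_induct)
    case (base u v)
    then have uv: "u \<in> carrier U" "v \<in> carrier V"
      by auto
    have "DD (DD (u \<boxtimes> v)) = DD (DU u \<diamondop> iV v) + DD (sg (iU u) \<diamondop> DV v)"
      using uv by (simp add: DD_tens DD_linear)
    also have "DD (DU u \<diamondop> iV v) = sg (DU u) \<diamondop> DV v"
      using uv DU_DU by (simp add: DD_rmul tmul_linear)
    also have "DD (sg (iU u) \<diamondop> DV v) = ksign (gdeg U u) \<cdot> (DU u \<diamondop> DV v)"
      using uv DV_DV by (simp add: sg_iU[OF base(3)] tmul_linear DD_linear DD_lmul)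
    finally show ?case
      using uv by (simp add: sgDU[OF base(3)] tmul_linear)
  qed (simp_all add: DD_linear)
  show ?thesis
    unfolding chain_algebra_def
  proof (intro conjI allI ballI)
    show "graded_linear (- 1) A A (dif A)"
      using DD_hcomp A.hcomp_carrier unfolding A_module(5)
      by (auto simp: graded_linear_def A_carrier A_module dif DD_linear)
    show "dif A (x \<otimes>\<^bsub>A\<^esub> y) = dif A x \<otimes>\<^bsub>A\<^esub> y \<oplus>\<^bsub>A\<^esub> ksign n \<odot>\<^bsub>A\<^esub> (x \<otimes>\<^bsub>A\<^esub> dif A y)"
      if x: "x \<in> hcomp A n" and y: "y \<in> carrier A" for n x y
    proof -
      have "x \<in> K" "y \<in> K"
        using A.hcomp_carrier[OF x] y by (simp_all add: A_carrier)
      then show ?thesis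
        using x by (simp add: A_module A_mult dif leibniz sg_hcomp tmul_linear)
    qed
  qed (auto simp: A_graded_algebra A.graded_free A_carrier dif DDDD A_module)
qed

end

section \<open>Maps of twisted tensor products\<close>

locale twisted_map = X: twisted_dif U V \<tau> A DU DV + Y: twisted_dif U' V' \<tau>' A' DU' DV'
  for U :: "('r::comm_ring_1, 'u, 'm) chalg_scheme" and V :: "('r, 'v, 'n) chalg_scheme" and \<tau>
    and A :: "('r, 'u \<times> 'v \<Rightarrow> 'r, 'k) chalg_scheme" and DU DV
    and U' :: "('r, 'u1, 'm1) chalg_scheme" and V' :: "('r, 'v1, 'n1) chalg_scheme" and \<tau>'
    and A' :: "('r, 'u1 \<times> 'v1 \<Rightarrow> 'r, 'k1) chalg_scheme" and DU' DV' +
  fixes \<phi> :: "'u \<Rightarrow> 'u1" and \<psi> :: "'v \<Rightarrow> 'v1"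
  assumes phi: "gralg_hom U U' \<phi>" and psi: "gralg_hom V V' \<psi>"
begin

lemma phi_closed [simp]: "u \<in> carrier U \<Longrightarrow> \<phi> u \<in> carrier U'"
  and phi_add: "u \<in> carrier U \<Longrightarrow> u' \<in> carrier U \<Longrightarrow> \<phi> (u \<oplus>\<^bsub>U\<^esub> u') = \<phi> u \<oplus>\<^bsub>U'\<^esub> \<phi> u'"
  and phi_smult: "u \<in> carrier U \<Longrightarrow> \<phi> (r \<odot>\<^bsub>U\<^esub> u) = r \<odot>\<^bsub>U'\<^esub> \<phi> u"
  and phi_mult: "u \<in> carrier U \<Longrightarrow> u' \<in> carrier U \<Longrightarrow> \<phi> (u \<otimes>\<^bsub>U\<^esub> u') = \<phi> u \<otimes>\<^bsub>U'\<^esub> \<phi> u'"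
  and phi_one: "\<phi> \<one>\<^bsub>U\<^esub> = \<one>\<^bsub>U'\<^esub>"
  and phi_hcomp: "u \<in> hcomp U n \<Longrightarrow> \<phi> u \<in> hcomp U' n"
  using phi unfolding gralg_hom_def graded_linear_def ring_hom_def by auto

lemma psi_closed [simp]: "v \<in> carrier V \<Longrightarrow> \<psi> v \<in> carrier V'"
  and psi_add: "v \<in> carrier V \<Longrightarrow> v' \<in> carrier V \<Longrightarrow> \<psi> (v \<oplus>\<^bsub>V\<^esub> v') = \<psi> v \<oplus>\<^bsub>V'\<^esub> \<psi> v'"
  and psi_smult: "v \<in> carrier V \<Longrightarrow> \<psi> (r \<odot>\<^bsub>V\<^esub> v) = r \<odot>\<^bsub>V'\<^esub> \<psi> v"
  and psi_mult: "v \<in> carrier V \<Longrightarrow> v' \<in> carrier V \<Longrightarrow> \<psi> (v \<otimes>\<^bsub>V\<^esub> v') = \<psi> v \<otimes>\<^bsub>V'\<^esub> \<psi> v'"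
  and psi_one: "\<psi> \<one>\<^bsub>V\<^esub> = \<one>\<^bsub>V'\<^esub>"
  and psi_hcomp: "v \<in> hcomp V n \<Longrightarrow> \<psi> v \<in> hcomp V' n"
  using psi unfolding gralg_hom_def graded_linear_def ring_hom_def by auto

abbreviation TT where "TT \<equiv> tensor_map U' V' \<phi> \<psi>"

lemma TT_K [simp]: "TT z \<in> Y.K"
  unfolding tensor_map_def by (intro lext_fsupp) (auto split: prod.split)

lemma TT_linear:
  "TT 0 = 0"
  "z \<in> X.K \<Longrightarrow> z' \<in> X.K \<Longrightarrow> TT (z + z') = TT z + TT z'"
  "z \<in> X.K \<Longrightarrow> TT (r \<cdot> z) = r \<cdot> TT z"
  unfolding tensor_map_def by (auto intro: lext_add lext_scale)

lemma TT_lext: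
  "z \<in> fsupp X \<Longrightarrow> (\<And>p. p \<in> X \<Longrightarrow> \<beta> p \<in> X.K) \<Longrightarrow> TT (lext \<beta> z) = lext (\<lambda>p. TT (\<beta> p)) z"
  unfolding tensor_map_def by (rule lext_lext)

lemma TT_tens: "u \<in> carrier U \<Longrightarrow> v \<in> carrier V \<Longrightarrow> TT (tens U V u v) = tens U' V' (\<phi> u) (\<psi> v)"
  unfolding tensor_map_def
  by (rule X.lext_tens[where Y = "hbasis U' \<times> hbasis V'"])
    (auto intro!: mbilI mlinI simp: phi_add psi_add phi_smult psi_smult Y.tens_add Y.tens_smult)

lemma TT_hcomp:
  assumes "z \<in> hcomp (tensor U V) n"
  shows "TT z \<in> hcomp (tensor U' V') n"
  unfolding tensor_map_def
proof (rule Y.T.lext_hcomp, clarify)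
  fix u v assume "z (u, v) \<noteq> 0"
  then have *: "u \<in> hbasis U" "v \<in> hbasis V" "gdeg U u + gdeg V v = n"
    using assms by (auto simp: tensor_hcomp dest: X.K_hbasis)
  then show "tens U' V' (\<phi> u) (\<psi> v) \<in> hcomp (tensor U' V') n"
    using Y.tens_hcomp[OF phi_hcomp[OF X.U.hbasis_hcomp] psi_hcomp[OF X.V.hbasis_hcomp]] by blast
qed

text \<open>The counterpart of \<open>swap_ok\<close> for maps: multiplicativity on the products (1
  \<otimes> v)(u \<otimes> 1). It is inherited by products in either variable for the same
  reasons.\<close>

definition tau_ok :: "'v \<Rightarrow> 'u \<Rightarrow> bool" where
  "tau_ok v u \<longleftrightarrow> TT (\<tau> v u) = \<tau>' (\<psi> v) (\<phi> u)"

lemma TT_lmul: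
  "z \<in> X.K \<Longrightarrow> u \<in> carrier U \<Longrightarrow> TT (X.mm (X.iU u) z) = Y.mm (Y.iU (\<phi> u)) (TT z)"
  by (induction rule: X.fsupp_tens_induct)
    (simp_all add: X.tmul_linear Y.tmul_linear TT_linear X.tmul_tens_left Y.tmul_tens_left TT_tens
      phi_mult)

lemma TT_rmul:
  "z \<in> X.K \<Longrightarrow> v \<in> carrier V \<Longrightarrow> TT (X.mm z (X.iV v)) = Y.mm (TT z) (Y.iV (\<psi> v))"
  by (induction rule: X.fsupp_tens_induct)
    (simp_all add: X.tmul_linear Y.tmul_linear TT_linear X.tmul_tens_right Y.tmul_tens_right TT_tens
      psi_mult)

lemma tau_ok_right:
  assumes u: "u \<in> carrier U" and ok: "\<And>v. v \<in> carrier V \<Longrightarrow> tau_ok v u" and z: "z \<in> X.K"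
  shows "TT (X.mm z (X.iU u)) = Y.mm (TT z) (Y.iU (\<phi> u))"
  using z
proof (induction rule: X.fsupp_tens_induct)
  case (base c d)
  then have cd: "c \<in> carrier U" "d \<in> carrier V"
    by auto
  have "TT (X.mm (tens U V c d) (X.iU u)) = TT (X.mm (X.iU c) (\<tau> d u))"
    using cd u by (simp add: X.tmul_assoc flip: X.tens_eq[of d c] X.tau_eq)
  also have "\<dots> = Y.mm (Y.iU (\<phi> c)) (\<tau>' (\<psi> d) (\<phi> u))"
    using cd u ok[OF cd(2)] by (simp add: TT_lmul tau_ok_def)
  also have "\<dots> = Y.mm (tens U' V' (\<phi> c) (\<psi> d)) (Y.iU (\<phi> u))"
    using cd u by (simp add: Y.tmul_assoc flip: Y.tens_eq[of "\<psi> d" "\<phi> c"] Y.tau_eq)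
  finally show ?case
    using cd by (simp add: TT_tens)
qed (simp_all add: X.tmul_linear Y.tmul_linear TT_linear)

lemma tau_ok_left:
  assumes v: "v \<in> carrier V" and ok: "\<And>u. u \<in> carrier U \<Longrightarrow> tau_ok v u" and z: "z \<in> X.K"
  shows "TT (X.mm (X.iV v) z) = Y.mm (Y.iV (\<psi> v)) (TT z)"
  using z
proof (induction rule: X.fsupp_tens_induct)
  case (base c d)
  then have cd: "c \<in> carrier U" "d \<in> carrier V"
    by auto
  have "TT (X.mm (X.iV v) (tens U V c d)) = TT (X.mm (\<tau> v c) (X.iV d))"
    using cd v by (simp add: X.tmul_assoc flip: X.tens_eq[of d c] X.tau_eq)
  also have "\<dots> = Y.mm (\<tau>' (\<psi> v) (\<phi> c)) (Y.iV (\<psi> d))"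
    using cd v ok[OF cd(1)] by (simp add: TT_rmul tau_ok_def)
  also have "\<dots> = Y.mm (Y.iV (\<psi> v)) (tens U' V' (\<phi> c) (\<psi> d))"
    using cd v by (simp add: Y.tmul_assoc flip: Y.tens_eq[of "\<psi> d" "\<phi> c"] Y.tau_eq)
  finally show ?case
    using cd by (simp add: TT_tens)
qed (simp_all add: X.tmul_linear Y.tmul_linear TT_linear)

lemma tau_ok_mult_right:
  assumes "u \<in> carrier U" "u' \<in> carrier U" "v \<in> carrier V"
    and "tau_ok v u" "\<And>v. v \<in> carrier V \<Longrightarrow> tau_ok v u'"
  shows "tau_ok v (u \<otimes>\<^bsub>U\<^esub> u')"
  using tau_ok_right[of u' "\<tau> v u"] assms
  by (simp add: tau_ok_def X.tau_mult_right' Y.tau_mult_right' phi_mult)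

lemma tau_ok_mult_left:
  assumes "v \<in> carrier V" "v' \<in> carrier V" "u \<in> carrier U"
    and "\<And>u. u \<in> carrier U \<Longrightarrow> tau_ok v u" "tau_ok v' u"
  shows "tau_ok (v \<otimes>\<^bsub>V\<^esub> v') u"
  using tau_ok_left[of v "\<tau> v' u"] assms
  by (simp add: tau_ok_def X.tau_mult_left' Y.tau_mult_left' psi_mult)

lemma tau_ok_one: "v \<in> carrier V \<Longrightarrow> tau_ok v \<one>\<^bsub>U\<^esub>" "u \<in> carrier U \<Longrightarrow> tau_ok \<one>\<^bsub>V\<^esub> u"
  by (simp_all add: tau_ok_def X.tau_one_right X.tau_one_left Y.tau_one_right Y.tau_one_left
      phi_one psi_one TT_tens)

lemma tau_ok_linear:
  assumes "v \<in> carrier V" "u \<in> carrier U" "u' \<in> carrier U" "tau_ok v u"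
  shows "tau_ok v u' \<Longrightarrow> tau_ok v (u \<oplus>\<^bsub>U\<^esub> u')" "tau_ok v (r \<odot>\<^bsub>U\<^esub> u)"
  using assms
  by (simp_all add: tau_ok_def mlinD[OF X.mlin_tau(2)] mlinD[OF Y.mlin_tau(2)] TT_linear
      phi_add phi_smult)

lemma tau_ok_linear_left:
  assumes "v \<in> carrier V" "v' \<in> carrier V" "u \<in> carrier U" "tau_ok v u"
  shows "tau_ok v' u \<Longrightarrow> tau_ok (v \<oplus>\<^bsub>V\<^esub> v') u" "tau_ok (r \<odot>\<^bsub>V\<^esub> v) u"
  using assms
  by (simp_all add: tau_ok_def mlinD[OF X.mlin_tau(1)] mlinD[OF Y.mlin_tau(1)] TT_linear
      psi_add psi_smult)

text \<open>Writing u \<otimes> v as a product reduces multiplicativity to \<open>tau_ok\<close>,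
  and then compatibility with the differentials to the two restrictions. The signs agree because
  \<open>\<phi>\<close> preserves degrees.\<close>

theorem TT_chain_algebra_hom:
  assumes ok: "\<And>v u. v \<in> carrier V \<Longrightarrow> u \<in> carrier U \<Longrightarrow> tau_ok v u"
    and TT_DU: "\<And>u. u \<in> carrier U \<Longrightarrow> TT (DU u) = DU' (\<phi> u)"
    and TT_DV: "\<And>v. v \<in> carrier V \<Longrightarrow> TT (DV v) = DV' (\<psi> v)"
    and dif: "\<And>z. z \<in> X.K \<Longrightarrow> dif A z = X.DD z" "\<And>z. z \<in> Y.K \<Longrightarrow> dif A' z = Y.DD z"
  shows "chain_algebra_hom A A' TT"
proof -
  have mult: "TT (X.mm x y) = Y.mm (TT x) (TT y)" if x: "x \<in> X.K" and y: "y \<in> X.K" for x y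
    using y
  proof (induction rule: X.fsupp_tens_induct)
    case (base u v)
    then have uv: "u \<in> carrier U" "v \<in> carrier V"
      by auto
    have "TT (X.mm x (X.mm (X.iU u) (X.iV v))) = TT (X.mm (X.mm x (X.iU u)) (X.iV v))"
      using x uv by (simp add: X.tmul_assoc)
    also have "\<dots> = Y.mm (Y.mm (TT x) (Y.iU (\<phi> u))) (Y.iV (\<psi> v))"
      using x uv by (simp add: TT_rmul tau_ok_right[OF uv(1) ok])
    also have "\<dots> = Y.mm (TT x) (TT (tens U V u v))"
      using x uv by (simp add: Y.tmul_assoc TT_tens Y.tens_eq)
    finally show ?case
      using uv by (simp add: X.tens_eq)
  qed (use x in \<open>simp_all add: X.tmul_linear Y.tmul_linear TT_linear\<close>)
  have "TT (X.DD z) = Y.DD (TT z)" if "z \<in> X.K" for z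
    using that
  proof (induction rule: X.fsupp_tens_induct)
    case (base u v)
    then have uv: "u \<in> carrier U" "v \<in> carrier V"
      by auto
    have sgU: "TT (X.sg (X.iU u)) = Y.sg (Y.iU (\<phi> u))"
      using uv by (simp add: X.sg_iU[OF base(3)] Y.sg_iU[OF phi_hcomp[OF base(3)]] TT_linear TT_tens psi_one)
    then show ?case
      using uv by (simp add: X.DD_tens Y.DD_tens TT_tens TT_linear mult TT_DU TT_DV psi_one phi_one)
  qed (simp_all add: X.DD_linear Y.DD_linear TT_linear)
  then show ?thesis
    unfolding chain_algebra_hom_def gralg_hom_def graded_linear_def ring_hom_def
    using TT_hcomp mult
    by (auto simp: X.A_carrier Y.A_carrier X.A_module(2,3,4,5) Y.A_module(2,3,4,5) X.A_one Y.A_one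
        X.A_mult Y.A_mult TT_linear dif TT_tens phi_one psi_one)
qed

end

lemma (in alg_tensor) tensor_map_id:
  assumes "\<And>u. u \<in> carrier U \<Longrightarrow> \<phi> u = u" "\<And>v. v \<in> carrier V \<Longrightarrow> \<psi> v = v" "z \<in> K"
  shows "tensor_map U V \<phi> \<psi> z = z"
proof -
  have "tensor_map U V \<phi> \<psi> z = lext (\<lambda>(u, v). u \<boxtimes> v) z"
    unfolding tensor_map_def using assms by (intro lext_cong) (auto dest!: K_hbasis)
  then show ?thesis
    using tens_expand[OF assms(3)] by simp
qed

section \<open>Coactions\<close>

text \<open>For maps such as \<open>sinv H\<close> that are linear only on elements of a fixed
  degree; composed with the projection to that degree they become linear on all of
  \<open>M\<close>.\<close>

lemma (in graded_free_mod) hcomp_eq_lext: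
  assumes v: "v \<in> hcomp M n"
    and F: "\<And>x. x \<in> hcomp M n \<Longrightarrow> F x \<in> fsupp Y"
      "\<And>x y. x \<in> hcomp M n \<Longrightarrow> y \<in> hcomp M n \<Longrightarrow> F (x \<oplus> y) = F x + F y"
      "\<And>r x. x \<in> hcomp M n \<Longrightarrow> F (r \<odot> x) = r \<cdot> F x"
  shows "F v = lext F (coord M v)"
proof -
  have proj_smult: "proj n (r \<odot> x) = r \<odot> proj n x" if "x \<in> carrier M" for r x
    using that
  proof (induction rule: carrier_induct)
    case (hcomp m x)
    then show ?case
      using hcomp_smult[OF hcomp, of r] by (simp add: proj_hcomp)
  qed (simp add: smult_add_right proj_add)
  have "mlin M Y (\<lambda>x. F (proj n x))"
    by (rule mlinI) (auto simp: F proj_in_hcomp proj_add proj_smult)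
  from mlin_eq_lext[OF this hcomp_carrier[OF v]]
  have "F v = lext (\<lambda>x. F (proj n x)) (coord M v)"
    using v by (simp add: proj_hcomp)
  also have "\<dots> = lext F (coord M v)"
    using coord_hcomp[OF v] hbasis_hcomp by (intro lext_cong) (metis proj_hcomp)
  finally show ?thesis .
qed

lemma (in graded_free_mod) mlin_finsum:
  assumes F: "mlin M Y F" and "finite I" and c: "\<And>i. i \<in> I \<Longrightarrow> c i \<in> carrier M"
  shows "F (\<Oplus>i\<in>I. r i \<odot> c i) = (\<Sum>i\<in>I. r i \<cdot> F (c i))"
  using assms(2) c
proof (induction I rule: finite_induct)
  case empty
  then show ?case
    by (simp add: mlin_0[OF F])
next
  case (insert i I)
  have "(\<Oplus>i\<in>insert i I. r i \<odot> c i) = r i \<odot> c i \<oplus> (\<Oplus>i\<in>I. r i \<odot> c i)"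
    using insert by (subst finsum_insert) auto
  then show ?case
    using insert by (simp add: mlinD[OF F] Pi_def)
qed

text \<open>Passes from coassociativity as an identity in P \<otimes> (Q \<otimes> S) to an identity
  of Sweedler sums with an arbitrary \<open>\<beta>\<close>: apply the linear extension of
  \<open>?G\<close> to the former. As \<open>?G\<close> is evaluated only at tensors with a basis
  element of P on the left, \<open>\<beta>\<close> is prescribed on basis triples and may contain
  signs. The two separate sums \<open>z\<close> and \<open>z'\<close> let the lemma cover
  comultiplications as well as left and right coactions.\<close>

lemma coassoc_lext:
  fixes P :: "('r::comm_ring_1, 'p, 'm) chalg_scheme" and Q :: "('r, 'q, 'n) chalg_scheme"
    and S :: "('r, 's, 'k) chalg_scheme"
  assumes free: "graded_free_mod P" "graded_free_mod Q" "graded_free_mod S"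
    and z: "z \<in> fsupp (Z \<times> hbasis S)" and z': "z' \<in> fsupp (hbasis P \<times> Z')"
    and f: "\<And>p. p \<in> Z \<Longrightarrow> f p \<in> fsupp (hbasis P \<times> hbasis Q)"
    and g: "\<And>t. t \<in> Z' \<Longrightarrow> g t \<in> fsupp (hbasis Q \<times> hbasis S)"
    and eq: "lext (\<lambda>(p, s). lext (\<lambda>(x, y). tens P (tensor Q S) x (tens Q S y s)) (f p)) z =
      lext (\<lambda>(p, t). tens P (tensor Q S) p (g t)) z'"
    and \<beta>: "\<And>x y s. x \<in> hbasis P \<Longrightarrow> y \<in> hbasis Q \<Longrightarrow> s \<in> hbasis S \<Longrightarrow> \<beta> x y s \<in> fsupp Y"
  shows "lext (\<lambda>(p, s). lext (\<lambda>(x, y). \<beta> x y s) (f p)) z = lext (\<lambda>(p, t). lext (\<lambda>(y, s). \<beta> p y s) (g t)) z'"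
proof -
  interpret QS: tensor_mod Q S
    using free by (simp add: tensor_mod_def)
  interpret W: fun_mod "tensor Q S" "hbasis Q \<times> hbasis S" "\<lambda>(x, y). gdeg Q x + gdeg S y"
    by (rule tensor_fun_mod)
  interpret PW: tensor_mod P "tensor Q S"
    using free(1) W.graded_free_mod_axioms by (simp add: tensor_mod_def)
  let ?G = "\<lambda>(x, w). lext (\<lambda>(y, s). \<beta> x y s) w"
  have G: "lext ?G (tens P (tensor Q S) x w) = lext (\<lambda>(y, s). \<beta> x y s) w"
    if "x \<in> hbasis P" "w \<in> fsupp (hbasis Q \<times> hbasis S)" for x w
    using PW.lext_tens_hbasis[of x Y ?G w] that \<beta> W.mlin_lext_id[of "\<lambda>(y, s). \<beta> x y s" Y]
    by (auto simp: tensor_simps)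
  have "lext (\<lambda>(p, s). lext (\<lambda>(x, y). \<beta> x y s) (f p)) z =
    lext (\<lambda>(p, s). lext ?G (lext (\<lambda>(x, y). tens P (tensor Q S) x (tens Q S y s)) (f p))) z"
  proof (intro lext_cong, clarify)
    fix p s assume "z (p, s) \<noteq> 0"
    then have ps: "p \<in> Z" "s \<in> hbasis S"
      using z fsupp_in by fastforce+
    have "lext ?G (lext (\<lambda>(x, y). tens P (tensor Q S) x (tens Q S y s)) (f p)) =
      lext (\<lambda>q. lext ?G (case q of (x, y) \<Rightarrow> tens P (tensor Q S) x (tens Q S y s))) (f p)"
      using f[OF ps(1)] by (rule lext_lext[where Y = "hbasis P \<times> hbasis (tensor Q S)"]) auto
    also have "\<dots> = lext (\<lambda>(x, y). \<beta> x y s) (f p)"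
      using ps f[OF ps(1)] by (intro lext_cong) (auto simp: G QS.tens_hbasis dest!: fsupp_in)
    finally show "lext (\<lambda>(x, y). \<beta> x y s) (f p) =
      lext ?G (lext (\<lambda>(x, y). tens P (tensor Q S) x (tens Q S y s)) (f p))" ..
  qed
  also have "\<dots> = lext ?G (lext (\<lambda>(p, s). lext (\<lambda>(x, y). tens P (tensor Q S) x (tens Q S y s)) (f p)) z)"
    by (subst lext_lext[OF z, where Y = "hbasis P \<times> hbasis (tensor Q S)"])
      (auto simp: split_def intro!: lext_fsupp)
  also have "\<dots> = lext ?G (lext (\<lambda>(p, t). tens P (tensor Q S) p (g t)) z')"
    by (simp only: eq)
  also have "\<dots> = lext (\<lambda>q. lext ?G (case q of (p, t) \<Rightarrow> tens P (tensor Q S) p (g t))) z'"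
    using z' by (rule lext_lext[where Y = "hbasis P \<times> hbasis (tensor Q S)"]) auto
  also have "\<dots> = lext (\<lambda>(p, t). lext (\<lambda>(y, s). \<beta> p y s) (g t)) z'"
    using z' g by (intro lext_cong) (auto simp: G dest!: fsupp_in)
  finally show ?thesis .
qed

text \<open>Only the multiplicative and differential properties of a coaction are kept, with both
  tensor factors left open. The comultiplication of \<open>H\<close>, left coactions and right
  coactions are the three instances.\<close>

locale coaction = P: chain_alg P + Q: chain_alg Q + B: chain_alg B
  for P :: "('r::comm_ring_1, 'p, 'm) chalg_scheme" and Q :: "('r, 'q, 'n) chalg_scheme"
    and B :: "('r, 'b, 'k) chalg_scheme" +
  fixes \<nu> :: "'b \<Rightarrow> 'p \<times> 'q \<Rightarrow> 'r"
  assumes nu_hom: "chain_algebra_hom B (tensor P Q) \<nu>"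
begin

sublocale tensor_mod P Q
  by unfold_locales

lemma mlin_nu: "mlin B (hbasis P \<times> hbasis Q) \<nu>"
  using nu_hom unfolding chain_algebra_hom_def gralg_hom_def graded_linear_def
  by (auto intro!: mlinI simp: tensor_simps)

lemma nu_fsupp [simp]: "b \<in> carrier B \<Longrightarrow> \<nu> b \<in> fsupp (hbasis P \<times> hbasis Q)"
  using mlinD(1)[OF mlin_nu] .

lemma nu_basis:
  assumes "b \<in> carrier B" "\<nu> b (x, y) \<noteq> 0"
  shows "x \<in> hbasis P" "y \<in> hbasis Q"
  using fsupp_in[OF nu_fsupp[OF assms(1)] assms(2)] by auto

text \<open>The last conclusion, |b| = |x| + |y| for the terms x \<otimes> y of the coaction on b,
  is what allows signs to be rearranged inside a Sweedler sum.\<close>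

lemma nu_supp:
  assumes "b \<in> hcomp B n" "\<nu> b (x, y) \<noteq> 0"
  shows "x \<in> hbasis P" "y \<in> hbasis Q" "x \<in> hcomp P (gdeg P x)" "y \<in> hcomp Q (gdeg Q y)"
    "x \<in> carrier P" "y \<in> carrier Q" "n = gdeg P x + gdeg Q y"
proof -
  have "\<nu> b \<in> hcomp (tensor P Q) n"
    using nu_hom assms(1) unfolding chain_algebra_hom_def gralg_hom_def graded_linear_def by auto
  then show "n = gdeg P x + gdeg Q y"
    using assms(2) by (auto simp: tensor_hcomp)
  show xy: "x \<in> hbasis P" "y \<in> hbasis Q"
    using nu_basis[OF B.hcomp_carrier[OF assms(1)] assms(2)] .
  show "x \<in> hcomp P (gdeg P x)" "y \<in> hcomp Q (gdeg Q y)" "x \<in> carrier P" "y \<in> carrier Q"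
    using xy P.hbasis_hcomp Q.hbasis_hcomp by auto
qed

lemma nu_one: "\<nu> \<one>\<^bsub>B\<^esub> = tens P Q \<one>\<^bsub>P\<^esub> \<one>\<^bsub>Q\<^esub>"
  using nu_hom unfolding chain_algebra_hom_def gralg_hom_def ring_hom_def
  by (auto simp: tensor_simps)

lemma nu_mult:
  assumes b: "b \<in> carrier B" "b' \<in> carrier B"
  shows "lext \<gamma> (\<nu> (b \<otimes>\<^bsub>B\<^esub> b')) = lext (\<lambda>(x, y). lext (\<lambda>(x', y').
    ksign (gdeg Q y * gdeg P x') \<cdot> lext \<gamma> (tens P Q (x \<otimes>\<^bsub>P\<^esub> x') (y \<otimes>\<^bsub>Q\<^esub> y'))) (\<nu> b')) (\<nu> b)"
proof -
  have "\<nu> (b \<otimes>\<^bsub>B\<^esub> b') = lext (\<lambda>(x, y). lext (\<lambda>(x', y').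
      ksign (gdeg Q y * gdeg P x') \<cdot> tens P Q (x \<otimes>\<^bsub>P\<^esub> x') (y \<otimes>\<^bsub>Q\<^esub> y')) (\<nu> b')) (\<nu> b)"
    using nu_hom b unfolding chain_algebra_hom_def gralg_hom_def ring_hom_def
    by (auto simp: tensor_def Let_def)
  then have "lext \<gamma> (\<nu> (b \<otimes>\<^bsub>B\<^esub> b')) = lext (\<lambda>p. lext \<gamma> (case p of (x, y) \<Rightarrow> lext (\<lambda>(x', y').
      ksign (gdeg Q y * gdeg P x') \<cdot> tens P Q (x \<otimes>\<^bsub>P\<^esub> x') (y \<otimes>\<^bsub>Q\<^esub> y')) (\<nu> b'))) (\<nu> b)"
    using nu_fsupp[OF b(1)]
    by (simp only:) (rule lext_lext[where Y = "hbasis P \<times> hbasis Q"], auto intro!: lext_fsupp)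
  also have "\<dots> = lext (\<lambda>(x, y). lext (\<lambda>p. lext \<gamma> (case p of (x', y') \<Rightarrow>
      ksign (gdeg Q y * gdeg P x') \<cdot> tens P Q (x \<otimes>\<^bsub>P\<^esub> x') (y \<otimes>\<^bsub>Q\<^esub> y'))) (\<nu> b')) (\<nu> b)"
    using nu_fsupp[OF b(2)] unfolding split_def
    by (intro lext_cong lext_lext[where Y = "hbasis P \<times> hbasis Q"]) auto
  also have "\<dots> = lext (\<lambda>(x, y). lext (\<lambda>(x', y').
    ksign (gdeg Q y * gdeg P x') \<cdot> lext \<gamma> (tens P Q (x \<otimes>\<^bsub>P\<^esub> x') (y \<otimes>\<^bsub>Q\<^esub> y'))) (\<nu> b')) (\<nu> b)"
    by (simp add: split_def lext_scale[OF tens_fsupp])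
  finally show ?thesis .
qed

lemma nu_dif:
  assumes b: "b \<in> carrier B"
  shows "lext \<gamma> (\<nu> (dif B b)) = lext (\<lambda>(x, y).
    lext \<gamma> (tens P Q (dif P x) y) + ksign (gdeg P x) \<cdot> lext \<gamma> (tens P Q x (dif Q y))) (\<nu> b)"
proof -
  have "\<nu> (dif B b) = lext (\<lambda>(x, y).
    tens P Q (dif P x) y + ksign (gdeg P x) \<cdot> tens P Q x (dif Q y)) (\<nu> b)"
    using nu_hom b unfolding chain_algebra_hom_def by (auto simp: tensor_def Let_def)
  then have "lext \<gamma> (\<nu> (dif B b)) = lext (\<lambda>p. lext \<gamma> (case p of (x, y) \<Rightarrow>
    tens P Q (dif P x) y + ksign (gdeg P x) \<cdot> tens P Q x (dif Q y))) (\<nu> b)"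
    using nu_fsupp[OF b] by (simp only:) (rule lext_lext[where Y = "hbasis P \<times> hbasis Q"], auto)
  then show ?thesis
    by (simp add: split_def lext_scale[OF tens_fsupp] lext_add[OF tens_fsupp fsupp_scale[OF tens_fsupp]])
qed

lemma mlin_lext_nu:
  "(\<And>x y. x \<in> hbasis P \<Longrightarrow> y \<in> hbasis Q \<Longrightarrow> \<beta> (x, y) \<in> fsupp Y) \<Longrightarrow> mlin B Y (\<lambda>b. lext \<beta> (\<nu> b))"
  by (rule mlin_lext[OF mlin_nu]) auto

end

section \<open>Hopf algebras\<close>

lemma tword_delta: "tword = delta"
  by (simp add: tword_def delta_def fun_eq_iff)

locale hopf =
  fixes H :: "('r::comm_ring_1, 'h) chopf" (structure)
  assumes hopf: "chain_hopf_algebra H"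
begin

sublocale chain_alg H
  using hopf by unfold_locales (simp add: chain_hopf_algebra_def)

sublocale D: coaction H H H "comult H"
  using hopf by unfold_locales (simp add: chain_hopf_algebra_def)

abbreviation \<epsilon> where "\<epsilon> \<equiv> counit H"

lemma counit_linear:
  "x \<in> carrier H \<Longrightarrow> y \<in> carrier H \<Longrightarrow> \<epsilon> (x \<oplus> y) = \<epsilon> x + \<epsilon> y"
  "x \<in> carrier H \<Longrightarrow> \<epsilon> (r \<odot> x) = r * \<epsilon> x"
  and counit_hcomp: "x \<in> hcomp H n \<Longrightarrow> n \<noteq> 0 \<Longrightarrow> \<epsilon> x = 0"
  using hopf unfolding chain_hopf_algebra_def by blast+

lemma connected:
  "n < 0 \<Longrightarrow> hcomp H n = {\<zero>}" "hcomp H 1 = {\<zero>}" "bij_betw (\<lambda>r. r \<odot> \<one>) UNIV (hcomp H 0)"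
  using hopf unfolding chain_hopf_algebra_def by blast+

lemma hbasis_degree:
  assumes "x \<in> hbasis H"
  shows "gdeg H x \<ge> 0" "gdeg H x \<noteq> 1"
  using connected(1,2) hbasis_hcomp[OF assms] hbasis_nonzero[OF assms]
  by (cases "gdeg H x < 0"; auto)+

lemma comult_coassoc:
  assumes "\<And>x y s. x \<in> hbasis H \<Longrightarrow> y \<in> hbasis H \<Longrightarrow> s \<in> hbasis H \<Longrightarrow> \<beta> x y s \<in> fsupp Y"
    and "c \<in> carrier H"
  shows "lext (\<lambda>(x, y). lext (\<lambda>(x1, x2). \<beta> x1 x2 y) (comult H x)) (comult H c) =
    lext (\<lambda>(x, y). lext (\<lambda>(y1, y2). \<beta> x y1 y2) (comult H y)) (comult H c)"
proof (rule coassoc_lext[where Z = "hbasis H" and Z' = "hbasis H"])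
  show "graded_free_mod H" "graded_free_mod H" "graded_free_mod H"
    by unfold_locales
  show "lext (\<lambda>(x, y). lext (\<lambda>(x1, x2). tens H (tensor H H) x1 (tens H H x2 y)) (comult H x)) (comult H c) =
    lext (\<lambda>(x, y). tens H (tensor H H) x (comult H y)) (comult H c)"
    using hopf assms(2) unfolding chain_hopf_algebra_def by blast
qed (use assms in auto)

lemma counit_left:
  assumes F: "mlin H Y F" and c: "c \<in> carrier H"
  shows "lext (\<lambda>(x, y). \<epsilon> x \<cdot> F y) (comult H c) = F c"
proof -
  let ?S = "{p. comult H c p \<noteq> 0}"
  have fin: "finite ?S"
    using D.nu_fsupp[OF c] by (rule fsupp_finite)
  have "F c = F (\<Oplus>p\<in>?S. (comult H c p * \<epsilon> (fst p)) \<odot> snd p)"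
    using hopf c unfolding chain_hopf_algebra_def by auto
  also have "\<dots> = (\<Sum>p\<in>?S. (comult H c p * \<epsilon> (fst p)) \<cdot> F (snd p))"
    using D.nu_basis[OF c] by (intro mlin_finsum[OF F fin]) auto
  also have "\<dots> = lext (\<lambda>(x, y). \<epsilon> x \<cdot> F y) (comult H c)"
    using fin by (simp add: lext_alt[of ?S] split_def)
  finally show ?thesis ..
qed

lemma counit_right:
  assumes F: "mlin H Y F" and c: "c \<in> carrier H"
  shows "lext (\<lambda>(x, y). \<epsilon> y \<cdot> F x) (comult H c) = F c"
proof -
  let ?S = "{p. comult H c p \<noteq> 0}"
  have fin: "finite ?S"
    using D.nu_fsupp[OF c] by (rule fsupp_finite)
  have "F c = F (\<Oplus>p\<in>?S. (comult H c p * \<epsilon> (snd p)) \<odot> fst p)"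
    using hopf c unfolding chain_hopf_algebra_def by auto
  also have "\<dots> = (\<Sum>p\<in>?S. (comult H c p * \<epsilon> (snd p)) \<cdot> F (fst p))"
    using D.nu_basis[OF c] by (intro mlin_finsum[OF F fin]) auto
  also have "\<dots> = lext (\<lambda>(x, y). \<epsilon> y \<cdot> F x) (comult H c)"
    using fin by (simp add: lext_alt[of ?S] split_def)
  finally show ?thesis ..
qed

text \<open>The counit law at 1 gives \<epsilon>(1) \<cdot> 1 = 1, because 1 is grouplike, and r
  \<cdot> 1 determines r by connectedness.\<close>

lemma counit_one: "\<epsilon> \<one> = 1"
proof -
  have "coord H \<one> = lext (\<lambda>(x, y). \<epsilon> x \<cdot> coord H y) (tens H H \<one> \<one>)"
    using counit_left[OF mlin_coord, of \<one>] by (simp add: D.nu_one)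
  also have "\<dots> = \<epsilon> \<one> \<cdot> coord H \<one>"
    by (rule D.lext_tens[where Y = "hbasis H"])
      (auto intro!: mbilI mlinI simp: counit_linear coord_add coord_smult fscale_add fscale_add_left mult_ac)
  finally have "coord H (\<epsilon> \<one> \<odot> \<one>) = coord H (1 \<odot> \<one>)"
    by (simp add: coord_smult)
  then have "\<epsilon> \<one> \<odot> \<one> = 1 \<odot> \<one>"
    by (rule coord_inject[rotated 2]) auto
  then show ?thesis
    by (rule injD[OF bij_betw_imp_inj_on[OF connected(3)]])
qed

lemma hcomp_0: "x \<in> hcomp H 0 \<Longrightarrow> x = \<epsilon> x \<odot> \<one>"
proof -
  assume "x \<in> hcomp H 0"
  then obtain r where "x = r \<odot> \<one>"
    using bij_betw_imp_surj_on[OF connected(3)] by auto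
  then show ?thesis
    by (simp add: counit_linear counit_one)
qed

text \<open>In degree 0 \<open>H\<close> consists of the multiples of 1, and the counit reads off
  the coefficient. This handles basis elements of degree 0, which need not be 1 itself.\<close>

lemma hcomp_0_eq:
  assumes F: "mlin H Y F" and x: "x \<in> hcomp H 0"
  shows "F x = \<epsilon> x \<cdot> F \<one>"
  using mlinD(3)[OF F, of \<one> "\<epsilon> x"] hcomp_0[OF x] by simp

lemma dif_one: "dif H \<one> = \<zero>"
  using cycles_closed(3) by (simp add: cycles_def)

section \<open>The desuspension\<close>

lemma desusp_simps:
  "add (desusp H) = add H" "zero (desusp H) = \<zero>" "smult (desusp H) = smult H"
  "hcomp (desusp H) n = (if n \<ge> 0 then hcomp H (n + 1) else {\<zero>})"
  by (simp_all add: desusp_def)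

text \<open>The definition of \<open>desusp\<close> refers to the decomposition selected by
  \<open>THE\<close>; uniqueness identifies it with the family of projections.\<close>

lemma desusp_carrier: "carrier (desusp H) = {x \<in> carrier H. \<forall>n\<le>0. proj n x = \<zero>}"
proof -
  have "(THE c. decomposition H x c) = (\<lambda>n. proj n x)" if "x \<in> carrier H" for x
    using decomposition_proj[OF that] decomposition_unique that by blast
  then show ?thesis
    by (auto simp: desusp_def)
qed

lemma desusp_hcomp_carrier: "n > 0 \<Longrightarrow> hcomp H n \<subseteq> carrier (desusp H)"
  by (auto simp: desusp_carrier hcomp_carrier proj_hcomp)

lemma proj_smult: "x \<in> carrier H \<Longrightarrow> proj n (r \<odot> x) = r \<odot> proj n x"
proof (induction rule: carrier_induct)
  case (hcomp m x)
  then show ?case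
    using hcomp_smult[OF hcomp, of r] by (simp add: proj_hcomp)
qed (simp add: smult_add_right proj_add)

lemma proj_minus: "x \<in> carrier H \<Longrightarrow> proj n (\<ominus> x) = \<ominus> proj n x"
  by (simp add: minus_eq_smult proj_smult)

lemma desusp_module: "module scalars (desusp H)"
proof (rule moduleI[OF scalars_cring])
  show "abelian_group (desusp H)"
  proof (rule abelian_groupI)
    show "\<exists>y\<in>carrier (desusp H). y \<oplus>\<^bsub>desusp H\<^esub> x = \<zero>\<^bsub>desusp H\<^esub>" if "x \<in> carrier (desusp H)" for x
      using that by (intro bexI[of _ "(- 1) \<odot> x"])
        (auto simp: desusp_carrier desusp_simps proj_minus l_neg simp flip: minus_eq_smult)
  qed (auto simp: desusp_carrier desusp_simps proj_add a_ac)
qed (auto simp: desusp_carrier desusp_simps proj_smult smult_add_left smult_add_right smult_smult)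

lemma desusp_finsum:
  assumes "f \<in> I \<rightarrow> carrier (desusp H)"
  shows "finsum (desusp H) f I = finsum H f I"
proof -
  interpret DD: module scalars "desusp H"
    by (rule desusp_module)
  show ?thesis
    using assms
  proof (induction I rule: infinite_finite_induct)
    case (insert i I)
    then have "f \<in> I \<rightarrow> carrier H" "f i \<in> carrier H"
      by (auto simp: desusp_carrier)
    then show ?case
      using insert by (simp add: DD.finsum_insert desusp_simps)
  qed (auto simp: desusp_simps)
qed

lemma desusp_hcomp_subset: "hcomp (desusp H) n \<subseteq> carrier (desusp H)"
  using desusp_hcomp_carrier[of "n + 1"] by (auto simp: desusp_simps desusp_carrier)

text \<open>The components are the same elements with indices shifted by one. Negative indices must
  vanish because H_+ starts in degree 1, that is, its desuspension in degree 0.\<close>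

lemma desusp_decomposition:
  "decomposition (desusp H) x c \<longleftrightarrow> decomposition H x (\<lambda>n. c (n - 1)) \<and> (\<forall>n<0. c n = \<zero>)"
proof -
  let ?S = "{n. c n \<noteq> \<zero>}"
  have comp: "(\<forall>n. c n \<in> hcomp (desusp H) n) \<longleftrightarrow> (\<forall>n. c (n - 1) \<in> hcomp H n) \<and> (\<forall>n<0. c n = \<zero>)"
  proof (intro iffI conjI allI impI)
    fix n assume c: "\<forall>n. c n \<in> hcomp (desusp H) n"
    show "c (n - 1) \<in> hcomp H n"
      using c[rule_format, of "n - 1"] by (auto simp: desusp_simps split: if_splits)
    show "c n = \<zero>" if "n < 0"
      using c[rule_format, of n] that by (simp add: desusp_simps)
  next
    fix n assume c: "(\<forall>n. c (n - 1) \<in> hcomp H n) \<and> (\<forall>n<0. c n = \<zero>)"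
    show "c n \<in> hcomp (desusp H) n"
      using c[THEN conjunct1, rule_format, of "n + 1"] c by (simp add: desusp_simps)
  qed
  have S: "{n. c (n - 1) \<noteq> \<zero>} = (\<lambda>n. n + 1) ` ?S"
  proof (rule Set.set_eqI)
    show "n \<in> {n. c (n - 1) \<noteq> \<zero>} \<longleftrightarrow> n \<in> (\<lambda>n. n + 1) ` ?S" for n
      by (auto simp: image_iff intro: exI[of _ "n - 1"])
  qed
  have fin: "finite {n. c (n - 1) \<noteq> \<zero>} \<longleftrightarrow> finite ?S"
    unfolding S by (rule finite_image_iff) simp
  have sum: "(\<Oplus>n\<in>{n. c (n - 1) \<noteq> \<zero>}. c (n - 1)) = (\<Oplus>\<^bsub>desusp H\<^esub>n\<in>?S. c n)"
    if "\<forall>n. c n \<in> hcomp (desusp H) n"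
  proof -
    have d: "c \<in> ?S \<rightarrow> carrier (desusp H)"
      using that desusp_hcomp_subset by blast
    then have "(\<lambda>n. c (n - 1)) \<in> (\<lambda>n. n + 1) ` ?S \<rightarrow> carrier H"
      by (auto simp: desusp_carrier)
    then have "(\<Oplus>n\<in>(\<lambda>n. n + 1) ` ?S. c (n - 1)) = (\<Oplus>n\<in>?S. c n)"
      by (subst finsum_reindex) auto
    then show ?thesis
      using desusp_finsum[OF d] by (simp add: S)
  qed
  show ?thesis
    unfolding decomposition_def using comp fin sum by (auto simp: desusp_simps)
qed

lemma desusp_graded_module: "graded_module (desusp H)"
proof -
  interpret DD: module scalars "desusp H"
    by (rule desusp_module)
  have neg: "\<ominus>\<^bsub>desusp H\<^esub> x = \<ominus> x" if "x \<in> carrier (desusp H)" for x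
    using that by (intro DD.M.minus_equality)
      (auto simp: desusp_carrier desusp_simps l_neg proj_minus)
  have "submodule (hcomp (desusp H) n) scalars (desusp H)" for n
  proof (rule DD.submoduleI[OF desusp_hcomp_subset])
    show "\<ominus>\<^bsub>desusp H\<^esub> x \<in> hcomp (desusp H) n" if "x \<in> hcomp (desusp H) n" for x
    proof -
      have "x \<in> carrier (desusp H)"
        using that desusp_hcomp_subset by blast
      then have "\<ominus>\<^bsub>desusp H\<^esub> x = (- 1) \<odot> x"
        by (simp add: neg desusp_carrier minus_eq_smult)
      then show ?thesis
        using that hcomp_smult[of x "n + 1" "- 1"] by (auto simp: desusp_simps)
    qed
  qed (auto simp: desusp_simps hcomp_add hcomp_smult)
  moreover have "\<exists>!c. decomposition (desusp H) x c" if x: "x \<in> carrier (desusp H)" for x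
  proof (rule ex1I)
    have xH: "x \<in> carrier H" "\<And>n. n \<le> 0 \<Longrightarrow> proj n x = \<zero>"
      using x by (auto simp: desusp_carrier)
    show "decomposition (desusp H) x (\<lambda>n. proj (n + 1) x)"
      using decomposition_proj[OF xH(1)] xH(2) by (simp add: desusp_decomposition)
    fix c assume "decomposition (desusp H) x c"
    then have "(\<lambda>n. c (n - 1)) = (\<lambda>n. proj n x)"
      using decomposition_unique[OF _ decomposition_proj[OF xH(1)] xH(1)] by (simp add: desusp_decomposition)
    then have "c (n + 1 - 1) = proj (n + 1) x" for n
      by metis
    then show "c = (\<lambda>n. proj (n + 1) x)"
      by auto
  qed
  ultimately show ?thesis
    unfolding graded_module_def using desusp_module by blast
qed

text \<open>An element of the carrier has zero projections in degrees at most 0, so by uniqueness of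
  coordinates no basis element of such a degree occurs in its expansion.\<close>

lemma desusp_homogeneous_basis: "homogeneous_basis (desusp H) {x \<in> hbasis H. gdeg H x > 0}"
  unfolding homogeneous_basis_def
proof (intro conjI ballI)
  let ?X = "{x \<in> hbasis H. gdeg H x > 0}"
  show X: "?X \<subseteq> (\<Union>n. hcomp (desusp H) n)"
  proof
    fix x assume "x \<in> ?X"
    then have "x \<in> hcomp (desusp H) (gdeg H x - 1)"
      using hbasis_hcomp by (simp add: desusp_simps)
    then show "x \<in> (\<Union>n. hcomp (desusp H) n)"
      by blast
  qed
  fix v assume v: "v \<in> carrier (desusp H)"
  interpret DD: module scalars "desusp H"
    by (rule desusp_module)
  have XD: "?X \<subseteq> carrier (desusp H)"
    using X desusp_hcomp_subset by blast
  have vH: "v \<in> carrier H" "\<And>n. n \<le> 0 \<Longrightarrow> proj n v = \<zero>"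
    using v by (auto simp: desusp_carrier)
  have sum: "(\<Oplus>\<^bsub>desusp H\<^esub>x\<in>{x. c x \<noteq> 0}. c x \<odot>\<^bsub>desusp H\<^esub> x) = asm c"
    if "{x. c x \<noteq> 0} \<subseteq> ?X" for c
  proof -
    have "(\<lambda>x. c x \<odot>\<^bsub>desusp H\<^esub> x) \<in> {x. c x \<noteq> 0} \<rightarrow> carrier (desusp H)"
      using that XD DD.smult_closed by auto
    then show ?thesis
      by (simp add: desusp_finsum asm_def desusp_simps)
  qed
  have pos: "gdeg H x > 0" if "coord H v x \<noteq> 0" for x
  proof (rule ccontr)
    assume "\<not> gdeg H x > 0"
    then have "proj (gdeg H x) v = \<zero>"
      using vH(2) by simp
    then have "(\<lambda>y. if gdeg H y = gdeg H x then coord H v y else 0) = 0"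
      using coord_asm[OF proj_coord, of "gdeg H x" v] coord_zero unfolding proj_def by simp
    from fun_cong[OF this, of x] show False
      using that by (simp add: zero_fun_apply)
  qed
  show "\<exists>!c :: 'h \<Rightarrow> 'r. {x. c x \<noteq> 0} \<subseteq> ?X \<and> finite {x. c x \<noteq> 0} \<and>
      v = (\<Oplus>\<^bsub>desusp H\<^esub>x\<in>{x. c x \<noteq> 0}. c x \<odot>\<^bsub>desusp H\<^esub> x)"
  proof (rule ex1I)
    have "{x. coord H v x \<noteq> 0} \<subseteq> ?X" "finite {x. coord H v x \<noteq> 0}"
      using pos fsupp_in[OF coord_fsupp] fsupp_finite[OF coord_fsupp] by auto
    then show "{x. coord H v x \<noteq> 0} \<subseteq> ?X \<and> finite {x. coord H v x \<noteq> 0} \<and>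
        v = (\<Oplus>\<^bsub>desusp H\<^esub>x\<in>{x. coord H v x \<noteq> 0}. coord H v x \<odot>\<^bsub>desusp H\<^esub> x)"
      using sum asm_coord[OF vH(1)] by auto
    fix c assume c: "{x. c x \<noteq> 0} \<subseteq> ?X \<and> finite {x. c x \<noteq> 0} \<and>
      v = (\<Oplus>\<^bsub>desusp H\<^esub>x\<in>{x. c x \<noteq> 0}. c x \<odot>\<^bsub>desusp H\<^esub> x)"
    then have "c \<in> fsupp (hbasis H)" "v = asm c"
      using sum[of c] by (auto simp: fsupp_def)
    then show "c = coord H v"
      using coord_asm by metis
  qed
qed

sublocale S: graded_free_mod "desusp H"
  using desusp_graded_module desusp_homogeneous_basis by unfold_locales (auto simp: graded_free_def)

text \<open>The alphabet of the cobar construction. It is chosen independently of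
  \<open>hbasis H\<close>, so a letter is in general only a linear combination of elements of
  \<open>hbasis H\<close>.\<close>

abbreviation E where "E \<equiv> hbasis (desusp H)"

lemma mlin_desusp: "mlin H Y F \<Longrightarrow> mlin (desusp H) Y F"
  unfolding mlin_def by (auto simp: desusp_carrier desusp_simps)

lemma E_hcomp:
  assumes "x \<in> E"
  shows "x \<in> hcomp H (gdeg H x)" "gdeg H x \<ge> 1" "gdeg (desusp H) x = gdeg H x - 1" "x \<in> carrier H"
    "x \<in> carrier (desusp H)"
proof -
  have x: "x \<in> hcomp (desusp H) (gdeg (desusp H) x)" "x \<noteq> \<zero>"
    using S.hbasis_hcomp[OF assms] S.hbasis_nonzero[OF assms] by (auto simp: desusp_simps)
  then have "gdeg (desusp H) x \<ge> 0" and h: "x \<in> hcomp H (gdeg (desusp H) x + 1)"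
    by (auto simp: desusp_simps split: if_splits)
  moreover have "gdeg H x = gdeg (desusp H) x + 1"
    using gdeg_eq[OF h x(2)] .
  ultimately show "x \<in> hcomp H (gdeg H x)" "gdeg H x \<ge> 1" "gdeg (desusp H) x = gdeg H x - 1" "x \<in> carrier H"
    using hcomp_carrier by auto
  show "x \<in> carrier (desusp H)"
    using assms by (rule S.hbasis_carrier)
qed

end

section \<open>The cobar construction\<close>

lemma delta_tmult: "delta us \<star> delta vs = (delta (us @ vs) :: 'h list \<Rightarrow> 'r::comm_ring_1)"
proof (rule ext)
  fix ws
  have "(delta us \<star> delta vs :: 'h list \<Rightarrow> 'r) ws =
    (\<Sum>i\<le>length ws. if i = length us then (if us @ vs = ws then 1 else 0) else 0)"
    unfolding tmult_def delta_def
  proof (intro sum.cong refl)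
    fix i assume "i \<in> {..length ws}"
    then have "take i ws = us \<and> drop i ws = vs \<longleftrightarrow> i = length us \<and> us @ vs = ws"
      by (auto simp: append_eq_conv_conj)
    then show "(if take i ws = us then 1 else 0) * (if drop i ws = vs then 1 else (0 :: 'r)) =
      (if i = length us then (if us @ vs = ws then 1 else 0) else 0)"
      by (auto split: if_splits)
  qed
  also have "\<dots> = (delta (us @ vs) :: 'h list \<Rightarrow> 'r) ws"
    by (auto simp: delta_def)
  finally show "(delta us \<star> delta vs :: 'h list \<Rightarrow> 'r) ws = delta (us @ vs) ws" .
qed

text \<open>A word has finitely many splittings, so the product is bilinear on all functions,
  whatever their supports.\<close>

lemma tmult_linear:
  "0 \<star> y = 0" "y \<star> 0 = 0"
  "(z + z') \<star> y = z \<star> y + z' \<star> y" "y \<star> (z + z') = y \<star> z + y \<star> z'"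
  "(r \<cdot> z) \<star> y = r \<cdot> (z \<star> y)" "y \<star> (r \<cdot> z) = r \<cdot> (y \<star> z)"
  "(- z) \<star> y = - (z \<star> y)" "y \<star> (- z) = - (y \<star> z)"
  "(z - z') \<star> y = z \<star> y - z' \<star> y" "y \<star> (z - z') = y \<star> z - y \<star> z'"
  by (auto simp: tmult_def fun_eq_iff fun_apply algebra_simps sum.distrib sum_distrib_left sum_negf sum_subtractf)

lemma tmult_fsupp:
  assumes "z \<in> fsupp (lists X)" "z' \<in> fsupp (lists X)"
  shows "z \<star> z' \<in> fsupp (lists X)"
  using assms(1)
proof (induction rule: fsupp_induct)
  case (base us)
  show ?case
    using assms(2)
  proof (induction rule: fsupp_induct)
    case (base vs)
    then show ?case
      using \<open>us \<in> lists X\<close> by (auto simp: delta_tmult intro!: delta_fsupp)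
  qed (simp_all add: tmult_linear)
qed (simp_all add: tmult_linear)

lemma tmult_assoc:
  assumes "x \<in> fsupp X" "y \<in> fsupp X" "z \<in> fsupp X"
  shows "(x \<star> y) \<star> z = x \<star> (y \<star> z)"
  using assms(1)
proof (induction rule: fsupp_induct)
  case (base us)
  show ?case
    using assms(2)
  proof (induction rule: fsupp_induct)
    case (base vs)
    show ?case
      using assms(3) by (induction rule: fsupp_induct) (simp_all add: tmult_linear delta_tmult)
  qed (simp_all add: tmult_linear)
qed (simp_all add: tmult_linear)

lemma tmult_one: "z \<in> fsupp X \<Longrightarrow> delta [] \<star> z = z" "z \<in> fsupp X \<Longrightarrow> z \<star> delta [] = z"
  by (induction rule: fsupp_induct; simp add: tmult_linear delta_tmult)+

lemma tmult_lext_left: "lext \<beta> z \<star> y = lext (\<lambda>p. \<beta> p \<star> y) z"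
  by (auto simp: tmult_def lext_def fun_eq_iff sum_distrib_left sum_distrib_right mult.assoc
      intro: sum.swap)

lemma tmult_lext_right: "y \<star> lext \<beta> z = lext (\<lambda>p. y \<star> \<beta> p) z"
proof (rule ext)
  fix ws
  have "(y \<star> lext \<beta> z) ws =
    (\<Sum>i\<le>length ws. \<Sum>p\<in>{p. z p \<noteq> 0}. z p * (y (take i ws) * \<beta> p (drop i ws)))"
    by (simp add: tmult_def lext_def sum_distrib_left mult_ac)
  also have "\<dots> = (\<Sum>p\<in>{p. z p \<noteq> 0}. \<Sum>i\<le>length ws. z p * (y (take i ws) * \<beta> p (drop i ws)))"
    by (rule sum.swap)
  also have "\<dots> = lext (\<lambda>p. y \<star> \<beta> p) z ws"
    by (simp add: tmult_def lext_def sum_distrib_left)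
  finally show "(y \<star> lext \<beta> z) ws = lext (\<lambda>p. y \<star> \<beta> p) z ws" .
qed

lemma mlin_tmult_left:
  "mlin M (lists X) F \<Longrightarrow> y \<in> fsupp (lists X) \<Longrightarrow> mlin M (lists X) (\<lambda>x. F x \<star> y)"
  unfolding mlin_def by (auto simp: tmult_linear intro: tmult_fsupp)

lemma mlin_tmult_right:
  "mlin M (lists X) F \<Longrightarrow> y \<in> fsupp (lists X) \<Longrightarrow> mlin M (lists X) (\<lambda>x. y \<star> F x)"
  unfolding mlin_def by (auto simp: tmult_linear intro: tmult_fsupp)

definition wdeg :: "('r, 'h, 'm) gralg_scheme \<Rightarrow> 'h list \<Rightarrow> int" where
  "wdeg H ws = (\<Sum>x\<leftarrow>ws. gdeg H x - 1)"

lemma wdeg_simps [simp]: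
  "wdeg H [] = 0" "wdeg H (a # as) = gdeg H a - 1 + wdeg H as" "wdeg H (us @ vs) = wdeg H us + wdeg H vs"
  by (simp_all add: wdeg_def)

lemma cobar_simps:
  "carrier (cobar H) = fsupp (lists (hbasis (desusp H)))"
  "mult (cobar H) = (\<star>)" "one (cobar H) = delta []" "zero (cobar H) = 0" "add (cobar H) = (+)"
  "smult (cobar H) = (\<cdot>)" "dif (cobar H) = lext (cobar_word H)"
  by (simp_all add: cobar_def Let_def fsupp_def tword_delta)

lemma cobar_hcomp:
  "hcomp (cobar H) n = {z \<in> fsupp (lists (hbasis (desusp H))). \<forall>ws. z ws \<noteq> 0 \<longrightarrow> wdeg H ws = n}"
  by (simp add: cobar_def Let_def fsupp_def wdeg_def)

lemma cobar_fun_mod: "fun_mod (cobar H) (lists (hbasis (desusp H))) (wdeg H)"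
  by unfold_locales (simp_all add: cobar_simps cobar_hcomp)

context hopf
begin

abbreviation W where "W \<equiv> fsupp (lists E)"

sublocale C: fun_mod "cobar H" "lists E" "wdeg H"
  by (rule cobar_fun_mod)

lemma tmult_hcomp:
  assumes "z \<in> hcomp (cobar H) m" "z' \<in> hcomp (cobar H) n"
  shows "z \<star> z' \<in> hcomp (cobar H) (m + n)"
proof (rule C.hcompI)
  show "z \<star> z' \<in> W"
    using assms by (auto simp: cobar_hcomp intro: tmult_fsupp)
  fix ws assume "(z \<star> z') ws \<noteq> 0"
  then obtain i where "z (take i ws) * z' (drop i ws) \<noteq> 0"
    unfolding tmult_def by (meson sum.not_neutral_contains_not_neutral)
  then have "z (take i ws) \<noteq> 0" "z' (drop i ws) \<noteq> 0"
    by auto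
  then have "wdeg H (take i ws) = m" "wdeg H (drop i ws) = n"
    using assms by (auto simp: cobar_hcomp)
  then show "wdeg H ws = m + n"
    using wdeg_simps(3)[of H "take i ws" "drop i ws"] by simp
qed

lemma cobar_graded_algebra: "graded_algebra (cobar H)"
proof -
  have "ring (cobar H)"
  proof (rule ringI)
    show "Group.monoid (cobar H)"
      by (rule monoidI) (auto simp: cobar_simps tmult_assoc tmult_one intro: tmult_fsupp)
  qed (auto simp: cobar_simps tmult_linear C.M.abelian_group_axioms)
  moreover have "\<one>\<^bsub>cobar H\<^esub> \<in> hcomp (cobar H) 0"
    using C.delta_hcomp[of "[]"] by (simp add: cobar_simps)
  ultimately show ?thesis
    using C.graded_module tmult_hcomp
    by (auto simp: graded_algebra_def cobar_simps tmult_linear)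
qed

sublocale C: graded_free_alg "cobar H"
  using cobar_graded_algebra C.graded_free by unfold_locales

lemma sinv_eq: "sinv H h = lext (\<lambda>x. delta [x]) (coord (desusp H) h)"
proof (rule ext)
  fix ws
  let ?c = "coord (desusp H) h"
  have fin: "finite {p. ?c p \<noteq> 0}"
    using S.coord_fsupp by (rule fsupp_finite)
  have "lext (\<lambda>x. delta [x]) ?c ws = (\<Sum>p\<in>{p. ?c p \<noteq> 0}. if ws = [p] then ?c p else 0)"
    by (simp add: lext_def delta_def if_distrib[of "\<lambda>x. _ * x"] cong: if_cong)
  also have "\<dots> = sinv H h ws"
  proof (cases "\<exists>x. ws = [x]")
    case True
    then obtain x where "ws = [x]"
      by blast
    then show ?thesis
      using fin by (auto simp: sinv_def)
  next
    case False
    then show ?thesis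
      by (auto simp: sinv_def split: list.split)
  qed
  finally show "sinv H h ws = lext (\<lambda>x. delta [x]) ?c ws" ..
qed

lemma mlin_sinv: "mlin (desusp H) (lists E) (sinv H)"
  unfolding sinv_eq by (rule S.mlin_extend) (auto intro!: delta_fsupp)

lemma sinv_W [simp]: "sinv H h \<in> W"
  unfolding sinv_eq by (intro lext_fsupp) (auto intro!: delta_fsupp dest: fsupp_in[OF S.coord_fsupp])

lemma sinv_E: "x \<in> E \<Longrightarrow> sinv H x = delta [x]"
  by (simp add: sinv_eq S.coord_hbasis)

text \<open>\<open>sinv\<close> is only additive on homogeneous elements of equal degree; \<open>ssv\<close> is its linear version.\<close>

definition ssv :: "'h \<Rightarrow> 'h list \<Rightarrow> 'r" where
  "ssv h = lext (sinv H) (coord H h)"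

lemma mlin_ssv: "mlin H (lists E) ssv"
  unfolding ssv_def by (rule mlin_extend) simp

lemma ssv_W [simp]: "ssv h \<in> W"
  unfolding ssv_def by (rule lext_fsupp) simp

text \<open>A nonzero element of degree at most 0 lies outside the carrier of
  \<open>desusp H\<close>, where \<open>coord\<close> is \<open>0\<close> by default; this default
  realises s^-1 1 = 0.\<close>

lemma sinv_nonpos:
  assumes "h \<in> hcomp H n" "n \<le> 0"
  shows "sinv H h = 0"
proof (cases "h = \<zero>")
  case True
  then show ?thesis
    using S.coord_zero by (simp add: sinv_eq desusp_simps)
next
  case False
  then have "h \<notin> carrier (desusp H)"
    using assms by (auto simp: desusp_carrier proj_hcomp)
  then show ?thesis
    by (simp add: sinv_eq coord_def zero_fun_def[symmetric])
qed

text \<open>In each positive degree \<open>sinv H\<close> is linear, hence determined by its values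
  on basis elements; in degrees at most 0 both sides vanish.\<close>

lemma sinv_ssv:
  assumes "h \<in> hcomp H n"
  shows "sinv H h = ssv h"
proof (cases "n > 0")
  case True
  then have sub: "x \<in> carrier (desusp H)" if "x \<in> hcomp H n" for x
    using desusp_hcomp_carrier that by blast
  show ?thesis
    unfolding ssv_def using mlinD[OF mlin_sinv]
    by (intro hcomp_eq_lext[OF assms, where Y = "lists E"]) (simp_all add: desusp_simps sub)
next
  case False
  have "ssv h = lext (\<lambda>x. 0) (coord H h)"
    unfolding ssv_def
  proof (rule lext_cong)
    fix x assume "coord H h x \<noteq> 0"
    then have "x \<in> hcomp H n"
      using coord_hcomp[OF assms] hbasis_hcomp by metis
    then show "sinv H x = 0"
      using False by (intro sinv_nonpos) auto
  qed
  then show ?thesis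
    using False sinv_nonpos[OF assms] by simp
qed

lemma ssv_nonpos: "h \<in> hcomp H n \<Longrightarrow> n \<le> 0 \<Longrightarrow> ssv h = 0"
  using sinv_ssv sinv_nonpos by metis

lemma ssv_one [simp]: "ssv \<one> = 0"
  using ssv_nonpos[OF one_hcomp] by simp

lemma ssv_zero [simp]: "ssv \<zero> = 0"
  by (rule mlin_0[OF mlin_ssv])

lemma sinv_hbasis: "x \<in> hbasis H \<Longrightarrow> sinv H x = ssv x"
  using sinv_ssv[OF hbasis_hcomp] .

lemma ssv_E: "x \<in> E \<Longrightarrow> ssv x = delta [x]"
  using sinv_ssv[OF E_hcomp(1)] sinv_E by metis

lemma ssv_desusp: "h \<in> carrier (desusp H) \<Longrightarrow> ssv h = lext (\<lambda>x. delta [x]) (coord (desusp H) h)"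
  using S.mlin_eq_lext[OF mlin_desusp[OF mlin_ssv]] ssv_E fsupp_in[OF S.coord_fsupp]
  by (metis (no_types, lifting) lext_cong)

lemma ssv_hcomp:
  assumes "h \<in> hcomp H n"
  shows "ssv h \<in> hcomp (cobar H) (n - 1)"
proof (cases "n > 0")
  case True
  have "h \<in> hcomp (desusp H) (n - 1)"
    using assms True by (simp add: desusp_simps)
  then have "sinv H h \<in> hcomp (cobar H) (n - 1)"
    unfolding sinv_eq
  proof (intro C.lext_hcomp)
    fix x assume h: "h \<in> hcomp (desusp H) (n - 1)" "coord (desusp H) h x \<noteq> 0"
    have "x \<in> E" "gdeg (desusp H) x = n - 1"
      using S.coord_hcomp[OF h] by auto
    then show "delta [x] \<in> hcomp (cobar H) (n - 1)"
      using C.delta_hcomp[of "[x]"] E_hcomp(3)[of x] by simp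
  qed
  then show ?thesis
    using sinv_ssv[OF assms] by simp
next
  case False
  then show ?thesis
    using ssv_nonpos[OF assms] C.hcomp_zero by (simp add: C.zero_eq)
qed

text \<open>\<open>H\<close> is the sum of the multiples of 1 and of H_+, and \<open>E\<close> is a
  basis of the latter.\<close>

lemma mlin_ssv_desusp_eqI:
  assumes F: "mlin H Y F" and G: "mlin H Y' G"
    and E: "\<And>x. x \<in> E \<Longrightarrow> F x = G x" and one: "F \<one> = G \<one>"
    and h: "h \<in> carrier H"
  shows "F h = G h"
proof (rule mlin_eqI[OF F G h])
  fix x assume x: "x \<in> hbasis H" "x \<in> hcomp H (gdeg H x)"
  show "F x = G x"
  proof (cases "gdeg H x = 0")
    case True
    then show ?thesis
      using x hcomp_0_eq[OF F] hcomp_0_eq[OF G] one by simp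
  next
    case False
    then have "x \<in> carrier (desusp H)"
      using x hbasis_degree[OF x(1)] desusp_hcomp_carrier[of "gdeg H x"] by auto
    then show ?thesis
      by (rule S.mlin_eqI[OF mlin_desusp[OF F] mlin_desusp[OF G]]) (rule E)
  qed
qed

section \<open>The cobar differential\<close>

definition csg :: "('h list \<Rightarrow> 'r) \<Rightarrow> 'h list \<Rightarrow> 'r" where
  "csg z = (\<lambda>ws. ksign (wdeg H ws) * z ws)"

lemma csg_linear: "csg 0 = 0" "csg (z + z') = csg z + csg z'" "csg (r \<cdot> z) = r \<cdot> csg z"
  by (auto simp: csg_def fun_eq_iff fun_apply algebra_simps)

lemma csg_hcomp: "z \<in> hcomp (cobar H) n \<Longrightarrow> csg z = ksign n \<cdot> z"
  by (force simp: csg_def cobar_hcomp fun_eq_iff fun_apply)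

lemma csg_delta: "csg (delta ws) = ksign (wdeg H ws) \<cdot> delta ws"
  by (auto simp: csg_def delta_def fun_eq_iff fun_apply)

lemma csg_W [simp]: "z \<in> W \<Longrightarrow> csg z \<in> W"
  by (rule fsuppI[of "{p. z p \<noteq> 0}"]) (auto simp: csg_def fsupp_def)

text \<open>The linear version of \<open>cobar_gen\<close>, written with the full coproduct: the
  terms c \<otimes> 1 and 1 \<otimes> c that \<open>reduced_comult\<close> removes contribute
  nothing, since \<open>ssv \<one>\<close> is \<open>0\<close>. The full coproduct is preferable
  because it is multiplicative and coassociative.\<close>

definition CG :: "'h \<Rightarrow> 'h list \<Rightarrow> 'r" where
  "CG c = - ssv (dif H c) + lext (\<lambda>(x, y). ksign (gdeg H x) \<cdot> (ssv x \<star> ssv y)) (comult H c)"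

lemma mlin_ssv_dif: "mlin H (lists E) (\<lambda>c. ssv (dif H c))"
  by (rule mlin_comp_graded[OF mlin_ssv dif_graded])

lemma mlin_CG: "mlin H (lists E) CG"
  unfolding CG_def
  by (intro mlin_add mlin_minus mlin_ssv_dif D.mlin_lext_nu) (auto intro!: tmult_fsupp)

lemma CG_W [simp]: "c \<in> carrier H \<Longrightarrow> CG c \<in> W"
  using mlinD(1)[OF mlin_CG] .

lemma mbil_ssv_tmult: "mbil H H (lists E) (\<lambda>x y. r \<cdot> (ssv x \<star> ssv y))"
  by (intro mbilI mlin_scale mlin_tmult_left mlin_tmult_right mlin_ssv) auto

lemma CG_one: "CG \<one> = 0"
  using D.lext_tens_hcomp[OF mbil_ssv_tmult[of 1] one_hcomp one_hcomp, of "\<lambda>(x, y). ksign (gdeg H x) \<cdot> (ssv x \<star> ssv y)"]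
  by (simp add: CG_def dif_one D.nu_one tmult_linear)

lemma cobar_gen_eq:
  assumes "c \<in> hcomp H n"
  shows "cobar_gen H c = CG c"
proof -
  let ?\<beta> = "\<lambda>(x, y). ksign (gdeg H x) \<cdot> (ssv x \<star> ssv y)"
  note c = hcomp_carrier[OF assms]
  have K: "reduced_comult H c \<in> fsupp (hbasis H \<times> hbasis H)"
    unfolding reduced_comult_def using c by (intro fsupp_diff) auto
  have "lext (\<lambda>(x, y). ksign (gdeg H x) \<cdot> (sinv H x \<star> sinv H y)) (reduced_comult H c) = lext ?\<beta> (reduced_comult H c)"
    using K by (intro lext_cong) (auto simp: sinv_hbasis dest!: fsupp_in)
  also have "\<dots> = lext ?\<beta> (comult H c) - lext ?\<beta> (tens H H c \<one>) - lext ?\<beta> (tens H H \<one> c)"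
    unfolding reduced_comult_def using c
    by (simp add: lext_diff[OF fsupp_diff[OF D.nu_fsupp D.tens_fsupp] D.tens_fsupp]
        lext_diff[OF D.nu_fsupp D.tens_fsupp])
  also have "lext ?\<beta> (tens H H c \<one>) = 0"
    using D.lext_tens_hcomp[OF mbil_ssv_tmult[of "ksign n"] assms one_hcomp, of ?\<beta>]
    by (simp add: tmult_linear)
  also have "lext ?\<beta> (tens H H \<one> c) = 0"
    using D.lext_tens_hcomp[OF mbil_ssv_tmult[of "ksign 0"] one_hcomp assms, of ?\<beta>]
    by (simp add: tmult_linear)
  finally show ?thesis
    using sinv_ssv[OF dif_hcomp[OF assms]] by (simp add: cobar_gen_def CG_def)
qed

text \<open>The letter s^-1 c has degree n - 1, and the differential lowers it once more.\<close>

lemma CG_hcomp: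
  assumes "c \<in> hcomp H n"
  shows "CG c \<in> hcomp (cobar H) (n - 2)"
proof -
  have 1: "lext (\<lambda>(x, y). ksign (gdeg H x) \<cdot> (ssv x \<star> ssv y)) (comult H c) \<in> hcomp (cobar H) (n - 2)"
  proof (rule C.lext_hcomp, clarify)
    fix x y assume "comult H c (x, y) \<noteq> 0"
    note s = D.nu_supp[OF assms this]
    have "ssv x \<star> ssv y \<in> hcomp (cobar H) ((gdeg H x - 1) + (gdeg H y - 1))"
      by (intro tmult_hcomp ssv_hcomp s)
    moreover have "(gdeg H x - 1) + (gdeg H y - 1) = n - 2"
      using s(7) by simp
    ultimately show "ksign (gdeg H x) \<cdot> (ssv x \<star> ssv y) \<in> hcomp (cobar H) (n - 2)"
      using C.hcomp_smult by (metis C.smult_eq)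
  qed
  have 2: "- ssv (dif H c) \<in> hcomp (cobar H) (n - 2)"
  proof -
    have "ssv (dif H c) \<in> hcomp (cobar H) (n - 2)"
      using ssv_hcomp[OF dif_hcomp[OF assms]] by simp
    then show ?thesis
      using C.hcomp_smult[of "ssv (dif H c)" "n - 2" "- 1"] by (simp add: C.smult_eq)
  qed
  show ?thesis
    unfolding CG_def using C.hcomp_add[OF 2 1] by (simp only: C.add_eq)
qed

abbreviation d\<Omega> where "d\<Omega> \<equiv> lext (cobar_word H)"

lemma cobar_word_Cons: "a \<in> E \<Longrightarrow> as \<in> lists E \<Longrightarrow>
    cobar_word H (a # as) = CG a \<star> delta as + ksign (gdeg H a - 1) \<cdot> (delta [a] \<star> cobar_word H as)"
  using cobar_gen_eq[OF E_hcomp(1)] by (simp add: sinv_E tword_delta)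

declare cobar_word.simps(2) [simp del]

lemma cobar_word_W [simp]: "ws \<in> lists E \<Longrightarrow> cobar_word H ws \<in> W"
  by (induction ws) (auto simp: cobar_word_Cons E_hcomp intro!: fsupp_add fsupp_scale tmult_fsupp delta_fsupp)

lemma d\<Omega>_W [simp]: "z \<in> W \<Longrightarrow> d\<Omega> z \<in> W"
  by (intro lext_fsupp cobar_word_W) (rule fsupp_in)

lemma d\<Omega>_linear:
  "d\<Omega> 0 = 0" "z \<in> W \<Longrightarrow> z' \<in> W \<Longrightarrow> d\<Omega> (z + z') = d\<Omega> z + d\<Omega> z'" "z \<in> W \<Longrightarrow> d\<Omega> (r \<cdot> z) = r \<cdot> d\<Omega> z"
  "z \<in> W \<Longrightarrow> d\<Omega> (- z) = - d\<Omega> z" "z \<in> W \<Longrightarrow> z' \<in> W \<Longrightarrow> d\<Omega> (z - z') = d\<Omega> z - d\<Omega> z'"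
  by (auto intro: lext_add lext_scale lext_minus lext_diff)

lemma mlin_d\<Omega>: "mlin M (lists E) F \<Longrightarrow> mlin M (lists E) (\<lambda>x. d\<Omega> (F x))"
  by (erule mlin_lext, rule cobar_word_W)

text \<open>The recursion splits off one letter at a time; associativity of concatenation extends
  the rule to any splitting, with the sign given by the degree of the left part.\<close>

lemma cobar_word_append:
  "us \<in> lists E \<Longrightarrow> vs \<in> lists E \<Longrightarrow> cobar_word H (us @ vs) =
    cobar_word H us \<star> delta vs + ksign (wdeg H us) \<cdot> (delta us \<star> cobar_word H vs)"
proof (induction us)
  case Nil
  then show ?case
    by (simp add: tmult_linear tmult_one[OF cobar_word_W])
next
  case (Cons a us)
  then have *: "a \<in> E" "us \<in> lists E"
    by auto
  note W = delta_fsupp[of "[a]" "lists E"] delta_fsupp[OF *(2)] delta_fsupp[OF Cons.prems(2)]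
    cobar_word_W[OF *(2)] cobar_word_W[OF Cons.prems(2)] CG_W[OF E_hcomp(4)[OF *(1)]]
  have "cobar_word H ((a # us) @ vs) = CG a \<star> (delta us \<star> delta vs) + ksign (gdeg H a - 1) \<cdot>
      (delta [a] \<star> (cobar_word H us \<star> delta vs + ksign (wdeg H us) \<cdot> (delta us \<star> cobar_word H vs)))"
    using Cons * by (simp add: cobar_word_Cons delta_tmult)
  also have "\<dots> = cobar_word H (a # us) \<star> delta vs + ksign (wdeg H (a # us)) \<cdot> (delta (a # us) \<star> cobar_word H vs)"
  proof -
    have "delta (a # us) = (delta [a] \<star> delta us :: 'h list \<Rightarrow> 'r)"
      by (simp add: delta_tmult)
    moreover have "delta [a] \<star> delta us \<star> cobar_word H vs = delta [a] \<star> (delta us \<star> cobar_word H vs)"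
      "delta [a] \<star> cobar_word H us \<star> delta vs = delta [a] \<star> (cobar_word H us \<star> delta vs)"
      "CG a \<star> delta us \<star> delta vs = CG a \<star> (delta us \<star> delta vs)"
      using * by (intro tmult_assoc[where X = "lists E"] W; simp)+
    ultimately show ?thesis
      using * by (simp add: cobar_word_Cons tmult_linear fscale_add ksign_add)
  qed
  finally show ?case .
qed

lemma d\<Omega>_tmult:
  assumes "z \<in> W" "z' \<in> W"
  shows "d\<Omega> (z \<star> z') = d\<Omega> z \<star> z' + csg z \<star> d\<Omega> z'"
  using assms(1)
proof (induction rule: fsupp_induct)
  case (base us)
  show ?case
    using assms(2)
  proof (induction rule: fsupp_induct)
    case (base vs)
    then show ?case
      using \<open>us \<in> lists E\<close> by (simp add: delta_tmult cobar_word_append csg_delta tmult_linear)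
  qed (simp_all add: tmult_linear d\<Omega>_linear tmult_fsupp base algebra_simps fscale_add)
qed (use assms(2) in \<open>simp_all add: tmult_linear d\<Omega>_linear csg_linear tmult_fsupp algebra_simps fscale_add\<close>)

lemma d\<Omega>_ssv: "h \<in> carrier H \<Longrightarrow> d\<Omega> (ssv h) = CG h"
proof (rule mlin_ssv_desusp_eqI[OF mlin_d\<Omega>[OF mlin_ssv] mlin_CG])
  show "d\<Omega> (ssv x) = CG x" if "x \<in> E" for x
    using that by (simp add: ssv_E cobar_word_Cons tmult_linear tmult_one[OF CG_W[OF E_hcomp(4)]])
qed (simp_all add: CG_one)

lemma d\<Omega>_hcomp: "z \<in> hcomp (cobar H) n \<Longrightarrow> d\<Omega> z \<in> hcomp (cobar H) (n - 1)"
proof (rule C.lext_hcomp)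
  fix ws assume z: "z \<in> hcomp (cobar H) n" "z ws \<noteq> 0"
  then have "ws \<in> lists E" "wdeg H ws = n"
    by (auto simp: cobar_hcomp dest: fsupp_in)
  then show "cobar_word H ws \<in> hcomp (cobar H) (n - 1)"
  proof (induction ws arbitrary: n)
    case Nil
    then show ?case
      using C.hcomp_zero by (simp add: C.zero_eq)
  next
    case (Cons a as)
    then have *: "a \<in> E" "as \<in> lists E" "wdeg H as = n - gdeg H a + 1"
      by auto
    have "CG a \<star> delta as \<in> hcomp (cobar H) ((gdeg H a - 2) + wdeg H as)"
      using * by (intro tmult_hcomp CG_hcomp E_hcomp C.delta_hcomp) auto
    moreover have "delta [a] \<star> cobar_word H as \<in> hcomp (cobar H) ((gdeg H a - 1) + (wdeg H as - 1))"
      using * Cons.IH C.delta_hcomp[of "[a]"] by (intro tmult_hcomp) auto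
    ultimately show ?case
      using * C.hcomp_add C.hcomp_smult unfolding C.add_eq C.smult_eq
      by (simp add: cobar_word_Cons algebra_simps)
  qed
qed

lemma ksign_diff_one: "ksign (n - 1) = (- ksign n :: 'r)" "ksign (n - 2) = (ksign n :: 'r)"
  by (auto simp: ksign_def)

text \<open>The square of the cobar differential vanishes on generators. The terms with two letters
  cancel because the comultiplication is a chain map, and the terms with three letters cancel by
  coassociativity.\<close>

lemma d\<Omega>_CG:
  assumes c: "c \<in> hcomp H n"
  shows "d\<Omega> (CG c) = 0"
proof -
  note cc = hcomp_carrier[OF c]
  let ?\<beta> = "\<lambda>(x, y). ksign (gdeg H x) \<cdot> (ssv x \<star> ssv y)"
  let ?S = "\<lambda>\<beta>. lext (\<lambda>(x, y). \<beta> x y) (comult H c)"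
  have basis: "x \<in> hbasis H" "y \<in> hbasis H" "x \<in> carrier H" "y \<in> carrier H" "x \<in> hcomp H (gdeg H x)"
    "y \<in> hcomp H (gdeg H y)"
    if "comult H c (x, y) \<noteq> 0" for x y
    using D.nu_supp[OF c that] by auto
  have 1: "lext ?\<beta> (comult H (dif H c)) =
    ?S (\<lambda>x y. - (ksign (gdeg H x) \<cdot> (ssv (dif H x) \<star> ssv y)) + ssv x \<star> ssv (dif H y))"
    unfolding D.nu_dif[OF cc]
  proof (intro lext_cong, clarify)
    fix x y assume "comult H c (x, y) \<noteq> 0"
    note b = basis[OF this]
    have "lext ?\<beta> (tens H H (dif H x) y) = ksign (gdeg H x - 1) \<cdot> (ssv (dif H x) \<star> ssv y)"
      by (rule D.lext_tens_hcomp[OF mbil_ssv_tmult dif_hcomp[OF b(5)] b(6)]) simp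
    moreover have "lext ?\<beta> (tens H H x (dif H y)) = ksign (gdeg H x) \<cdot> (ssv x \<star> ssv (dif H y))"
      by (rule D.lext_tens_hcomp[OF mbil_ssv_tmult b(5) dif_hcomp[OF b(6)]]) simp
    ultimately show "lext ?\<beta> (tens H H (dif H x) y) + ksign (gdeg H x) \<cdot> lext ?\<beta> (tens H H x (dif H y)) =
      - (ksign (gdeg H x) \<cdot> (ssv (dif H x) \<star> ssv y)) + ssv x \<star> ssv (dif H y)"
      by (simp add: ksign_diff_one)
  qed
  \<comment> \<open>Because |x| = |x1| + |x2|, the remaining sign is that of the middle factor x2.
    In \<open>cub'\<close> it is that of y1, again the middle factor, so coassociativity matches the
    two sums with their signs.\<close>
  have cub: "ksign (gdeg H x) \<cdot> (lext ?\<beta> (comult H x) \<star> ssv y) =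
      lext (\<lambda>(x1, x2). ksign (gdeg H x2) \<cdot> (ssv x1 \<star> ssv x2 \<star> ssv y)) (comult H x)"
    if "comult H c (x, y) \<noteq> 0" for x y
    unfolding tmult_lext_left lext_fun_scale[symmetric]
  proof (intro lext_cong, clarify)
    fix x1 x2 assume "comult H x (x1, x2) \<noteq> 0"
    then have "gdeg H x = gdeg H x1 + gdeg H x2"
      using D.nu_supp[OF basis(5)[OF that]] by blast
    then have "(ksign (gdeg H x) * ksign (gdeg H x1) :: 'r) = ksign (gdeg H x2)"
      by (simp add: ksign_add mult_ac)
    then show "ksign (gdeg H x) \<cdot> ((ksign (gdeg H x1) \<cdot> (ssv x1 \<star> ssv x2)) \<star> ssv y) =
      ksign (gdeg H x2) \<cdot> (ssv x1 \<star> ssv x2 \<star> ssv y)"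
      by (simp add: tmult_linear)
  qed
  have cub': "ssv x \<star> lext ?\<beta> (comult H y) =
      lext (\<lambda>(y1, y2). ksign (gdeg H y1) \<cdot> (ssv x \<star> ssv y1 \<star> ssv y2)) (comult H y)" for x y
    unfolding tmult_lext_right
    by (intro lext_cong) (auto simp: tmult_linear tmult_assoc[where X = "lists E"])
  have 2: "d\<Omega> (?\<beta> (x, y)) = - (ksign (gdeg H x) \<cdot> (ssv (dif H x) \<star> ssv y)) + ssv x \<star> ssv (dif H y) +
      (lext (\<lambda>(x1, x2). ksign (gdeg H x2) \<cdot> (ssv x1 \<star> ssv x2 \<star> ssv y)) (comult H x) -
       lext (\<lambda>(y1, y2). ksign (gdeg H y1) \<cdot> (ssv x \<star> ssv y1 \<star> ssv y2)) (comult H y))"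
    if "comult H c (x, y) \<noteq> 0" for x y
  proof -
    note b = basis[OF that]
    have "d\<Omega> (?\<beta> (x, y)) = ksign (gdeg H x) \<cdot> (CG x \<star> ssv y + ksign (gdeg H x - 1) \<cdot> (ssv x \<star> CG y))"
      using b by (simp add: d\<Omega>_linear tmult_fsupp d\<Omega>_tmult d\<Omega>_ssv csg_hcomp[OF ssv_hcomp[OF b(5)]] tmult_linear)
    also have "\<dots> = ksign (gdeg H x) \<cdot> (CG x \<star> ssv y) - ssv x \<star> CG y"
      by (simp add: ksign_diff_one fscale_diff)
    also have "\<dots> = - (ksign (gdeg H x) \<cdot> (ssv (dif H x) \<star> ssv y)) + ssv x \<star> ssv (dif H y) +
       (ksign (gdeg H x) \<cdot> (lext ?\<beta> (comult H x) \<star> ssv y) - ssv x \<star> lext ?\<beta> (comult H y))"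
      unfolding CG_def by (simp add: tmult_linear fscale_add fscale_diff algebra_simps)
    finally show ?thesis
      unfolding cub[OF that] cub' .
  qed
  have L: "lext ?\<beta> (comult H c) \<in> W"
    by (intro lext_fsupp) (auto intro!: tmult_fsupp)
  have "d\<Omega> (lext ?\<beta> (comult H c)) = lext (\<lambda>p. d\<Omega> (?\<beta> p)) (comult H c)"
    using D.nu_fsupp[OF cc] by (rule lext_lext[where Y = "lists E"]) (auto intro!: tmult_fsupp)
  then have "d\<Omega> (CG c) = - CG (dif H c) + lext (\<lambda>p. d\<Omega> (?\<beta> p)) (comult H c)"
    using cc L unfolding CG_def[of c] by (simp add: d\<Omega>_linear d\<Omega>_ssv)
  also have "CG (dif H c) = lext ?\<beta> (comult H (dif H c))"
    using cc by (simp add: CG_def)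
  also have "lext (\<lambda>p. d\<Omega> (?\<beta> p)) (comult H c) =
    ?S (\<lambda>x y. - (ksign (gdeg H x) \<cdot> (ssv (dif H x) \<star> ssv y)) + ssv x \<star> ssv (dif H y)) +
    (?S (\<lambda>x y. lext (\<lambda>(x1, x2). ksign (gdeg H x2) \<cdot> (ssv x1 \<star> ssv x2 \<star> ssv y)) (comult H x)) -
     ?S (\<lambda>x y. lext (\<lambda>(y1, y2). ksign (gdeg H y1) \<cdot> (ssv x \<star> ssv y1 \<star> ssv y2)) (comult H y)))"
    (is "?l = ?r")
  proof -
    have "?l = ?S (\<lambda>x y. (- (ksign (gdeg H x) \<cdot> (ssv (dif H x) \<star> ssv y)) + ssv x \<star> ssv (dif H y)) +
      (lext (\<lambda>(x1, x2). ksign (gdeg H x2) \<cdot> (ssv x1 \<star> ssv x2 \<star> ssv y)) (comult H x) +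
       - lext (\<lambda>(y1, y2). ksign (gdeg H y1) \<cdot> (ssv x \<star> ssv y1 \<star> ssv y2)) (comult H y)))"
    proof (intro lext_cong, clarify)
      fix x y assume "comult H c (x, y) \<noteq> 0"
      from 2[OF this] show "d\<Omega> (ksign (gdeg H x) \<cdot> (ssv x \<star> ssv y)) =
          (- (ksign (gdeg H x) \<cdot> (ssv (dif H x) \<star> ssv y)) + ssv x \<star> ssv (dif H y)) +
      (lext (\<lambda>(x1, x2). ksign (gdeg H x2) \<cdot> (ssv x1 \<star> ssv x2 \<star> ssv y)) (comult H x) +
       - lext (\<lambda>(y1, y2). ksign (gdeg H y1) \<cdot> (ssv x \<star> ssv y1 \<star> ssv y2)) (comult H y))"
        by simp
    qed
    also have "\<dots> = ?r"
      unfolding split_def lext_fun_add lext_fun_minus by simp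
    finally show ?thesis .
  qed
  also have "?S (\<lambda>x y. lext (\<lambda>(x1, x2). ksign (gdeg H x2) \<cdot> (ssv x1 \<star> ssv x2 \<star> ssv y)) (comult H x)) =
     ?S (\<lambda>x y. lext (\<lambda>(y1, y2). ksign (gdeg H y1) \<cdot> (ssv x \<star> ssv y1 \<star> ssv y2)) (comult H y))"
    by (rule comult_coassoc[where Y = "lists E", OF _ cc]) (auto intro!: tmult_fsupp)
  finally show ?thesis
    by (simp add: 1)
qed

text \<open>For a word starting with the letter a, the mixed terms carry the signs of |a| - 2, the
  degree of \<open>CG a\<close>, and of |a| - 1, the degree of the letter; these are
  opposite.\<close>

lemma d\<Omega>_d\<Omega>: "z \<in> W \<Longrightarrow> d\<Omega> (d\<Omega> z) = 0"
proof (induction rule: fsupp_induct)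
  case (base ws)
  then have "d\<Omega> (cobar_word H ws) = 0"
  proof (induction ws)
    case (Cons a as)
    then have *: "a \<in> E" "as \<in> lists E" and IH: "d\<Omega> (cobar_word H as) = 0"
      by auto
    note a = E_hcomp[OF *(1)]
    have "d\<Omega> (cobar_word H (a # as)) =
      d\<Omega> (CG a) \<star> delta as + csg (CG a) \<star> cobar_word H as +
      ksign (gdeg H a - 1) \<cdot> (CG a \<star> cobar_word H as + csg (delta [a]) \<star> d\<Omega> (cobar_word H as))"
      using * a d\<Omega>_ssv[OF a(4)]
      by (simp add: cobar_word_Cons d\<Omega>_linear d\<Omega>_tmult tmult_fsupp ssv_E)
    then show ?case
      using csg_hcomp[OF CG_hcomp[OF a(1)]] d\<Omega>_CG[OF a(1)] IH
      by (simp add: tmult_linear ksign_diff_one)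
  qed simp
  then show ?case
    by simp
qed (simp_all add: d\<Omega>_linear)

end

section \<open>Functoriality of the cobar construction\<close>

locale hopf_map = X: hopf H + Y: hopf H'
  for H :: "('r::comm_ring_1, 'h) chopf" and H' :: "('r, 'k) chopf" +
  fixes f :: "'h \<Rightarrow> 'k"
  assumes hopf_hom: "chain_hopf_algebra_hom H H' f"
begin

sublocale f: chain_alg_hom H H' f
  using hopf_hom by unfold_locales (simp add: chain_hopf_algebra_hom_def)

abbreviation \<phi> where "\<phi> \<equiv> cobar_map H' f"

lemma comult_hom: "c \<in> carrier H \<Longrightarrow> comult H' (f c) = lext (\<lambda>(x, y). tens H' H' (f x) (f y)) (comult H c)"
  using hopf_hom by (simp add: chain_hopf_algebra_hom_def tensor_map_def)

lemma mlin_f: "mlin H' Y F \<Longrightarrow> mlin H Y (\<lambda>x. F (f x))"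
  by (intro mlinI) (simp_all add: f.hom_closed f.hom_add f.hom_smult mlinD)

lemma phi_Nil: "\<phi> (delta []) = delta []"
  by (simp add: cobar_map_def tword_delta)

lemma phi_Cons: "a \<in> X.E \<Longrightarrow> \<phi> (delta (a # as)) = Y.ssv (f a) \<star> \<phi> (delta as)"
  using Y.sinv_ssv[OF f.hom_hcomp[OF X.E_hcomp(1)]] by (simp add: cobar_map_def)

lemma phi_word_W [simp]: "ws \<in> lists X.E \<Longrightarrow> \<phi> (delta ws) \<in> Y.W"
  by (induction ws) (simp_all add: phi_Nil phi_Cons tmult_fsupp)

lemma phi_lext: "\<phi> z = lext (\<lambda>ws. \<phi> (delta ws)) z"
  by (simp add: cobar_map_def)

lemma phi_linear:
  "\<phi> 0 = 0" "z \<in> X.W \<Longrightarrow> z' \<in> X.W \<Longrightarrow> \<phi> (z + z') = \<phi> z + \<phi> z'" "z \<in> X.W \<Longrightarrow> \<phi> (r \<cdot> z) = r \<cdot> \<phi> z"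
  "z \<in> X.W \<Longrightarrow> \<phi> (- z) = - \<phi> z" "z \<in> X.W \<Longrightarrow> z' \<in> X.W \<Longrightarrow> \<phi> (z - z') = \<phi> z - \<phi> z'"
  unfolding cobar_map_def by (auto intro: lext_add lext_scale lext_minus lext_diff)

lemma phi_W [simp]: "z \<in> X.W \<Longrightarrow> \<phi> z \<in> Y.W"
  by (subst phi_lext, intro lext_fsupp phi_word_W) (rule fsupp_in)

lemma mlin_phi: "mlin M (lists X.E) F \<Longrightarrow> mlin M (lists Y.E) (\<lambda>x. \<phi> (F x))"
  unfolding mlin_def by (auto simp: phi_linear)

lemma phi_append: "us \<in> lists X.E \<Longrightarrow> vs \<in> lists X.E \<Longrightarrow>
    \<phi> (delta (us @ vs)) = \<phi> (delta us) \<star> \<phi> (delta vs)"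
proof (induction us)
  case (Cons a us)
  have "Y.ssv (f a) \<star> \<phi> (delta us) \<star> \<phi> (delta vs) = Y.ssv (f a) \<star> (\<phi> (delta us) \<star> \<phi> (delta vs))"
    using Cons by (intro tmult_assoc[where X = "lists Y.E"] phi_word_W) auto
  then show ?case
    using Cons by (simp add: phi_Cons)
qed (simp add: phi_Nil tmult_one[OF phi_word_W])

lemma phi_tmult:
  assumes "z \<in> X.W" "z' \<in> X.W"
  shows "\<phi> (z \<star> z') = \<phi> z \<star> \<phi> z'"
  using assms(1)
proof (induction rule: fsupp_induct)
  case (base us)
  show ?case
    using assms(2)
  proof (induction rule: fsupp_induct)
    case (base vs)
    then show ?case
      using \<open>us \<in> lists X.E\<close> by (simp add: delta_tmult phi_append)
  qed (simp_all add: tmult_linear phi_linear tmult_fsupp base)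
qed (use assms(2) in \<open>simp_all add: tmult_linear phi_linear tmult_fsupp\<close>)

lemma phi_ssv: "h \<in> carrier H \<Longrightarrow> \<phi> (X.ssv h) = Y.ssv (f h)"
proof (rule X.mlin_ssv_desusp_eqI[OF mlin_phi[OF X.mlin_ssv] mlin_f[OF Y.mlin_ssv]])
  show "\<phi> (X.ssv x) = Y.ssv (f x)" if "x \<in> X.E" for x
    using that by (simp add: X.ssv_E phi_Cons phi_Nil tmult_one[OF Y.ssv_W])
qed (simp_all add: f.hom_one phi_linear)

lemma phi_hcomp: "z \<in> hcomp (cobar H) n \<Longrightarrow> \<phi> z \<in> hcomp (cobar H') n"
proof (subst phi_lext, rule Y.C.lext_hcomp)
  fix ws assume z: "z \<in> hcomp (cobar H) n" "z ws \<noteq> 0"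
  then have "ws \<in> lists X.E" "wdeg H ws = n"
    by (auto simp: cobar_hcomp dest: fsupp_in)
  then show "\<phi> (delta ws) \<in> hcomp (cobar H') n"
  proof (induction ws arbitrary: n)
    case Nil
    then show ?case
      using Y.C.delta_hcomp[of "[]"] by (simp add: phi_Nil)
  next
    case (Cons a ws)
    then have "Y.ssv (f a) \<star> \<phi> (delta ws) \<in> hcomp (cobar H') ((gdeg H a - 1) + wdeg H ws)"
      by (intro Y.tmult_hcomp Y.ssv_hcomp f.hom_hcomp X.E_hcomp) auto
    then show ?case
      using Cons by (simp add: phi_Cons)
  qed
qed

lemma phi_gralg_hom: "gralg_hom (cobar H) (cobar H') \<phi>"
  by (auto simp: gralg_hom_def graded_linear_def ring_hom_def cobar_simps phi_linear phi_tmult phi_Nil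
      phi_hcomp)

text \<open>As \<open>f\<close> preserves degrees, the signs in both expressions agree, and the
  claim follows from compatibility of \<open>f\<close> with differentials and coproducts.\<close>

lemma phi_CG:
  assumes c: "c \<in> hcomp H n"
  shows "\<phi> (X.CG c) = Y.CG (f c)"
proof -
  note cc = X.hcomp_carrier[OF c]
  let ?\<beta> = "\<lambda>(x, y). ksign (gdeg H x) \<cdot> (X.ssv x \<star> X.ssv y)"
  let ?\<beta>' = "\<lambda>(x, y). ksign (gdeg H' x) \<cdot> (Y.ssv x \<star> Y.ssv y)"
  have L: "lext ?\<beta> (comult H c) \<in> X.W"
    by (intro lext_fsupp) (auto intro!: tmult_fsupp)
  have "\<phi> (lext ?\<beta> (comult H c)) = lext (\<lambda>p. \<phi> (?\<beta> p)) (comult H c)"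
    using X.D.nu_fsupp[OF cc] unfolding cobar_map_def
    by (rule lext_lext[where Y = "lists X.E"]) (auto intro!: tmult_fsupp)
  also have "\<dots> = lext (\<lambda>p. lext ?\<beta>' (case p of (x, y) \<Rightarrow> tens H' H' (f x) (f y))) (comult H c)"
  proof (intro lext_cong, clarify)
    fix x y assume "comult H c (x, y) \<noteq> 0"
    note b = X.D.nu_supp[OF c this]
    have "lext ?\<beta>' (tens H' H' (f x) (f y)) = ksign (gdeg H x) \<cdot> (Y.ssv (f x) \<star> Y.ssv (f y))"
      by (rule Y.D.lext_tens_hcomp[OF Y.mbil_ssv_tmult f.hom_hcomp[OF b(3)] f.hom_hcomp[OF b(4)]]) simp
    then show "\<phi> (ksign (gdeg H x) \<cdot> (X.ssv x \<star> X.ssv y)) = lext ?\<beta>' (tens H' H' (f x) (f y))"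
      using b by (simp add: phi_linear tmult_fsupp phi_tmult phi_ssv)
  qed
  also have "\<dots> = lext ?\<beta>' (comult H' (f c))"
    unfolding comult_hom[OF cc] using X.D.nu_fsupp[OF cc]
    by (rule lext_lext[symmetric, where Y = "hbasis H' \<times> hbasis H'"]) auto
  finally show ?thesis
    using cc L unfolding X.CG_def Y.CG_def by (simp add: phi_linear phi_ssv f.hom_dif)
qed

lemma phi_dif: "z \<in> X.W \<Longrightarrow> \<phi> (X.d\<Omega> z) = Y.d\<Omega> (\<phi> z)"
proof (induction rule: fsupp_induct)
  case (base ws)
  then have "\<phi> (cobar_word H ws) = Y.d\<Omega> (\<phi> (delta ws))"
  proof (induction ws)
    case Nil
    then show ?case
      by (simp add: phi_Nil phi_linear)
  next
    case (Cons a as)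
    then have *: "a \<in> X.E" "as \<in> lists X.E"
      by auto
    note a = X.E_hcomp[OF *(1)]
    have "\<phi> (delta [a]) = Y.ssv (f a)"
      using * by (simp add: phi_Cons phi_Nil tmult_one[OF Y.ssv_W])
    then show ?case
      using * a Cons.IH Y.csg_hcomp[OF Y.ssv_hcomp[OF f.hom_hcomp[OF a(1)]]]
      by (simp add: X.cobar_word_Cons phi_linear tmult_fsupp phi_tmult phi_CG[OF a(1)] phi_Cons
          Y.d\<Omega>_tmult Y.d\<Omega>_ssv f.hom_closed tmult_linear)
  qed
  then show ?case
    by simp
qed (simp_all add: X.d\<Omega>_linear Y.d\<Omega>_linear phi_linear)

end

lemma (in hopf) cobar_map_id:
  assumes "\<And>x. x \<in> carrier H \<Longrightarrow> f x = x" "z \<in> W"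
  shows "cobar_map H f z = z"
proof -
  have *: "foldr (\<lambda>a u. sinv H (f a) \<star> u) ws (tword []) = delta ws" if "ws \<in> lists E" for ws
    using that by (induction ws) (auto simp: tword_delta assms(1) E_hcomp sinv_E delta_tmult)
  then have "cobar_map H f z = lext delta z"
    unfolding cobar_map_def by (intro lext_cong * fsupp_in[OF assms(2)])
  then show ?thesis
    using lext_delta_id[OF assms(2)] by simp
qed

lemma cobar_map_comp:
  assumes "hopf_map H H' f" "hopf_map H' H'' f'" "hopf_map H H'' g"
    and g: "\<And>x. x \<in> carrier H \<Longrightarrow> g x = f' (f x)" and "z \<in> carrier (cobar H)"
  shows "cobar_map H'' g z = cobar_map H'' f' (cobar_map H' f z)"
proof -
  interpret f: hopf_map H H' f
    by fact
  interpret f': hopf_map H' H'' f'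
    by fact
  interpret h: hopf_map H H'' g
    by fact
  have "z \<in> f.X.W"
    using assms(5) by (simp add: cobar_simps)
  then show ?thesis
  proof (induction rule: fsupp_induct)
    case (base ws)
    then show ?case
    proof (induction ws)
      case (Cons a ws)
      then show ?case
        using f.f.hom_closed[of a] f.X.E_hcomp(4)[of a]
        by (simp add: h.phi_Cons f.phi_Cons f'.phi_tmult f'.phi_ssv g)
    qed (simp add: h.phi_Nil f.phi_Nil f'.phi_Nil)
  qed (simp_all add: h.phi_linear f.phi_linear f'.phi_linear)
qed

section \<open>Distributive laws on words\<close>

context alg_tensor
begin

text \<open>Formulated, like \<open>ract\<close>, for arbitrary maps \<open>S\<close>, so that the
  exchange with a word can be composed from exchanges with single letters before it is known to be a
  distributive law. In this notation the law for products in U reads \<tau> v (u u') =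
  \<open>lact (\<lambda>d. \<tau> d u') (\<tau> v u)\<close>.\<close>

definition lact :: "('v \<Rightarrow> 'u \<times> 'v \<Rightarrow> 'r) \<Rightarrow> ('u \<times> 'v \<Rightarrow> 'r) \<Rightarrow> 'u \<times> 'v \<Rightarrow> 'r" where
  "lact S = lext (\<lambda>(c, d). lmul U V c (S d))"

definition ract :: "('u \<Rightarrow> 'u \<times> 'v \<Rightarrow> 'r) \<Rightarrow> ('u \<times> 'v \<Rightarrow> 'r) \<Rightarrow> 'u \<times> 'v \<Rightarrow> 'r" where
  "ract S = lext (\<lambda>(c, d). rmul U V (S c) d)"

lemma act_K [simp]: "lact S z \<in> K" "ract S' z \<in> K"
  unfolding lact_def ract_def by (auto intro!: lext_fsupp split: prod.split)

lemma lact_linear: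
  "lact S 0 = 0"
  "z \<in> K \<Longrightarrow> z' \<in> K \<Longrightarrow> lact S (z + z') = lact S z + lact S z'"
  "z \<in> K \<Longrightarrow> lact S (r \<cdot> z) = r \<cdot> lact S z"
  unfolding lact_def by (auto intro: lext_add lext_scale)

lemma ract_linear:
  "ract S 0 = 0"
  "z \<in> K \<Longrightarrow> z' \<in> K \<Longrightarrow> ract S (z + z') = ract S z + ract S z'"
  "z \<in> K \<Longrightarrow> ract S (r \<cdot> z) = r \<cdot> ract S z"
  unfolding ract_def by (auto intro: lext_add lext_scale)

lemma lact_tens:
  assumes "mlin V (hbasis U \<times> hbasis V) S" "c \<in> carrier U" "d \<in> carrier V"
  shows "lact S (c \<boxtimes> d) = lmul U V c (S d)"
  unfolding lact_def using assms
  by (intro lext_tens[where Y = "hbasis U \<times> hbasis V"] mbilI mlin_lmul mlin_lmul1) (auto dest: mlinD(1))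

lemma ract_tens:
  assumes "mlin U (hbasis U \<times> hbasis V) S" "c \<in> carrier U" "d \<in> carrier V"
  shows "ract S (c \<boxtimes> d) = rmul U V (S c) d"
  unfolding ract_def using assms
  by (intro lext_tens[where Y = "hbasis U \<times> hbasis V"] mbilI mlin_rmul mlin_rmul2) (auto dest: mlinD(1))

lemma lact_lext:
  "z \<in> fsupp X \<Longrightarrow> (\<And>p. p \<in> X \<Longrightarrow> \<beta> p \<in> K) \<Longrightarrow> lact S (lext \<beta> z) = lext (\<lambda>p. lact S (\<beta> p)) z"
  unfolding lact_def by (rule lext_lext)

lemma ract_lext:
  "z \<in> fsupp X \<Longrightarrow> (\<And>p. p \<in> X \<Longrightarrow> \<beta> p \<in> K) \<Longrightarrow> ract S (lext \<beta> z) = lext (\<lambda>p. ract S (\<beta> p)) z"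
  unfolding ract_def by (rule lext_lext)

lemma mlin_lact: "mlin M (hbasis U \<times> hbasis V) F \<Longrightarrow> mlin M (hbasis U \<times> hbasis V) (\<lambda>x. lact S (F x))"
  unfolding mlin_def by (auto simp: lact_linear)

lemma mlin_ract: "mlin M (hbasis U \<times> hbasis V) F \<Longrightarrow> mlin M (hbasis U \<times> hbasis V) (\<lambda>x. ract S (F x))"
  unfolding mlin_def by (auto simp: ract_linear)

lemma lact_lmul:
  assumes S: "mlin V (hbasis U \<times> hbasis V) S" and "u \<in> carrier U" "z \<in> K"
  shows "lact S (lmul U V u z) = lmul U V u (lact S z)"
  using assms(3)
proof (induction rule: fsupp_tens_induct)
  case (base c d)
  then show ?case
    using assms(2) mlinD(1)[OF S] by (simp add: lmul_tens lact_tens[OF S] lmul_lmul)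
qed (simp_all add: lact_linear lmul_linear)

lemma ract_rmul:
  assumes S: "mlin U (hbasis U \<times> hbasis V) S" and "v \<in> carrier V" "z \<in> K"
  shows "ract S (rmul U V z v) = rmul U V (ract S z) v"
  using assms(3)
proof (induction rule: fsupp_tens_induct)
  case (base c d)
  then show ?case
    using assms(2) mlinD(1)[OF S] by (simp add: rmul_tens ract_tens[OF S] rmul_rmul)
qed (simp_all add: ract_linear rmul_linear)

lemma lact_lact:
  assumes S: "mlin V (hbasis U \<times> hbasis V) S" and S': "mlin V (hbasis U \<times> hbasis V) S'" and "z \<in> K"
  shows "lact S (lact S' z) = lact (\<lambda>d. lact S (S' d)) z"
  using assms(3)
proof (induction rule: fsupp_tens_induct)
  case (base c d)
  then show ?case
    using mlinD(1)[OF S'] by (simp add: lact_tens[OF S'] lact_tens[OF mlin_lact[OF S']] lact_lmul[OF S])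
qed (simp_all add: lact_linear)

lemma ract_ract:
  assumes S: "mlin U (hbasis U \<times> hbasis V) S" and S': "mlin U (hbasis U \<times> hbasis V) S'" and "z \<in> K"
  shows "ract S (ract S' z) = ract (\<lambda>d. ract S (S' d)) z"
  using assms(3)
proof (induction rule: fsupp_tens_induct)
  case (base c d)
  then show ?case
    using mlinD(1)[OF S'] by (simp add: ract_tens[OF S'] ract_tens[OF mlin_ract[OF S']] ract_rmul[OF S])
qed (simp_all add: ract_linear)

text \<open>The two sides of \<open>(v d)(c u) = v (d (c u))\<close>, for \<open>S\<close> the right multiplication by \<open>u\<close>.\<close>

lemma lact_ract:
  assumes \<tau>: "mbil V U (hbasis U \<times> hbasis V) \<tau>"
    and S: "mlin V (hbasis U \<times> hbasis V) S"
    and mult: "\<And>f. f \<in> carrier V \<Longrightarrow> S (f \<otimes>\<^bsub>V\<^esub> d) = ract (\<tau> f) (S d)"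
    and right: "\<And>u u'. u \<in> carrier U \<Longrightarrow> u' \<in> carrier U \<Longrightarrow>
      \<tau> v (u \<otimes>\<^bsub>U\<^esub> u') = lact (\<lambda>d. \<tau> d u') (\<tau> v u)"
    and v: "v \<in> carrier V" and c: "c \<in> carrier U" and d: "d \<in> carrier V"
  shows "lact S (rmul U V (\<tau> v c) d) = ract (\<tau> v) (lmul U V c (S d))"
proof -
  note tau = mbil_fsupp[OF \<tau>]
  \<comment> \<open>Both sides are brought to the sum of e \<cdot> \<tau> f g \<cdot> k over the
    terms e \<otimes> f of \<tau> v c and g \<otimes> k of S d.\<close>
  have "lact S (rmul U V z d) = lext (\<lambda>(e, f). ract (\<lambda>g. lmul U V e (\<tau> f g)) (S d)) z" if "z \<in> K" for z
  proof -
    have "lact S (rmul U V z d) = lext (\<lambda>p. lact S (case p of (e, f) \<Rightarrow> e \<boxtimes> (f \<otimes>\<^bsub>V\<^esub> d))) z"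
      unfolding rmul_def using that by (intro lact_lext[of _ "hbasis U \<times> hbasis V"]) auto
    also have "\<dots> = lext (\<lambda>(e, f). ract (\<lambda>g. lmul U V e (\<tau> f g)) (S d)) z"
    proof (intro lext_cong, clarify)
      fix e f assume "z (e, f) \<noteq> 0"
      then have ef: "e \<in> carrier U" "f \<in> carrier V"
        using K_hbasis[OF that] by auto
      have "lmul U V e (ract (\<tau> f) x) = ract (\<lambda>g. lmul U V e (\<tau> f g)) x" if "x \<in> K" for x
        using that
      proof (induction rule: fsupp_tens_induct)
        case (base g k)
        then show ?case
          using ef tau
          by (simp add: ract_tens[OF mbilD(2)[OF \<tau>]] ract_tens[OF mlin_lmul[OF mbilD(2)[OF \<tau>]]] lmul_rmul)
      qed (simp_all add: ract_linear lmul_linear)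
      then show "lact S (e \<boxtimes> (f \<otimes>\<^bsub>V\<^esub> d)) = ract (\<lambda>g. lmul U V e (\<tau> f g)) (S d)"
        using ef d by (simp add: lact_tens[OF S] mult mlinD(1)[OF S])
    qed
    finally show ?thesis .
  qed
  then have "lact S (rmul U V (\<tau> v c) d) = lext (\<lambda>(e, f). ract (\<lambda>g. lmul U V e (\<tau> f g)) (S d)) (\<tau> v c)"
    using tau[OF v c] by blast
  also have "\<dots> = lext (\<lambda>(g, k). lext (\<lambda>(e, f). rmul U V (lmul U V e (\<tau> f g)) k) (\<tau> v c)) (S d)"
    unfolding ract_def split_def by (rule lext_swap)
  also have "\<dots> = lext (\<lambda>(g, k). rmul U V (\<tau> v (c \<otimes>\<^bsub>U\<^esub> g)) k) (S d)"
  proof (intro lext_cong, clarify)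
    fix g k assume "S d (g, k) \<noteq> 0"
    then have gk: "g \<in> carrier U" "k \<in> carrier V"
      using K_hbasis[OF mlinD(1)[OF S d]] by auto
    have "rmul U V (lact (\<lambda>d. \<tau> d g) (\<tau> v c)) k = lext (\<lambda>p. rmul U V (case p of (e, f) \<Rightarrow> lmul U V e (\<tau> f g)) k) (\<tau> v c)"
      unfolding lact_def using tau[OF v c] by (rule rmul_lext) auto
    then show "lext (\<lambda>(e, f). rmul U V (lmul U V e (\<tau> f g)) k) (\<tau> v c) = rmul U V (\<tau> v (c \<otimes>\<^bsub>U\<^esub> g)) k"
      using c gk by (simp add: right split_def)
  qed
  also have "\<dots> = lext (\<lambda>p. ract (\<tau> v) (case p of (g, k) \<Rightarrow> (c \<otimes>\<^bsub>U\<^esub> g) \<boxtimes> k)) (S d)"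
    using c v K_hbasis[OF mlinD(1)[OF S d]] by (intro lext_cong) (auto simp: ract_tens[OF mbilD(2)[OF \<tau>]])
  also have "\<dots> = ract (\<tau> v) (lmul U V c (S d))"
    unfolding lmul_def using mlinD(1)[OF S d] by (intro ract_lext[symmetric, of _ "hbasis U \<times> hbasis V"]) auto
  finally show ?thesis .
qed

end

section \<open>Left comodule algebras\<close>

context hopf
begin

lemma mlin_smult_right: "mlin H Y F \<Longrightarrow> a \<in> carrier H \<Longrightarrow> mlin H Y (\<lambda>h. F (h \<otimes> a))"
  and mlin_smult_left: "mlin H Y F \<Longrightarrow> a \<in> carrier H \<Longrightarrow> mlin H Y (\<lambda>h. F (a \<otimes> h))"
  by (rule mlinI; simp add: mlinD l_distr r_distr smult_mult)+

lemma W_carrier: "w \<in> W \<Longrightarrow> w \<in> carrier (cobar H)"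
  by (simp add: cobar_simps)

text \<open>Letters come from H_+, and degree 1 is excluded by H_1 = 0. This keeps the differential
  of a letter in positive degree.\<close>

lemma E_degree: "a \<in> E \<Longrightarrow> gdeg H a \<ge> 2"
  using E_hcomp[of a] S.hbasis_nonzero[of a] connected(2)
  by (cases "gdeg H a = 1") (auto simp: desusp_simps)

text \<open>A left factor of degree 0 is a multiple of 1, and the counit law adds the corresponding
  terms up to 1 \<otimes> c.\<close>

lemma comult_left_0:
  assumes G: "\<And>y. y \<in> carrier H \<Longrightarrow> mlin H Y (\<lambda>x. G x y)" "mlin H Y (G \<one>)" and c: "c \<in> carrier H"
  shows "lext (\<lambda>(x, y). if gdeg H x = 0 then G x y else 0) (comult H c) = G \<one> c"
proof -
  have "lext (\<lambda>(x, y). if gdeg H x = 0 then G x y else 0) (comult H c) =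
    lext (\<lambda>(x, y). \<epsilon> x \<cdot> G \<one> y) (comult H c)"
  proof (intro lext_cong, clarify)
    fix x y assume "comult H c (x, y) \<noteq> 0"
    from D.nu_basis[OF c this] have "x \<in> hcomp H (gdeg H x)" "y \<in> carrier H"
      using hbasis_hcomp by auto
    then show "(if gdeg H x = 0 then G x y else 0) = \<epsilon> x \<cdot> G \<one> y"
      using hcomp_0_eq[OF G(1), of y x] counit_hcomp by auto
  qed
  then show ?thesis
    using counit_left[OF G(2) c] by simp
qed

lemma comult_right_0:
  assumes G: "\<And>x. x \<in> carrier H \<Longrightarrow> mlin H Y (G x)" "mlin H Y (\<lambda>x. G x \<one>)" and c: "c \<in> carrier H"
  shows "lext (\<lambda>(x, y). if gdeg H y = 0 then G x y else 0) (comult H c) = G c \<one>"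
proof -
  have "lext (\<lambda>(x, y). if gdeg H y = 0 then G x y else 0) (comult H c) =
    lext (\<lambda>(x, y). \<epsilon> y \<cdot> G x \<one>) (comult H c)"
  proof (intro lext_cong, clarify)
    fix x y assume "comult H c (x, y) \<noteq> 0"
    from D.nu_basis[OF c this] have "y \<in> hcomp H (gdeg H y)" "x \<in> carrier H"
      using hbasis_hcomp by auto
    then show "(if gdeg H y = 0 then G x y else 0) = \<epsilon> y \<cdot> G x \<one>"
      using hcomp_0_eq[OF G(1), of x y] counit_hcomp by auto
  qed
  then show ?thesis
    using counit_right[OF G(2) c] by simp
qed

text \<open>The coproduct consists of 1 \<otimes> c, c \<otimes> 1 and terms with both factors of
  positive degree; as n > 0, no term is counted twice. The signed \<open>\<beta>\<close> has to
  agree with a bilinear map only at the two extreme bidegrees.\<close>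

lemma comult_split:
  assumes c: "c \<in> hcomp H n" "n > 0"
    and G: "mbil H H Y G" and G': "mbil H H Y G'"
    and \<beta>: "\<And>x y. x \<in> hbasis H \<Longrightarrow> y \<in> hbasis H \<Longrightarrow> gdeg H x = 0 \<Longrightarrow> gdeg H y = n \<Longrightarrow> \<beta> x y = G x y"
      "\<And>x y. x \<in> hbasis H \<Longrightarrow> y \<in> hbasis H \<Longrightarrow> gdeg H x = n \<Longrightarrow> gdeg H y = 0 \<Longrightarrow> \<beta> x y = G' x y"
  shows "lext (\<lambda>(x, y). \<beta> x y) (comult H c) =
    lext (\<lambda>(x, y). if gdeg H x > 0 \<and> gdeg H y > 0 then \<beta> x y else 0) (comult H c) + (G \<one> c + G' c \<one>)"
proof -
  note cc = hcomp_carrier[OF c(1)]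
  have "lext (\<lambda>(x, y). \<beta> x y) (comult H c) = lext (\<lambda>p.
      (case p of (x, y) \<Rightarrow> if gdeg H x > 0 \<and> gdeg H y > 0 then \<beta> x y else 0) +
      ((case p of (x, y) \<Rightarrow> if gdeg H x = 0 then G x y else 0) +
       (case p of (x, y) \<Rightarrow> if gdeg H y = 0 then G' x y else 0))) (comult H c)"
  proof (intro lext_cong, clarify)
    fix x y assume "comult H c (x, y) \<noteq> 0"
    note b = D.nu_supp[OF c(1) this]
    have "gdeg H x \<ge> 0" "gdeg H y \<ge> 0" "gdeg H x + gdeg H y = n"
      using b hbasis_degree by auto
    then show "\<beta> x y = (if gdeg H x > 0 \<and> gdeg H y > 0 then \<beta> x y else 0) +
      ((if gdeg H x = 0 then G x y else 0) + (if gdeg H y = 0 then G' x y else 0))"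
      using \<beta>[OF b(1,2)] c(2) by (cases "gdeg H x = 0"; cases "gdeg H y = 0") auto
  qed
  also have "lext (\<lambda>p. case p of (x, y) \<Rightarrow> if gdeg H x = 0 then G x y else 0) (comult H c) = G \<one> c"
    using mbilD[OF G] cc by (intro comult_left_0) auto
  then show ?thesis
    using comult_right_0[OF mbilD(2)[OF G'] mbilD(1)[OF G'] cc] calculation
    by (simp add: lext_fun_add)
qed

end

locale left_comod = hopf H
  for H :: "('r::comm_ring_1, 'h) chopf" (structure) +
  fixes B :: "('r, 'b, 'h) lcomodalg"
  assumes left_comod: "left_comodule_algebra H B"
begin

sublocale B: chain_alg B
  using left_comod by unfold_locales (simp add: left_comodule_algebra_def)

sublocale N: coaction H B B "lcoact B"
  using left_comod by unfold_locales (simp add: left_comodule_algebra_def)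

sublocale T: alg_tensor "cobar H" B
  by unfold_locales

abbreviation \<nu> where "\<nu> \<equiv> lcoact B"
abbreviation wt (infixr \<open>\<boxtimes>\<close> 70) where "w \<boxtimes> b \<equiv> tens (cobar H) B w b"
abbreviation KB where "KB \<equiv> hbasis (cobar H) \<times> hbasis B"

section \<open>Coassociativity and counit of a left coaction\<close>

lemma nu_coassoc:
  assumes "\<And>x y s. x \<in> hbasis H \<Longrightarrow> y \<in> hbasis H \<Longrightarrow> s \<in> hbasis B \<Longrightarrow> \<beta> x y s \<in> fsupp Y"
    and "b \<in> carrier B"
  shows "lext (\<lambda>(h, x). lext (\<lambda>(h1, h2). \<beta> h1 h2 x) (comult H h)) (\<nu> b) =
    lext (\<lambda>(h, x). lext (\<lambda>(h', x'). \<beta> h h' x') (\<nu> x)) (\<nu> b)"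
proof (rule coassoc_lext[where Z = "hbasis H" and Z' = "hbasis B"])
  show "graded_free_mod H" "graded_free_mod H" "graded_free_mod B"
    by unfold_locales
  show "lext (\<lambda>(h, b'). lext (\<lambda>(h1, h2). tens H (tensor H B) h1 (tens H B h2 b')) (comult H h)) (\<nu> b) =
    lext (\<lambda>(h, b'). tens H (tensor H B) h (\<nu> b')) (\<nu> b)"
    using left_comod assms(2) unfolding left_comodule_algebra_def by blast
qed (use assms in auto)

lemma nu_counit:
  assumes F: "mlin B Y F" and b: "b \<in> carrier B"
  shows "lext (\<lambda>(h, x). \<epsilon> h \<cdot> F x) (\<nu> b) = F b"
proof -
  let ?S = "{p. \<nu> b p \<noteq> 0}"
  have fin: "finite ?S"
    using N.nu_fsupp[OF b] by (rule fsupp_finite)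
  have "F b = F (\<Oplus>\<^bsub>B\<^esub>p\<in>?S. (\<nu> b p * \<epsilon> (fst p)) \<odot>\<^bsub>B\<^esub> snd p)"
    using left_comod b unfolding left_comodule_algebra_def by auto
  also have "\<dots> = (\<Sum>p\<in>?S. (\<nu> b p * \<epsilon> (fst p)) \<cdot> F (snd p))"
    using N.nu_basis[OF b] by (intro B.mlin_finsum[OF F fin]) auto
  also have "\<dots> = lext (\<lambda>(h, x). \<epsilon> h \<cdot> F x) (\<nu> b)"
    using fin by (simp add: lext_alt[of ?S] split_def)
  finally show ?thesis ..
qed

text \<open>By the counit law, the terms of the coaction with left factor in degree 0 add up to 1
  \<otimes> b.\<close>

lemma nu_0:
  assumes G: "\<And>x. x \<in> carrier B \<Longrightarrow> mlin H Y (\<lambda>h. G h x)" "mlin B Y (G \<one>)" and b: "b \<in> carrier B"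
  shows "lext (\<lambda>(h, x). if gdeg H h = 0 then G h x else 0) (\<nu> b) = G \<one> b"
proof -
  have "lext (\<lambda>(h, x). if gdeg H h = 0 then G h x else 0) (\<nu> b) = lext (\<lambda>(h, x). \<epsilon> h \<cdot> G \<one> x) (\<nu> b)"
  proof (intro lext_cong, clarify)
    fix h x assume "\<nu> b (h, x) \<noteq> 0"
    from N.nu_basis[OF b this] have "h \<in> hcomp H (gdeg H h)" "x \<in> carrier B"
      using hbasis_hcomp by auto
    then show "(if gdeg H h = 0 then G h x else 0) = \<epsilon> h \<cdot> G \<one> x"
      using hcomp_0_eq[OF G(1), of x h] counit_hcomp by auto
  qed
  then show ?thesis
    using nu_counit[OF G(2) b] by simp
qed

text \<open>The prescribed value of (1 \<otimes> b)(s^-1 a \<otimes> 1). The degree n of a is a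
  separate argument, which makes the expression linear in a. The sign is the Koszul sign for moving
  s^-1 past h and s^-1 a past x, as n + 1 and n - 1 have the same parity.\<close>

definition letter :: "int \<Rightarrow> 'h \<Rightarrow> 'b \<Rightarrow> ('h list \<Rightarrow> 'r) \<times> 'b \<Rightarrow> 'r" where
  "letter n a b = lext (\<lambda>(h, x). ksign (gdeg H h + (n + 1) * gdeg B x) \<cdot> (ssv (h \<otimes> a) \<boxtimes> x)) (\<nu> b)"

lemma mlin_letter: "mlin B KB (letter n a)"
  unfolding letter_def by (rule N.mlin_lext_nu) auto

lemma mlin_wt1: "mlin H (lists E) F \<Longrightarrow> mlin H KB (\<lambda>h. F h \<boxtimes> x)"
  using mlinD(1)[of H "lists E" F] T.tens_add(1) T.tens_smult(1) unfolding mlin_def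
  by (simp add: cobar_simps)

lemma mlin_ssv_mult:
  "a \<in> carrier H \<Longrightarrow> mlin H KB (\<lambda>h. ssv (h \<otimes> a) \<boxtimes> x)"
  "h \<in> carrier H \<Longrightarrow> mlin H KB (\<lambda>a. ssv (h \<otimes> a) \<boxtimes> x)"
  using mlin_wt1[OF mlin_smult_right[OF mlin_ssv]] mlin_wt1[OF mlin_smult_left[OF mlin_ssv]] by auto

lemma mbil_letter: "a \<in> carrier H \<Longrightarrow> mbil H B KB (\<lambda>h x. r \<cdot> (ssv (h \<otimes> a) \<boxtimes> x))"
  by (rule mbilI; rule mlin_scale; auto intro: mlin_ssv_mult T.mlin_tens)

lemma mlin_letter_a: "b \<in> carrier B \<Longrightarrow> mlin H KB (\<lambda>a. letter n a b)"
  unfolding letter_def split_def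
  by (intro mlin_lext_fun mlin_scale mlin_ssv_mult) (auto dest: N.nu_basis)

section \<open>Moving an element of B past a word\<close>

lemma left_swap_K [simp]: "left_swap H B as b \<in> T.K"
  by (cases as) (auto intro!: lext_fsupp split: prod.split)

lemma mlin_left_swap: "mlin B KB (left_swap H B as)"
  by (cases as) (auto intro!: T.mlin_tens N.mlin_lext_nu lext_fsupp)

text \<open>One exchange with the first letter, after which the factor in B that remains is moved
  past the rest of the word. Since h \<cdot> a is homogeneous, \<open>sinv\<close> may be replaced
  by the linear \<open>ssv\<close>.\<close>

lemma left_swap_Cons:
  assumes "a \<in> E" "b \<in> carrier B"
  shows "left_swap H B (a # as) b = T.lact (left_swap H B as) (letter (gdeg H a) a b)"
proof -
  have "T.lact (left_swap H B as) (letter (gdeg H a) a b) = lext (\<lambda>p. T.lact (left_swap H B as)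
    (case p of (h, x) \<Rightarrow> ksign (gdeg H h + (gdeg H a + 1) * gdeg B x) \<cdot> (ssv (h \<otimes> a) \<boxtimes> x))) (\<nu> b)"
    unfolding letter_def using N.nu_fsupp[OF assms(2)] by (rule T.lact_lext) auto
  also have "\<dots> = left_swap H B (a # as) b"
    unfolding left_swap.simps
  proof (intro lext_cong, clarify)
    fix h x assume "\<nu> b (h, x) \<noteq> 0"
    from N.nu_basis[OF assms(2) this]
    have hx: "h \<in> hcomp H (gdeg H h)" "x \<in> carrier B"
      using hbasis_hcomp by auto
    have "sinv H (h \<otimes> a) = ssv (h \<otimes> a)"
      by (rule sinv_ssv[OF mult_hcomp[OF hx(1) E_hcomp(1)[OF assms(1)]]])
    then show "T.lact (left_swap H B as) (ksign (gdeg H h + (gdeg H a + 1) * gdeg B x) \<cdot> (ssv (h \<otimes> a) \<boxtimes> x)) =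
      ksign (gdeg H h + (gdeg H a + 1) * gdeg B x) \<cdot>
        lext (\<lambda>(u, c). (sinv H (h \<otimes> a) \<star> u) \<boxtimes> c) (left_swap H B as x)"
      using hx by (simp add: T.lact_linear T.lact_tens[OF mlin_left_swap] W_carrier lmul_def cobar_simps)
  qed
  finally show ?thesis ..
qed

declare left_swap.simps(2) [simp del]

definition \<tau> :: "'b \<Rightarrow> ('h list \<Rightarrow> 'r) \<Rightarrow> ('h list \<Rightarrow> 'r) \<times> 'b \<Rightarrow> 'r" where
  "\<tau> b w = lext (\<lambda>as. left_swap H B as b) w"

lemma tau_bil: "mbil B (cobar H) KB \<tau>"
  unfolding \<tau>_def by (intro mbilI mlin_lext_fun C.mlin_lext_id mlin_left_swap left_swap_K)

lemma tau_K [simp]: "b \<in> carrier B \<Longrightarrow> w \<in> W \<Longrightarrow> \<tau> b w \<in> T.K"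
  using mbil_fsupp[OF tau_bil] by (simp add: cobar_simps)

lemma tau_delta: "\<tau> b (delta as) = left_swap H B as b"
  by (simp add: \<tau>_def)

lemma tau_linear:
  "\<tau> b 0 = 0" "w \<in> W \<Longrightarrow> w' \<in> W \<Longrightarrow> \<tau> b (w + w') = \<tau> b w + \<tau> b w'"
  "w \<in> W \<Longrightarrow> \<tau> b (r \<cdot> w) = r \<cdot> \<tau> b w" "w \<in> W \<Longrightarrow> \<tau> b (- w) = - \<tau> b w"
  unfolding \<tau>_def by (auto intro: lext_add lext_scale lext_minus)

lemma tau_lext:
  "z \<in> fsupp X \<Longrightarrow> (\<And>p. p \<in> X \<Longrightarrow> \<beta> p \<in> W) \<Longrightarrow> \<tau> b (lext \<beta> z) = lext (\<lambda>p. \<tau> b (\<beta> p)) z"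
  unfolding \<tau>_def by (rule lext_lext)

lemma mlin_tau: "w \<in> W \<Longrightarrow> mlin B KB (\<lambda>b. \<tau> b w)"
  using mbilD(1)[OF tau_bil] by (simp add: cobar_simps)

lemma left_swap_single: "a \<in> E \<Longrightarrow> b \<in> carrier B \<Longrightarrow> left_swap H B [a] b = letter (gdeg H a) a b"
proof -
  assume a: "a \<in> E" and b: "b \<in> carrier B"
  have "T.lact (\<lambda>b. \<one>\<^bsub>cobar H\<^esub> \<boxtimes> b) z = z" if "z \<in> T.K" for z
    using that
    by (induction rule: T.fsupp_tens_induct)
      (simp_all add: T.lact_linear T.lact_tens[OF T.mlin_tens(2)] T.lmul_tens)
  then show ?thesis
    using a b mlinD(1)[OF mlin_letter] by (simp add: left_swap_Cons)
qed

text \<open>Extends the formula from letters in \<open>E\<close> to all homogeneous \<open>a\<close>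
  by linearity. Positivity matters: for a = 1 the left side is \<open>0\<close>, whereas
  \<open>letter 0 \<one> b\<close> is the sum of s^-1 h \<otimes> x up to signs.\<close>

lemma tau_ssv:
  assumes a: "a \<in> hcomp H n" "n > 0" and b: "b \<in> carrier B"
  shows "\<tau> b (ssv a) = letter n a b"
proof -
  have aD: "a \<in> carrier (desusp H)" "a \<in> hcomp (desusp H) (n - 1)"
    using a desusp_hcomp_carrier[OF a(2)] by (auto simp: desusp_simps)
  have "\<tau> b (ssv a) = lext (\<lambda>x. \<tau> b (delta [x])) (coord (desusp H) a)"
    unfolding ssv_desusp[OF aD(1)] by (rule tau_lext[OF S.coord_fsupp]) auto
  also have "\<dots> = letter n a b"
  proof (rule S.lext_coord_hcomp[OF mlin_desusp[OF mlin_letter_a[OF b]] aD(2)])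
    fix x assume "x \<in> E" "gdeg (desusp H) x = n - 1"
    then show "\<tau> b (delta [x]) = letter n x b"
      using E_hcomp(3)[of x] b by (simp add: tau_delta left_swap_single)
  qed
  finally show ?thesis .
qed

lemma letter_hcomp:
  assumes a: "a \<in> hcomp H n" and b: "b \<in> hcomp B m"
  shows "letter n a b \<in> hcomp (tensor (cobar H) B) (m + (n - 1))"
  unfolding letter_def
proof (rule T.T.lext_hcomp, clarify)
  fix h x assume "\<nu> b (h, x) \<noteq> 0"
  note s = N.nu_supp[OF b this]
  have "ssv (h \<otimes> a) \<boxtimes> x \<in> hcomp (tensor (cobar H) B) ((gdeg H h + n - 1) + gdeg B x)"
    by (intro T.tens_hcomp ssv_hcomp mult_hcomp s a)
  then show "ksign (gdeg H h + (n + 1) * gdeg B x) \<cdot> (ssv (h \<otimes> a) \<boxtimes> x) \<in>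
      hcomp (tensor (cobar H) B) (m + (n - 1))"
    using s(7) T.T.hcomp_smult unfolding T.T.smult_eq by (simp add: algebra_simps)
qed

lemma left_swap_hcomp:
  "as \<in> lists E \<Longrightarrow> b \<in> hcomp B m \<Longrightarrow> left_swap H B as b \<in> hcomp (tensor (cobar H) B) (m + wdeg H as)"
proof (induction as arbitrary: b m)
  case Nil
  then show ?case
    using T.tens_hcomp[OF C.one_hcomp Nil(2)] by simp
next
  case (Cons a as)
  then have a: "a \<in> E" "as \<in> lists E"
    by auto
  note b = B.hcomp_carrier[OF Cons.prems(2)]
  have l: "letter (gdeg H a) a b \<in> hcomp (tensor (cobar H) B) (m + (gdeg H a - 1))"
    by (rule letter_hcomp[OF E_hcomp(1)[OF a(1)] Cons.prems(2)])
  have "T.lact (left_swap H B as) (letter (gdeg H a) a b) \<in>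
      hcomp (tensor (cobar H) B) (m + (gdeg H a - 1) + wdeg H as)"
    unfolding T.lact_def
  proof (rule T.T.lext_hcomp, clarify)
    fix c d assume "letter (gdeg H a) a b (c, d) \<noteq> 0"
    then have cd: "c \<in> hbasis (cobar H)" "d \<in> hbasis B" "gdeg (cobar H) c + gdeg B d = m + (gdeg H a - 1)"
      using l by (auto simp: tensor_hcomp dest: T.K_hbasis)
    have "lmul (cobar H) B c (left_swap H B as d) \<in>
        hcomp (tensor (cobar H) B) (gdeg (cobar H) c + (gdeg B d + wdeg H as))"
      using cd by (intro T.lmul_hcomp Cons.IH a C.hbasis_hcomp B.hbasis_hcomp)
    then show "lmul (cobar H) B c (left_swap H B as d) \<in>
        hcomp (tensor (cobar H) B) (m + (gdeg H a - 1) + wdeg H as)"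
      using cd(3) by (simp add: add.assoc[symmetric])
  qed
  then show ?case
    using a b by (simp add: left_swap_Cons algebra_simps)
qed

lemma left_swap_append:
  "as \<in> lists E \<Longrightarrow> b \<in> carrier B \<Longrightarrow>
    left_swap H B (as @ bs) b = T.lact (left_swap H B bs) (left_swap H B as b)"
proof (induction as arbitrary: b)
  case Nil
  then show ?case
    by (simp add: T.lact_tens[OF mlin_left_swap] T.lmul_one)
next
  case (Cons a as)
  have l: "letter (gdeg H a) a b \<in> T.K"
    using mlinD(1)[OF mlin_letter Cons.prems(2)] .
  have "T.lact (left_swap H B (as @ bs)) (letter (gdeg H a) a b) =
    T.lact (\<lambda>d. T.lact (left_swap H B bs) (left_swap H B as d)) (letter (gdeg H a) a b)"
    unfolding T.lact_def[of "left_swap H B (as @ bs)"]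
      T.lact_def[of "\<lambda>d. T.lact (left_swap H B bs) (left_swap H B as d)"]
    using Cons T.K_hbasis[OF l] by (intro lext_cong) auto
  then show ?case
    using Cons l by (simp add: left_swap_Cons T.lact_lact[OF mlin_left_swap mlin_left_swap])
qed

lemma tau_right:
  assumes b: "b \<in> carrier B" and w: "w \<in> W" "w' \<in> W"
  shows "\<tau> b (w \<star> w') = T.lact (\<lambda>d. \<tau> d w') (\<tau> b w)"
proof -
  \<comment> \<open>The word \<open>w'\<close> enters through the map \<open>S\<close>, so the
    induction on \<open>w'\<close> needs that \<open>lact S z\<close> is linear in \<open>S\<close>
    too.\<close>
  have lact_add: "T.lact (\<lambda>d. S d + S' d) z = T.lact S z + T.lact S' z"
    if "mlin B KB S" "mlin B KB S'" "z \<in> T.K" for S S' z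
    using that(3)
    by (induction rule: T.fsupp_tens_induct)
      (simp_all add: T.lact_linear T.lact_tens that mlin_add T.lmul_linear mlinD(1)[OF that(1)]
        mlinD(1)[OF that(2)] fscale_add algebra_simps)
  have lact_scale: "T.lact (\<lambda>d. r \<cdot> S d) z = r \<cdot> T.lact S z"
    if "mlin B KB S" "z \<in> T.K" for S z r
    using that(2)
    by (induction rule: T.fsupp_tens_induct)
      (simp_all add: T.lact_linear T.lact_tens that mlin_scale T.lmul_linear mlinD(1)[OF that(1)]
        fscale_add mult.commute)
  have lact_zero: "T.lact (\<lambda>d. 0) z = 0" for z
    by (simp add: T.lact_def T.lmul_linear split_def)
  show ?thesis
    using w(2)
  proof (induction rule: fsupp_induct)
    case (base bs)
    show ?case
      using w(1)
    proof (induction rule: fsupp_induct)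
      case (base as)
      then show ?case
        using b by (simp add: delta_tmult tau_delta left_swap_append)
    qed (simp_all add: tmult_linear tau_linear tmult_fsupp base b T.lact_linear)
  next
    case (add z z')
    then show ?case
      using w(1) b by (simp add: tmult_linear tau_linear tmult_fsupp lact_add mlin_tau)
  next
    case (scale r z)
    then show ?case
      using w(1) b by (simp add: tmult_linear tau_linear tmult_fsupp lact_scale mlin_tau)
  qed (simp add: tmult_linear tau_linear lact_zero)
qed

text \<open>The factor b' passes s^-1 a first and leaves s^-1 (h' a), whose degree |h'| + n is still
  positive, so \<open>tau_ssv\<close> applies again when b is moved past it. The result is the
  coaction on b b', expanded as a product, by associativity in H.\<close>

lemma letter_mult:
  assumes a: "a \<in> hcomp H n" "n > 0" and b: "b \<in> carrier B" "b' \<in> carrier B"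
  shows "letter n a (b \<otimes>\<^bsub>B\<^esub> b') = T.ract (\<tau> b) (letter n a b')"
proof -
  note ac = hcomp_carrier[OF a(1)]
  let ?\<gamma> = "\<lambda>(h, x). ksign (gdeg H h + (n + 1) * gdeg B x) \<cdot> (ssv (h \<otimes> a) \<boxtimes> x)"
  let ?s = "\<lambda>h x h' x'. ksign (gdeg B x * gdeg H h') * ksign (gdeg H h + gdeg H h' + (n + 1) * (gdeg B x + gdeg B x')) :: 'r"
  let ?t = "\<lambda>h x h' x'. ?s h x h' x' \<cdot> (ssv (h \<otimes> h' \<otimes> a) \<boxtimes> (x \<otimes>\<^bsub>B\<^esub> x'))"
  have "letter n a (b \<otimes>\<^bsub>B\<^esub> b') = lext (\<lambda>(h, x). lext (\<lambda>(h', x'). ?t h x h' x') (\<nu> b')) (\<nu> b)"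
    unfolding letter_def N.nu_mult[OF b]
  proof (intro lext_cong, clarify, intro lext_cong, clarify)
    fix h x h' x' assume "\<nu> b (h, x) \<noteq> 0" "\<nu> b' (h', x') \<noteq> 0"
    then have hb: "h \<in> hbasis H" "x \<in> hbasis B" "h' \<in> hbasis H" "x' \<in> hbasis B"
      using N.nu_basis b by auto
    have "lext ?\<gamma> (tens H B (h \<otimes> h') (x \<otimes>\<^bsub>B\<^esub> x')) =
      ksign (gdeg H h + gdeg H h' + (n + 1) * (gdeg B x + gdeg B x')) \<cdot> (ssv (h \<otimes> h' \<otimes> a) \<boxtimes> (x \<otimes>\<^bsub>B\<^esub> x'))"
      by (rule N.lext_tens_hcomp[OF mbil_letter[OF ac]
            mult_hcomp[OF hbasis_hcomp[OF hb(1)] hbasis_hcomp[OF hb(3)]]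
            B.mult_hcomp[OF B.hbasis_hcomp[OF hb(2)] B.hbasis_hcomp[OF hb(4)]]]) simp
    then show "ksign (gdeg B x * gdeg H h') \<cdot> lext ?\<gamma> (tens H B (h \<otimes> h') (x \<otimes>\<^bsub>B\<^esub> x')) = ?t h x h' x'"
      by simp
  qed
  also have "\<dots> = lext (\<lambda>(h', x'). lext (\<lambda>(h, x). ?t h x h' x') (\<nu> b)) (\<nu> b')"
    unfolding split_def by (rule lext_swap)
  also have "\<dots> = lext (\<lambda>p. T.ract (\<tau> b) (?\<gamma> p)) (\<nu> b')"
  proof (intro lext_cong, clarify)
    fix h' x' assume "\<nu> b' (h', x') \<noteq> 0"
    from N.nu_basis[OF b(2) this]
    have hx: "h' \<in> hbasis H" "x' \<in> hbasis B" "h' \<in> hcomp H (gdeg H h')" "h' \<in> carrier H" "x' \<in> carrier B"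
      using hbasis_hcomp by auto
    have pos: "gdeg H h' + n > 0"
      using hbasis_degree[OF hx(1)] a(2) by simp
    have "T.ract (\<tau> b) (?\<gamma> (h', x')) = ksign (gdeg H h' + (n + 1) * gdeg B x') \<cdot>
        rmul (cobar H) B (letter (gdeg H h' + n) (h' \<otimes> a) b) x'"
      using hx b(1) by (simp add: T.ract_linear T.ract_tens[OF mbilD(2)[OF tau_bil]] W_carrier
          tau_ssv[OF mult_hcomp[OF hx(3) a(1)] pos])
    also have "\<dots> = ksign (gdeg H h' + (n + 1) * gdeg B x') \<cdot> lext (\<lambda>p. rmul (cobar H) B
      (case p of (h, x) \<Rightarrow> ksign (gdeg H h + (gdeg H h' + n + 1) * gdeg B x) \<cdot> (ssv (h \<otimes> (h' \<otimes> a)) \<boxtimes> x)) x') (\<nu> b)"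
      unfolding letter_def by (subst T.rmul_lext[OF N.nu_fsupp[OF b(1)]]) auto
    also have "\<dots> = lext (\<lambda>(h, x). ?t h x h' x') (\<nu> b)"
      unfolding lext_fun_scale[symmetric]
    proof (intro lext_cong, clarify)
      fix h x assume "\<nu> b (h, x) \<noteq> 0"
      then have hb: "h \<in> carrier H" "x \<in> carrier B"
        using N.nu_basis b by auto
      have "ksign (gdeg H h' + (n + 1) * gdeg B x') * ksign (gdeg H h + (gdeg H h' + n + 1) * gdeg B x) = ?s h x h' x'"
        unfolding ksign_add[symmetric] by (rule ksign_cong) (simp; blast)
      then show "ksign (gdeg H h' + (n + 1) * gdeg B x') \<cdot> rmul (cobar H) B
          (ksign (gdeg H h + (gdeg H h' + n + 1) * gdeg B x) \<cdot> (ssv (h \<otimes> (h' \<otimes> a)) \<boxtimes> x)) x' = ?t h x h' x'"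
        using hb hx ac by (simp add: T.rmul_linear T.rmul_tens W_carrier m_assoc)
    qed
    finally show "lext (\<lambda>(h, x). ?t h x h' x') (\<nu> b) = T.ract (\<tau> b)
        (ksign (gdeg H h' + (n + 1) * gdeg B x') \<cdot> (ssv (h' \<otimes> a) \<boxtimes> x'))"
      by simp
  qed
  also have "\<dots> = T.ract (\<tau> b) (letter n a b')"
    unfolding letter_def using N.nu_fsupp[OF b(2)] by (intro T.ract_lext[symmetric]) auto
  finally show ?thesis .
qed

text \<open>Induction on the word, uniform in b and b'. In the step, moving past the remaining word
  has to commute with moving b in from the left; \<open>lact_ract\<close> derives this from the
  induction hypothesis and \<open>tau_right\<close>.\<close>

lemma tau_left:
  assumes b: "b \<in> carrier B" "b' \<in> carrier B" and w: "w \<in> W"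
  shows "\<tau> (b \<otimes>\<^bsub>B\<^esub> b') w = T.ract (\<tau> b) (\<tau> b' w)"
  using w
proof (induction rule: fsupp_induct)
  case (base as)
  then show ?case
    using b
  proof (induction as arbitrary: b b' rule: list.induct)
    case Nil
    have "\<tau> b (delta []) = delta [] \<boxtimes> b" for b
      by (simp add: tau_delta cobar_simps)
    then show ?case
      using Nil by (simp add: T.ract_tens[OF mbilD(2)[OF tau_bil]] W_carrier T.rmul_tens)
  next
    case (Cons a as)
    then have a: "a \<in> E" "as \<in> lists E"
      by auto
    note ah = E_hcomp[OF a(1)]
    let ?l = "letter (gdeg H a) a b'"
    have l: "?l \<in> T.K"
      using mlinD(1)[OF mlin_letter Cons.prems(3)] .
    have "T.lact (left_swap H B as) (T.ract (\<tau> b) z) = T.ract (\<tau> b) (T.lact (left_swap H B as) z)"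
      if "z \<in> T.K" for z
      using that
    proof (induction rule: T.fsupp_tens_induct)
      case (base c d)
      then have cd: "c \<in> carrier (cobar H)" "d \<in> carrier B"
        by auto
      have "T.lact (left_swap H B as) (rmul (cobar H) B (\<tau> b c) d) =
        T.ract (\<tau> b) (lmul (cobar H) B c (left_swap H B as d))"
      proof (rule T.lact_ract[OF tau_bil mlin_left_swap _ _ Cons.prems(2) cd])
        show "left_swap H B as (f \<otimes>\<^bsub>B\<^esub> d) = T.ract (\<tau> f) (left_swap H B as d)" if "f \<in> carrier B" for f
          using Cons.IH[OF a(2) that cd(2)] by (simp add: tau_delta)
        show "\<tau> b (u \<otimes>\<^bsub>cobar H\<^esub> u') = T.lact (\<lambda>d. \<tau> d u') (\<tau> b u)"
          if "u \<in> carrier (cobar H)" "u' \<in> carrier (cobar H)" for u u'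
          using that tau_right[OF Cons.prems(2)] by (simp add: cobar_simps)
      qed
      then show ?case
        using cd by (simp add: T.ract_tens[OF mbilD(2)[OF tau_bil Cons.prems(2)]] T.lact_tens[OF mlin_left_swap])
    qed (simp_all add: T.ract_linear T.lact_linear)
    then show ?case
      using Cons.prems a l letter_mult[OF ah(1) _ Cons.prems(2,3)] ah(2)
      by (simp add: tau_delta left_swap_Cons)
  qed
qed (use b in \<open>simp_all add: tau_linear T.ract_linear\<close>)

lemma tau_one:
  assumes "w \<in> W"
  shows "\<tau> \<one>\<^bsub>B\<^esub> w = w \<boxtimes> \<one>\<^bsub>B\<^esub>"
  using assms
proof (induction rule: fsupp_induct)
  case (base as)
  then show ?case
  proof (induction as)
    case (Cons a as)
    then have a: "a \<in> E" "as \<in> lists E"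
      by auto
    note ah = E_hcomp[OF a(1)]
    have "letter (gdeg H a) a \<one>\<^bsub>B\<^esub> = ksign 0 \<cdot> (ssv (\<one> \<otimes> a) \<boxtimes> \<one>\<^bsub>B\<^esub>)"
      unfolding letter_def N.nu_one
      by (rule N.lext_tens_hcomp[OF mbil_letter[OF ah(4)] one_hcomp B.one_hcomp]) simp
    then have "\<tau> \<one>\<^bsub>B\<^esub> (delta (a # as)) = lmul (cobar H) B (delta [a]) (left_swap H B as \<one>\<^bsub>B\<^esub>)"
      using a ah by (simp add: tau_delta left_swap_Cons T.lact_tens[OF mlin_left_swap] W_carrier ssv_E
         )
    then show ?case
      using Cons a by (simp add: tau_delta[symmetric] T.lmul_tens W_carrier) (simp add: cobar_simps delta_tmult)
  qed (simp add: tau_delta cobar_simps)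
next
  case (add z z')
  then show ?case
    using T.tens_add(1)[of z z'] by (simp add: tau_linear cobar_simps)
next
  case (scale r z)
  then show ?case
    using T.tens_smult(1)[of z r] by (simp add: tau_linear cobar_simps)
next
  case zero
  then show ?case
    using T.tens_zero(1) by (simp add: tau_linear cobar_simps)
qed

lemma tau_hcomp:
  assumes "b \<in> hcomp B m" "w \<in> hcomp (cobar H) n"
  shows "\<tau> b w \<in> hcomp (tensor (cobar H) B) (m + n)"
  unfolding \<tau>_def
proof (rule T.T.lext_hcomp)
  fix as assume "w as \<noteq> 0"
  then have "as \<in> lists E" "wdeg H as = n"
    using assms(2) by (auto simp: cobar_hcomp dest: fsupp_in)
  then show "left_swap H B as b \<in> hcomp (tensor (cobar H) B) (m + n)"
    using left_swap_hcomp[OF _ assms(1)] by metis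
qed

sublocale X: twisted_tensor "cobar H" B \<tau>
proof unfold_locales
  show "\<tau> v (u \<otimes>\<^bsub>cobar H\<^esub> u') = lext (\<lambda>(c, d). lmul (cobar H) B c (\<tau> d u')) (\<tau> v u)"
    if "v \<in> carrier B" "u \<in> carrier (cobar H)" "u' \<in> carrier (cobar H)" for v u u'
    using tau_right that by (simp add: cobar_simps T.lact_def)
  show "\<tau> (v \<otimes>\<^bsub>B\<^esub> v') u = lext (\<lambda>(c, d). rmul (cobar H) B (\<tau> v c) d) (\<tau> v' u)"
    if "v \<in> carrier B" "v' \<in> carrier B" "u \<in> carrier (cobar H)" for v v' u
    using tau_left that by (simp add: cobar_simps T.ract_def)
qed (use tau_bil tau_hcomp tau_one in \<open>auto simp: cobar_simps tau_delta\<close>)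

abbreviation pr (infixl \<open>\<diamondop>\<close> 72) where "z \<diamondop> z' \<equiv> tmul (cobar H) B \<tau> z z'"

section \<open>The differential on \<Omega>H \<otimes> B\<close>

definition DU :: "('h list \<Rightarrow> 'r) \<Rightarrow> ('h list \<Rightarrow> 'r) \<times> 'b \<Rightarrow> 'r" where
  "DU w = d\<Omega> w \<boxtimes> \<one>\<^bsub>B\<^esub>"

text \<open>The part of D(1 \<otimes> b) that comes from the twisting; in \<open>DV\<close> it is
  added to the internal differential.\<close>

definition RR :: "'b \<Rightarrow> ('h list \<Rightarrow> 'r) \<times> 'b \<Rightarrow> 'r" where
  "RR b = lext (\<lambda>(h, x). ssv h \<boxtimes> x) (\<nu> b)"

definition DV :: "'b \<Rightarrow> ('h list \<Rightarrow> 'r) \<times> 'b \<Rightarrow> 'r" where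
  "DV b = T.iV (dif B b) + RR b"

lemma W_add: "w \<in> W \<Longrightarrow> w' \<in> W \<Longrightarrow> (w + w') \<boxtimes> b = w \<boxtimes> b + w' \<boxtimes> b"
  and W_scale: "w \<in> W \<Longrightarrow> (r \<cdot> w) \<boxtimes> b = r \<cdot> (w \<boxtimes> b)"
  and W_zero: "0 \<boxtimes> b = 0"
  using T.tens_add(1)[of w w'] T.tens_smult(1)[of w r] T.tens_zero(1) by (simp_all add: cobar_simps)

lemma W_minus: "w \<in> W \<Longrightarrow> (- w) \<boxtimes> b = - (w \<boxtimes> b)"
  using W_scale[of w "- 1" b] by simp

lemma W_lext:
  assumes "z \<in> fsupp X" "\<And>p. p \<in> X \<Longrightarrow> \<beta> p \<in> W"
  shows "lext \<beta> z \<boxtimes> b = lext (\<lambda>p. \<beta> p \<boxtimes> b) z"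
proof -
  have "mlin (cobar H) KB (\<lambda>w. w \<boxtimes> b)"
    by (rule T.mlin_tens)
  then have F: "w \<boxtimes> b = lext (\<lambda>ws. delta ws \<boxtimes> b) w" if "w \<in> W" for w
    using C.mlin_eq_lext_delta that by blast
  have "lext \<beta> z \<boxtimes> b = lext (\<lambda>ws. delta ws \<boxtimes> b) (lext \<beta> z)"
    by (rule F) (auto intro: lext_fsupp assms(2) fsupp_in[OF assms(1)])
  also have "\<dots> = lext (\<lambda>p. lext (\<lambda>ws. delta ws \<boxtimes> b) (\<beta> p)) z"
    using assms by (rule lext_lext)
  also have "\<dots> = lext (\<lambda>p. \<beta> p \<boxtimes> b) z"
    using F assms(2) fsupp_in[OF assms(1)] by (intro lext_cong) (auto simp: F[symmetric])
  finally show ?thesis .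
qed

lemma mlin_DU: "mlin (cobar H) KB DU"
  by (intro mlinI) (simp_all add: DU_def cobar_simps d\<Omega>_linear W_add W_scale)

lemma mlin_RR: "mlin B KB RR"
  unfolding RR_def by (rule N.mlin_lext_nu) auto

lemma mlin_DV: "mlin B KB DV"
  unfolding DV_def by (intro mlin_add mlin_RR mlin_comp_graded[OF T.mlin_tens(2) B.dif_graded])

lemma RR_K [simp]: "b \<in> carrier B \<Longrightarrow> RR b \<in> T.K"
  using mlinD(1)[OF mlin_RR] .

lemma DU_hcomp: "w \<in> hcomp (cobar H) n \<Longrightarrow> DU w \<in> hcomp (tensor (cobar H) B) (n - 1)"
  using T.tens_hcomp[OF d\<Omega>_hcomp B.one_hcomp] by (simp add: DU_def)

lemma DV_hcomp:
  assumes "b \<in> hcomp B n"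
  shows "DV b \<in> hcomp (tensor (cobar H) B) (n - 1)"
proof -
  have "RR b \<in> hcomp (tensor (cobar H) B) (n - 1)"
    unfolding RR_def
  proof (rule T.T.lext_hcomp, clarify)
    fix h x assume "\<nu> b (h, x) \<noteq> 0"
    note s = N.nu_supp[OF assms this]
    have "ssv h \<boxtimes> x \<in> hcomp (tensor (cobar H) B) ((gdeg H h - 1) + gdeg B x)"
      by (intro T.tens_hcomp ssv_hcomp s)
    then show "ssv h \<boxtimes> x \<in> hcomp (tensor (cobar H) B) (n - 1)"
      using s(7) by (simp add: algebra_simps)
  qed
  moreover have "T.iV (dif B b) \<in> hcomp (tensor (cobar H) B) (0 + (n - 1))"
    by (intro T.tens_hcomp C.one_hcomp B.dif_hcomp assms)
  ultimately show ?thesis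
    using T.T.hcomp_add unfolding T.T.add_eq by (simp add: DV_def)
qed

lemma sg_iU_csg: "w \<in> W \<Longrightarrow> T.sg (T.iU w) = T.iU (csg w)"
proof (induction rule: fsupp_induct)
  case (base ws)
  then show ?case
    using T.sg_tens[OF C.delta_hcomp[OF base] B.one_hcomp] by (simp add: csg_delta W_scale)
qed (simp_all add: W_add W_scale W_zero csg_linear T.sg_linear)

lemma iU_tmult: "w \<in> W \<Longrightarrow> w' \<in> W \<Longrightarrow> T.iU (w \<star> w') = T.iU w \<diamondop> T.iU w'"
  using X.iU_mult[of w w'] by (simp add: cobar_simps)

lemma DU_mult:
  assumes "w \<in> W" "w' \<in> W"
  shows "DU (w \<star> w') = DU w \<diamondop> T.iU w' + T.sg (T.iU w) \<diamondop> DU w'"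
  using assms by (simp add: DU_def d\<Omega>_tmult W_add tmult_fsupp iU_tmult sg_iU_csg)

lemma mbil_ssv_wt: "mbil H B KB (\<lambda>h x. ssv h \<boxtimes> x)"
  by (intro mbilI mlin_wt1 mlin_ssv T.mlin_tens)

lemma rmul_letter:
  assumes "b \<in> carrier B" "b' \<in> carrier B" "a \<in> carrier H"
  shows "rmul (cobar H) B (letter n a b) b' =
    lext (\<lambda>(h, x). ksign (gdeg H h + (n + 1) * gdeg B x) \<cdot> (ssv (h \<otimes> a) \<boxtimes> (x \<otimes>\<^bsub>B\<^esub> b'))) (\<nu> b)"
proof -
  have "rmul (cobar H) B (letter n a b) b' = lext (\<lambda>p. rmul (cobar H) B (case p of (h, x) \<Rightarrow>
      ksign (gdeg H h + (n + 1) * gdeg B x) \<cdot> (ssv (h \<otimes> a) \<boxtimes> x)) b') (\<nu> b)"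
    unfolding letter_def using N.nu_fsupp[OF assms(1)] by (rule T.rmul_lext) auto
  also have "\<dots> = lext (\<lambda>(h, x). ksign (gdeg H h + (n + 1) * gdeg B x) \<cdot> (ssv (h \<otimes> a) \<boxtimes> (x \<otimes>\<^bsub>B\<^esub> b'))) (\<nu> b)"
    using assms N.nu_basis[OF assms(1)]
    by (intro lext_cong) (auto simp: T.rmul_linear T.rmul_tens W_carrier)
  finally show ?thesis .
qed

lemma lmul_letter:
  assumes "b \<in> carrier B" "w \<in> W" "a \<in> carrier H"
  shows "lmul (cobar H) B w (letter n a b) =
    lext (\<lambda>(h, x). ksign (gdeg H h + (n + 1) * gdeg B x) \<cdot> ((w \<star> ssv (h \<otimes> a)) \<boxtimes> x)) (\<nu> b)"
proof -
  have "lmul (cobar H) B w (letter n a b) = lext (\<lambda>p. lmul (cobar H) B w (case p of (h, x) \<Rightarrow>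
      ksign (gdeg H h + (n + 1) * gdeg B x) \<cdot> (ssv (h \<otimes> a) \<boxtimes> x))) (\<nu> b)"
    unfolding letter_def using N.nu_fsupp[OF assms(1)] by (rule T.lmul_lext) auto
  also have "\<dots> = lext (\<lambda>(h, x). ksign (gdeg H h + (n + 1) * gdeg B x) \<cdot> ((w \<star> ssv (h \<otimes> a)) \<boxtimes> x)) (\<nu> b)"
    using assms N.nu_basis[OF assms(1)]
    by (intro lext_cong) (auto simp: T.lmul_linear T.lmul_tens W_carrier, simp add: cobar_simps)
  finally show ?thesis .
qed

lemma iV_tens: "b \<in> carrier B \<Longrightarrow> w \<in> W \<Longrightarrow> x \<in> carrier B \<Longrightarrow> T.iV b \<diamondop> (w \<boxtimes> x) = rmul (cobar H) B (\<tau> b w) x"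
  by (simp add: X.tmul_tens W_carrier T.lmul_one)

text \<open>Split the coaction on b' by the degree of h'. The terms with |h'| = 0 add up to 1
  \<otimes> b' by the counit law and yield RR b \<cdot> b'. In those with |h'| > 0 the formula for a
  letter identifies s^-1 (h h') \<otimes> x x' with the product of b and s^-1 h' \<otimes> x', which
  yields b \<cdot> RR b'. The first kind is invisible in RR b' because s^-1 kills it.\<close>

lemma RR_mult:
  assumes b: "b \<in> hcomp B m" and b': "b' \<in> carrier B"
  shows "RR (b \<otimes>\<^bsub>B\<^esub> b') = RR b \<diamondop> T.iV b' + ksign m \<cdot> (T.iV b \<diamondop> RR b')"
proof -
  note bc = B.hcomp_carrier[OF b]
  let ?G = "\<lambda>h' x'. lext (\<lambda>(h, x). ssv (h \<otimes> h') \<boxtimes> (x \<otimes>\<^bsub>B\<^esub> x')) (\<nu> b)"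
  let ?P = "\<lambda>h x h' x'. ksign (gdeg B x * gdeg H h') \<cdot> (ssv (h \<otimes> h') \<boxtimes> (x \<otimes>\<^bsub>B\<^esub> x'))"
  have "RR (b \<otimes>\<^bsub>B\<^esub> b') = lext (\<lambda>(h, x). lext (\<lambda>(h', x'). ?P h x h' x') (\<nu> b')) (\<nu> b)"
    unfolding RR_def N.nu_mult[OF bc b']
    using N.nu_basis[OF bc] N.nu_basis[OF b']
    by (intro lext_cong, clarify, intro lext_cong, clarify) (simp add: N.lext_tens[OF mbil_ssv_wt])
  also have "\<dots> = lext (\<lambda>(h', x'). lext (\<lambda>(h, x). ?P h x h' x') (\<nu> b)) (\<nu> b')"
    unfolding split_def by (rule lext_swap)
  also have "\<dots> = lext (\<lambda>p. (case p of (h', x') \<Rightarrow> if gdeg H h' = 0 then ?G h' x' else 0) +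
      ksign m \<cdot> (T.iV b \<diamondop> (case p of (h', x') \<Rightarrow> ssv h' \<boxtimes> x'))) (\<nu> b')"
  proof (intro lext_cong, clarify)
    fix h' x' assume "\<nu> b' (h', x') \<noteq> 0"
    from N.nu_basis[OF b' this]
    have hx: "h' \<in> hbasis H" "h' \<in> hcomp H (gdeg H h')" "h' \<in> carrier H" "x' \<in> carrier B"
      using hbasis_hcomp by auto
    show "lext (\<lambda>(h, x). ?P h x h' x') (\<nu> b) =
      (if gdeg H h' = 0 then ?G h' x' else 0) + ksign m \<cdot> (T.iV b \<diamondop> (ssv h' \<boxtimes> x'))"
    proof (cases "gdeg H h' = 0")
      case True
      then show ?thesis
        using ssv_nonpos[OF hx(2)] by (simp add: W_zero X.tmul_linear)
    next
      case False
      then have pos: "gdeg H h' > 0"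
        using hbasis_degree[OF hx(1)] by simp
      have "ksign m \<cdot> (T.iV b \<diamondop> (ssv h' \<boxtimes> x')) = ksign m \<cdot> lext (\<lambda>(h, x).
          ksign (gdeg H h + (gdeg H h' + 1) * gdeg B x) \<cdot> (ssv (h \<otimes> h') \<boxtimes> (x \<otimes>\<^bsub>B\<^esub> x'))) (\<nu> b)"
        using hx bc by (simp add: iV_tens tau_ssv[OF hx(2) pos] rmul_letter)
      also have "\<dots> = lext (\<lambda>(h, x). ?P h x h' x') (\<nu> b)"
        unfolding lext_fun_scale[symmetric]
      proof (intro lext_cong, clarify)
        fix h x assume "\<nu> b (h, x) \<noteq> 0"
        from N.nu_supp(7)[OF b this]
        have "ksign m * ksign (gdeg H h + (gdeg H h' + 1) * gdeg B x) = (ksign (gdeg B x * gdeg H h') :: 'r)"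
          unfolding ksign_add[symmetric] by (intro ksign_cong) (simp; blast)
        then show "ksign m \<cdot> ksign (gdeg H h + (gdeg H h' + 1) * gdeg B x) \<cdot>
            (ssv (h \<otimes> h') \<boxtimes> (x \<otimes>\<^bsub>B\<^esub> x')) = ?P h x h' x'"
          by simp
      qed
      finally show ?thesis
        using False by simp
    qed
  qed
  also have "\<dots> = lext (\<lambda>(h', x'). if gdeg H h' = 0 then ?G h' x' else 0) (\<nu> b') +
      ksign m \<cdot> lext (\<lambda>p. T.iV b \<diamondop> (case p of (h', x') \<Rightarrow> ssv h' \<boxtimes> x')) (\<nu> b')"
    unfolding lext_fun_add lext_fun_scale ..
  also have "lext (\<lambda>p. T.iV b \<diamondop> (case p of (h', x') \<Rightarrow> ssv h' \<boxtimes> x')) (\<nu> b') = T.iV b \<diamondop> RR b'"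
    unfolding RR_def using N.nu_fsupp[OF b'] by (intro X.tmul_lext_right[symmetric]) auto
  also have "lext (\<lambda>(h', x'). if gdeg H h' = 0 then ?G h' x' else 0) (\<nu> b') = ?G \<one> b'"
  proof (rule nu_0[where Y = KB, OF _ _ b'])
    show "mlin H KB (\<lambda>h. ?G h x)" for x
      unfolding split_def using N.nu_basis[OF bc] by (intro mlin_lext_fun mlin_ssv_mult(2)) auto
    show "mlin B KB (?G \<one>)"
    proof (rule mlin_lext_fun, clarify)
      fix h x assume "\<nu> b (h, x) \<noteq> 0"
      then have "x \<in> carrier B"
        using N.nu_basis[OF bc] by auto
      then show "mlin B KB (\<lambda>y. ssv (h \<otimes> \<one>) \<boxtimes> (x \<otimes>\<^bsub>B\<^esub> y))"
        using mlinD[OF T.mlin_tens(2)] by (intro mlinI) (auto simp: B.r_distr B.smult_mult)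
    qed
  qed
  also have "?G \<one> b' = RR b \<diamondop> T.iV b'"
  proof -
    have "rmul (cobar H) B (RR b) b' = lext (\<lambda>p. rmul (cobar H) B (case p of (h, x) \<Rightarrow> ssv h \<boxtimes> x) b') (\<nu> b)"
      unfolding RR_def using N.nu_fsupp[OF bc] by (rule T.rmul_lext) auto
    also have "\<dots> = ?G \<one> b'"
      using b' N.nu_basis[OF bc] by (intro lext_cong) (auto simp: T.rmul_tens W_carrier)
    finally show ?thesis
      using X.rmul_eq[OF RR_K[OF bc] b'] by simp
  qed
  finally show ?thesis .
qed

lemma DV_mult:
  assumes "b \<in> carrier B" and b': "b' \<in> carrier B"
  shows "DV (b \<otimes>\<^bsub>B\<^esub> b') = DV b \<diamondop> T.iV b' + T.sg (T.iV b) \<diamondop> DV b'"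
proof (rule B.mlin_eqI[OF _ _ assms(1)])
  show "mlin B KB (\<lambda>b. DV (b \<otimes>\<^bsub>B\<^esub> b'))"
    using b' by (intro mlinI) (auto simp: mlinD[OF mlin_DV] B.l_distr B.smult_mult)
  show "mlin B KB (\<lambda>b. DV b \<diamondop> T.iV b' + T.sg (T.iV b) \<diamondop> DV b')"
    by (intro mlin_add X.mlin_tmul_left mlin_DV T.mlin_sg T.mlin_tens)
  fix b assume b: "b \<in> hbasis B" "b \<in> hcomp B (gdeg B b)"
  let ?m = "gdeg B b"
  have "T.sg (T.iV b) = ksign ?m \<cdot> T.iV b"
    using T.sg_tens[OF C.one_hcomp b(2)] by simp
  then show "DV (b \<otimes>\<^bsub>B\<^esub> b') = DV b \<diamondop> T.iV b' + T.sg (T.iV b) \<diamondop> DV b'"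
    using b b' by (simp add: DV_def B.dif_leibniz[OF b(2)] RR_mult[OF b(2) b'] T.tens_add T.tens_smult
        X.iV_mult X.tmul_linear fscale_add algebra_simps)
qed

text \<open>Brings the fields of \<open>left_cobar\<close> into the shape required by
  \<open>twisted_alg\<close>. The multiplication is \<open>tmul\<close> because
  \<open>\<tau>\<close> is the linear extension of \<open>left_swap\<close> over words.\<close>

lemma left_cobar_simps:
  "carrier (left_cobar (H, B)) = carrier (tensor (cobar H) B)" "add (left_cobar (H, B)) = (+)"
  "zero (left_cobar (H, B)) = 0" "smult (left_cobar (H, B)) = (\<cdot>)"
  "hcomp (left_cobar (H, B)) = hcomp (tensor (cobar H) B)"
  "one (left_cobar (H, B)) = \<one>\<^bsub>cobar H\<^esub> \<boxtimes> \<one>\<^bsub>B\<^esub>"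
  "mult (left_cobar (H, B)) = tmul (cobar H) B \<tau>" "dif (left_cobar (H, B)) = left_dif H B"
  by (simp_all add: left_cobar_def tensor_simps fun_eq_iff left_mult_def tmul_def \<tau>_def cobar_simps)

sublocale Y: twisted_dif "cobar H" B \<tau> "left_cobar (H, B)" DU DV
proof unfold_locales
  show "DU (u \<otimes>\<^bsub>cobar H\<^esub> u') = DU u \<diamondop> T.iU u' + T.sg (T.iU u) \<diamondop> DU u'"
    if "u \<in> carrier (cobar H)" "u' \<in> carrier (cobar H)" for u u'
    using that DU_mult by (simp add: cobar_simps)
qed (simp_all add: left_cobar_simps mlin_DU mlin_DV DU_hcomp DV_hcomp DV_mult)

text \<open>Recovers the explicit formula for D from the abstract derivation. The degree k fixes the
  sign, so u can be any homogeneous element and not just a basis element.\<close>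

lemma DD_wt:
  assumes u: "u \<in> hcomp (cobar H) k" and b: "b \<in> carrier B"
  shows "Y.DD (u \<boxtimes> b) = d\<Omega> u \<boxtimes> b + ksign k \<cdot> (u \<boxtimes> dif B b) +
    ksign k \<cdot> lext (\<lambda>(h, x). (u \<star> ssv h) \<boxtimes> x) (\<nu> b)"
proof -
  have uc: "u \<in> carrier (cobar H)" "u \<in> W"
    using C.hcomp_carrier[OF u] by (simp_all add: cobar_simps)
  have "lmul (cobar H) B u (RR b) = lext (\<lambda>p. lmul (cobar H) B u (case p of (h, x) \<Rightarrow> ssv h \<boxtimes> x)) (\<nu> b)"
    unfolding RR_def using N.nu_fsupp[OF b] by (rule T.lmul_lext) auto
  also have "\<dots> = lext (\<lambda>(h, x). (u \<star> ssv h) \<boxtimes> x) (\<nu> b)"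
    using uc N.nu_basis[OF b] by (intro lext_cong) (auto simp: T.lmul_tens W_carrier, simp add: cobar_simps)
  finally have "lmul (cobar H) B u (DV b) = u \<boxtimes> dif B b + lext (\<lambda>(h, x). (u \<star> ssv h) \<boxtimes> x) (\<nu> b)"
    using uc b by (simp add: DV_def T.lmul_linear T.lmul_tens)
  moreover have "DU u \<diamondop> T.iV b = d\<Omega> u \<boxtimes> b"
    using uc b by (simp add: DU_def X.tens_eq W_carrier)
  moreover have "DV b \<in> T.K"
    using mlinD(1)[OF mlin_DV b] .
  ultimately show ?thesis
    using uc b Y.sg_iU[OF u]
    by (simp add: Y.DD_tens X.tmul_linear fscale_add add.assoc flip: X.lmul_eq)
qed

lemma DD_DU: "w \<in> W \<Longrightarrow> Y.DD (DU w) = 0"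
  using Y.DD_iU[of "d\<Omega> w"] by (simp add: DU_def cobar_simps d\<Omega>_d\<Omega> W_zero)

lemma CG_wt:
  assumes "h \<in> carrier H"
  shows "CG h \<boxtimes> x = - (ssv (dif H h) \<boxtimes> x) + lext (\<lambda>(c, c'). ksign (gdeg H c) \<cdot> ((ssv c \<star> ssv c') \<boxtimes> x)) (comult H h)"
proof -
  let ?\<beta> = "\<lambda>(x, y). ksign (gdeg H x) \<cdot> (ssv x \<star> ssv y)"
  have L: "lext ?\<beta> (comult H h) \<in> W"
    by (intro lext_fsupp) (auto intro!: tmult_fsupp)
  have "lext ?\<beta> (comult H h) \<boxtimes> x = lext (\<lambda>p. ?\<beta> p \<boxtimes> x) (comult H h)"
    using D.nu_fsupp[OF assms] by (rule W_lext) (auto intro!: tmult_fsupp)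
  also have "\<dots> = lext (\<lambda>(c, c'). ksign (gdeg H c) \<cdot> ((ssv c \<star> ssv c') \<boxtimes> x)) (comult H h)"
    by (intro lext_cong) (auto simp: W_scale tmult_fsupp)
  finally show ?thesis
    using L W_add[of "- ssv (dif H h)" "lext ?\<beta> (comult H h)" x] by (simp add: CG_def W_minus)
qed

text \<open>As the coaction is a chain map, the terms with one letter in D(RR b) are -RR(db), which
  cancel against the twisted part of D(1 \<otimes> db). The terms with two letters come from the
  coproduct of h and from the coaction on x, with opposite signs.\<close>

lemma DD_DV:
  assumes b: "b \<in> carrier B"
  shows "Y.DD (DV b) = 0"
proof -
  let ?\<beta> = "\<lambda>x y s. ksign (gdeg H x) \<cdot> ((ssv x \<star> ssv y) \<boxtimes> s)"
  have 1: "RR (dif B b) = lext (\<lambda>(h, x). ssv (dif H h) \<boxtimes> x + ksign (gdeg H h) \<cdot> (ssv h \<boxtimes> dif B x)) (\<nu> b)"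
    unfolding RR_def N.nu_dif[OF b] using N.nu_basis[OF b]
    by (intro lext_cong) (auto simp: N.lext_tens[OF mbil_ssv_wt])
  have 2: "Y.DD (ssv h \<boxtimes> x) = - (ssv (dif H h) \<boxtimes> x + ksign (gdeg H h) \<cdot> (ssv h \<boxtimes> dif B x)) +
      (lext (\<lambda>(h1, h2). ?\<beta> h1 h2 x) (comult H h) + - lext (\<lambda>(h', x'). ?\<beta> h h' x') (\<nu> x))"
    if "\<nu> b (h, x) \<noteq> 0" for h x
  proof -
    have hx: "h \<in> hcomp H (gdeg H h)" "h \<in> carrier H" "x \<in> carrier B"
      using N.nu_basis[OF b that] hbasis_hcomp by auto
    have "lext (\<lambda>(h', x'). ?\<beta> h h' x') (\<nu> x) = ksign (gdeg H h) \<cdot> lext (\<lambda>(h', x'). (ssv h \<star> ssv h') \<boxtimes> x') (\<nu> x)"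
      unfolding split_def by (rule lext_fun_scale)
    then show ?thesis
      using hx by (simp add: DD_wt[OF ssv_hcomp[OF hx(1)] hx(3)] d\<Omega>_ssv CG_wt ksign_diff_one)
  qed
  have "Y.DD (RR b) = lext (\<lambda>p. Y.DD (case p of (h, x) \<Rightarrow> ssv h \<boxtimes> x)) (\<nu> b)"
    unfolding RR_def using N.nu_fsupp[OF b] by (rule Y.DD_lext) auto
  also have "\<dots> = lext (\<lambda>p. - (case p of (h, x) \<Rightarrow> ssv (dif H h) \<boxtimes> x + ksign (gdeg H h) \<cdot> (ssv h \<boxtimes> dif B x)) +
      ((case p of (h, x) \<Rightarrow> lext (\<lambda>(h1, h2). ?\<beta> h1 h2 x) (comult H h)) +
       - (case p of (h, x) \<Rightarrow> lext (\<lambda>(h', x'). ?\<beta> h h' x') (\<nu> x)))) (\<nu> b)"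
    by (intro lext_cong) (auto simp: 2)
  also have "\<dots> = - RR (dif B b) + (lext (\<lambda>(h, x). lext (\<lambda>(h1, h2). ?\<beta> h1 h2 x) (comult H h)) (\<nu> b) +
      - lext (\<lambda>(h, x). lext (\<lambda>(h', x'). ?\<beta> h h' x') (\<nu> x)) (\<nu> b))"
    unfolding lext_fun_add lext_fun_minus 1 ..
  also have "lext (\<lambda>(h, x). lext (\<lambda>(h1, h2). ?\<beta> h1 h2 x) (comult H h)) (\<nu> b) =
      lext (\<lambda>(h, x). lext (\<lambda>(h', x'). ?\<beta> h h' x') (\<nu> x)) (\<nu> b)"
    by (rule nu_coassoc[where Y = KB, OF _ b]) auto
  finally have "Y.DD (RR b) = - RR (dif B b)"
    by simp
  then show ?thesis
    using b Y.DD_iV[of "dif B b"] by (simp add: DV_def[of b] Y.DD_linear) (simp add: DV_def)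
qed

text \<open>The two sides of the Leibniz rule for \<open>(1 \<otimes> b)(s\<^sup>-\<^sup>1a \<otimes> 1)\<close> are compared separately in the terms
  that are linear and in those that are quadratic in letters.\<close>

lemma swap_linear:
  assumes a: "a \<in> hcomp H n" and b: "b \<in> hcomp B m"
  shows "lext (\<lambda>(h, x). ksign (gdeg H h + (n + 1) * gdeg B x) \<cdot>
      (- (ssv (dif H (h \<otimes> a)) \<boxtimes> x) + ksign (gdeg H h + n - 1) \<cdot> (ssv (h \<otimes> a) \<boxtimes> dif B x))) (\<nu> b) =
    letter n a (dif B b) + - (ksign m \<cdot> letter (n - 1) (dif H a) b)"
proof -
  note ac = hcomp_carrier[OF a] and bc = B.hcomp_carrier[OF b]
  let ?\<gamma> = "\<lambda>(h, x). ksign (gdeg H h + (n + 1) * gdeg B x) \<cdot> (ssv (h \<otimes> a) \<boxtimes> x)"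
  let ?t = "\<lambda>h x. ksign (gdeg H h + (n - 1 + 1) * gdeg B x) \<cdot> (ssv (h \<otimes> dif H a) \<boxtimes> x)"
  have "letter n a (dif B b) + - (ksign m \<cdot> letter (n - 1) (dif H a) b) = lext (\<lambda>p. (case p of (h, x) \<Rightarrow>
      lext ?\<gamma> (tens H B (dif H h) x) + ksign (gdeg H h) \<cdot> lext ?\<gamma> (tens H B h (dif B x))) +
      - (ksign m \<cdot> (case p of (h, x) \<Rightarrow> ?t h x))) (\<nu> b)"
    unfolding letter_def N.nu_dif[OF bc] lext_fun_add lext_fun_minus lext_fun_scale ..
  also have "\<dots> = lext (\<lambda>(h, x). ksign (gdeg H h + (n + 1) * gdeg B x) \<cdot>
      (- (ssv (dif H (h \<otimes> a)) \<boxtimes> x) + ksign (gdeg H h + n - 1) \<cdot> (ssv (h \<otimes> a) \<boxtimes> dif B x))) (\<nu> b)"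
  proof (intro lext_cong, clarify)
    fix h x assume "\<nu> b (h, x) \<noteq> 0"
    note s = N.nu_supp[OF b this]
    let ?h = "gdeg H h" and ?x = "gdeg B x"
    have 1: "lext ?\<gamma> (tens H B (dif H h) x) = ksign (?h - 1 + (n + 1) * ?x) \<cdot> (ssv (dif H h \<otimes> a) \<boxtimes> x)"
      by (rule N.lext_tens_hcomp[OF mbil_letter[OF ac] dif_hcomp[OF s(3)] s(4)]) simp
    have 2: "lext ?\<gamma> (tens H B h (dif B x)) = ksign (?h + (n + 1) * (?x - 1)) \<cdot> (ssv (h \<otimes> a) \<boxtimes> dif B x)"
      by (rule N.lext_tens_hcomp[OF mbil_letter[OF ac] s(3) B.dif_hcomp[OF s(4)]]) simp
    have "ssv (dif H (h \<otimes> a)) = ssv (dif H h \<otimes> a) + ksign ?h \<cdot> ssv (h \<otimes> dif H a)"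
      using s ac by (simp add: dif_leibniz[OF s(3)] mlinD[OF mlin_ssv])
    then have 3: "ssv (dif H (h \<otimes> a)) \<boxtimes> x = ssv (dif H h \<otimes> a) \<boxtimes> x + ksign ?h \<cdot> (ssv (h \<otimes> dif H a) \<boxtimes> x)"
      by (simp add: W_add W_scale)
    have 4: "ksign (?h - 1 + (n + 1) * ?x) = - (ksign (?h + (n + 1) * ?x) :: 'r)"
      by (rule ksign_neg) (simp, argo)
    have 5: "ksign ?h * ksign (?h + (n + 1) * (?x - 1)) = (ksign (?h + (n + 1) * ?x) * ksign (?h + n - 1) :: 'r)"
      unfolding ksign_add[symmetric] by (rule ksign_cong) (simp, argo)
    have 6: "ksign m * ksign (?h + (n - 1 + 1) * ?x) = (ksign (?h + (n + 1) * ?x) * ksign ?h :: 'r)"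
      unfolding ksign_add[symmetric] s(7) by (rule ksign_cong) (simp, argo)
    show "lext ?\<gamma> (tens H B (dif H h) x) + ksign ?h \<cdot> lext ?\<gamma> (tens H B h (dif B x)) + - (ksign m \<cdot> ?t h x) =
      ksign (?h + (n + 1) * ?x) \<cdot>
        (- (ssv (dif H (h \<otimes> a)) \<boxtimes> x) + ksign (?h + n - 1) \<cdot> (ssv (h \<otimes> a) \<boxtimes> dif B x))"
      unfolding 1 2 3 4 fscale_fscale 5 6 fscale_add fscale_minus by simp
  qed
  finally show ?thesis ..
qed

section \<open>Quadratic terms in the Leibniz rule for b and a letter\<close>

lemma tau_pair:
  assumes b: "b \<in> carrier B" and a: "a \<in> hcomp H n" "n > 0" and a': "a' \<in> hcomp H n'" "n' > 0"
  shows "\<tau> b (ssv a \<star> ssv a') = lext (\<lambda>(h, x). lext (\<lambda>(h', x').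
    (ksign (gdeg H h + (n + 1) * gdeg B x) * ksign (gdeg H h' + (n' + 1) * gdeg B x')) \<cdot>
      ((ssv (h \<otimes> a) \<star> ssv (h' \<otimes> a')) \<boxtimes> x')) (\<nu> x)) (\<nu> b)"
proof -
  have "\<tau> b (ssv a \<star> ssv a') = T.lact (\<lambda>d. \<tau> d (ssv a')) (letter n a b)"
    using b by (simp add: tau_right tau_ssv[OF a])
  also have "\<dots> = lext (\<lambda>p. T.lact (\<lambda>d. \<tau> d (ssv a')) (case p of (h, x) \<Rightarrow>
      ksign (gdeg H h + (n + 1) * gdeg B x) \<cdot> (ssv (h \<otimes> a) \<boxtimes> x))) (\<nu> b)"
    unfolding letter_def using N.nu_fsupp[OF b] by (rule T.lact_lext) auto
  also have "\<dots> = lext (\<lambda>(h, x). lext (\<lambda>(h', x').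
    (ksign (gdeg H h + (n + 1) * gdeg B x) * ksign (gdeg H h' + (n' + 1) * gdeg B x')) \<cdot>
      ((ssv (h \<otimes> a) \<star> ssv (h' \<otimes> a')) \<boxtimes> x')) (\<nu> x)) (\<nu> b)"
  proof (intro lext_cong, clarify)
    fix h x assume "\<nu> b (h, x) \<noteq> 0"
    then have x: "x \<in> carrier B"
      using N.nu_basis[OF b] by auto
    have "T.lact (\<lambda>d. \<tau> d (ssv a')) (ksign (gdeg H h + (n + 1) * gdeg B x) \<cdot> (ssv (h \<otimes> a) \<boxtimes> x)) =
      ksign (gdeg H h + (n + 1) * gdeg B x) \<cdot> lmul (cobar H) B (ssv (h \<otimes> a)) (letter n' a' x)"
      using x by (simp add: T.lact_linear T.lact_tens[OF mlin_tau] W_carrier tau_ssv[OF a'])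
    also have "\<dots> = lext (\<lambda>(h', x'). (ksign (gdeg H h + (n + 1) * gdeg B x) *
        ksign (gdeg H h' + (n' + 1) * gdeg B x')) \<cdot> ((ssv (h \<otimes> a) \<star> ssv (h' \<otimes> a')) \<boxtimes> x')) (\<nu> x)"
      unfolding lmul_letter[OF x ssv_W hcomp_carrier[OF a'(1)]] lext_fun_scale[symmetric]
      by (simp add: split_def)
    finally show "T.lact (\<lambda>d. \<tau> d (ssv a')) (ksign (gdeg H h + (n + 1) * gdeg B x) \<cdot> (ssv (h \<otimes> a) \<boxtimes> x)) =
      lext (\<lambda>(h', x'). (ksign (gdeg H h + (n + 1) * gdeg B x) * ksign (gdeg H h' + (n' + 1) * gdeg B x')) \<cdot>
        ((ssv (h \<otimes> a) \<star> ssv (h' \<otimes> a')) \<boxtimes> x')) (\<nu> x)" .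
  qed
  finally show ?thesis .
qed

lemma mbil_pair:
  assumes "h \<in> carrier H" "h' \<in> carrier H"
  shows "mbil H H KB (\<lambda>a a'. r \<cdot> ((ssv (h \<otimes> a) \<star> ssv (h' \<otimes> a')) \<boxtimes> x))"
  using assms by (intro mbilI mlin_scale mlin_wt1)
    (auto intro!: mlin_tmult_left mlin_tmult_right mlin_smult_left[OF mlin_ssv])

lemma mbil_ssv_pair: "mbil H H KB (\<lambda>c c'. r \<cdot> ((ssv c \<star> ssv c') \<boxtimes> x))"
  by (intro mbilI mlin_scale mlin_wt1) (auto intro!: mlin_tmult_left mlin_tmult_right mlin_ssv)

text \<open>In the coproduct of \<open>a\<close>, the terms \<open>1 \<otimes> a\<close> and \<open>a \<otimes> 1\<close> account for the twisted parts of the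
  differential.\<close>

lemma swap_quadratic:
  assumes a: "a \<in> hcomp H n" "n > 0" and b: "b \<in> hcomp B m"
  shows "lext (\<lambda>(h, x). ksign (gdeg H h + (n + 1) * gdeg B x) \<cdot>
      (lext (\<lambda>(c, c'). ksign (gdeg H c) \<cdot> ((ssv c \<star> ssv c') \<boxtimes> x)) (comult H (h \<otimes> a)) +
       ksign (gdeg H h + n - 1) \<cdot> lext (\<lambda>(h', x'). (ssv (h \<otimes> a) \<star> ssv h') \<boxtimes> x') (\<nu> x))) (\<nu> b) =
    lext (\<lambda>(h, x). lmul (cobar H) B (ssv h) (letter n a x)) (\<nu> b) +
    ksign m \<cdot> lext (\<lambda>(a1, a2). ksign (gdeg H a1) \<cdot> \<tau> b (ssv a1 \<star> ssv a2)) (comult H a)"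
proof -
  note ac = hcomp_carrier[OF a(1)] and bc = B.hcomp_carrier[OF b]
  let ?k = "\<lambda>h' x a1. ksign (gdeg H h' + (n + 1) * gdeg B x + gdeg H h' * gdeg H a1 + gdeg H a1) :: 'r"
  let ?w = "\<lambda>h a1 h' a2 x. (ssv (h \<otimes> a1) \<star> ssv (h' \<otimes> a2)) \<boxtimes> x"
  let ?\<beta> = "\<lambda>h h' x. lext (\<lambda>(a1, a2). ?k h' x a1 \<cdot> ?w h a1 h' a2 x) (comult H a)"
  let ?\<Theta> = "\<lambda>a1 a2 h h' x. if gdeg H a1 > 0 \<and> gdeg H a2 > 0 then ?k h' x a1 \<cdot> ?w h a1 h' a2 x else 0"
  let ?M = "\<lambda>h h' x. lext (\<lambda>(a1, a2). ?\<Theta> a1 a2 h h' x) (comult H a)"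
  let ?G1 = "\<lambda>h h' x. ksign (gdeg H h' + (n + 1) * gdeg B x) \<cdot> ((ssv h \<star> ssv (h' \<otimes> a)) \<boxtimes> x)"
  let ?G2 = "\<lambda>h h' x. ksign (gdeg H h' + (n + 1) * gdeg B x + gdeg H h' * n + n) \<cdot> ((ssv (h \<otimes> a) \<star> ssv h') \<boxtimes> x)"
  \<comment> \<open>Multiplicativity of the coproduct expands h \<cdot> a. The sign
    \<open>?k\<close> collects the sign of the letter, the Koszul sign for exchanging h2 and a1, and
    the sign in the cobar differential; |h| = |h1| + |h2| removes h1 from it.\<close>
  have A: "ksign (gdeg H h + (n + 1) * gdeg B x) \<cdot>
      lext (\<lambda>(c, c'). ksign (gdeg H c) \<cdot> ((ssv c \<star> ssv c') \<boxtimes> x)) (comult H (h \<otimes> a)) =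
    lext (\<lambda>(h1, h2). ?\<beta> h1 h2 x) (comult H h)"
    if h: "h \<in> hcomp H (gdeg H h)" for h x
  proof -
    let ?\<gamma> = "\<lambda>(c, c'). ksign (gdeg H c) \<cdot> ((ssv c \<star> ssv c') \<boxtimes> x)"
    show ?thesis
      unfolding D.nu_mult[OF hcomp_carrier[OF h] ac]
    proof (subst lext_fun_scale[symmetric], rule lext_cong, clarify)
      fix h1 h2 assume "comult H h (h1, h2) \<noteq> 0"
      note s = D.nu_supp[OF h this]
      show "ksign (gdeg H h + (n + 1) * gdeg B x) \<cdot> lext (\<lambda>(x', y').
          ksign (gdeg H h2 * gdeg H x') \<cdot> lext ?\<gamma> (tens H H (h1 \<otimes> x') (h2 \<otimes> y'))) (comult H a) = ?\<beta> h1 h2 x"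
      proof (subst lext_fun_scale[symmetric], rule lext_cong, clarify)
        fix a1 a2 assume "comult H a (a1, a2) \<noteq> 0"
        note t = D.nu_supp[OF a(1) this]
        have "lext ?\<gamma> (tens H H (h1 \<otimes> a1) (h2 \<otimes> a2)) = ksign (gdeg H h1 + gdeg H a1) \<cdot> ?w h1 a1 h2 a2 x"
          by (rule D.lext_tens_hcomp[OF mbil_ssv_pair mult_hcomp[OF s(3) t(3)] mult_hcomp[OF s(4) t(4)]]) simp
        moreover have "ksign (gdeg H h + (n + 1) * gdeg B x) *
            (ksign (gdeg H h2 * gdeg H a1) * ksign (gdeg H h1 + gdeg H a1)) = ?k h2 x a1"
          unfolding ksign_add[symmetric] s(7) by (rule ksign_cong) auto
        ultimately show "ksign (gdeg H h + (n + 1) * gdeg B x) \<cdot> ksign (gdeg H h2 * gdeg H a1) \<cdot>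
            lext ?\<gamma> (tens H H (h1 \<otimes> a1) (h2 \<otimes> a2)) = ?k h2 x a1 \<cdot> ?w h1 a1 h2 a2 x"
          by simp
      qed
    qed
  qed
  \<comment> \<open>The twisted part of D(s^-1 (h a) \<otimes> x) is the negative of the
    \<open>?G2\<close> terms and will cancel against them.\<close>
  have E: "ksign (gdeg H h + (n + 1) * gdeg B x) \<cdot> ksign (gdeg H h + n - 1) \<cdot>
      lext (\<lambda>(h', x'). (ssv (h \<otimes> a) \<star> ssv h') \<boxtimes> x') (\<nu> x) = - lext (\<lambda>(h', x'). ?G2 h h' x') (\<nu> x)"
    if x: "x \<in> hcomp B (gdeg B x)" for h x
    unfolding lext_fun_scale[symmetric] lext_fun_minus[symmetric]
  proof (intro lext_cong, clarify)
    fix h' x' assume "\<nu> x (h', x') \<noteq> 0"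
    note s = N.nu_supp[OF x this]
    have "ksign (gdeg H h + (n + 1) * gdeg B x) * ksign (gdeg H h + n - 1) =
        (- ksign (gdeg H h' + (n + 1) * gdeg B x' + gdeg H h' * n + n) :: 'r)"
      unfolding ksign_add[symmetric] s(7) by (rule ksign_neg) auto
    then show "ksign (gdeg H h + (n + 1) * gdeg B x) \<cdot> ksign (gdeg H h + n - 1) \<cdot>
        ((ssv (h \<otimes> a) \<star> ssv h') \<boxtimes> x') = - ?G2 h h' x'"
      by simp
  qed
  \<comment> \<open>In the coproduct of a, the term 1 \<otimes> a gives \<open>?G1\<close>, the term
    a \<otimes> 1 gives \<open>?G2\<close>, and \<open>?M\<close> keeps the terms with both factors
    of positive degree.\<close>
  have C: "?\<beta> h h' x = ?M h h' x + (?G1 h h' x + ?G2 h h' x)" if "h \<in> carrier H" "h' \<in> carrier H" for h h' x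
    using comult_split[OF a mbil_pair[OF that] mbil_pair[OF that],
        of "\<lambda>a1 a2. ?k h' x a1 \<cdot> ?w h a1 h' a2 x" "ksign (gdeg H h' + (n + 1) * gdeg B x)" x
          "ksign (gdeg H h' + (n + 1) * gdeg B x + gdeg H h' * n + n)" x] that
    by simp
  have F: "lmul (cobar H) B (ssv h) (letter n a x) = lext (\<lambda>(h', x'). ?G1 h h' x') (\<nu> x)" if "x \<in> carrier B" for h x
    by (rule lmul_letter[OF that ssv_W ac])
  \<comment> \<open>The terms in \<open>?M\<close> are those that arise when b is moved past s^-1 a1
    s^-1 a2, so they account for the quadratic part of the cobar differential of s^-1 a. If a1 or a2
    has degree 0, both sides vanish.\<close>
  have D: "lext (\<lambda>(h, x). lext (\<lambda>(h', x'). ?M h h' x') (\<nu> x)) (\<nu> b) =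
    ksign m \<cdot> lext (\<lambda>(a1, a2). ksign (gdeg H a1) \<cdot> \<tau> b (ssv a1 \<star> ssv a2)) (comult H a)"
  proof -
    have "ksign m \<cdot> lext (\<lambda>(a1, a2). ksign (gdeg H a1) \<cdot> \<tau> b (ssv a1 \<star> ssv a2)) (comult H a) =
      lext (\<lambda>p. lext (\<lambda>q. lext (\<lambda>q'. ?\<Theta> (fst p) (snd p) (fst q) (fst q') (snd q')) (\<nu> (snd q))) (\<nu> b)) (comult H a)"
      unfolding lext_fun_scale[symmetric]
    proof (intro lext_cong, clarify)
      fix a1 a2 assume "comult H a (a1, a2) \<noteq> 0"
      note t = D.nu_supp[OF a(1) this]
      show "ksign m \<cdot> ksign (gdeg H a1) \<cdot> \<tau> b (ssv a1 \<star> ssv a2) =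
        lext (\<lambda>q. lext (\<lambda>q'. ?\<Theta> (fst (a1, a2)) (snd (a1, a2)) (fst q) (fst q') (snd q')) (\<nu> (snd q))) (\<nu> b)"
      proof (cases "gdeg H a1 > 0 \<and> gdeg H a2 > 0")
        case True
        then have "ksign m \<cdot> ksign (gdeg H a1) \<cdot> \<tau> b (ssv a1 \<star> ssv a2) =
          ksign m \<cdot> ksign (gdeg H a1) \<cdot> lext (\<lambda>(h, x). lext (\<lambda>(h', x').
            (ksign (gdeg H h + (gdeg H a1 + 1) * gdeg B x) * ksign (gdeg H h' + (gdeg H a2 + 1) * gdeg B x')) \<cdot>
              ?w h a1 h' a2 x') (\<nu> x)) (\<nu> b)"
          using tau_pair[OF bc t(3) _ t(4)] by simp
        also have "\<dots> = lext (\<lambda>(h, x). lext (\<lambda>(h', x'). ?k h' x' a1 \<cdot> ?w h a1 h' a2 x') (\<nu> x)) (\<nu> b)"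
          unfolding lext_fun_scale[symmetric]
        proof (intro lext_cong, clarify)
          fix h x assume "\<nu> b (h, x) \<noteq> 0"
          note s = N.nu_supp[OF b this]
          show "ksign m \<cdot> ksign (gdeg H a1) \<cdot> lext (\<lambda>(h', x').
            (ksign (gdeg H h + (gdeg H a1 + 1) * gdeg B x) * ksign (gdeg H h' + (gdeg H a2 + 1) * gdeg B x')) \<cdot>
              ?w h a1 h' a2 x') (\<nu> x) = lext (\<lambda>(h', x'). ?k h' x' a1 \<cdot> ?w h a1 h' a2 x') (\<nu> x)"
            unfolding lext_fun_scale[symmetric]
          proof (intro lext_cong, clarify)
            fix h' x' assume "\<nu> x (h', x') \<noteq> 0"
            note s' = N.nu_supp[OF s(4) this]
            have "ksign m * (ksign (gdeg H a1) * (ksign (gdeg H h + (gdeg H a1 + 1) * gdeg B x) *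
                ksign (gdeg H h' + (gdeg H a2 + 1) * gdeg B x'))) = ?k h' x' a1"
              unfolding ksign_add[symmetric] s(7) s'(7) t(7) by (rule ksign_cong) auto
            then show "ksign m \<cdot> ksign (gdeg H a1) \<cdot> (ksign (gdeg H h + (gdeg H a1 + 1) * gdeg B x) *
                ksign (gdeg H h' + (gdeg H a2 + 1) * gdeg B x')) \<cdot> ?w h a1 h' a2 x' = ?k h' x' a1 \<cdot> ?w h a1 h' a2 x'"
              by simp
          qed
        qed
        finally show ?thesis
          using True by (simp add: split_def)
      next
        case False
        then have "gdeg H a1 = 0 \<or> gdeg H a2 = 0"
          using hbasis_degree(1)[OF t(1)] hbasis_degree(1)[OF t(2)] by auto
        then have "ssv a1 \<star> ssv a2 = 0"
          using ssv_nonpos[OF t(3)] ssv_nonpos[OF t(4)] by (auto simp: tmult_linear)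
        then show ?thesis
          using False by (auto simp: tau_linear)
      qed
    qed
    also have "\<dots> = lext (\<lambda>q. lext (\<lambda>p. lext (\<lambda>q'. ?\<Theta> (fst p) (snd p) (fst q) (fst q') (snd q')) (\<nu> (snd q))) (comult H a)) (\<nu> b)"
      by (rule lext_swap)
    also have "\<dots> = lext (\<lambda>q. lext (\<lambda>q'. lext (\<lambda>p. ?\<Theta> (fst p) (snd p) (fst q) (fst q') (snd q')) (comult H a)) (\<nu> (snd q))) (\<nu> b)"
      by (intro lext_cong lext_swap)
    finally show ?thesis
      by (simp only: split_def)
  qed
  have "lext (\<lambda>(h, x). ksign (gdeg H h + (n + 1) * gdeg B x) \<cdot>
      (lext (\<lambda>(c, c'). ksign (gdeg H c) \<cdot> ((ssv c \<star> ssv c') \<boxtimes> x)) (comult H (h \<otimes> a)) +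
       ksign (gdeg H h + n - 1) \<cdot> lext (\<lambda>(h', x'). (ssv (h \<otimes> a) \<star> ssv h') \<boxtimes> x') (\<nu> x))) (\<nu> b) =
    lext (\<lambda>p. (case p of (h, x) \<Rightarrow> lext (\<lambda>(h1, h2). ?\<beta> h1 h2 x) (comult H h)) +
      - (case p of (h, x) \<Rightarrow> lext (\<lambda>(h', x'). ?G2 h h' x') (\<nu> x))) (\<nu> b)"
  proof (intro lext_cong, clarify)
    fix h x assume "\<nu> b (h, x) \<noteq> 0"
    note s = N.nu_supp[OF b this]
    show "ksign (gdeg H h + (n + 1) * gdeg B x) \<cdot>
      (lext (\<lambda>(c, c'). ksign (gdeg H c) \<cdot> ((ssv c \<star> ssv c') \<boxtimes> x)) (comult H (h \<otimes> a)) +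
       ksign (gdeg H h + n - 1) \<cdot> lext (\<lambda>(h', x'). (ssv (h \<otimes> a) \<star> ssv h') \<boxtimes> x') (\<nu> x)) =
      lext (\<lambda>(h1, h2). ?\<beta> h1 h2 x) (comult H h) + - lext (\<lambda>(h', x'). ?G2 h h' x') (\<nu> x)"
      unfolding fscale_add A[OF s(3)] E[OF s(4)] ..
  qed
  also have "\<dots> = lext (\<lambda>(h, x). lext (\<lambda>(h1, h2). ?\<beta> h1 h2 x) (comult H h)) (\<nu> b) +
      - lext (\<lambda>(h, x). lext (\<lambda>(h', x'). ?G2 h h' x') (\<nu> x)) (\<nu> b)"
    unfolding lext_fun_add lext_fun_minus ..
  \<comment> \<open>Coassociativity replaces the coproduct of h by the iterated coaction, so that
    these terms are indexed in the same way as the twisted part and can be compared with it.\<close>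
  also have "lext (\<lambda>(h, x). lext (\<lambda>(h1, h2). ?\<beta> h1 h2 x) (comult H h)) (\<nu> b) =
      lext (\<lambda>(h, x). lext (\<lambda>(h', x'). ?\<beta> h h' x') (\<nu> x)) (\<nu> b)"
    by (rule nu_coassoc[where Y = KB, OF _ bc]) (auto intro!: lext_fsupp)
  also have "\<dots> = lext (\<lambda>p. (case p of (h, x) \<Rightarrow> lext (\<lambda>(h', x'). ?M h h' x') (\<nu> x)) +
      ((case p of (h, x) \<Rightarrow> lmul (cobar H) B (ssv h) (letter n a x)) +
       (case p of (h, x) \<Rightarrow> lext (\<lambda>(h', x'). ?G2 h h' x') (\<nu> x)))) (\<nu> b)"
  proof (intro lext_cong, clarify)
    fix h x assume "\<nu> b (h, x) \<noteq> 0"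
    note s = N.nu_supp[OF b this]
    have "lext (\<lambda>(h', x'). ?\<beta> h h' x') (\<nu> x) = lext (\<lambda>p. (case p of (h', x') \<Rightarrow> ?M h h' x') +
        ((case p of (h', x') \<Rightarrow> ?G1 h h' x') + (case p of (h', x') \<Rightarrow> ?G2 h h' x'))) (\<nu> x)"
    proof (intro lext_cong, clarify)
      fix h' x' assume "\<nu> x (h', x') \<noteq> 0"
      then have "h' \<in> carrier H"
        using N.nu_basis[OF s(6)] by auto
      then show "?\<beta> h h' x' = ?M h h' x' + (?G1 h h' x' + ?G2 h h' x')"
        by (rule C[OF s(5)])
    qed
    then show "lext (\<lambda>(h', x'). ?\<beta> h h' x') (\<nu> x) = lext (\<lambda>(h', x'). ?M h h' x') (\<nu> x) +
        (lmul (cobar H) B (ssv h) (letter n a x) + lext (\<lambda>(h', x'). ?G2 h h' x') (\<nu> x))"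
      unfolding lext_fun_add F[OF s(6)] .
  qed
  also have "\<dots> = lext (\<lambda>(h, x). lext (\<lambda>(h', x'). ?M h h' x') (\<nu> x)) (\<nu> b) +
      (lext (\<lambda>(h, x). lmul (cobar H) B (ssv h) (letter n a x)) (\<nu> b) +
       lext (\<lambda>(h, x). lext (\<lambda>(h', x'). ?G2 h h' x') (\<nu> x)) (\<nu> b))"
    unfolding lext_fun_add ..
  finally show ?thesis
    unfolding D by (simp add: algebra_simps)
qed

lemma swap_ok_ssv:
  assumes a: "a \<in> E" and b: "b \<in> hcomp B m"
  shows "Y.swap_ok b (ssv a)"
proof -
  let ?n = "gdeg H a"
  note ah = E_hcomp(1)[OF a] and ac = E_hcomp(4)[OF a] and bc = B.hcomp_carrier[OF b]
  \<comment> \<open>The second inequality is where H_1 = 0 enters: \<open>tau_ssv\<close> is applied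
    to \<open>dif H a\<close>, of degree \<open>?n - 1\<close>, and its formula fails in degree
    0.\<close>
  have n: "?n > 0" "?n - 1 > 0"
    using E_degree[OF a] by auto
  have "Y.DD (\<tau> b (ssv a)) = lext (\<lambda>p. Y.DD (case p of (h, x) \<Rightarrow>
      ksign (gdeg H h + (?n + 1) * gdeg B x) \<cdot> (ssv (h \<otimes> a) \<boxtimes> x))) (\<nu> b)"
    unfolding tau_ssv[OF ah n(1) bc] letter_def using N.nu_fsupp[OF bc] by (rule Y.DD_lext) auto
  also have "\<dots> = lext (\<lambda>p. (case p of (h, x) \<Rightarrow> ksign (gdeg H h + (?n + 1) * gdeg B x) \<cdot>
      (- (ssv (dif H (h \<otimes> a)) \<boxtimes> x) + ksign (gdeg H h + ?n - 1) \<cdot> (ssv (h \<otimes> a) \<boxtimes> dif B x))) +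
    (case p of (h, x) \<Rightarrow> ksign (gdeg H h + (?n + 1) * gdeg B x) \<cdot>
      (lext (\<lambda>(c, c'). ksign (gdeg H c) \<cdot> ((ssv c \<star> ssv c') \<boxtimes> x)) (comult H (h \<otimes> a)) +
       ksign (gdeg H h + ?n - 1) \<cdot> lext (\<lambda>(h', x'). (ssv (h \<otimes> a) \<star> ssv h') \<boxtimes> x') (\<nu> x)))) (\<nu> b)"
  proof (intro lext_cong, clarify)
    fix h x assume "\<nu> b (h, x) \<noteq> 0"
    note s = N.nu_supp[OF b this]
    have ha: "h \<otimes> a \<in> hcomp H (gdeg H h + ?n)"
      by (rule mult_hcomp[OF s(3) ah])
    show "Y.DD (ksign (gdeg H h + (?n + 1) * gdeg B x) \<cdot> (ssv (h \<otimes> a) \<boxtimes> x)) =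
      ksign (gdeg H h + (?n + 1) * gdeg B x) \<cdot>
      (- (ssv (dif H (h \<otimes> a)) \<boxtimes> x) + ksign (gdeg H h + ?n - 1) \<cdot> (ssv (h \<otimes> a) \<boxtimes> dif B x)) +
      ksign (gdeg H h + (?n + 1) * gdeg B x) \<cdot>
      (lext (\<lambda>(c, c'). ksign (gdeg H c) \<cdot> ((ssv c \<star> ssv c') \<boxtimes> x)) (comult H (h \<otimes> a)) +
       ksign (gdeg H h + ?n - 1) \<cdot> lext (\<lambda>(h', x'). (ssv (h \<otimes> a) \<star> ssv h') \<boxtimes> x') (\<nu> x))"
      unfolding fscale_add[symmetric] Y.DD_linear(3)[OF T.tens_fsupp] DD_wt[OF ssv_hcomp[OF ha] s(6)]
        d\<Omega>_ssv[OF hcomp_carrier[OF ha]] CG_wt[OF hcomp_carrier[OF ha]]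
      by (simp add: algebra_simps)
  qed
  also have "\<dots> = (letter ?n a (dif B b) + - (ksign m \<cdot> letter (?n - 1) (dif H a) b)) +
    (lext (\<lambda>(h, x). lmul (cobar H) B (ssv h) (letter ?n a x)) (\<nu> b) +
     ksign m \<cdot> lext (\<lambda>(a1, a2). ksign (gdeg H a1) \<cdot> \<tau> b (ssv a1 \<star> ssv a2)) (comult H a))"
    unfolding lext_fun_add swap_linear[OF ah b] swap_quadratic[OF ah n(1) b] ..
  also have "letter ?n a (dif B b) = T.iV (dif B b) \<diamondop> T.iU (ssv a)"
    using bc tau_ssv[OF ah n(1)] by (simp add: X.tau_eq W_carrier)
  also have "lext (\<lambda>(h, x). lmul (cobar H) B (ssv h) (letter ?n a x)) (\<nu> b) = RR b \<diamondop> T.iU (ssv a)"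
  proof -
    have "RR b \<diamondop> T.iU (ssv a) = lext (\<lambda>p. (case p of (h, x) \<Rightarrow> ssv h \<boxtimes> x) \<diamondop> T.iU (ssv a)) (\<nu> b)"
      unfolding RR_def using N.nu_fsupp[OF bc] by (rule X.tmul_lext_left) auto
    also have "\<dots> = lext (\<lambda>(h, x). lmul (cobar H) B (ssv h) (letter ?n a x)) (\<nu> b)"
    proof (intro lext_cong, clarify)
      fix h x assume "\<nu> b (h, x) \<noteq> 0"
      then have x: "x \<in> carrier B"
        using N.nu_basis[OF bc] by auto
      then show "(ssv h \<boxtimes> x) \<diamondop> T.iU (ssv a) = lmul (cobar H) B (ssv h) (letter ?n a x)"
        using tau_ssv[OF ah n(1) x] by (simp add: X.tmul_tens W_carrier T.rmul_one[OF mlinD(1)[OF mlin_letter]])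
    qed
    finally show ?thesis ..
  qed
  \<comment> \<open>Completing the quadratic part to \<open>CG a\<close> leaves a term with
    \<open>dif H a\<close>, which cancels the one produced by \<open>swap_linear\<close>.\<close>
  also have "lext (\<lambda>(a1, a2). ksign (gdeg H a1) \<cdot> \<tau> b (ssv a1 \<star> ssv a2)) (comult H a) =
    \<tau> b (CG a) + letter (?n - 1) (dif H a) b"
  proof -
    let ?\<beta> = "\<lambda>(x, y). ksign (gdeg H x) \<cdot> (ssv x \<star> ssv y)"
    have L: "lext ?\<beta> (comult H a) \<in> W"
      by (intro lext_fsupp) (auto intro!: tmult_fsupp)
    have "\<tau> b (lext ?\<beta> (comult H a)) = lext (\<lambda>p. \<tau> b (?\<beta> p)) (comult H a)"
      using D.nu_fsupp[OF ac] by (rule tau_lext) (auto intro!: tmult_fsupp)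
    also have "\<dots> = lext (\<lambda>(a1, a2). ksign (gdeg H a1) \<cdot> \<tau> b (ssv a1 \<star> ssv a2)) (comult H a)"
      by (intro lext_cong) (auto simp: tau_linear tmult_fsupp)
    finally show ?thesis
      using L tau_ssv[OF dif_hcomp[OF ah] n(2) bc] tau_linear(2)[of "- ssv (dif H a)" "lext ?\<beta> (comult H a)" b]
      by (simp add: CG_def tau_linear)
  qed
  also have "T.sg (T.iV b) \<diamondop> DU (ssv a) = ksign m \<cdot> \<tau> b (CG a)"
    using bc ac Y.sg_iV[OF b] by (simp add: X.tmul_linear DU_def d\<Omega>_ssv X.tau_eq W_carrier)
  then have "T.iV (dif B b) \<diamondop> T.iU (ssv a) + - (ksign m \<cdot> letter (?n - 1) (dif H a) b) +
      (RR b \<diamondop> T.iU (ssv a) + ksign m \<cdot> (\<tau> b (CG a) + letter (?n - 1) (dif H a) b)) =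
      DV b \<diamondop> T.iU (ssv a) + T.sg (T.iV b) \<diamondop> DU (ssv a)"
    using bc by (simp add: DV_def X.tmul_linear fscale_add algebra_simps)
  finally show ?thesis
    by (simp add: Y.swap_ok_def)
qed

lemma swap_ok:
  assumes b: "b \<in> carrier B" and w: "w \<in> W"
  shows "Y.swap_ok b w"
proof -
  have letter: "Y.swap_ok b (delta [a])" if "a \<in> E" "b \<in> carrier B" for a b
    using that(2)
  proof (induction rule: B.carrier_induct)
    case (add x y)
    then show ?case
      using that(1) by (intro Y.swap_ok_linear_left) (auto intro!: W_carrier)
  next
    case (hcomp n x)
    then show ?case
      using swap_ok_ssv[OF that(1) hcomp] ssv_E[OF that(1)] by simp
  qed
  have words: "Y.swap_ok b (delta as)" if "as \<in> lists E" "b \<in> carrier B" for as b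
    using that
  proof (induction as arbitrary: b rule: list.induct)
    case Nil
    then show ?case
      using Y.swap_ok_one(1) by (simp add: cobar_simps)
  next
    case (Cons a as)
    have "Y.swap_ok b (delta [a] \<otimes>\<^bsub>cobar H\<^esub> delta as)"
      using Cons letter by (intro Y.swap_ok_mult_right) (auto intro!: W_carrier delta_fsupp)
    then show ?case
      by (simp add: cobar_simps delta_tmult)
  qed
  show ?thesis
    using w
  proof (induction rule: fsupp_induct)
    case zero
    then show ?case
      using Y.swap_ok_linear(2)[OF b _ _ words[of "[]"], of "delta []" 0] b
      by (simp add: cobar_simps)
  next
    case (add z z')
    then show ?case
      using Y.swap_ok_linear(1)[OF b, of z z'] by (simp add: cobar_simps)
  next
    case (scale r z)
    then show ?case
      using Y.swap_ok_linear(2)[OF b, of z z r] by (simp add: cobar_simps)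
  qed (rule words[OF _ b])
qed

section \<open>The chain algebra \<Omega>H \<otimes> B\<close>

lemma left_dif_eq:
  assumes "z \<in> T.K"
  shows "left_dif H B z = Y.DD z"
proof -
  have "left_dif H B z = lext (\<lambda>(w, b). Y.DD (w \<boxtimes> b)) z"
    unfolding left_dif_def
  proof (intro lext_cong, clarify)
    fix w b assume "z (w, b) \<noteq> 0"
    from T.K_hbasis[OF assms this]
    have wb: "w \<in> hcomp (cobar H) (gdeg (cobar H) w)" "b \<in> carrier B"
      using C.hbasis_hcomp by auto
    have "lext (\<lambda>(h, b'). (w \<star> sinv H h) \<boxtimes> b') (\<nu> b) = lext (\<lambda>(h, b'). (w \<star> ssv h) \<boxtimes> b') (\<nu> b)"
      using N.nu_basis[OF wb(2)] by (intro lext_cong) (auto simp: sinv_hbasis)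
    then show "dif (cobar H) w \<boxtimes> b + ksign (gdeg (cobar H) w) \<cdot> (w \<boxtimes> dif B b) +
        ksign (gdeg (cobar H) w) \<cdot> lext (\<lambda>(h, b'). (w \<star> sinv H h) \<boxtimes> b') (\<nu> b) = Y.DD (w \<boxtimes> b)"
      using DD_wt[OF wb] by (simp add: cobar_simps)
  qed
  also have "\<dots> = Y.DD (lext (\<lambda>(w, b). w \<boxtimes> b) z)"
    using Y.DD_lext[OF assms, of "\<lambda>(w, b). w \<boxtimes> b"] by (simp add: split_def)
  finally show ?thesis
    by (simp add: T.tens_expand[OF assms])
qed

theorem left_cobar_chain_algebra: "chain_algebra (left_cobar (H, B))"
proof (rule Y.A_chain_algebra)
  show "Y.swap_ok v u" if "v \<in> carrier B" "u \<in> carrier (cobar H)" for v u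
    using that swap_ok by (simp add: cobar_simps)
  show "Y.DD (DU u) = 0" if "u \<in> carrier (cobar H)" for u
    using that DD_DU by (simp add: cobar_simps)
qed (auto simp: DD_DV left_cobar_simps left_dif_eq)

text \<open>The embeddings of both factors are multiplicative in any twisted product. For the
  exchange formula, \<open>tau_ssv\<close> is rewritten with \<open>sinv\<close>, which agrees with
  \<open>ssv\<close> on the homogeneous elements h \<cdot> a.\<close>

theorem left_cobar_laws: "left_cobar_laws (H, B) (left_cobar (H, B))"
proof -
  have "T.iV b \<diamondop> T.iU (sinv H a) =
      lext (\<lambda>(h, b'). ksign (gdeg H h + (n + 1) * gdeg B b') \<cdot> (sinv H (h \<otimes> a) \<boxtimes> b')) (\<nu> b)"
    if "n > 0" "a \<in> hcomp H n" "b \<in> carrier B" for n a b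
  proof -
    have "T.iV b \<diamondop> T.iU (sinv H a) = letter n a b"
      using that by (simp add: sinv_ssv X.tau_eq W_carrier tau_ssv)
    also have "\<dots> = lext (\<lambda>(h, b'). ksign (gdeg H h + (n + 1) * gdeg B b') \<cdot> (sinv H (h \<otimes> a) \<boxtimes> b')) (\<nu> b)"
      unfolding letter_def
    proof (intro lext_cong, clarify)
      fix h x assume "\<nu> b (h, x) \<noteq> 0"
      then have "h \<in> hbasis H"
        using N.nu_basis[OF that(3)] by blast
      then show "ksign (gdeg H h + (n + 1) * gdeg B x) \<cdot> (ssv (h \<otimes> a) \<boxtimes> x) =
          ksign (gdeg H h + (n + 1) * gdeg B x) \<cdot> (sinv H (h \<otimes> a) \<boxtimes> x)"
        using sinv_ssv[OF mult_hcomp[OF hbasis_hcomp that(2)]] by simp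
    qed
    finally show ?thesis .
  qed
  then show ?thesis
    using left_cobar_chain_algebra Y.iU_gralg_hom Y.iV_gralg_hom
    by (auto simp: left_cobar_laws_def left_cobar_simps X.tens_eq)
qed

end

section \<open>Naturality for left comodule algebras\<close>

locale left_comod_map = F: hopf_map H H' f + L: left_comod H B + R: left_comod H' B'
  for H :: "('r::comm_ring_1, 'h) chopf" and H' :: "('r, 'k) chopf" and f
    and B :: "('r, 'b, 'h) lcomodalg" and B' :: "('r, 'c, 'k) lcomodalg" +
  fixes g :: "'b \<Rightarrow> 'c"
  assumes g_hom: "chain_algebra_hom B B' g"
    and coact_hom: "b \<in> carrier B \<Longrightarrow> tensor_map H' B' f g (lcoact B b) = lcoact B' (g b)"
begin

sublocale g: chain_alg_hom B B' g
  using g_hom by unfold_locales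

sublocale Z: twisted_map "cobar H" B L.\<tau> "left_cobar (H, B)" L.DU L.DV
    "cobar H'" B' R.\<tau> "left_cobar (H', B')" R.DU R.DV F.\<phi> g
  using F.phi_gralg_hom g_hom by unfold_locales (simp_all add: chain_algebra_hom_def)

lemma coact_lext:
  assumes "b \<in> carrier B"
  shows "lext \<gamma> (lcoact B' (g b)) = lext (\<lambda>(h, x). lext \<gamma> (tens H' B' (f h) (g x))) (lcoact B b)"
proof -
  have "lext \<gamma> (lcoact B' (g b)) = lext (\<lambda>p. lext \<gamma> (case p of (h, x) \<Rightarrow> tens H' B' (f h) (g x))) (lcoact B b)"
    unfolding coact_hom[OF assms, symmetric] tensor_map_def
    using L.N.nu_fsupp[OF assms] by (rule lext_lext[where Y = "hbasis H' \<times> hbasis B'"]) auto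
  then show ?thesis
    by (simp add: split_def)
qed

text \<open>The formula for a letter is preserved term by term: f is multiplicative, the coactions
  correspond under f \<otimes> g, and both maps preserve the degrees on which the signs
  depend.\<close>

lemma TT_letter:
  assumes a: "a \<in> hcomp H n" and b: "b \<in> carrier B"
  shows "Z.TT (L.letter n a b) = R.letter n (f a) (g b)"
proof -
  have "Z.TT (L.letter n a b) = lext (\<lambda>p. Z.TT (case p of (h, x) \<Rightarrow>
      ksign (gdeg H h + (n + 1) * gdeg B x) \<cdot> tens (cobar H) B (F.X.ssv (h \<otimes>\<^bsub>H\<^esub> a)) x)) (lcoact B b)"
    unfolding L.letter_def using L.N.nu_fsupp[OF b] by (rule Z.TT_lext) auto
  also have "\<dots> = R.letter n (f a) (g b)"
    unfolding R.letter_def coact_lext[OF b]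
  proof (intro lext_cong, clarify)
    fix h x assume "lcoact B b (h, x) \<noteq> 0"
    from L.N.nu_basis[OF b this]
    have hx: "h \<in> hcomp H (gdeg H h)" "x \<in> hcomp B (gdeg B x)" "h \<in> carrier H" "x \<in> carrier B"
      using F.X.hbasis_hcomp L.B.hbasis_hcomp by auto
    note ac = F.X.hcomp_carrier[OF a]
    have "lext (\<lambda>(h, x). ksign (gdeg H' h + (n + 1) * gdeg B' x) \<cdot> tens (cobar H') B' (F.Y.ssv (h \<otimes>\<^bsub>H'\<^esub> f a)) x)
        (tens H' B' (f h) (g x)) =
      ksign (gdeg H h + (n + 1) * gdeg B x) \<cdot> tens (cobar H') B' (F.Y.ssv (f h \<otimes>\<^bsub>H'\<^esub> f a)) (g x)"
      by (rule R.N.lext_tens_hcomp[OF R.mbil_letter[OF F.f.hom_closed[OF ac]]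
            F.f.hom_hcomp[OF hx(1)] g.hom_hcomp[OF hx(2)]]) simp
    then show "Z.TT (ksign (gdeg H h + (n + 1) * gdeg B x) \<cdot> tens (cobar H) B (F.X.ssv (h \<otimes>\<^bsub>H\<^esub> a)) x) =
      lext (\<lambda>(h, x). ksign (gdeg H' h + (n + 1) * gdeg B' x) \<cdot> tens (cobar H') B' (F.Y.ssv (h \<otimes>\<^bsub>H'\<^esub> f a)) x)
        (tens H' B' (f h) (g x))"
      using hx ac by (simp add: Z.TT_linear Z.TT_tens F.X.W_carrier F.phi_ssv F.f.hom_mult)
  qed
  finally show ?thesis .
qed

lemma tau_ok:
  assumes b: "b \<in> carrier B" and w: "w \<in> F.X.W"
  shows "Z.tau_ok b w"
proof -
  have letter: "Z.tau_ok b (delta [a])" if a: "a \<in> F.X.E" "b \<in> carrier B" for a b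
  proof -
    note ah = F.X.E_hcomp[OF a(1)]
    have "gdeg H a > 0"
      using ah(2) by simp
    then show ?thesis
      using F.phi_ssv[OF ah(4)] a(2) TT_letter[OF ah(1) a(2)] L.tau_ssv[OF ah(1) _ a(2)]
        R.tau_ssv[OF F.f.hom_hcomp[OF ah(1)] _ g.hom_closed[OF a(2)]] F.X.ssv_E[OF a(1)]
      by (simp add: Z.tau_ok_def)
  qed
  have words: "Z.tau_ok b (delta as)" if "as \<in> lists F.X.E" "b \<in> carrier B" for as b
    using that
  proof (induction as arbitrary: b rule: list.induct)
    case Nil
    then show ?case
      using Z.tau_ok_one(1) by (simp add: cobar_simps)
  next
    case (Cons a as)
    have "Z.tau_ok b (delta [a] \<otimes>\<^bsub>cobar H\<^esub> delta as)"
      using Cons letter by (intro Z.tau_ok_mult_right) (auto intro!: F.X.W_carrier delta_fsupp)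
    then show ?case
      by (simp add: cobar_simps delta_tmult)
  qed
  show ?thesis
    using w
  proof (induction rule: fsupp_induct)
    case zero
    then show ?case
      using Z.tau_ok_linear(2)[OF b _ _ words[of "[]"], of "delta []" 0] b
      by (simp add: cobar_simps)
  next
    case (add z z')
    then show ?case
      using Z.tau_ok_linear(1)[OF b, of z z'] by (simp add: cobar_simps)
  next
    case (scale r z)
    then show ?case
      using Z.tau_ok_linear(2)[OF b, of z z r] by (simp add: cobar_simps)
  qed (rule words[OF _ b])
qed

lemma TT_RR:
  assumes b: "b \<in> carrier B"
  shows "Z.TT (L.RR b) = R.RR (g b)"
proof -
  have "Z.TT (L.RR b) = lext (\<lambda>p. Z.TT (case p of (h, x) \<Rightarrow> tens (cobar H) B (F.X.ssv h) x)) (lcoact B b)"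
    unfolding L.RR_def using L.N.nu_fsupp[OF b] by (rule Z.TT_lext) auto
  also have "\<dots> = R.RR (g b)"
    unfolding R.RR_def coact_lext[OF b] using L.N.nu_basis[OF b]
    by (intro lext_cong)
      (auto simp: Z.TT_tens F.X.W_carrier F.phi_ssv R.N.lext_tens[OF R.mbil_ssv_wt] F.f.hom_closed g.hom_closed)
  finally show ?thesis .
qed

theorem left_cobar_map_hom:
  "chain_algebra_hom (left_cobar (H, B)) (left_cobar (H', B')) (left_cobar_map (H', B') (f, g))"
proof -
  have "chain_algebra_hom (left_cobar (H, B)) (left_cobar (H', B')) Z.TT"
  proof (rule Z.TT_chain_algebra_hom)
    show "Z.tau_ok v u" if "v \<in> carrier B" "u \<in> carrier (cobar H)" for v u
      using that tau_ok by (simp add: cobar_simps)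
    show "Z.TT (L.DU u) = R.DU (F.\<phi> u)" if "u \<in> carrier (cobar H)" for u
      using that F.phi_dif by (simp add: L.DU_def R.DU_def Z.TT_tens cobar_simps g.hom_one)
    show "Z.TT (L.DV v) = R.DV (g v)" if "v \<in> carrier B" for v
      using that by (simp add: L.DV_def R.DV_def Z.TT_linear TT_RR Z.TT_tens Z.phi_one g.hom_dif)
  qed (auto simp: L.left_cobar_simps R.left_cobar_simps L.left_dif_eq R.left_dif_eq)
  then show ?thesis
    by (simp add: left_cobar_map_def)
qed

end

section \<open>Right comodule algebras\<close>

locale right_comod = hopf H
  for H :: "('r::comm_ring_1, 'h) chopf" (structure) +
  fixes B :: "('r, 'b, 'h) rcomodalg"
  assumes right_comod: "right_comodule_algebra H B"
begin

sublocale B: chain_alg B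
  using right_comod by unfold_locales (simp add: right_comodule_algebra_def)

sublocale N: coaction B H B "rcoact B"
  using right_comod by unfold_locales (simp add: right_comodule_algebra_def)

sublocale T: alg_tensor B "cobar H"
  by unfold_locales

abbreviation \<nu> where "\<nu> \<equiv> rcoact B"
abbreviation wt (infixr \<open>\<boxtimes>\<close> 70) where "b \<boxtimes> w \<equiv> tens B (cobar H) b w"
abbreviation KB where "KB \<equiv> hbasis B \<times> hbasis (cobar H)"

section \<open>Coassociativity and counit of a right coaction\<close>

lemma nu_coassoc:
  assumes "\<And>x y s. x \<in> hbasis B \<Longrightarrow> y \<in> hbasis H \<Longrightarrow> s \<in> hbasis H \<Longrightarrow> \<beta> x y s \<in> fsupp Y"
    and "b \<in> carrier B"
  shows "lext (\<lambda>(x, h). lext (\<lambda>(x', h'). \<beta> x' h' h) (\<nu> x)) (\<nu> b) =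
    lext (\<lambda>(x, h). lext (\<lambda>(h1, h2). \<beta> x h1 h2) (comult H h)) (\<nu> b)"
proof (rule coassoc_lext[where Z = "hbasis B" and Z' = "hbasis H"])
  show "graded_free_mod B" "graded_free_mod H" "graded_free_mod H"
    by unfold_locales
  show "lext (\<lambda>(b', h). lext (\<lambda>(b'', h'). tens B (tensor H H) b'' (tens H H h' h)) (\<nu> b')) (\<nu> b) =
    lext (\<lambda>(b', h). tens B (tensor H H) b' (comult H h)) (\<nu> b)"
    using right_comod assms(2) unfolding right_comodule_algebra_def by blast
qed (use assms in auto)

lemma nu_counit:
  assumes F: "mlin B Y F" and b: "b \<in> carrier B"
  shows "lext (\<lambda>(x, h). \<epsilon> h \<cdot> F x) (\<nu> b) = F b"
proof -
  let ?S = "{p. \<nu> b p \<noteq> 0}"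
  have fin: "finite ?S"
    using N.nu_fsupp[OF b] by (rule fsupp_finite)
  have "F b = F (\<Oplus>\<^bsub>B\<^esub>p\<in>?S. (\<nu> b p * \<epsilon> (snd p)) \<odot>\<^bsub>B\<^esub> fst p)"
    using right_comod b unfolding right_comodule_algebra_def by auto
  also have "\<dots> = (\<Sum>p\<in>?S. (\<nu> b p * \<epsilon> (snd p)) \<cdot> F (fst p))"
    using N.nu_basis[OF b] by (intro B.mlin_finsum[OF F fin]) auto
  also have "\<dots> = lext (\<lambda>(x, h). \<epsilon> h \<cdot> F x) (\<nu> b)"
    using fin by (simp add: lext_alt[of ?S] split_def)
  finally show ?thesis ..
qed

lemma nu_0:
  assumes G: "\<And>x. x \<in> carrier B \<Longrightarrow> mlin H Y (G x)" "mlin B Y (\<lambda>x. G x \<one>)" and b: "b \<in> carrier B"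
  shows "lext (\<lambda>(x, h). if gdeg H h = 0 then G x h else 0) (\<nu> b) = G b \<one>"
proof -
  have "lext (\<lambda>(x, h). if gdeg H h = 0 then G x h else 0) (\<nu> b) = lext (\<lambda>(x, h). \<epsilon> h \<cdot> G x \<one>) (\<nu> b)"
  proof (intro lext_cong, clarify)
    fix x h assume "\<nu> b (x, h) \<noteq> 0"
    from N.nu_basis[OF b this] have "h \<in> hcomp H (gdeg H h)" "x \<in> carrier B"
      using hbasis_hcomp by auto
    then show "(if gdeg H h = 0 then G x h else 0) = \<epsilon> h \<cdot> G x \<one>"
      using hcomp_0_eq[OF G(1), of x h] counit_hcomp by auto
  qed
  then show ?thesis
    using nu_counit[OF G(2) b] by simp
qed

text \<open>The prescribed value of (1 \<otimes> s^-1 a)(b \<otimes> 1), again with the degree n of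
  a as an argument to make it linear in a. The sign is the Koszul sign for moving s^-1 a, of degree
  n - 1, past x.\<close>

definition letter :: "int \<Rightarrow> 'h \<Rightarrow> 'b \<Rightarrow> 'b \<times> ('h list \<Rightarrow> 'r) \<Rightarrow> 'r" where
  "letter n a b = lext (\<lambda>(x, h). ksign ((n - 1) * gdeg B x) \<cdot> (x \<boxtimes> ssv (a \<otimes> h))) (\<nu> b)"

lemma mlin_letter: "mlin B KB (letter n a)"
  unfolding letter_def by (rule N.mlin_lext_nu) auto

lemma letter_K [simp]: "b \<in> carrier B \<Longrightarrow> letter n a b \<in> T.K"
  using mlinD(1)[OF mlin_letter] .

lemma mlin_wt2: "mlin H (lists E) F \<Longrightarrow> mlin H KB (\<lambda>h. x \<boxtimes> F h)"
  using mlinD(1)[of H "lists E" F] T.tens_add(2) T.tens_smult(2) unfolding mlin_def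
  by (simp add: cobar_simps)

lemma mlin_ssv_mult:
  "a \<in> carrier H \<Longrightarrow> mlin H KB (\<lambda>h. x \<boxtimes> ssv (a \<otimes> h))"
  "h \<in> carrier H \<Longrightarrow> mlin H KB (\<lambda>a. x \<boxtimes> ssv (a \<otimes> h))"
  using mlin_wt2[OF mlin_smult_right[OF mlin_ssv]] mlin_wt2[OF mlin_smult_left[OF mlin_ssv]] by auto

lemma mbil_letter: "a \<in> carrier H \<Longrightarrow> mbil B H KB (\<lambda>x h. r \<cdot> (x \<boxtimes> ssv (a \<otimes> h)))"
  by (rule mbilI; rule mlin_scale; auto intro: mlin_ssv_mult T.mlin_tens)

lemma mlin_letter_a: "b \<in> carrier B \<Longrightarrow> mlin H KB (\<lambda>a. letter n a b)"
  unfolding letter_def split_def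
  by (intro mlin_lext_fun mlin_scale mlin_ssv_mult) (auto dest: N.nu_basis)

lemma rmul_letter:
  assumes "b \<in> carrier B" "w \<in> W" "a \<in> carrier H"
  shows "rmul B (cobar H) (letter n a b) w =
    lext (\<lambda>(x, h). ksign ((n - 1) * gdeg B x) \<cdot> (x \<boxtimes> (ssv (a \<otimes> h) \<star> w))) (\<nu> b)"
proof -
  have "rmul B (cobar H) (letter n a b) w = lext (\<lambda>p. rmul B (cobar H) (case p of (x, h) \<Rightarrow>
      ksign ((n - 1) * gdeg B x) \<cdot> (x \<boxtimes> ssv (a \<otimes> h))) w) (\<nu> b)"
    unfolding letter_def using N.nu_fsupp[OF assms(1)] by (rule T.rmul_lext) auto
  also have "\<dots> = lext (\<lambda>(x, h). ksign ((n - 1) * gdeg B x) \<cdot> (x \<boxtimes> (ssv (a \<otimes> h) \<star> w))) (\<nu> b)"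
    using assms N.nu_basis[OF assms(1)]
    by (intro lext_cong) (auto simp: T.rmul_linear T.rmul_tens W_carrier, simp add: cobar_simps)
  finally show ?thesis .
qed

lemma lmul_letter:
  assumes "b \<in> carrier B" "b' \<in> carrier B" "a \<in> carrier H"
  shows "lmul B (cobar H) b (letter n a b') =
    lext (\<lambda>(x, h). ksign ((n - 1) * gdeg B x) \<cdot> ((b \<otimes>\<^bsub>B\<^esub> x) \<boxtimes> ssv (a \<otimes> h))) (\<nu> b')"
proof -
  have "lmul B (cobar H) b (letter n a b') = lext (\<lambda>p. lmul B (cobar H) b (case p of (x, h) \<Rightarrow>
      ksign ((n - 1) * gdeg B x) \<cdot> (x \<boxtimes> ssv (a \<otimes> h)))) (\<nu> b')"
    unfolding letter_def using N.nu_fsupp[OF assms(2)] by (rule T.lmul_lext) auto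
  also have "\<dots> = lext (\<lambda>(x, h). ksign ((n - 1) * gdeg B x) \<cdot> ((b \<otimes>\<^bsub>B\<^esub> x) \<boxtimes> ssv (a \<otimes> h))) (\<nu> b')"
    using assms N.nu_basis[OF assms(2)]
    by (intro lext_cong) (auto simp: T.lmul_linear T.lmul_tens W_carrier)
  finally show ?thesis .
qed

section \<open>Moving a word past an element of B\<close>

lemma right_swap_K [simp]: "right_swap H B as b \<in> T.K"
  by (cases as) (auto intro!: lext_fsupp split: prod.split)

text \<open>The letter next to b is the last one and moves first, so the exchange with the first
  letter is applied to the result for the rest of the word. Hence \<open>ract\<close> takes the
  place that \<open>lact\<close> has on the other side.\<close>

lemma right_swap_Cons:
  assumes "a \<in> E"
  shows "right_swap H B (a # as) b = T.ract (letter (gdeg H a) a) (right_swap H B as b)"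
  unfolding T.ract_def right_swap.simps
proof (intro lext_cong, clarify)
  fix c u assume "right_swap H B as b (c, u) \<noteq> 0"
  then have cu: "c \<in> carrier B" "u \<in> W"
    using T.K_hbasis[OF right_swap_K] C.hbasis_carrier by (auto simp: C.carrier_eq)
  note ah = E_hcomp[OF assms]
  have "lext (\<lambda>(c', h). ksign ((gdeg H a - 1) * gdeg B c') \<cdot> (c' \<boxtimes> (sinv H (a \<otimes> h) \<star> u))) (\<nu> c) =
    lext (\<lambda>(x, h). ksign ((gdeg H a - 1) * gdeg B x) \<cdot> (x \<boxtimes> (ssv (a \<otimes> h) \<star> u))) (\<nu> c)"
  proof (intro lext_cong, clarify)
    fix x h assume "\<nu> c (x, h) \<noteq> 0"
    then have "h \<in> hcomp H (gdeg H h)"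
      using N.nu_basis[OF cu(1)] hbasis_hcomp by blast
    then show "ksign ((gdeg H a - 1) * gdeg B x) \<cdot> (x \<boxtimes> (sinv H (a \<otimes> h) \<star> u)) =
      ksign ((gdeg H a - 1) * gdeg B x) \<cdot> (x \<boxtimes> (ssv (a \<otimes> h) \<star> u))"
      using sinv_ssv[OF mult_hcomp[OF ah(1)]] by simp
  qed
  then show "lext (\<lambda>(c', h). ksign ((gdeg H a - 1) * gdeg B c') \<cdot> (c' \<boxtimes> (sinv H (a \<otimes> h) \<star> u))) (\<nu> c) =
      rmul B (cobar H) (letter (gdeg H a) a c) u"
    using rmul_letter[OF cu ah(4)] by simp
qed

declare right_swap.simps(2) [simp del]

text \<open>The recursion hands b down to the rest of the word, so linearity in b is inherited along
  the word.\<close>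

lemma mlin_right_swap: "as \<in> lists E \<Longrightarrow> mlin B KB (right_swap H B as)"
proof (induction as rule: list.induct)
  case (Cons a as)
  then have "right_swap H B (a # as) = (\<lambda>b. T.ract (letter (gdeg H a) a) (right_swap H B as b))"
    using right_swap_Cons by fastforce
  then show ?case
    using Cons T.mlin_ract by auto
qed (simp add: T.mlin_tens)

definition \<tau> :: "('h list \<Rightarrow> 'r) \<Rightarrow> 'b \<Rightarrow> 'b \<times> ('h list \<Rightarrow> 'r) \<Rightarrow> 'r" where
  "\<tau> w b = lext (\<lambda>as. right_swap H B as b) w"

lemma mlin_tau: "w \<in> W \<Longrightarrow> mlin B KB (\<tau> w)"
  unfolding \<tau>_def by (intro mlin_lext_fun mlin_right_swap) (rule fsupp_in)

lemma tau_bil: "mbil (cobar H) B KB \<tau>"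
proof (rule mbilI)
  show "mlin (cobar H) KB (\<lambda>w. \<tau> w b)" for b
    unfolding \<tau>_def by (intro C.mlin_lext_id right_swap_K)
qed (simp add: mlin_tau cobar_simps)

lemma tau_K [simp]: "b \<in> carrier B \<Longrightarrow> w \<in> W \<Longrightarrow> \<tau> w b \<in> T.K"
  using mlinD(1)[OF mlin_tau] .

lemma tau_delta: "\<tau> (delta as) b = right_swap H B as b"
  by (simp add: \<tau>_def)

lemma tau_linear:
  "\<tau> 0 b = 0" "w \<in> W \<Longrightarrow> w' \<in> W \<Longrightarrow> \<tau> (w + w') b = \<tau> w b + \<tau> w' b"
  "w \<in> W \<Longrightarrow> \<tau> (r \<cdot> w) b = r \<cdot> \<tau> w b" "w \<in> W \<Longrightarrow> \<tau> (- w) b = - \<tau> w b"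
  unfolding \<tau>_def by (auto intro: lext_add lext_scale lext_minus)

lemma tau_lext:
  "z \<in> fsupp X \<Longrightarrow> (\<And>p. p \<in> X \<Longrightarrow> \<beta> p \<in> W) \<Longrightarrow> \<tau> (lext \<beta> z) b = lext (\<lambda>p. \<tau> (\<beta> p) b) z"
  unfolding \<tau>_def by (rule lext_lext)

lemma right_swap_single:
  assumes "a \<in> E" "b \<in> carrier B"
  shows "right_swap H B [a] b = letter (gdeg H a) a b"
  using assms by (simp add: right_swap_Cons T.ract_tens[OF mlin_letter] T.rmul_one)

lemma tau_ssv:
  assumes a: "a \<in> hcomp H n" "n > 0" and b: "b \<in> carrier B"
  shows "\<tau> (ssv a) b = letter n a b"
proof -
  have aD: "a \<in> carrier (desusp H)" "a \<in> hcomp (desusp H) (n - 1)"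
    using a desusp_hcomp_carrier[OF a(2)] by (auto simp: desusp_simps)
  have "\<tau> (ssv a) b = lext (\<lambda>x. \<tau> (delta [x]) b) (coord (desusp H) a)"
    unfolding ssv_desusp[OF aD(1)] by (rule tau_lext[OF S.coord_fsupp]) auto
  also have "\<dots> = letter n a b"
  proof (rule S.lext_coord_hcomp[OF mlin_desusp[OF mlin_letter_a[OF b]] aD(2)])
    fix x assume "x \<in> E" "gdeg (desusp H) x = n - 1"
    then show "\<tau> (delta [x]) b = letter n x b"
      using E_hcomp(3)[of x] b by (simp add: tau_delta right_swap_single)
  qed
  finally show ?thesis .
qed

lemma letter_hcomp:
  assumes a: "a \<in> hcomp H n" and b: "b \<in> hcomp B m"
  shows "letter n a b \<in> hcomp (tensor B (cobar H)) (n - 1 + m)"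
  unfolding letter_def
proof (rule T.T.lext_hcomp, clarify)
  fix x h assume "\<nu> b (x, h) \<noteq> 0"
  note s = N.nu_supp[OF b this]
  have "x \<boxtimes> ssv (a \<otimes> h) \<in> hcomp (tensor B (cobar H)) (gdeg B x + (n + gdeg H h - 1))"
    by (intro T.tens_hcomp ssv_hcomp mult_hcomp s a)
  then show "ksign ((n - 1) * gdeg B x) \<cdot> (x \<boxtimes> ssv (a \<otimes> h)) \<in> hcomp (tensor B (cobar H)) (n - 1 + m)"
    using s(7) T.T.hcomp_smult unfolding T.T.smult_eq by (simp add: algebra_simps)
qed

lemma right_swap_hcomp:
  "as \<in> lists E \<Longrightarrow> b \<in> hcomp B m \<Longrightarrow> right_swap H B as b \<in> hcomp (tensor B (cobar H)) (wdeg H as + m)"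
proof (induction as rule: list.induct)
  case Nil
  then show ?case
    using T.tens_hcomp[OF Nil(2) C.one_hcomp] by simp
next
  case (Cons a as)
  then have a: "a \<in> E" "as \<in> lists E"
    by auto
  have IH: "right_swap H B as b \<in> hcomp (tensor B (cobar H)) (wdeg H as + m)"
    by (rule Cons.IH[OF a(2) Cons.prems(2)])
  show ?case
    unfolding right_swap_Cons[OF a(1)] T.ract_def
  proof (rule T.T.lext_hcomp, clarify)
    fix c d assume "right_swap H B as b (c, d) \<noteq> 0"
    then have cd: "c \<in> hbasis B" "d \<in> hbasis (cobar H)" "gdeg B c + gdeg (cobar H) d = wdeg H as + m"
      using T.K_hbasis[OF right_swap_K] IH by (auto simp: tensor_hcomp simp del: right_swap_K)
    have "rmul B (cobar H) (letter (gdeg H a) a c) d \<in>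
        hcomp (tensor B (cobar H)) ((gdeg H a - 1 + gdeg B c) + gdeg (cobar H) d)"
      using cd by (intro T.rmul_hcomp letter_hcomp E_hcomp a C.hbasis_hcomp B.hbasis_hcomp)
    then show "rmul B (cobar H) (letter (gdeg H a) a c) d \<in> hcomp (tensor B (cobar H)) (wdeg H (a # as) + m)"
      using cd(3) by (simp add: add.assoc)
  qed
qed

lemma right_swap_append:
  "as \<in> lists E \<Longrightarrow> b \<in> carrier B \<Longrightarrow>
    right_swap H B (as @ bs) b = T.ract (right_swap H B as) (right_swap H B bs b)"
proof (induction as rule: list.induct)
  case Nil
  have "T.ract (\<lambda>b. b \<boxtimes> \<one>\<^bsub>cobar H\<^esub>) z = z" if "z \<in> T.K" for z
    using that
    by (induction rule: T.fsupp_tens_induct)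
      (simp_all add: T.ract_linear T.ract_tens[OF T.mlin_tens(1)] T.rmul_tens)
  then show ?case
    by simp
next
  case (Cons a as)
  then have a: "a \<in> E" "as \<in> lists E"
    by auto
  have "T.ract (right_swap H B (a # as)) z = T.ract (\<lambda>d. T.ract (letter (gdeg H a) a) (right_swap H B as d)) z" for z
    using right_swap_Cons[OF a(1)] by (simp add: T.ract_def)
  then show ?case
    using Cons a by (simp add: right_swap_Cons T.ract_ract[OF mlin_letter mlin_right_swap])
qed

lemma tau_left:
  assumes b: "b \<in> carrier B" and w: "w \<in> W" "w' \<in> W"
  shows "\<tau> (w \<star> w') b = T.ract (\<tau> w) (\<tau> w' b)"
proof -
  have ract_add: "T.ract (\<lambda>d. S d + S' d) z = T.ract S z + T.ract S' z"
    if "mlin B KB S" "mlin B KB S'" "z \<in> T.K" for S S' z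
    using that(3)
    by (induction rule: T.fsupp_tens_induct)
      (simp_all add: T.ract_linear T.ract_tens that mlin_add T.rmul_linear mlinD(1)[OF that(1)]
        mlinD(1)[OF that(2)] fscale_add algebra_simps)
  have ract_scale: "T.ract (\<lambda>d. r \<cdot> S d) z = r \<cdot> T.ract S z"
    if "mlin B KB S" "z \<in> T.K" for S z r
    using that(2)
    by (induction rule: T.fsupp_tens_induct)
      (simp_all add: T.ract_linear T.ract_tens that mlin_scale T.rmul_linear mlinD(1)[OF that(1)]
        fscale_add mult.commute)
  have ract_zero: "T.ract (\<lambda>d. 0) z = 0" for z
    by (simp add: T.ract_def T.rmul_linear split_def)
  have eq: "\<tau> 0 = (\<lambda>b. 0)" "z \<in> W \<Longrightarrow> z' \<in> W \<Longrightarrow> \<tau> (z + z') = (\<lambda>b. \<tau> z b + \<tau> z' b)"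
    "z \<in> W \<Longrightarrow> \<tau> (r \<cdot> z) = (\<lambda>b. r \<cdot> \<tau> z b)" "\<tau> (delta as) = right_swap H B as" for z z' r as
    by (auto simp: tau_linear tau_delta)
  show ?thesis
    using w(1)
  proof (induction rule: fsupp_induct)
    case (base as)
    show ?case
      using w(2)
    proof (induction rule: fsupp_induct)
      case (base bs)
      then show ?case
        using b \<open>as \<in> lists E\<close> by (simp add: delta_tmult eq right_swap_append)
    qed (simp_all add: tmult_linear tau_linear tmult_fsupp base b T.ract_linear)
  next
    case (add z z')
    then show ?case
      using w(2) b by (simp add: tmult_linear tau_linear tmult_fsupp ract_add mlin_tau eq(2))
  next
    case (scale r z)
    then show ?case
      using w(2) b by (simp add: tmult_linear tau_linear tmult_fsupp ract_scale mlin_tau eq(3))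
  qed (simp add: tmult_linear tau_linear ract_zero eq(1))
qed

text \<open>The letter passes b first and becomes s^-1 (a h), still of positive degree n + |h|,
  which then passes b'. Associativity in H and multiplicativity of the coaction identify the outcome
  with a single passage past b b'.\<close>

lemma letter_mult:
  assumes a: "a \<in> hcomp H n" "n > 0" and b: "b \<in> carrier B" "b' \<in> carrier B"
  shows "letter n a (b \<otimes>\<^bsub>B\<^esub> b') = T.lact (\<lambda>d. \<tau> d b') (letter n a b)"
proof -
  note ac = hcomp_carrier[OF a(1)]
  let ?\<gamma> = "\<lambda>(x, h). ksign ((n - 1) * gdeg B x) \<cdot> (x \<boxtimes> ssv (a \<otimes> h))"
  have "letter n a (b \<otimes>\<^bsub>B\<^esub> b') = lext (\<lambda>p. T.lact (\<lambda>d. \<tau> d b') (?\<gamma> p)) (\<nu> b)"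
    unfolding letter_def N.nu_mult[OF b]
  proof (intro lext_cong, clarify)
    fix x h assume "\<nu> b (x, h) \<noteq> 0"
    from N.nu_basis[OF b(1) this]
    have xh: "h \<in> hbasis H" "x \<in> hbasis B" "h \<in> hcomp H (gdeg H h)" "h \<in> carrier H" "x \<in> carrier B"
      "x \<in> hcomp B (gdeg B x)"
      using hbasis_hcomp B.hbasis_hcomp by auto
    have pos: "n + gdeg H h > 0"
      using hbasis_degree[OF xh(1)] a(2) by simp
    have "T.lact (\<lambda>d. \<tau> d b') (?\<gamma> (x, h)) = ksign ((n - 1) * gdeg B x) \<cdot>
        lmul B (cobar H) x (letter (n + gdeg H h) (a \<otimes> h) b')"
      using xh b(2) by (simp add: T.lact_linear T.lact_tens[OF mbilD(1)[OF tau_bil]] W_carrier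
          tau_ssv[OF mult_hcomp[OF a(1) xh(3)] pos])
    also have "\<dots> = ksign ((n - 1) * gdeg B x) \<cdot> lext (\<lambda>(x', h').
        ksign ((n + gdeg H h - 1) * gdeg B x') \<cdot> ((x \<otimes>\<^bsub>B\<^esub> x') \<boxtimes> ssv (a \<otimes> h \<otimes> h'))) (\<nu> b')"
      using xh ac b(2) by (simp add: lmul_letter)
    also have "\<dots> = lext (\<lambda>(x', h'). ksign (gdeg H h * gdeg B x') \<cdot>
        lext ?\<gamma> (tens B H (x \<otimes>\<^bsub>B\<^esub> x') (h \<otimes> h'))) (\<nu> b')"
    proof (subst lext_fun_scale[symmetric], rule lext_cong, clarify)
      fix x' h' assume "\<nu> b' (x', h') \<noteq> 0"
      from N.nu_basis[OF b(2) this]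
      have xh': "h' \<in> hcomp H (gdeg H h')" "h' \<in> carrier H" "x' \<in> hcomp B (gdeg B x')"
        using hbasis_hcomp B.hbasis_hcomp by auto
      have "lext ?\<gamma> (tens B H (x \<otimes>\<^bsub>B\<^esub> x') (h \<otimes> h')) =
        ksign ((n - 1) * (gdeg B x + gdeg B x')) \<cdot> ((x \<otimes>\<^bsub>B\<^esub> x') \<boxtimes> ssv (a \<otimes> (h \<otimes> h')))"
        by (rule N.lext_tens_hcomp[OF mbil_letter[OF ac] B.mult_hcomp[OF xh(6) xh'(3)]
              mult_hcomp[OF xh(3) xh'(1)]]) simp
      moreover have "ksign ((n - 1) * gdeg B x) * ksign ((n + gdeg H h - 1) * gdeg B x') =
        (ksign (gdeg H h * gdeg B x') * ksign ((n - 1) * (gdeg B x + gdeg B x')) :: 'r)"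
        unfolding ksign_add[symmetric] by (rule ksign_cong) (simp, argo)
      ultimately show "ksign ((n - 1) * gdeg B x) \<cdot> ksign ((n + gdeg H h - 1) * gdeg B x') \<cdot>
          ((x \<otimes>\<^bsub>B\<^esub> x') \<boxtimes> ssv (a \<otimes> h \<otimes> h')) =
        ksign (gdeg H h * gdeg B x') \<cdot> lext ?\<gamma> (tens B H (x \<otimes>\<^bsub>B\<^esub> x') (h \<otimes> h'))"
        using ac xh(4) xh'(2) by (simp add: m_assoc)
    qed
    finally show "lext (\<lambda>(x', h'). ksign (gdeg H h * gdeg B x') \<cdot>
        lext ?\<gamma> (tens B H (x \<otimes>\<^bsub>B\<^esub> x') (h \<otimes> h'))) (\<nu> b') =
      T.lact (\<lambda>d. \<tau> d b') (ksign ((n - 1) * gdeg B x) \<cdot> (x \<boxtimes> ssv (a \<otimes> h)))"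
      by simp
  qed
  also have "\<dots> = T.lact (\<lambda>d. \<tau> d b') (letter n a b)"
    unfolding letter_def using N.nu_fsupp[OF b(1)] by (intro T.lact_lext[symmetric]) auto
  finally show ?thesis .
qed

text \<open>Induction on the word. Here \<open>lact_ract\<close> is used with the exchange with b'
  in the role of \<open>S\<close>; its hypotheses are \<open>tau_left\<close> for the words and
  \<open>letter_mult\<close> for the first letter.\<close>

lemma tau_right:
  assumes b: "b \<in> carrier B" "b' \<in> carrier B" and w: "w \<in> W"
  shows "\<tau> w (b \<otimes>\<^bsub>B\<^esub> b') = T.lact (\<lambda>d. \<tau> d b') (\<tau> w b)"
  using w
proof (induction rule: fsupp_induct)
  case (base as)
  then show ?case
  proof (induction as rule: list.induct)
    case Nil
    have "\<tau> (delta []) b = b \<boxtimes> delta []" for b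
      by (simp add: tau_delta cobar_simps)
    then show ?case
      using Nil b by (simp add: T.lact_tens[OF mbilD(1)[OF tau_bil]] W_carrier T.lmul_tens)
  next
    case (Cons a as)
    then have a: "a \<in> E" "as \<in> lists E"
      by auto
    note ah = E_hcomp[OF a(1)]
    let ?n = "gdeg H a"
    have l: "\<tau> (ssv a) c = letter ?n a c" if "c \<in> carrier B" for c
      using tau_ssv[OF ah(1) _ that] ah(2) by simp
    have "T.ract (letter ?n a) (T.lact (\<lambda>d. \<tau> d b') z) = T.lact (\<lambda>d. \<tau> d b') (T.ract (letter ?n a) z)"
      if "z \<in> T.K" for z
      using that
    proof (induction rule: T.fsupp_tens_induct)
      case (base c u)
      then have cu: "c \<in> carrier B" "u \<in> carrier (cobar H)" "u \<in> W"
        using C.hbasis_carrier by (auto simp: C.carrier_eq)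
      have "T.lact (\<lambda>d. \<tau> d b') (rmul B (cobar H) (\<tau> (ssv a) c) u) =
        T.ract (\<tau> (ssv a)) (lmul B (cobar H) c (\<tau> u b'))"
      proof (rule T.lact_ract[OF tau_bil mbilD(1)[OF tau_bil b(2)] _ _ W_carrier[OF ssv_W] cu(1,2)])
        show "\<tau> (f \<otimes>\<^bsub>cobar H\<^esub> u) b' = T.ract (\<tau> f) (\<tau> u b')" if "f \<in> carrier (cobar H)" for f
          using that tau_left[OF b(2) _ cu(3)] by (simp add: cobar_simps)
        show "\<tau> (ssv a) (x \<otimes>\<^bsub>B\<^esub> x') = T.lact (\<lambda>d. \<tau> d x') (\<tau> (ssv a) x)"
          if "x \<in> carrier B" "x' \<in> carrier B" for x x'
          using that letter_mult[OF ah(1) _ that] ah(2) by (simp add: l)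
      qed
      moreover have "T.ract (\<tau> (ssv a)) x = T.ract (letter ?n a) x" if "x \<in> T.K" for x
        unfolding T.ract_def using T.K_hbasis[OF that] by (intro lext_cong) (auto simp: l)
      ultimately show ?case
        using cu b by (simp add: T.ract_tens[OF mlin_letter] T.lact_tens[OF mbilD(1)[OF tau_bil]] l)
    qed (simp_all add: T.ract_linear T.lact_linear)
    then show ?case
      using Cons a b by (simp add: tau_delta right_swap_Cons)
  qed
qed (use b in \<open>simp_all add: tau_linear T.lact_linear\<close>)

lemma tau_one:
  assumes "w \<in> W"
  shows "\<tau> w \<one>\<^bsub>B\<^esub> = \<one>\<^bsub>B\<^esub> \<boxtimes> w"
  using assms
proof (induction rule: fsupp_induct)
  case (base as)
  then show ?case
  proof (induction as rule: list.induct)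
    case (Cons a as)
    then have a: "a \<in> E" "as \<in> lists E"
      by auto
    note ah = E_hcomp[OF a(1)]
    have "letter (gdeg H a) a \<one>\<^bsub>B\<^esub> = ksign 0 \<cdot> (\<one>\<^bsub>B\<^esub> \<boxtimes> ssv (a \<otimes> \<one>))"
      unfolding letter_def N.nu_one
      by (rule N.lext_tens_hcomp[OF mbil_letter[OF ah(4)] B.one_hcomp one_hcomp]) simp
    then have l: "letter (gdeg H a) a \<one>\<^bsub>B\<^esub> = \<one>\<^bsub>B\<^esub> \<boxtimes> delta [a]"
      using ah a by (simp add: ssv_E)
    have "right_swap H B as \<one>\<^bsub>B\<^esub> = \<one>\<^bsub>B\<^esub> \<boxtimes> delta as"
      using Cons a by (simp add: tau_delta)
    then have "\<tau> (delta (a # as)) \<one>\<^bsub>B\<^esub> = rmul B (cobar H) (\<one>\<^bsub>B\<^esub> \<boxtimes> delta [a]) (delta as)"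
      using a by (simp add: tau_delta right_swap_Cons T.ract_tens[OF mlin_letter] W_carrier l)
    then show ?case
      using a by (simp add: T.rmul_tens W_carrier) (simp add: cobar_simps delta_tmult)
  qed (simp add: tau_delta cobar_simps)
next
  case (add z z')
  then show ?case
    using T.tens_add(2)[of z z'] by (simp add: tau_linear cobar_simps)
next
  case (scale r z)
  then show ?case
    using T.tens_smult(2)[of z _ r] by (simp add: tau_linear cobar_simps)
next
  case zero
  then show ?case
    using T.tens_zero(2) by (simp add: tau_linear cobar_simps)
qed

lemma tau_hcomp:
  assumes "w \<in> hcomp (cobar H) m" "b \<in> hcomp B n"
  shows "\<tau> w b \<in> hcomp (tensor B (cobar H)) (m + n)"
  unfolding \<tau>_def
proof (rule T.T.lext_hcomp)
  fix as assume "w as \<noteq> 0"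
  then have "as \<in> lists E" "wdeg H as = m"
    using assms(1) by (auto simp: cobar_hcomp dest: fsupp_in)
  then show "right_swap H B as b \<in> hcomp (tensor B (cobar H)) (m + n)"
    using right_swap_hcomp[OF _ assms(2)] by metis
qed

sublocale X: twisted_tensor B "cobar H" \<tau>
proof unfold_locales
  show "\<tau> v (u \<otimes>\<^bsub>B\<^esub> u') = lext (\<lambda>(c, d). lmul B (cobar H) c (\<tau> d u')) (\<tau> v u)"
    if "v \<in> carrier (cobar H)" "u \<in> carrier B" "u' \<in> carrier B" for v u u'
    using tau_right that by (simp add: cobar_simps T.lact_def)
  show "\<tau> (v \<otimes>\<^bsub>cobar H\<^esub> v') u = lext (\<lambda>(c, d). rmul B (cobar H) (\<tau> v c) d) (\<tau> v' u)"
    if "v \<in> carrier (cobar H)" "v' \<in> carrier (cobar H)" "u \<in> carrier B" for v v' u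
    using tau_left that by (simp add: cobar_simps T.ract_def)
qed (use tau_bil tau_hcomp tau_one in \<open>auto simp: cobar_simps tau_delta\<close>)

section \<open>The differential on B \<otimes> \<Omega>H\<close>

abbreviation pr (infixl \<open>\<diamondop>\<close> 72) where "z \<diamondop> z' \<equiv> tmul B (cobar H) \<tau> z z'"

text \<open>The twisting part of D(b \<otimes> 1), up to the overall minus sign that is supplied in
  \<open>DU\<close>.\<close>

definition RR :: "'b \<Rightarrow> 'b \<times> ('h list \<Rightarrow> 'r) \<Rightarrow> 'r" where
  "RR b = lext (\<lambda>(x, h). ksign (gdeg B x) \<cdot> (x \<boxtimes> ssv h)) (\<nu> b)"

definition DU :: "'b \<Rightarrow> 'b \<times> ('h list \<Rightarrow> 'r) \<Rightarrow> 'r" where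
  "DU b = T.iU (dif B b) + - RR b"

definition DV :: "('h list \<Rightarrow> 'r) \<Rightarrow> 'b \<times> ('h list \<Rightarrow> 'r) \<Rightarrow> 'r" where
  "DV w = \<one>\<^bsub>B\<^esub> \<boxtimes> d\<Omega> w"

lemma W_add: "w \<in> W \<Longrightarrow> w' \<in> W \<Longrightarrow> b \<boxtimes> (w + w') = b \<boxtimes> w + b \<boxtimes> w'"
  and W_scale: "w \<in> W \<Longrightarrow> b \<boxtimes> (r \<cdot> w) = r \<cdot> (b \<boxtimes> w)"
  and W_zero: "b \<boxtimes> 0 = 0"
  using T.tens_add(2)[of w w'] T.tens_smult(2)[of w b r] T.tens_zero(2) by (simp_all add: cobar_simps)

lemma W_minus: "w \<in> W \<Longrightarrow> b \<boxtimes> (- w) = - (b \<boxtimes> w)"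
  using W_scale[of w b "- 1"] by simp

lemma W_lext:
  assumes "z \<in> fsupp X" "\<And>p. p \<in> X \<Longrightarrow> \<beta> p \<in> W"
  shows "b \<boxtimes> lext \<beta> z = lext (\<lambda>p. b \<boxtimes> \<beta> p) z"
proof -
  have "mlin (cobar H) KB (\<lambda>w. b \<boxtimes> w)"
    by (rule T.mlin_tens)
  then have F: "b \<boxtimes> w = lext (\<lambda>ws. b \<boxtimes> delta ws) w" if "w \<in> W" for w
    using C.mlin_eq_lext_delta that by blast
  have "b \<boxtimes> lext \<beta> z = lext (\<lambda>ws. b \<boxtimes> delta ws) (lext \<beta> z)"
    by (rule F) (auto intro: lext_fsupp assms(2) fsupp_in[OF assms(1)])
  also have "\<dots> = lext (\<lambda>p. lext (\<lambda>ws. b \<boxtimes> delta ws) (\<beta> p)) z"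
    using assms by (rule lext_lext)
  also have "\<dots> = lext (\<lambda>p. b \<boxtimes> \<beta> p) z"
    using F assms(2) fsupp_in[OF assms(1)] by (intro lext_cong) (auto simp: F[symmetric])
  finally show ?thesis .
qed

lemma mlin_DV: "mlin (cobar H) KB DV"
  by (intro mlinI) (simp_all add: DV_def cobar_simps d\<Omega>_linear W_add W_scale)

lemma mlin_RR: "mlin B KB RR"
  unfolding RR_def by (rule N.mlin_lext_nu) auto

lemma mlin_DU: "mlin B KB DU"
  unfolding DU_def by (intro mlin_add mlin_minus mlin_RR mlin_comp_graded[OF T.mlin_tens(1) B.dif_graded])

lemma RR_K [simp]: "b \<in> carrier B \<Longrightarrow> RR b \<in> T.K"
  using mlinD(1)[OF mlin_RR] .

lemma DV_hcomp: "w \<in> hcomp (cobar H) n \<Longrightarrow> DV w \<in> hcomp (tensor B (cobar H)) (n - 1)"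
  using T.tens_hcomp[OF B.one_hcomp d\<Omega>_hcomp] by (simp add: DV_def)

lemma DU_hcomp:
  assumes "b \<in> hcomp B n"
  shows "DU b \<in> hcomp (tensor B (cobar H)) (n - 1)"
proof -
  have "RR b \<in> hcomp (tensor B (cobar H)) (n - 1)"
    unfolding RR_def
  proof (rule T.T.lext_hcomp, clarify)
    fix x h assume "\<nu> b (x, h) \<noteq> 0"
    note s = N.nu_supp[OF assms this]
    have "x \<boxtimes> ssv h \<in> hcomp (tensor B (cobar H)) (gdeg B x + (gdeg H h - 1))"
      by (intro T.tens_hcomp ssv_hcomp s)
    then show "ksign (gdeg B x) \<cdot> (x \<boxtimes> ssv h) \<in> hcomp (tensor B (cobar H)) (n - 1)"
      using s(7) T.T.hcomp_smult unfolding T.T.smult_eq by (simp add: algebra_simps)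
  qed
  then have 1: "- RR b \<in> hcomp (tensor B (cobar H)) (n - 1)"
    using T.T.hcomp_smult[of "RR b" "n - 1" "- 1"] unfolding T.T.smult_eq by simp
  have 2: "T.iU (dif B b) \<in> hcomp (tensor B (cobar H)) (n - 1)"
    using T.tens_hcomp[OF B.dif_hcomp[OF assms] C.one_hcomp] by simp
  show ?thesis
    using T.T.hcomp_add[OF 2 1] unfolding T.T.add_eq DU_def .
qed

lemma sg_iV_csg: "w \<in> W \<Longrightarrow> T.sg (T.iV w) = T.iV (csg w)"
proof (induction rule: fsupp_induct)
  case (base ws)
  then show ?case
    using T.sg_tens[OF B.one_hcomp C.delta_hcomp[OF base]] by (simp add: csg_delta W_scale)
qed (simp_all add: W_add W_scale W_zero csg_linear T.sg_linear)

lemma iV_tmult: "w \<in> W \<Longrightarrow> w' \<in> W \<Longrightarrow> T.iV (w \<star> w') = T.iV w \<diamondop> T.iV w'"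
  using X.iV_mult[of w w'] by (simp add: cobar_simps)

lemma DV_mult:
  assumes "w \<in> W" "w' \<in> W"
  shows "DV (w \<star> w') = DV w \<diamondop> T.iV w' + T.sg (T.iV w) \<diamondop> DV w'"
  using assms by (simp add: DV_def d\<Omega>_tmult W_add tmult_fsupp iV_tmult sg_iV_csg)

lemma mbil_wt_ssv: "mbil B H KB (\<lambda>x h. r \<cdot> (x \<boxtimes> ssv h))"
  by (intro mbilI mlin_scale mlin_wt2 mlin_ssv T.mlin_tens)

lemma tens_iU:
  "b \<in> carrier B \<Longrightarrow> w \<in> W \<Longrightarrow> x \<in> carrier B \<Longrightarrow> (x \<boxtimes> w) \<diamondop> T.iU b = lmul B (cobar H) x (\<tau> w b)"
  by (simp add: X.tmul_tens W_carrier T.rmul_one)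

text \<open>Now the coaction on b is split by the degree of h. The terms with |h| = 0 add up to b
  \<otimes> 1 and yield b \<cdot> RR b', with sign (-1)^m since |x| = m there. In those with |h| > 0
  the letter s^-1 h is moved past b', which yields RR b \<cdot> b'.\<close>

lemma RR_mult:
  assumes b: "b \<in> hcomp B m" and b': "b' \<in> carrier B"
  shows "RR (b \<otimes>\<^bsub>B\<^esub> b') = RR b \<diamondop> T.iU b' + ksign m \<cdot> (T.iU b \<diamondop> RR b')"
proof -
  note bc = B.hcomp_carrier[OF b]
  let ?G = "\<lambda>x h. lext (\<lambda>(x', h'). ksign (gdeg B x') \<cdot> ((x \<otimes>\<^bsub>B\<^esub> x') \<boxtimes> ssv (h \<otimes> h'))) (\<nu> b')"
  let ?\<gamma> = "\<lambda>(x, h). ksign (gdeg B x) \<cdot> (x \<boxtimes> ssv h)"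
  have "RR (b \<otimes>\<^bsub>B\<^esub> b') = lext (\<lambda>p. ksign m \<cdot> (case p of (x, h) \<Rightarrow> if gdeg H h = 0 then ?G x h else 0) +
      (case p of (x, h) \<Rightarrow> ksign (gdeg B x) \<cdot> (x \<boxtimes> ssv h)) \<diamondop> T.iU b') (\<nu> b)"
    unfolding RR_def N.nu_mult[OF bc b']
  proof (intro lext_cong, clarify)
    fix x h assume "\<nu> b (x, h) \<noteq> 0"
    note s = N.nu_supp[OF b this]
    have inner: "ksign (gdeg H h * gdeg B x') \<cdot> lext ?\<gamma> (tens B H (x \<otimes>\<^bsub>B\<^esub> x') (h \<otimes> h')) =
      ksign (gdeg H h * gdeg B x' + gdeg B x + gdeg B x') \<cdot> ((x \<otimes>\<^bsub>B\<^esub> x') \<boxtimes> ssv (h \<otimes> h'))"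
      if "\<nu> b' (x', h') \<noteq> 0" for x' h'
    proof -
      from N.nu_basis[OF b' that]
      have xh': "h' \<in> hcomp H (gdeg H h')" "x' \<in> hcomp B (gdeg B x')"
        using hbasis_hcomp B.hbasis_hcomp by auto
      have "lext ?\<gamma> (tens B H (x \<otimes>\<^bsub>B\<^esub> x') (h \<otimes> h')) =
        ksign (gdeg B x + gdeg B x') \<cdot> ((x \<otimes>\<^bsub>B\<^esub> x') \<boxtimes> ssv (h \<otimes> h'))"
        by (rule N.lext_tens_hcomp[OF mbil_wt_ssv B.mult_hcomp[OF s(3) xh'(2)] mult_hcomp[OF s(4) xh'(1)]]) simp
      then show ?thesis
        by (simp add: ksign_add mult.assoc)
    qed
    have "lext (\<lambda>(x', h'). ksign (gdeg H h * gdeg B x') \<cdot> lext ?\<gamma> (tens B H (x \<otimes>\<^bsub>B\<^esub> x') (h \<otimes> h'))) (\<nu> b') =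
      lext (\<lambda>(x', h'). ksign (gdeg H h * gdeg B x' + gdeg B x + gdeg B x') \<cdot> ((x \<otimes>\<^bsub>B\<^esub> x') \<boxtimes> ssv (h \<otimes> h'))) (\<nu> b')"
      using inner by (intro lext_cong) auto
    also have "\<dots> = ksign m \<cdot> (if gdeg H h = 0 then ?G x h else 0) +
        (ksign (gdeg B x) \<cdot> (x \<boxtimes> ssv h)) \<diamondop> T.iU b'"
    proof (cases "gdeg H h = 0")
      case True
      then have "gdeg B x = m"
        using s(7) by simp
      with True show ?thesis
        using ssv_nonpos[OF s(4)]
        by (simp add: W_zero X.tmul_linear ksign_add lext_fun_scale[symmetric] split_def)
    next
      case False
      then have pos: "gdeg H h > 0"
        using hbasis_degree[OF s(2)] by simp
      have "(ksign (gdeg B x) \<cdot> (x \<boxtimes> ssv h)) \<diamondop> T.iU b' = ksign (gdeg B x) \<cdot> lext (\<lambda>(x', h').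
          ksign ((gdeg H h - 1) * gdeg B x') \<cdot> ((x \<otimes>\<^bsub>B\<^esub> x') \<boxtimes> ssv (h \<otimes> h'))) (\<nu> b')"
        using s b' by (simp add: X.tmul_linear tens_iU tau_ssv[OF s(4) pos] lmul_letter)
      also have "\<dots> = lext (\<lambda>(x', h'). ksign (gdeg H h * gdeg B x' + gdeg B x + gdeg B x') \<cdot>
          ((x \<otimes>\<^bsub>B\<^esub> x') \<boxtimes> ssv (h \<otimes> h'))) (\<nu> b')"
      proof (subst lext_fun_scale[symmetric], rule lext_cong, clarify)
        fix x' h' assume "\<nu> b' (x', h') \<noteq> 0"
        have "ksign (gdeg B x) * ksign ((gdeg H h - 1) * gdeg B x') =
            (ksign (gdeg H h * gdeg B x' + gdeg B x + gdeg B x') :: 'r)"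
          unfolding ksign_add[symmetric] by (intro ksign_cong) (simp; blast)
        then show "ksign (gdeg B x) \<cdot> ksign ((gdeg H h - 1) * gdeg B x') \<cdot> ((x \<otimes>\<^bsub>B\<^esub> x') \<boxtimes> ssv (h \<otimes> h')) =
          ksign (gdeg H h * gdeg B x' + gdeg B x + gdeg B x') \<cdot> ((x \<otimes>\<^bsub>B\<^esub> x') \<boxtimes> ssv (h \<otimes> h'))"
          by simp
      qed
      finally show ?thesis
        using False by simp
    qed
    finally show "lext (\<lambda>(x', h'). ksign (gdeg H h * gdeg B x') \<cdot>
        lext ?\<gamma> (tens B H (x \<otimes>\<^bsub>B\<^esub> x') (h \<otimes> h'))) (\<nu> b') =
      ksign m \<cdot> (if gdeg H h = 0 then ?G x h else 0) + (ksign (gdeg B x) \<cdot> (x \<boxtimes> ssv h)) \<diamondop> T.iU b'" .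
  qed
  also have "\<dots> = ksign m \<cdot> lext (\<lambda>(x, h). if gdeg H h = 0 then ?G x h else 0) (\<nu> b) +
      lext (\<lambda>p. (case p of (x, h) \<Rightarrow> ksign (gdeg B x) \<cdot> (x \<boxtimes> ssv h)) \<diamondop> T.iU b') (\<nu> b)"
    unfolding lext_fun_add lext_fun_scale ..
  also have "lext (\<lambda>p. (case p of (x, h) \<Rightarrow> ksign (gdeg B x) \<cdot> (x \<boxtimes> ssv h)) \<diamondop> T.iU b') (\<nu> b) = RR b \<diamondop> T.iU b'"
    unfolding RR_def using N.nu_fsupp[OF bc] by (intro X.tmul_lext_left[symmetric]) auto
  also have "lext (\<lambda>(x, h). if gdeg H h = 0 then ?G x h else 0) (\<nu> b) = ?G b \<one>"
  proof (rule nu_0[where Y = KB, OF _ _ bc])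
    show "mlin H KB (?G x)" for x
      unfolding split_def using N.nu_basis[OF b']
      by (intro mlin_lext_fun mlin_scale mlin_ssv_mult(2)) auto
    show "mlin B KB (\<lambda>x. ?G x \<one>)"
    proof (rule mlin_lext_fun, clarify)
      fix x h assume "\<nu> b' (x, h) \<noteq> 0"
      then have "x \<in> carrier B"
        using N.nu_basis[OF b'] by auto
      then show "mlin B KB (\<lambda>y. ksign (gdeg B x) \<cdot> ((y \<otimes>\<^bsub>B\<^esub> x) \<boxtimes> ssv (\<one> \<otimes> h)))"
        using mlinD[OF T.mlin_tens(1)] by (intro mlin_scale mlinI) (auto simp: B.l_distr B.smult_mult)
    qed
  qed
  also have "?G b \<one> = T.iU b \<diamondop> RR b'"
  proof -
    have "lmul B (cobar H) b (RR b') = lext (\<lambda>p. lmul B (cobar H) b (case p of (x, h) \<Rightarrow>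
        ksign (gdeg B x) \<cdot> (x \<boxtimes> ssv h))) (\<nu> b')"
      unfolding RR_def using N.nu_fsupp[OF b'] by (rule T.lmul_lext) auto
    also have "\<dots> = ?G b \<one>"
      using bc N.nu_basis[OF b'] by (intro lext_cong) (auto simp: T.lmul_linear T.lmul_tens W_carrier)
    finally show ?thesis
      using X.lmul_eq[OF RR_K[OF b'] bc] by simp
  qed
  finally show ?thesis
    by (simp add: add.commute)
qed

lemma DU_tmul:
  assumes "b \<in> carrier B"
  shows "DU b \<diamondop> z = T.iU (dif B b) \<diamondop> z + - (RR b \<diamondop> z)"
    and "z \<diamondop> DU b = z \<diamondop> T.iU (dif B b) + - (z \<diamondop> RR b)"
proof -
  have K: "T.iU (dif B b) \<in> T.K" "RR b \<in> T.K" "- RR b \<in> T.K"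
    using assms by auto
  show "DU b \<diamondop> z = T.iU (dif B b) \<diamondop> z + - (RR b \<diamondop> z)"
    unfolding DU_def X.tmul_linear(2)[OF K(1,3)] using K by (simp add: X.tmul_linear)
  show "z \<diamondop> DU b = z \<diamondop> T.iU (dif B b) + - (z \<diamondop> RR b)"
    unfolding DU_def X.tmul_linear_right(2)[OF K(1,3)] using K by (simp add: X.tmul_linear)
qed

lemma DU_mult:
  assumes "b \<in> carrier B" and b': "b' \<in> carrier B"
  shows "DU (b \<otimes>\<^bsub>B\<^esub> b') = DU b \<diamondop> T.iU b' + T.sg (T.iU b) \<diamondop> DU b'"
proof (rule B.mlin_eqI[OF _ _ assms(1)])
  show "mlin B KB (\<lambda>b. DU (b \<otimes>\<^bsub>B\<^esub> b'))"
    using b' by (intro mlinI) (auto simp: mlinD[OF mlin_DU] B.l_distr B.smult_mult)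
  show "mlin B KB (\<lambda>b. DU b \<diamondop> T.iU b' + T.sg (T.iU b) \<diamondop> DU b')"
    by (intro mlin_add X.mlin_tmul_left mlin_DU T.mlin_sg T.mlin_tens)
  fix b assume b: "b \<in> hbasis B" "b \<in> hcomp B (gdeg B b)"
  let ?m = "gdeg B b"
  have "T.sg (T.iU b) = ksign ?m \<cdot> T.iU b"
    using T.sg_tens[OF b(2) C.one_hcomp] by simp
  then show "DU (b \<otimes>\<^bsub>B\<^esub> b') = DU b \<diamondop> T.iU b' + T.sg (T.iU b) \<diamondop> DU b'"
    using b b' by (simp add: DU_tmul X.tmul_linear)
      (simp add: DU_def B.dif_leibniz[OF b(2)] RR_mult[OF b(2) b'] T.tens_add T.tens_smult
        X.iU_mult fscale_add fscale_minus algebra_simps)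
qed

lemma right_cobar_simps:
  "carrier (right_cobar (H, B)) = carrier (tensor B (cobar H))" "add (right_cobar (H, B)) = (+)"
  "zero (right_cobar (H, B)) = 0" "smult (right_cobar (H, B)) = (\<cdot>)"
  "hcomp (right_cobar (H, B)) = hcomp (tensor B (cobar H))"
  "one (right_cobar (H, B)) = \<one>\<^bsub>B\<^esub> \<boxtimes> \<one>\<^bsub>cobar H\<^esub>"
  "mult (right_cobar (H, B)) = tmul B (cobar H) \<tau>" "dif (right_cobar (H, B)) = right_dif H B"
  by (simp_all add: right_cobar_def tensor_simps fun_eq_iff right_mult_def tmul_def \<tau>_def cobar_simps)

sublocale Y: twisted_dif B "cobar H" \<tau> "right_cobar (H, B)" DU DV
proof unfold_locales
  show "DV (v \<otimes>\<^bsub>cobar H\<^esub> v') = DV v \<diamondop> T.iV v' + T.sg (T.iV v) \<diamondop> DV v'"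
    if "v \<in> carrier (cobar H)" "v' \<in> carrier (cobar H)" for v v'
    using that DV_mult by (simp add: cobar_simps)
qed (simp_all add: right_cobar_simps mlin_DU mlin_DV DU_hcomp DV_hcomp DU_mult)

lemma DD_wt:
  assumes b: "b \<in> hcomp B k" and w: "w \<in> W"
  shows "Y.DD (b \<boxtimes> w) = dif B b \<boxtimes> w + ksign k \<cdot> (b \<boxtimes> d\<Omega> w) +
    - lext (\<lambda>(x, h). ksign (gdeg B x) \<cdot> (x \<boxtimes> (ssv h \<star> w))) (\<nu> b)"
proof -
  note bc = B.hcomp_carrier[OF b] and wc = W_carrier[OF w]
  have "rmul B (cobar H) (RR b) w = lext (\<lambda>p. rmul B (cobar H) (case p of (x, h) \<Rightarrow>
      ksign (gdeg B x) \<cdot> (x \<boxtimes> ssv h)) w) (\<nu> b)"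
    unfolding RR_def using N.nu_fsupp[OF bc] by (rule T.rmul_lext) auto
  also have "\<dots> = lext (\<lambda>(x, h). ksign (gdeg B x) \<cdot> (x \<boxtimes> (ssv h \<star> w))) (\<nu> b)"
    using wc N.nu_basis[OF bc]
    by (intro lext_cong) (auto simp: T.rmul_linear T.rmul_tens W_carrier, simp add: cobar_simps)
  finally have "RR b \<diamondop> T.iV w = lext (\<lambda>(x, h). ksign (gdeg B x) \<cdot> (x \<boxtimes> (ssv h \<star> w))) (\<nu> b)"
    using X.rmul_eq[OF RR_K[OF bc] wc] by simp
  moreover have "T.iU b \<diamondop> DV w = b \<boxtimes> d\<Omega> w"
    using bc w by (simp add: DV_def X.tens_eq W_carrier)
  ultimately show ?thesis
    using bc wc Y.sg_iU[OF b]
    by (simp add: Y.DD_tens X.tmul_linear DU_tmul X.tens_eq)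
qed

lemma DD_DV: "w \<in> W \<Longrightarrow> Y.DD (DV w) = 0"
  using Y.DD_iV[of "d\<Omega> w"] by (simp add: DV_def cobar_simps d\<Omega>_d\<Omega> W_zero)

lemma wt_CG:
  assumes "h \<in> carrier H"
  shows "x \<boxtimes> CG h = - (x \<boxtimes> ssv (dif H h)) + lext (\<lambda>(c, c'). ksign (gdeg H c) \<cdot> (x \<boxtimes> (ssv c \<star> ssv c'))) (comult H h)"
proof -
  let ?\<beta> = "\<lambda>(x, y). ksign (gdeg H x) \<cdot> (ssv x \<star> ssv y)"
  have L: "lext ?\<beta> (comult H h) \<in> W"
    by (intro lext_fsupp) (auto intro!: tmult_fsupp)
  have "x \<boxtimes> lext ?\<beta> (comult H h) = lext (\<lambda>p. x \<boxtimes> ?\<beta> p) (comult H h)"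
    using D.nu_fsupp[OF assms] by (rule W_lext) (auto intro!: tmult_fsupp)
  also have "\<dots> = lext (\<lambda>(c, c'). ksign (gdeg H c) \<cdot> (x \<boxtimes> (ssv c \<star> ssv c'))) (comult H h)"
    by (intro lext_cong) (auto simp: W_scale tmult_fsupp)
  finally show ?thesis
    using L W_add[of "- ssv (dif H h)" "lext ?\<beta> (comult H h)" x] by (simp add: CG_def W_minus)
qed

text \<open>As before, the terms with one letter cancel because the coaction is a chain map. For
  those with two letters, the signs first have to be expressed by the middle factor.\<close>

lemma DD_DU:
  assumes b: "b \<in> carrier B"
  shows "Y.DD (DU b) = 0"
proof -
  let ?\<beta> = "\<lambda>x h1 h2. ksign (gdeg H h1) \<cdot> (x \<boxtimes> (ssv h1 \<star> ssv h2))"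
  let ?\<gamma> = "\<lambda>(x, h). ksign (gdeg B x) \<cdot> (x \<boxtimes> ssv h)"
  have 1: "RR (dif B b) = lext (\<lambda>(x, h). - (ksign (gdeg B x) \<cdot> (dif B x \<boxtimes> ssv h)) + x \<boxtimes> ssv (dif H h)) (\<nu> b)"
    unfolding RR_def N.nu_dif[OF b]
  proof (intro lext_cong, clarify)
    fix x h assume "\<nu> b (x, h) \<noteq> 0"
    from N.nu_basis[OF b this]
    have s: "h \<in> hcomp H (gdeg H h)" "x \<in> hcomp B (gdeg B x)"
      using hbasis_hcomp B.hbasis_hcomp by auto
    have 1: "lext ?\<gamma> (tens B H (dif B x) h) = ksign (gdeg B x - 1) \<cdot> (dif B x \<boxtimes> ssv h)"
      by (rule N.lext_tens_hcomp[OF mbil_wt_ssv B.dif_hcomp[OF s(2)] s(1)]) simp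
    have 2: "lext ?\<gamma> (tens B H x (dif H h)) = ksign (gdeg B x) \<cdot> (x \<boxtimes> ssv (dif H h))"
      by (rule N.lext_tens_hcomp[OF mbil_wt_ssv s(2) dif_hcomp[OF s(1)]]) simp
    show "lext ?\<gamma> (tens B H (dif B x) h) + ksign (gdeg B x) \<cdot> lext ?\<gamma> (tens B H x (dif H h)) =
      - (ksign (gdeg B x) \<cdot> (dif B x \<boxtimes> ssv h)) + x \<boxtimes> ssv (dif H h)"
      unfolding 1 2 by (simp add: ksign_diff_one)
  qed
  have 2: "Y.DD (ksign (gdeg B x) \<cdot> (x \<boxtimes> ssv h)) =
      - (- (ksign (gdeg B x) \<cdot> (dif B x \<boxtimes> ssv h)) + x \<boxtimes> ssv (dif H h)) +
      (lext (\<lambda>(h1, h2). ?\<beta> x h1 h2) (comult H h) + - lext (\<lambda>(x', h'). ?\<beta> x' h' h) (\<nu> x))"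
    if "\<nu> b (x, h) \<noteq> 0" for x h
  proof -
    have s: "x \<in> hcomp B (gdeg B x)" "h \<in> carrier H"
      using N.nu_basis[OF b that] B.hbasis_hcomp by auto
    \<comment> \<open>Because |x| = |x'| + |h'|, the product of the two signs is that of h', the
      middle factor, as in the term from the coproduct; coassociativity then applies.\<close>
    have "ksign (gdeg B x) \<cdot> lext (\<lambda>(x', h'). ksign (gdeg B x') \<cdot> (x' \<boxtimes> (ssv h' \<star> ssv h))) (\<nu> x) =
      lext (\<lambda>(x', h'). ?\<beta> x' h' h) (\<nu> x)"
    proof (subst lext_fun_scale[symmetric], rule lext_cong, clarify)
      fix x' h' assume "\<nu> x (x', h') \<noteq> 0"
      note t = N.nu_supp[OF s(1) this]
      have "ksign (gdeg B x) * ksign (gdeg B x') = (ksign (gdeg H h') :: 'r)"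
        unfolding ksign_add[symmetric] t(7) by (rule ksign_cong) simp
      then show "ksign (gdeg B x) \<cdot> ksign (gdeg B x') \<cdot> (x' \<boxtimes> (ssv h' \<star> ssv h)) =
        ksign (gdeg H h') \<cdot> (x' \<boxtimes> (ssv h' \<star> ssv h))"
        by simp
    qed
    then show ?thesis
      using s(2) by (simp add: Y.DD_linear DD_wt[OF s(1)] d\<Omega>_ssv wt_CG fscale_add fscale_diff)
  qed
  have "Y.DD (RR b) = lext (\<lambda>p. Y.DD (case p of (x, h) \<Rightarrow> ksign (gdeg B x) \<cdot> (x \<boxtimes> ssv h))) (\<nu> b)"
    unfolding RR_def using N.nu_fsupp[OF b] by (rule Y.DD_lext) auto
  also have "\<dots> = lext (\<lambda>p. - (case p of (x, h) \<Rightarrow> - (ksign (gdeg B x) \<cdot> (dif B x \<boxtimes> ssv h)) + x \<boxtimes> ssv (dif H h)) +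
      ((case p of (x, h) \<Rightarrow> lext (\<lambda>(h1, h2). ?\<beta> x h1 h2) (comult H h)) +
       - (case p of (x, h) \<Rightarrow> lext (\<lambda>(x', h'). ?\<beta> x' h' h) (\<nu> x)))) (\<nu> b)"
    by (intro lext_cong, clarify) (use 2 in simp)
  also have "\<dots> = - RR (dif B b) + (lext (\<lambda>(x, h). lext (\<lambda>(h1, h2). ?\<beta> x h1 h2) (comult H h)) (\<nu> b) +
      - lext (\<lambda>(x, h). lext (\<lambda>(x', h'). ?\<beta> x' h' h) (\<nu> x)) (\<nu> b))"
    unfolding lext_fun_add lext_fun_minus 1 ..
  also have "lext (\<lambda>(x, h). lext (\<lambda>(x', h'). ?\<beta> x' h' h) (\<nu> x)) (\<nu> b) =
      lext (\<lambda>(x, h). lext (\<lambda>(h1, h2). ?\<beta> x h1 h2) (comult H h)) (\<nu> b)"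
    by (rule nu_coassoc[where Y = KB, OF _ b]) auto
  finally have "Y.DD (RR b) = - RR (dif B b)"
    by simp
  then show ?thesis
    using b Y.DD_iU[of "dif B b"] Y.DD_linear(2)[of "T.iU (dif B b)" "- RR b"]
    by (simp add: DU_def Y.DD_linear(4))
qed

text \<open>The terms of D((1 \<otimes> s^-1 a)(b \<otimes> 1)) with a single letter. The Leibniz
  rule in H for a \<cdot> h and the compatibility of the coaction with the differentials distribute
  them over da and db.\<close>

lemma swap_linear:
  assumes a: "a \<in> hcomp H n" and b: "b \<in> hcomp B m"
  shows "lext (\<lambda>(x, h). ksign ((n - 1) * gdeg B x) \<cdot>
      (dif B x \<boxtimes> ssv (a \<otimes> h) + - (ksign (gdeg B x) \<cdot> (x \<boxtimes> ssv (dif H (a \<otimes> h)))))) (\<nu> b) =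
    - letter (n - 1) (dif H a) b + ksign (n - 1) \<cdot> letter n a (dif B b)"
proof -
  note ac = hcomp_carrier[OF a] and bc = B.hcomp_carrier[OF b]
  let ?\<gamma> = "\<lambda>(x, h). ksign ((n - 1) * gdeg B x) \<cdot> (x \<boxtimes> ssv (a \<otimes> h))"
  let ?t = "\<lambda>x h. ksign ((n - 1 - 1) * gdeg B x) \<cdot> (x \<boxtimes> ssv (dif H a \<otimes> h))"
  have "- letter (n - 1) (dif H a) b + ksign (n - 1) \<cdot> letter n a (dif B b) =
    lext (\<lambda>p. - (case p of (x, h) \<Rightarrow> ?t x h) + ksign (n - 1) \<cdot> (case p of (x, h) \<Rightarrow>
      lext ?\<gamma> (tens B H (dif B x) h) + ksign (gdeg B x) \<cdot> lext ?\<gamma> (tens B H x (dif H h)))) (\<nu> b)"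
    unfolding letter_def N.nu_dif[OF bc] lext_fun_add lext_fun_minus lext_fun_scale ..
  also have "\<dots> = lext (\<lambda>(x, h). ksign ((n - 1) * gdeg B x) \<cdot>
      (dif B x \<boxtimes> ssv (a \<otimes> h) + - (ksign (gdeg B x) \<cdot> (x \<boxtimes> ssv (dif H (a \<otimes> h)))))) (\<nu> b)"
  proof (intro lext_cong, clarify)
    fix x h assume "\<nu> b (x, h) \<noteq> 0"
    note s = N.nu_supp[OF b this]
    let ?x = "gdeg B x"
    have 1: "lext ?\<gamma> (tens B H (dif B x) h) = ksign ((n - 1) * (?x - 1)) \<cdot> (dif B x \<boxtimes> ssv (a \<otimes> h))"
      by (rule N.lext_tens_hcomp[OF mbil_letter[OF ac] B.dif_hcomp[OF s(3)] s(4)]) simp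
    have 2: "lext ?\<gamma> (tens B H x (dif H h)) = ksign ((n - 1) * ?x) \<cdot> (x \<boxtimes> ssv (a \<otimes> dif H h))"
      by (rule N.lext_tens_hcomp[OF mbil_letter[OF ac] s(3) dif_hcomp[OF s(4)]]) simp
    have "ssv (dif H (a \<otimes> h)) = ssv (dif H a \<otimes> h) + ksign n \<cdot> ssv (a \<otimes> dif H h)"
      using s ac by (simp add: dif_leibniz[OF a] mlinD[OF mlin_ssv])
    then have 3: "x \<boxtimes> ssv (dif H (a \<otimes> h)) = x \<boxtimes> ssv (dif H a \<otimes> h) + ksign n \<cdot> (x \<boxtimes> ssv (a \<otimes> dif H h))"
      by (simp add: W_add W_scale)
    have 4: "ksign (n - 1) * ksign ((n - 1) * (?x - 1)) = (ksign ((n - 1) * ?x) :: 'r)"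
      unfolding ksign_add[symmetric] by (rule ksign_cong) (simp, argo)
    have 5: "ksign (n - 1) * (ksign ?x * ksign ((n - 1) * ?x)) =
        (- (ksign ((n - 1) * ?x) * (ksign ?x * ksign n)) :: 'r)"
      unfolding ksign_add[symmetric] by (rule ksign_neg) (simp, argo)
    have 6: "(ksign ((n - 1 - 1) * ?x) :: 'r) = ksign ((n - 1) * ?x) * ksign ?x"
      unfolding ksign_add[symmetric] by (rule ksign_cong) (simp, argo)
    show "- ?t x h + ksign (n - 1) \<cdot> (lext ?\<gamma> (tens B H (dif B x) h) +
        ksign ?x \<cdot> lext ?\<gamma> (tens B H x (dif H h))) =
      ksign ((n - 1) * ?x) \<cdot> (dif B x \<boxtimes> ssv (a \<otimes> h) + - (ksign ?x \<cdot> (x \<boxtimes> ssv (dif H (a \<otimes> h)))))"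
      unfolding 1 2 3 fscale_fscale fscale_add 4 5 6 fscale_minus by simp
  qed
  finally show ?thesis ..
qed

section \<open>Quadratic terms in the Leibniz rule for a letter and b\<close>

lemma tau_pair:
  assumes b: "b \<in> carrier B" and a: "a \<in> hcomp H n" "n > 0" and a': "a' \<in> hcomp H n'" "n' > 0"
  shows "\<tau> (ssv a \<star> ssv a') b = lext (\<lambda>(x, h). lext (\<lambda>(x', h').
    (ksign ((n' - 1) * gdeg B x) * ksign ((n - 1) * gdeg B x')) \<cdot>
      (x' \<boxtimes> (ssv (a \<otimes> h') \<star> ssv (a' \<otimes> h)))) (\<nu> x)) (\<nu> b)"
proof -
  have "\<tau> (ssv a \<star> ssv a') b = T.ract (\<tau> (ssv a)) (letter n' a' b)"
    using b by (simp add: tau_left tau_ssv[OF a'])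
  also have "\<dots> = lext (\<lambda>p. T.ract (\<tau> (ssv a)) (case p of (x, h) \<Rightarrow>
      ksign ((n' - 1) * gdeg B x) \<cdot> (x \<boxtimes> ssv (a' \<otimes> h)))) (\<nu> b)"
    unfolding letter_def using N.nu_fsupp[OF b] by (rule T.ract_lext) auto
  also have "\<dots> = lext (\<lambda>(x, h). lext (\<lambda>(x', h').
    (ksign ((n' - 1) * gdeg B x) * ksign ((n - 1) * gdeg B x')) \<cdot>
      (x' \<boxtimes> (ssv (a \<otimes> h') \<star> ssv (a' \<otimes> h)))) (\<nu> x)) (\<nu> b)"
  proof (intro lext_cong, clarify)
    fix x h assume "\<nu> b (x, h) \<noteq> 0"
    then have x: "x \<in> carrier B"
      using N.nu_basis[OF b] by auto
    have "T.ract (\<tau> (ssv a)) (ksign ((n' - 1) * gdeg B x) \<cdot> (x \<boxtimes> ssv (a' \<otimes> h))) =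
      ksign ((n' - 1) * gdeg B x) \<cdot> rmul B (cobar H) (letter n a x) (ssv (a' \<otimes> h))"
      using x by (simp add: T.ract_linear T.ract_tens[OF mlin_tau] W_carrier tau_ssv[OF a])
    also have "\<dots> = lext (\<lambda>(x', h'). (ksign ((n' - 1) * gdeg B x) * ksign ((n - 1) * gdeg B x')) \<cdot>
        (x' \<boxtimes> (ssv (a \<otimes> h') \<star> ssv (a' \<otimes> h)))) (\<nu> x)"
      unfolding rmul_letter[OF x ssv_W hcomp_carrier[OF a(1)]] lext_fun_scale[symmetric]
      by (simp add: split_def)
    finally show "T.ract (\<tau> (ssv a)) (ksign ((n' - 1) * gdeg B x) \<cdot> (x \<boxtimes> ssv (a' \<otimes> h))) =
      lext (\<lambda>(x', h'). (ksign ((n' - 1) * gdeg B x) * ksign ((n - 1) * gdeg B x')) \<cdot>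
        (x' \<boxtimes> (ssv (a \<otimes> h') \<star> ssv (a' \<otimes> h)))) (\<nu> x)" .
  qed
  finally show ?thesis .
qed

lemma mbil_pair:
  assumes "h \<in> carrier H" "h' \<in> carrier H"
  shows "mbil H H KB (\<lambda>a a'. r \<cdot> (x \<boxtimes> (ssv (a \<otimes> h) \<star> ssv (a' \<otimes> h'))))"
  using assms by (intro mbilI mlin_scale mlin_wt2)
    (auto intro!: mlin_tmult_left mlin_tmult_right mlin_smult_right[OF mlin_ssv])

lemma mbil_ssv_pair: "mbil H H KB (\<lambda>c c'. r \<cdot> (x \<boxtimes> (ssv c \<star> ssv c')))"
  by (intro mbilI mlin_scale mlin_wt2) (auto intro!: mlin_tmult_left mlin_tmult_right mlin_ssv)

text \<open>Compared with the other side, the extreme terms of the coproduct of a exchange roles: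
  those from 1 \<otimes> a (\<open>?G1\<close>) cancel against the twisted part of D, and those from
  a \<otimes> 1 (\<open>?G2\<close>) give the product of s^-1 a with RR b. The terms with both
  factors positive (\<open>?M\<close>) again give the quadratic part of the cobar differential,
  moved past b.\<close>

lemma swap_quadratic:
  assumes a: "a \<in> hcomp H n" "n > 0" and b: "b \<in> hcomp B m"
  shows "lext (\<lambda>(x, h). ksign ((n - 1) * gdeg B x) \<cdot>
      (- lext (\<lambda>(x', h'). ksign (gdeg B x') \<cdot> (x' \<boxtimes> (ssv h' \<star> ssv (a \<otimes> h)))) (\<nu> x) +
       ksign (gdeg B x) \<cdot> lext (\<lambda>(c, c'). ksign (gdeg H c) \<cdot> (x \<boxtimes> (ssv c \<star> ssv c'))) (comult H (a \<otimes> h)))) (\<nu> b) =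
    lext (\<lambda>(a1, a2). ksign (gdeg H a1) \<cdot> \<tau> (ssv a1 \<star> ssv a2) b) (comult H a) +
    - (ksign (n - 1) \<cdot> lext (\<lambda>(x, h). ksign (gdeg B x) \<cdot> rmul B (cobar H) (letter n a x) (ssv h)) (\<nu> b))"
proof -
  note ac = hcomp_carrier[OF a(1)] and bc = B.hcomp_carrier[OF b]
  let ?k = "\<lambda>x h a1 a2. ksign (n * gdeg B x + gdeg H a2 * gdeg H h + gdeg H a1 + gdeg H h) :: 'r"
  let ?w = "\<lambda>x h h' a1 a2. x \<boxtimes> (ssv (a1 \<otimes> h) \<star> ssv (a2 \<otimes> h'))"
  let ?\<beta> = "\<lambda>x h h'. lext (\<lambda>(a1, a2). ?k x h a1 a2 \<cdot> ?w x h h' a1 a2) (comult H a)"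
  let ?\<Theta> = "\<lambda>a1 a2 x h h'. if gdeg H a1 > 0 \<and> gdeg H a2 > 0 then ?k x h a1 a2 \<cdot> ?w x h h' a1 a2 else 0"
  let ?M = "\<lambda>x h h'. lext (\<lambda>(a1, a2). ?\<Theta> a1 a2 x h h') (comult H a)"
  let ?G1 = "\<lambda>x h h'. ksign (n * gdeg B x + n * gdeg H h + gdeg H h) \<cdot> (x \<boxtimes> (ssv h \<star> ssv (a \<otimes> h')))"
  let ?G2 = "\<lambda>x h h'. ksign (n * gdeg B x + n + gdeg H h) \<cdot> (x \<boxtimes> (ssv (a \<otimes> h) \<star> ssv h'))"
  \<comment> \<open>In the coproduct of a \<cdot> h the sum over the coproduct of a is the outer
    one. The sums are exchanged at the end, so that coassociativity can act on the coproduct of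
    h.\<close>
  have A: "ksign ((n - 1) * gdeg B x) \<cdot> ksign (gdeg B x) \<cdot>
      lext (\<lambda>(c, c'). ksign (gdeg H c) \<cdot> (x \<boxtimes> (ssv c \<star> ssv c'))) (comult H (a \<otimes> h)) =
    lext (\<lambda>(h1, h2). ?\<beta> x h1 h2) (comult H h)"
    if h: "h \<in> hcomp H (gdeg H h)" for h x
  proof -
    let ?\<gamma> = "\<lambda>(c, c'). ksign (gdeg H c) \<cdot> (x \<boxtimes> (ssv c \<star> ssv c'))"
    have "ksign ((n - 1) * gdeg B x) \<cdot> ksign (gdeg B x) \<cdot> lext ?\<gamma> (comult H (a \<otimes> h)) =
      lext (\<lambda>(a1, a2). lext (\<lambda>(h1, h2). ?k x h1 a1 a2 \<cdot> ?w x h1 h2 a1 a2) (comult H h)) (comult H a)"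
      unfolding D.nu_mult[OF ac hcomp_carrier[OF h]] fscale_fscale
    proof (subst lext_fun_scale[symmetric], rule lext_cong, clarify)
      fix a1 a2 assume "comult H a (a1, a2) \<noteq> 0"
      note t = D.nu_supp[OF a(1) this]
      show "(ksign ((n - 1) * gdeg B x) * ksign (gdeg B x)) \<cdot> lext (\<lambda>(x', y').
          ksign (gdeg H a2 * gdeg H x') \<cdot> lext ?\<gamma> (tens H H (a1 \<otimes> x') (a2 \<otimes> y'))) (comult H h) =
        lext (\<lambda>(h1, h2). ?k x h1 a1 a2 \<cdot> ?w x h1 h2 a1 a2) (comult H h)"
      proof (subst lext_fun_scale[symmetric], rule lext_cong, clarify)
        fix h1 h2 assume "comult H h (h1, h2) \<noteq> 0"
        note s = D.nu_supp[OF h this]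
        have "lext ?\<gamma> (tens H H (a1 \<otimes> h1) (a2 \<otimes> h2)) = ksign (gdeg H a1 + gdeg H h1) \<cdot> ?w x h1 h2 a1 a2"
          by (rule D.lext_tens_hcomp[OF mbil_ssv_pair mult_hcomp[OF t(3) s(3)] mult_hcomp[OF t(4) s(4)]]) simp
        moreover have "ksign ((n - 1) * gdeg B x) * ksign (gdeg B x) *
            (ksign (gdeg H a2 * gdeg H h1) * ksign (gdeg H a1 + gdeg H h1)) = ?k x h1 a1 a2"
          unfolding ksign_add[symmetric] by (rule ksign_cong) auto
        ultimately show "(ksign ((n - 1) * gdeg B x) * ksign (gdeg B x)) \<cdot> ksign (gdeg H a2 * gdeg H h1) \<cdot>
            lext ?\<gamma> (tens H H (a1 \<otimes> h1) (a2 \<otimes> h2)) = ?k x h1 a1 a2 \<cdot> ?w x h1 h2 a1 a2"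
          by simp
      qed
    qed
    also have "\<dots> = lext (\<lambda>(h1, h2). ?\<beta> x h1 h2) (comult H h)"
      unfolding split_def by (rule lext_swap)
    finally show ?thesis .
  qed
  have E: "ksign ((n - 1) * gdeg B x) \<cdot> lext (\<lambda>(x', h'). ksign (gdeg B x') \<cdot>
      (x' \<boxtimes> (ssv h' \<star> ssv (a \<otimes> h)))) (\<nu> x) = lext (\<lambda>(x', h'). ?G1 x' h' h) (\<nu> x)"
    if x: "x \<in> hcomp B (gdeg B x)" for h x
  proof (subst lext_fun_scale[symmetric], rule lext_cong, clarify)
    fix x' h' assume "\<nu> x (x', h') \<noteq> 0"
    note s = N.nu_supp[OF x this]
    have "ksign ((n - 1) * gdeg B x) * ksign (gdeg B x') =
        (ksign (n * gdeg B x' + n * gdeg H h' + gdeg H h') :: 'r)"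
      unfolding ksign_add[symmetric] s(7) by (rule ksign_cong) (simp, argo)
    then show "ksign ((n - 1) * gdeg B x) \<cdot> ksign (gdeg B x') \<cdot> (x' \<boxtimes> (ssv h' \<star> ssv (a \<otimes> h))) = ?G1 x' h' h"
      by simp
  qed
  have C: "?\<beta> x h h' = ?M x h h' + (?G1 x h h' + ?G2 x h h')" if "h \<in> carrier H" "h' \<in> carrier H" for x h h'
    using comult_split[OF a mbil_pair[OF that] mbil_pair[OF that],
        of "\<lambda>a1 a2. ?k x h a1 a2 \<cdot> ?w x h h' a1 a2" "ksign (n * gdeg B x + n * gdeg H h + gdeg H h)" x
          "ksign (n * gdeg B x + n + gdeg H h)" x] that
    by simp
  \<comment> \<open>The overall minus sign of the twisting enters here, through the parity of n - 1
    as against n; |x| = |x'| + |h'| brings the sign into the form found in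
    \<open>?G2\<close>.\<close>
  have F: "- (ksign (n - 1) \<cdot> ksign (gdeg B x) \<cdot> rmul B (cobar H) (letter n a x) (ssv h)) =
      lext (\<lambda>(x', h'). ?G2 x' h' h) (\<nu> x)"
    if x: "x \<in> hcomp B (gdeg B x)" for h x
    unfolding rmul_letter[OF B.hcomp_carrier[OF x] ssv_W ac] fscale_fscale
  proof (subst lext_fun_scale[symmetric], subst lext_fun_minus[symmetric], rule lext_cong, clarify)
    fix x' h' assume "\<nu> x (x', h') \<noteq> 0"
    note s = N.nu_supp[OF x this]
    have "ksign (n - 1) * ksign (gdeg B x) * ksign ((n - 1) * gdeg B x') =
        (- ksign (n * gdeg B x' + n + gdeg H h') :: 'r)"
      unfolding ksign_add[symmetric] s(7) by (rule ksign_neg) (simp, argo)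
    then show "- ((ksign (n - 1) * ksign (gdeg B x)) \<cdot> ksign ((n - 1) * gdeg B x') \<cdot>
        (x' \<boxtimes> (ssv (a \<otimes> h') \<star> ssv h))) = ?G2 x' h' h"
      by simp
  qed
  have D: "lext (\<lambda>(x, h). lext (\<lambda>(x', h'). ?M x' h' h) (\<nu> x)) (\<nu> b) =
    lext (\<lambda>(a1, a2). ksign (gdeg H a1) \<cdot> \<tau> (ssv a1 \<star> ssv a2) b) (comult H a)"
  proof -
    have "lext (\<lambda>(a1, a2). ksign (gdeg H a1) \<cdot> \<tau> (ssv a1 \<star> ssv a2) b) (comult H a) =
      lext (\<lambda>p. lext (\<lambda>q. lext (\<lambda>q'. ?\<Theta> (fst p) (snd p) (fst q') (snd q') (snd q)) (\<nu> (fst q))) (\<nu> b)) (comult H a)"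
    proof (intro lext_cong, clarify)
      fix a1 a2 assume "comult H a (a1, a2) \<noteq> 0"
      note t = D.nu_supp[OF a(1) this]
      show "ksign (gdeg H a1) \<cdot> \<tau> (ssv a1 \<star> ssv a2) b =
        lext (\<lambda>q. lext (\<lambda>q'. ?\<Theta> (fst (a1, a2)) (snd (a1, a2)) (fst q') (snd q') (snd q)) (\<nu> (fst q))) (\<nu> b)"
      proof (cases "gdeg H a1 > 0 \<and> gdeg H a2 > 0")
        case True
        then have "ksign (gdeg H a1) \<cdot> \<tau> (ssv a1 \<star> ssv a2) b =
          ksign (gdeg H a1) \<cdot> lext (\<lambda>(x, h). lext (\<lambda>(x', h').
            (ksign ((gdeg H a2 - 1) * gdeg B x) * ksign ((gdeg H a1 - 1) * gdeg B x')) \<cdot>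
              ?w x' h' h a1 a2) (\<nu> x)) (\<nu> b)"
          using tau_pair[OF bc t(3) _ t(4)] by simp
        also have "\<dots> = lext (\<lambda>(x, h). lext (\<lambda>(x', h'). ?k x' h' a1 a2 \<cdot> ?w x' h' h a1 a2) (\<nu> x)) (\<nu> b)"
        proof (subst lext_fun_scale[symmetric], rule lext_cong, clarify)
          fix x h assume "\<nu> b (x, h) \<noteq> 0"
          note s = N.nu_supp[OF b this]
          show "ksign (gdeg H a1) \<cdot> lext (\<lambda>(x', h').
            (ksign ((gdeg H a2 - 1) * gdeg B x) * ksign ((gdeg H a1 - 1) * gdeg B x')) \<cdot>
              ?w x' h' h a1 a2) (\<nu> x) = lext (\<lambda>(x', h'). ?k x' h' a1 a2 \<cdot> ?w x' h' h a1 a2) (\<nu> x)"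
          proof (subst lext_fun_scale[symmetric], rule lext_cong, clarify)
            fix x' h' assume "\<nu> x (x', h') \<noteq> 0"
            note s' = N.nu_supp[OF s(3) this]
            have "ksign (gdeg H a1) * (ksign ((gdeg H a2 - 1) * gdeg B x) * ksign ((gdeg H a1 - 1) * gdeg B x')) =
                ?k x' h' a1 a2"
              unfolding ksign_add[symmetric] s'(7) t(7) by (rule ksign_cong) auto
            then show "ksign (gdeg H a1) \<cdot> (ksign ((gdeg H a2 - 1) * gdeg B x) *
                ksign ((gdeg H a1 - 1) * gdeg B x')) \<cdot> ?w x' h' h a1 a2 = ?k x' h' a1 a2 \<cdot> ?w x' h' h a1 a2"
              by simp
          qed
        qed
        finally show ?thesis
          using True by (simp add: split_def)
      next
        case False
        then have "gdeg H a1 = 0 \<or> gdeg H a2 = 0"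
          using hbasis_degree(1)[OF t(1)] hbasis_degree(1)[OF t(2)] by auto
        then have "ssv a1 \<star> ssv a2 = 0"
          using ssv_nonpos[OF t(3)] ssv_nonpos[OF t(4)] by (auto simp: tmult_linear)
        then show ?thesis
          using False by (auto simp: tau_linear)
      qed
    qed
    also have "\<dots> = lext (\<lambda>q. lext (\<lambda>p. lext (\<lambda>q'. ?\<Theta> (fst p) (snd p) (fst q') (snd q') (snd q)) (\<nu> (fst q))) (comult H a)) (\<nu> b)"
      by (rule lext_swap)
    also have "\<dots> = lext (\<lambda>q. lext (\<lambda>q'. lext (\<lambda>p. ?\<Theta> (fst p) (snd p) (fst q') (snd q') (snd q)) (comult H a)) (\<nu> (fst q))) (\<nu> b)"
      by (intro lext_cong lext_swap)
    finally show ?thesis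
      by (simp only: split_def)
  qed
  have "lext (\<lambda>(x, h). ksign ((n - 1) * gdeg B x) \<cdot>
      (- lext (\<lambda>(x', h'). ksign (gdeg B x') \<cdot> (x' \<boxtimes> (ssv h' \<star> ssv (a \<otimes> h)))) (\<nu> x) +
       ksign (gdeg B x) \<cdot> lext (\<lambda>(c, c'). ksign (gdeg H c) \<cdot> (x \<boxtimes> (ssv c \<star> ssv c'))) (comult H (a \<otimes> h)))) (\<nu> b) =
    lext (\<lambda>p. - (case p of (x, h) \<Rightarrow> lext (\<lambda>(x', h'). ?G1 x' h' h) (\<nu> x)) +
      (case p of (x, h) \<Rightarrow> lext (\<lambda>(h1, h2). ?\<beta> x h1 h2) (comult H h))) (\<nu> b)"
  proof (intro lext_cong, clarify)
    fix x h assume "\<nu> b (x, h) \<noteq> 0"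
    note s = N.nu_supp[OF b this]
    show "ksign ((n - 1) * gdeg B x) \<cdot>
      (- lext (\<lambda>(x', h'). ksign (gdeg B x') \<cdot> (x' \<boxtimes> (ssv h' \<star> ssv (a \<otimes> h)))) (\<nu> x) +
       ksign (gdeg B x) \<cdot> lext (\<lambda>(c, c'). ksign (gdeg H c) \<cdot> (x \<boxtimes> (ssv c \<star> ssv c'))) (comult H (a \<otimes> h))) =
      - lext (\<lambda>(x', h'). ?G1 x' h' h) (\<nu> x) + lext (\<lambda>(h1, h2). ?\<beta> x h1 h2) (comult H h)"
      unfolding fscale_add A[OF s(4)] fscale_minus E[OF s(3)] ..
  qed
  also have "\<dots> = - lext (\<lambda>(x, h). lext (\<lambda>(x', h'). ?G1 x' h' h) (\<nu> x)) (\<nu> b) +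
      lext (\<lambda>(x, h). lext (\<lambda>(h1, h2). ?\<beta> x h1 h2) (comult H h)) (\<nu> b)"
    unfolding lext_fun_add lext_fun_minus ..
  also have "lext (\<lambda>(x, h). lext (\<lambda>(h1, h2). ?\<beta> x h1 h2) (comult H h)) (\<nu> b) =
      lext (\<lambda>(x, h). lext (\<lambda>(x', h'). ?\<beta> x' h' h) (\<nu> x)) (\<nu> b)"
    by (rule nu_coassoc[where Y = KB, OF _ bc, symmetric]) (auto intro!: lext_fsupp)
  also have "\<dots> = lext (\<lambda>p. (case p of (x, h) \<Rightarrow> lext (\<lambda>(x', h'). ?M x' h' h) (\<nu> x)) +
      ((case p of (x, h) \<Rightarrow> lext (\<lambda>(x', h'). ?G1 x' h' h) (\<nu> x)) +
       - (ksign (n - 1) \<cdot> (case p of (x, h) \<Rightarrow> ksign (gdeg B x) \<cdot> rmul B (cobar H) (letter n a x) (ssv h))))) (\<nu> b)"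
  proof (intro lext_cong, clarify)
    fix x h assume "\<nu> b (x, h) \<noteq> 0"
    note s = N.nu_supp[OF b this]
    have "lext (\<lambda>(x', h'). ?\<beta> x' h' h) (\<nu> x) = lext (\<lambda>p. (case p of (x', h') \<Rightarrow> ?M x' h' h) +
        ((case p of (x', h') \<Rightarrow> ?G1 x' h' h) + (case p of (x', h') \<Rightarrow> ?G2 x' h' h))) (\<nu> x)"
    proof (intro lext_cong, clarify)
      fix x' h' assume "\<nu> x (x', h') \<noteq> 0"
      then have "h' \<in> carrier H"
        using N.nu_basis[OF s(5)] by auto
      then show "?\<beta> x' h' h = ?M x' h' h + (?G1 x' h' h + ?G2 x' h' h)"
        by (rule C[OF _ s(6)])
    qed
    then show "lext (\<lambda>(x', h'). ?\<beta> x' h' h) (\<nu> x) = lext (\<lambda>(x', h'). ?M x' h' h) (\<nu> x) +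
        (lext (\<lambda>(x', h'). ?G1 x' h' h) (\<nu> x) +
         - (ksign (n - 1) \<cdot> ksign (gdeg B x) \<cdot> rmul B (cobar H) (letter n a x) (ssv h)))"
      unfolding lext_fun_add F[OF s(3)] .
  qed
  also have "\<dots> = lext (\<lambda>(x, h). lext (\<lambda>(x', h'). ?M x' h' h) (\<nu> x)) (\<nu> b) +
      (lext (\<lambda>(x, h). lext (\<lambda>(x', h'). ?G1 x' h' h) (\<nu> x)) (\<nu> b) +
       - (ksign (n - 1) \<cdot> lext (\<lambda>(x, h). ksign (gdeg B x) \<cdot> rmul B (cobar H) (letter n a x) (ssv h)) (\<nu> b)))"
    unfolding lext_fun_add lext_fun_minus lext_fun_scale ..
  finally show ?thesis
    unfolding D by (simp add: algebra_simps)
qed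

lemma swap_ok_ssv:
  assumes a: "a \<in> E" and b: "b \<in> hcomp B m"
  shows "Y.swap_ok (ssv a) b"
proof -
  let ?n = "gdeg H a"
  note ah = E_hcomp(1)[OF a] and ac = E_hcomp(4)[OF a] and bc = B.hcomp_carrier[OF b]
  \<comment> \<open>As for left comodule algebras, H_1 = 0 guarantees that the formula for a letter
    may be applied to \<open>dif H a\<close>.\<close>
  have n: "?n > 0" "?n - 1 > 0"
    using E_degree[OF a] by auto
  let ?L = "lext (\<lambda>(a1, a2). ksign (gdeg H a1) \<cdot> \<tau> (ssv a1 \<star> ssv a2) b) (comult H a)"
  let ?R = "lext (\<lambda>(x, h). ksign (gdeg B x) \<cdot> rmul B (cobar H) (letter ?n a x) (ssv h)) (\<nu> b)"
  have "Y.DD (\<tau> (ssv a) b) = lext (\<lambda>p. Y.DD (case p of (x, h) \<Rightarrow>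
      ksign ((?n - 1) * gdeg B x) \<cdot> (x \<boxtimes> ssv (a \<otimes> h)))) (\<nu> b)"
    unfolding tau_ssv[OF ah n(1) bc] letter_def using N.nu_fsupp[OF bc] by (rule Y.DD_lext) auto
  also have "\<dots> = lext (\<lambda>p. (case p of (x, h) \<Rightarrow> ksign ((?n - 1) * gdeg B x) \<cdot>
      (dif B x \<boxtimes> ssv (a \<otimes> h) + - (ksign (gdeg B x) \<cdot> (x \<boxtimes> ssv (dif H (a \<otimes> h)))))) +
    (case p of (x, h) \<Rightarrow> ksign ((?n - 1) * gdeg B x) \<cdot>
      (- lext (\<lambda>(x', h'). ksign (gdeg B x') \<cdot> (x' \<boxtimes> (ssv h' \<star> ssv (a \<otimes> h)))) (\<nu> x) +
       ksign (gdeg B x) \<cdot> lext (\<lambda>(c, c'). ksign (gdeg H c) \<cdot> (x \<boxtimes> (ssv c \<star> ssv c'))) (comult H (a \<otimes> h))))) (\<nu> b)"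
  proof (intro lext_cong, clarify)
    fix x h assume "\<nu> b (x, h) \<noteq> 0"
    note s = N.nu_supp[OF b this]
    have ha: "a \<otimes> h \<in> carrier H"
      using ac s by simp
    show "Y.DD (ksign ((?n - 1) * gdeg B x) \<cdot> (x \<boxtimes> ssv (a \<otimes> h))) =
      ksign ((?n - 1) * gdeg B x) \<cdot>
      (dif B x \<boxtimes> ssv (a \<otimes> h) + - (ksign (gdeg B x) \<cdot> (x \<boxtimes> ssv (dif H (a \<otimes> h))))) +
      ksign ((?n - 1) * gdeg B x) \<cdot>
      (- lext (\<lambda>(x', h'). ksign (gdeg B x') \<cdot> (x' \<boxtimes> (ssv h' \<star> ssv (a \<otimes> h)))) (\<nu> x) +
       ksign (gdeg B x) \<cdot> lext (\<lambda>(c, c'). ksign (gdeg H c) \<cdot> (x \<boxtimes> (ssv c \<star> ssv c'))) (comult H (a \<otimes> h)))"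
      unfolding fscale_add[symmetric] Y.DD_linear(3)[OF T.tens_fsupp] DD_wt[OF s(3) ssv_W]
        d\<Omega>_ssv[OF ha] wt_CG[OF ha]
      by (simp add: fscale_diff algebra_simps)
  qed
  also have "\<dots> = (- letter (?n - 1) (dif H a) b + ksign (?n - 1) \<cdot> letter ?n a (dif B b)) +
      (?L + - (ksign (?n - 1) \<cdot> ?R))"
    unfolding lext_fun_add swap_linear[OF ah b] swap_quadratic[OF ah n(1) b] ..
  also have "letter ?n a (dif B b) = T.iV (ssv a) \<diamondop> T.iU (dif B b)"
    using bc tau_ssv[OF ah n(1)] by (simp add: X.tau_eq W_carrier)
  also have "?R = T.iV (ssv a) \<diamondop> RR b"
  proof -
    have "T.iV (ssv a) \<diamondop> RR b = lext (\<lambda>p. T.iV (ssv a) \<diamondop> (case p of (x, h) \<Rightarrow>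
        ksign (gdeg B x) \<cdot> (x \<boxtimes> ssv h))) (\<nu> b)"
      unfolding RR_def using N.nu_fsupp[OF bc] by (rule X.tmul_lext_right) auto
    also have "\<dots> = ?R"
    proof (intro lext_cong, clarify)
      fix x h assume "\<nu> b (x, h) \<noteq> 0"
      then have x: "x \<in> carrier B"
        using N.nu_basis[OF bc] by auto
      then show "T.iV (ssv a) \<diamondop> (ksign (gdeg B x) \<cdot> (x \<boxtimes> ssv h)) =
          ksign (gdeg B x) \<cdot> rmul B (cobar H) (letter ?n a x) (ssv h)"
        using tau_ssv[OF ah n(1) x] by (simp add: X.tmul_linear X.tmul_tens W_carrier T.lmul_one)
    qed
    finally show ?thesis ..
  qed
  also have "?L = \<tau> (CG a) b + letter (?n - 1) (dif H a) b"
  proof -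
    let ?\<beta> = "\<lambda>(x, y). ksign (gdeg H x) \<cdot> (ssv x \<star> ssv y)"
    have L: "lext ?\<beta> (comult H a) \<in> W"
      by (intro lext_fsupp) (auto intro!: tmult_fsupp)
    have "\<tau> (lext ?\<beta> (comult H a)) b = lext (\<lambda>p. \<tau> (?\<beta> p) b) (comult H a)"
      using D.nu_fsupp[OF ac] by (rule tau_lext) (auto intro!: tmult_fsupp)
    also have "\<dots> = ?L"
      by (intro lext_cong) (auto simp: tau_linear tmult_fsupp)
    finally show ?thesis
      using L tau_ssv[OF dif_hcomp[OF ah] n(2) bc] tau_linear(2)[of "- ssv (dif H a)" "lext ?\<beta> (comult H a)" b]
      by (simp add: CG_def tau_linear)
  qed
  also have "\<tau> (CG a) b = DV (ssv a) \<diamondop> T.iU b"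
    using bc ac by (simp add: DV_def d\<Omega>_ssv X.tau_eq W_carrier)
  finally show ?thesis
    using bc Y.sg_iV[OF ssv_hcomp[OF ah]] DU_tmul(2)[OF bc, of "T.iV (ssv a)"]
    by (simp add: Y.swap_ok_def X.tmul_linear fscale_diff)
qed

lemma swap_ok:
  assumes b: "b \<in> carrier B" and w: "w \<in> W"
  shows "Y.swap_ok w b"
proof -
  have letter: "Y.swap_ok (delta [a]) b" if "a \<in> E" "b \<in> carrier B" for a b
    using that(2)
  proof (induction rule: B.carrier_induct)
    case (add x y)
    then show ?case
      using that(1) by (intro Y.swap_ok_linear) (auto intro!: W_carrier)
  next
    case (hcomp n x)
    then show ?case
      using swap_ok_ssv[OF that(1) hcomp] ssv_E[OF that(1)] by simp
  qed
  have words: "Y.swap_ok (delta as) b" if "as \<in> lists E" "b \<in> carrier B" for as b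
    using that
  proof (induction as arbitrary: b rule: list.induct)
    case Nil
    then show ?case
      using Y.swap_ok_one(2) by (simp add: cobar_simps)
  next
    case (Cons a as)
    have "Y.swap_ok (delta [a] \<otimes>\<^bsub>cobar H\<^esub> delta as) b"
      using Cons letter by (intro Y.swap_ok_mult_left) (auto intro!: W_carrier delta_fsupp)
    then show ?case
      by (simp add: cobar_simps delta_tmult)
  qed
  show ?thesis
    using w
  proof (induction rule: fsupp_induct)
    case zero
    then show ?case
      using Y.swap_ok_linear_left(2)[OF _ _ b words[of "[]"], of "delta []" 0] b
      by (simp add: cobar_simps)
  next
    case (add z z')
    then show ?case
      using Y.swap_ok_linear_left(1)[OF _ _ b, of z z'] by (simp add: cobar_simps)
  next
    case (scale r z)
    then show ?case
      using Y.swap_ok_linear_left(2)[OF _ _ b, of z z r] by (simp add: cobar_simps)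
  qed (rule words[OF _ b])
qed

section \<open>The chain algebra B \<otimes> \<Omega>H\<close>

lemma right_dif_eq:
  assumes "z \<in> T.K"
  shows "right_dif H B z = Y.DD z"
proof -
  have "right_dif H B z = lext (\<lambda>(b, w). Y.DD (b \<boxtimes> w)) z"
    unfolding right_dif_def
  proof (intro lext_cong, clarify)
    fix b w assume "z (b, w) \<noteq> 0"
    from T.K_hbasis[OF assms this]
    have wb: "b \<in> hcomp B (gdeg B b)" "w \<in> W" "b \<in> carrier B"
      using B.hbasis_hcomp C.hbasis_carrier by (auto simp: C.carrier_eq)
    have "lext (\<lambda>(b', h). ksign (gdeg B b') \<cdot> (b' \<boxtimes> (sinv H h \<star> w))) (\<nu> b) =
      lext (\<lambda>(b', h). ksign (gdeg B b') \<cdot> (b' \<boxtimes> (ssv h \<star> w))) (\<nu> b)"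
      using N.nu_basis[OF wb(3)] by (intro lext_cong) (auto simp: sinv_hbasis)
    then show "dif B b \<boxtimes> w + ksign (gdeg B b) \<cdot> (b \<boxtimes> dif (cobar H) w) -
        lext (\<lambda>(b', h). ksign (gdeg B b') \<cdot> (b' \<boxtimes> (sinv H h \<star> w))) (\<nu> b) = Y.DD (b \<boxtimes> w)"
      using DD_wt[OF wb(1,2)] by (simp add: cobar_simps)
  qed
  also have "\<dots> = Y.DD (lext (\<lambda>(b, w). b \<boxtimes> w) z)"
    using Y.DD_lext[OF assms, of "\<lambda>(b, w). b \<boxtimes> w"] by (simp add: split_def)
  finally show ?thesis
    by (simp add: T.tens_expand[OF assms])
qed

theorem right_cobar_chain_algebra: "chain_algebra (right_cobar (H, B))"
proof (rule Y.A_chain_algebra)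
  show "Y.swap_ok v u" if "v \<in> carrier (cobar H)" "u \<in> carrier B" for v u
    using that swap_ok by (simp add: cobar_simps)
  show "Y.DD (DV v) = 0" if "v \<in> carrier (cobar H)" for v
    using that DD_DV by (simp add: cobar_simps)
qed (auto simp: DD_DU right_cobar_simps right_dif_eq)

theorem right_cobar_laws: "right_cobar_laws (H, B) (right_cobar (H, B))"
proof -
  have "T.iV (sinv H a) \<diamondop> T.iU b =
      lext (\<lambda>(b', h). ksign ((n - 1) * gdeg B b') \<cdot> (b' \<boxtimes> sinv H (a \<otimes> h))) (\<nu> b)"
    if "n > 0" "a \<in> hcomp H n" "b \<in> carrier B" for n a b
  proof -
    have "T.iV (sinv H a) \<diamondop> T.iU b = letter n a b"
      using that by (simp add: sinv_ssv X.tau_eq W_carrier tau_ssv)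
    also have "\<dots> = lext (\<lambda>(b', h). ksign ((n - 1) * gdeg B b') \<cdot> (b' \<boxtimes> sinv H (a \<otimes> h))) (\<nu> b)"
      unfolding letter_def
    proof (intro lext_cong, clarify)
      fix x h assume "\<nu> b (x, h) \<noteq> 0"
      then have "h \<in> hbasis H"
        using N.nu_basis[OF that(3)] by blast
      then show "ksign ((n - 1) * gdeg B x) \<cdot> (x \<boxtimes> ssv (a \<otimes> h)) =
          ksign ((n - 1) * gdeg B x) \<cdot> (x \<boxtimes> sinv H (a \<otimes> h))"
        using sinv_ssv[OF mult_hcomp[OF that(2) hbasis_hcomp]] by simp
    qed
    finally show ?thesis .
  qed
  then show ?thesis
    using right_cobar_chain_algebra Y.iU_gralg_hom Y.iV_gralg_hom
    by (auto simp: right_cobar_laws_def right_cobar_simps X.tens_eq)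
qed

end

section \<open>Naturality for right comodule algebras\<close>

locale right_comod_map = F: hopf_map H H' f + L: right_comod H B + R: right_comod H' B'
  for H :: "('r::comm_ring_1, 'h) chopf" and H' :: "('r, 'k) chopf" and f
    and B :: "('r, 'b, 'h) rcomodalg" and B' :: "('r, 'c, 'k) rcomodalg" +
  fixes g :: "'b \<Rightarrow> 'c"
  assumes g_hom: "chain_algebra_hom B B' g"
    and coact_hom: "b \<in> carrier B \<Longrightarrow> tensor_map B' H' g f (rcoact B b) = rcoact B' (g b)"
begin

sublocale g: chain_alg_hom B B' g
  using g_hom by unfold_locales

sublocale Z: twisted_map B "cobar H" L.\<tau> "right_cobar (H, B)" L.DU L.DV
    B' "cobar H'" R.\<tau> "right_cobar (H', B')" R.DU R.DV g F.\<phi>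
  using F.phi_gralg_hom g_hom by unfold_locales (simp_all add: chain_algebra_hom_def)

lemma coact_lext:
  assumes "b \<in> carrier B"
  shows "lext \<gamma> (rcoact B' (g b)) = lext (\<lambda>(x, h). lext \<gamma> (tens B' H' (g x) (f h))) (rcoact B b)"
proof -
  have "lext \<gamma> (rcoact B' (g b)) = lext (\<lambda>p. lext \<gamma> (case p of (x, h) \<Rightarrow> tens B' H' (g x) (f h))) (rcoact B b)"
    unfolding coact_hom[OF assms, symmetric] tensor_map_def
    using L.N.nu_fsupp[OF assms] by (rule lext_lext[where Y = "hbasis B' \<times> hbasis H'"]) auto
  then show ?thesis
    by (simp add: split_def)
qed

lemma TT_letter:
  assumes a: "a \<in> hcomp H n" and b: "b \<in> carrier B"
  shows "Z.TT (L.letter n a b) = R.letter n (f a) (g b)"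
proof -
  have "Z.TT (L.letter n a b) = lext (\<lambda>p. Z.TT (case p of (x, h) \<Rightarrow>
      ksign ((n - 1) * gdeg B x) \<cdot> tens B (cobar H) x (F.X.ssv (a \<otimes>\<^bsub>H\<^esub> h)))) (rcoact B b)"
    unfolding L.letter_def using L.N.nu_fsupp[OF b] by (rule Z.TT_lext) auto
  also have "\<dots> = R.letter n (f a) (g b)"
    unfolding R.letter_def coact_lext[OF b]
  proof (intro lext_cong, clarify)
    fix x h assume "rcoact B b (x, h) \<noteq> 0"
    from L.N.nu_basis[OF b this]
    have hx: "h \<in> hcomp H (gdeg H h)" "x \<in> hcomp B (gdeg B x)" "h \<in> carrier H" "x \<in> carrier B"
      using F.X.hbasis_hcomp L.B.hbasis_hcomp by auto
    note ac = F.X.hcomp_carrier[OF a]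
    have "lext (\<lambda>(x, h). ksign ((n - 1) * gdeg B' x) \<cdot> tens B' (cobar H') x (F.Y.ssv (f a \<otimes>\<^bsub>H'\<^esub> h)))
        (tens B' H' (g x) (f h)) =
      ksign ((n - 1) * gdeg B x) \<cdot> tens B' (cobar H') (g x) (F.Y.ssv (f a \<otimes>\<^bsub>H'\<^esub> f h))"
      by (rule R.N.lext_tens_hcomp[OF R.mbil_letter[OF F.f.hom_closed[OF ac]]
            g.hom_hcomp[OF hx(2)] F.f.hom_hcomp[OF hx(1)]]) simp
    then show "Z.TT (ksign ((n - 1) * gdeg B x) \<cdot> tens B (cobar H) x (F.X.ssv (a \<otimes>\<^bsub>H\<^esub> h))) =
      lext (\<lambda>(x, h). ksign ((n - 1) * gdeg B' x) \<cdot> tens B' (cobar H') x (F.Y.ssv (f a \<otimes>\<^bsub>H'\<^esub> h)))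
        (tens B' H' (g x) (f h))"
      using hx ac by (simp add: Z.TT_linear Z.TT_tens F.X.W_carrier F.phi_ssv F.f.hom_mult)
  qed
  finally show ?thesis .
qed

lemma tau_ok:
  assumes b: "b \<in> carrier B" and w: "w \<in> F.X.W"
  shows "Z.tau_ok w b"
proof -
  have letter: "Z.tau_ok (delta [a]) b" if a: "a \<in> F.X.E" "b \<in> carrier B" for a b
  proof -
    note ah = F.X.E_hcomp[OF a(1)]
    have "gdeg H a > 0"
      using ah(2) by simp
    then show ?thesis
      using F.phi_ssv[OF ah(4)] a(2) TT_letter[OF ah(1) a(2)] L.tau_ssv[OF ah(1) _ a(2)]
        R.tau_ssv[OF F.f.hom_hcomp[OF ah(1)] _ g.hom_closed[OF a(2)]] F.X.ssv_E[OF a(1)]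
      by (simp add: Z.tau_ok_def)
  qed
  have words: "Z.tau_ok (delta as) b" if "as \<in> lists F.X.E" "b \<in> carrier B" for as b
    using that
  proof (induction as arbitrary: b rule: list.induct)
    case Nil
    then show ?case
      using Z.tau_ok_one(2) by (simp add: cobar_simps)
  next
    case (Cons a as)
    have "Z.tau_ok (delta [a] \<otimes>\<^bsub>cobar H\<^esub> delta as) b"
      using Cons letter by (intro Z.tau_ok_mult_left) (auto intro!: F.X.W_carrier delta_fsupp)
    then show ?case
      by (simp add: cobar_simps delta_tmult)
  qed
  show ?thesis
    using w
  proof (induction rule: fsupp_induct)
    case zero
    then show ?case
      using Z.tau_ok_linear_left(2)[OF _ _ b words[of "[]"], of "delta []" 0] b
      by (simp add: cobar_simps)
  next
    case (add z z')
    then show ?case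
      using Z.tau_ok_linear_left(1)[OF _ _ b, of z z'] by (simp add: cobar_simps)
  next
    case (scale r z)
    then show ?case
      using Z.tau_ok_linear_left(2)[OF _ _ b, of z z r] by (simp add: cobar_simps)
  qed (rule words[OF _ b])
qed

lemma TT_RR:
  assumes b: "b \<in> carrier B"
  shows "Z.TT (L.RR b) = R.RR (g b)"
proof -
  have "Z.TT (L.RR b) = lext (\<lambda>p. Z.TT (case p of (x, h) \<Rightarrow>
      ksign (gdeg B x) \<cdot> tens B (cobar H) x (F.X.ssv h))) (rcoact B b)"
    unfolding L.RR_def using L.N.nu_fsupp[OF b] by (rule Z.TT_lext) auto
  also have "\<dots> = R.RR (g b)"
    unfolding R.RR_def coact_lext[OF b]
  proof (intro lext_cong, clarify)
    fix x h assume "rcoact B b (x, h) \<noteq> 0"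
    from L.N.nu_basis[OF b this]
    have hx: "h \<in> hcomp H (gdeg H h)" "x \<in> hcomp B (gdeg B x)" "h \<in> carrier H" "x \<in> carrier B"
      using F.X.hbasis_hcomp L.B.hbasis_hcomp by auto
    have "lext (\<lambda>(x, h). ksign (gdeg B' x) \<cdot> tens B' (cobar H') x (F.Y.ssv h)) (tens B' H' (g x) (f h)) =
      ksign (gdeg B x) \<cdot> tens B' (cobar H') (g x) (F.Y.ssv (f h))"
      by (rule R.N.lext_tens_hcomp[OF R.mbil_wt_ssv g.hom_hcomp[OF hx(2)] F.f.hom_hcomp[OF hx(1)]]) simp
    then show "Z.TT (ksign (gdeg B x) \<cdot> tens B (cobar H) x (F.X.ssv h)) =
      lext (\<lambda>(x, h). ksign (gdeg B' x) \<cdot> tens B' (cobar H') x (F.Y.ssv h)) (tens B' H' (g x) (f h))"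
      using hx by (simp add: Z.TT_linear Z.TT_tens F.X.W_carrier F.phi_ssv)
  qed
  finally show ?thesis .
qed

theorem right_cobar_map_hom:
  "chain_algebra_hom (right_cobar (H, B)) (right_cobar (H', B')) (right_cobar_map (H', B') (f, g))"
proof -
  have "chain_algebra_hom (right_cobar (H, B)) (right_cobar (H', B')) Z.TT"
  proof (rule Z.TT_chain_algebra_hom)
    show "Z.tau_ok v u" if "v \<in> carrier (cobar H)" "u \<in> carrier B" for v u
      using that tau_ok by (simp add: cobar_simps)
    show "Z.TT (L.DV v) = R.DV (F.\<phi> v)" if "v \<in> carrier (cobar H)" for v
      using that F.phi_dif by (simp add: L.DV_def R.DV_def Z.TT_tens cobar_simps g.hom_one)
    show "Z.TT (L.DU u) = R.DU (g u)" if u: "u \<in> carrier B" for u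
      using u Z.TT_linear(3)[OF L.RR_K[OF u], of "- 1"] Z.TT_linear(2)[of "L.T.iU (dif B u)" "- L.RR u"]
      by (simp add: L.DU_def R.DU_def TT_RR Z.TT_tens Z.psi_one g.hom_dif)
  qed (auto simp: L.right_cobar_simps R.right_cobar_simps L.right_dif_eq R.right_dif_eq)
  then show ?thesis
    by (simp add: right_cobar_map_def)
qed

end

section \<open>Functoriality\<close>

lemma chain_algebra_hom_comp:
  assumes "chain_algebra_hom A B f" "chain_algebra_hom B C g"
  shows "chain_algebra_hom A C (g \<circ> f)"
  using assms unfolding chain_algebra_hom_def gralg_hom_def graded_linear_def ring_hom_def
  by (auto simp: Pi_iff)

text \<open>The composites are compared pointwise on carriers because functoriality of the cobar
  construction is available only there.\<close>

lemma tensor_map_comp: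
  assumes "alg_tensor U V" "alg_tensor U' V'" "alg_tensor U'' V''"
    and \<phi>: "gralg_hom U U' \<phi>" and \<psi>: "gralg_hom V V' \<psi>"
    and \<phi>': "gralg_hom U' U'' \<phi>'" and \<psi>': "gralg_hom V' V'' \<psi>'"
    and \<phi>'': "\<And>u. u \<in> carrier U \<Longrightarrow> \<phi>'' u = \<phi>' (\<phi> u)" and \<psi>'': "\<And>v. v \<in> carrier V \<Longrightarrow> \<psi>'' v = \<psi>' (\<psi> v)"
    and z: "z \<in> carrier (tensor U V)"
  shows "tensor_map U'' V'' \<phi>'' \<psi>'' z = tensor_map U'' V'' \<phi>' \<psi>' (tensor_map U' V' \<phi> \<psi> z)"
proof -
  interpret X: alg_tensor U V by fact
  interpret Y: alg_tensor U' V' by fact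
  interpret Z: alg_tensor U'' V'' by fact
  have K: "z \<in> X.K"
    using z by (simp add: X.T.carrier_eq)
  have tens: "tensor_map U'' V'' \<phi>' \<psi>' (tens U' V' u v) = tens U'' V'' (\<phi>' u) (\<psi>' v)"
    if "u \<in> carrier U'" "v \<in> carrier V'" for u v
    unfolding tensor_map_def using \<phi>' \<psi>' that
    by (intro Y.lext_tens[where Y = "hbasis U'' \<times> hbasis V''"])
      (auto intro!: mbilI mlinI simp: Z.tens_add Z.tens_smult gralg_hom_def graded_linear_def ring_hom_def Pi_iff)
  have "tensor_map U'' V'' \<phi>' \<psi>' (tensor_map U' V' \<phi> \<psi> z) =
    lext (\<lambda>p. tensor_map U'' V'' \<phi>' \<psi>' (case p of (u, v) \<Rightarrow> tens U' V' (\<phi> u) (\<psi> v))) z"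
    unfolding tensor_map_def using K by (rule lext_lext[where Y = "hbasis U' \<times> hbasis V'"]) auto
  also have "\<dots> = tensor_map U'' V'' \<phi>'' \<psi>'' z"
    unfolding tensor_map_def[of _ _ \<phi>'' \<psi>'']
  proof (intro lext_cong, clarify)
    fix u v assume "z (u, v) \<noteq> 0"
    then have "u \<in> carrier U" "v \<in> carrier V"
      using X.K_hbasis[OF K] by auto
    then show "tensor_map U'' V'' \<phi>' \<psi>' (tens U' V' (\<phi> u) (\<psi> v)) = tens U'' V'' (\<phi>'' u) (\<psi>'' v)"
      using tens[of "\<phi> u" "\<psi> v"] \<phi> \<psi> \<phi>'' \<psi>'' by (simp add: gralg_hom_def graded_linear_def Pi_iff)
  qed
  finally show ?thesis ..
qed

text \<open>The comultiplication is the only point that needs an argument; it follows from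
  functoriality of the tensor product of maps.\<close>

lemma hopf_map_comp:
  assumes "hopf_map H H' f" "hopf_map H' H'' f'"
  shows "hopf_map H H'' (f' \<circ> f)"
proof -
  interpret f: hopf_map H H' f by fact
  interpret f': hopf_map H' H'' f' by fact
  have "tensor_map H'' H'' (f' \<circ> f) (f' \<circ> f) (comult H c) = comult H'' ((f' \<circ> f) c)" if c: "c \<in> carrier H" for c
  proof -
    have "tensor_map H'' H'' (f' \<circ> f) (f' \<circ> f) (comult H c) =
      tensor_map H'' H'' f' f' (tensor_map H' H' f f (comult H c))"
      using f.hopf_hom f'.hopf_hom f.X.D.nu_fsupp[OF c]
      by (intro tensor_map_comp[of H H H' H' H'' H''])
        (auto intro: alg_tensor.intro f.X.graded_free_alg_axioms f.Y.graded_free_alg_axioms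
          f'.Y.graded_free_alg_axioms simp: chain_hopf_algebra_hom_def chain_algebra_hom_def tensor_simps)
    then show ?thesis
      using c f.hopf_hom f'.hopf_hom f.f.hom_closed[OF c] by (simp add: chain_hopf_algebra_hom_def)
  qed
  then have "chain_hopf_algebra_hom H H'' (f' \<circ> f)"
    using f.hopf_hom f'.hopf_hom f.f.hom_closed
    by (auto simp: chain_hopf_algebra_hom_def intro: chain_algebra_hom_comp)
  then show ?thesis
    by unfold_locales
qed

text \<open>This and the next three equivalences translate between the predicates of the categories
  and the locales in which the constructions were carried out.\<close>

lemma CAl_obj_iff: "CAl_obj (H, B) \<longleftrightarrow> left_comod H B"
  by (simp add: CAl_obj_def left_comod_def left_comod_axioms_def hopf_def)

lemma CAl_hom_iff: "CAl_hom (H, B) (H', B') (f, g) \<longleftrightarrow> left_comod_map H H' f B B' g"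
  by (auto simp: CAl_hom_def CAl_obj_def left_comod_map_def left_comod_map_axioms_def hopf_map_def
      hopf_map_axioms_def left_comod_def left_comod_axioms_def hopf_def)

lemma CAr_obj_iff: "CAr_obj (H, B) \<longleftrightarrow> right_comod H B"
  by (simp add: CAr_obj_def right_comod_def right_comod_axioms_def hopf_def)

lemma CAr_hom_iff: "CAr_hom (H, B) (H', B') (f, g) \<longleftrightarrow> right_comod_map H H' f B B' g"
  by (auto simp: CAr_hom_def CAr_obj_def right_comod_map_def right_comod_map_axioms_def hopf_map_def
      hopf_map_axioms_def right_comod_def right_comod_axioms_def hopf_def)

lemma left_cobar_map_id:
  assumes "left_comod H B" "z \<in> carrier (left_cobar (H, B))"
  shows "left_cobar_map (H, B) CA_id z = z"
proof -
  interpret left_comod H B by fact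
  show ?thesis
    unfolding left_cobar_map_def CA_id_def prod.case
    using assms(2) by (intro T.tensor_map_id) (simp_all add: cobar_map_id left_cobar_simps T.T.carrier_eq cobar_simps)
qed

lemma right_cobar_map_id:
  assumes "right_comod H B" "z \<in> carrier (right_cobar (H, B))"
  shows "right_cobar_map (H, B) CA_id z = z"
proof -
  interpret right_comod H B by fact
  show ?thesis
    unfolding right_cobar_map_def CA_id_def prod.case
    using assms(2) by (intro T.tensor_map_id) (simp_all add: cobar_map_id right_cobar_simps T.T.carrier_eq cobar_simps)
qed

lemma left_cobar_map_comp:
  assumes "left_comod_map H H' f B B' g" "left_comod_map H' H'' f' B' B'' g'"
    and z: "z \<in> carrier (left_cobar (H, B))"
  shows "left_cobar_map (H'', B'') (CA_comp (f', g') (f, g)) z =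
    left_cobar_map (H'', B'') (f', g') (left_cobar_map (H', B') (f, g) z)"
proof -
  interpret f: left_comod_map H H' f B B' g by fact
  interpret f': left_comod_map H' H'' f' B' B'' g' by fact
  show ?thesis
    unfolding left_cobar_map_def CA_comp_def prod.case
  proof (rule tensor_map_comp[OF f.L.T.alg_tensor_axioms f.R.T.alg_tensor_axioms f'.R.T.alg_tensor_axioms
        f.F.phi_gralg_hom _ f'.F.phi_gralg_hom])
    show "gralg_hom B B' g" "gralg_hom B' B'' g'"
      using f.g_hom f'.g_hom by (auto simp: chain_algebra_hom_def)
    show "cobar_map H'' (f' \<circ> f) w = cobar_map H'' f' (cobar_map H' f w)" if "w \<in> carrier (cobar H)" for w
      by (rule cobar_map_comp[OF f.F.hopf_map_axioms f'.F.hopf_map_axioms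
            hopf_map_comp[OF f.F.hopf_map_axioms f'.F.hopf_map_axioms] _ that]) simp
  qed (use z in \<open>simp_all add: f.L.left_cobar_simps\<close>)
qed

lemma right_cobar_map_comp:
  assumes "right_comod_map H H' f B B' g" "right_comod_map H' H'' f' B' B'' g'"
    and z: "z \<in> carrier (right_cobar (H, B))"
  shows "right_cobar_map (H'', B'') (CA_comp (f', g') (f, g)) z =
    right_cobar_map (H'', B'') (f', g') (right_cobar_map (H', B') (f, g) z)"
proof -
  interpret f: right_comod_map H H' f B B' g by fact
  interpret f': right_comod_map H' H'' f' B' B'' g' by fact
  show ?thesis
    unfolding right_cobar_map_def CA_comp_def prod.case
  proof (rule tensor_map_comp[OF f.L.T.alg_tensor_axioms f.R.T.alg_tensor_axioms f'.R.T.alg_tensor_axioms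
        _ f.F.phi_gralg_hom _ f'.F.phi_gralg_hom])
    show "gralg_hom B B' g" "gralg_hom B' B'' g'"
      using f.g_hom f'.g_hom by (auto simp: chain_algebra_hom_def)
    show "cobar_map H'' (f' \<circ> f) w = cobar_map H'' f' (cobar_map H' f w)" if "w \<in> carrier (cobar H)" for w
      by (rule cobar_map_comp[OF f.F.hopf_map_axioms f'.F.hopf_map_axioms
            hopf_map_comp[OF f.F.hopf_map_axioms f'.F.hopf_map_axioms] _ that]) simp
  qed (use z in \<open>simp_all add: f.L.right_cobar_simps\<close>)
qed

lemma left_cobar_obj: "CAl_obj X \<Longrightarrow> chain_algebra (left_cobar X)"
  using left_comod.left_cobar_chain_algebra by (cases X) (simp add: CAl_obj_iff)

lemma left_cobar_hom:
  "CAl_hom X X' \<phi> \<Longrightarrow> chain_algebra_hom (left_cobar X) (left_cobar X') (left_cobar_map X' \<phi>)"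
  using left_comod_map.left_cobar_map_hom by (cases X; cases X'; cases \<phi>) (simp add: CAl_hom_iff)

lemma Cotor_l_obj:
  assumes "CAl_obj X"
  shows "left_cobar_laws X (left_cobar X) \<and> graded_algebra (Cotor_l X)"
proof -
  interpret chain_alg "left_cobar X"
    using left_cobar_obj[OF assms] by unfold_locales
  show ?thesis
    using assms left_comod.left_cobar_laws homology_graded_algebra
    by (cases X) (simp add: CAl_obj_iff Cotor_l_def)
qed

lemma CAl_hom_obj: "CAl_hom X X' \<phi> \<Longrightarrow> CAl_obj X \<and> CAl_obj X'"
  by (cases X; cases X'; cases \<phi>; simp add: CAl_hom_def)

lemma Cotor_l_hom:
  assumes "CAl_hom X X' \<phi>"
  shows "chain_algebra_hom (left_cobar X) (left_cobar X') (left_cobar_map X' \<phi>) \<and>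
    gralg_hom (Cotor_l X) (Cotor_l X') (Cotor_l_map X' \<phi>)"
proof -
  interpret chain_alg_hom "left_cobar X" "left_cobar X'" "left_cobar_map X' \<phi>"
    using assms CAl_hom_obj[OF assms] by unfold_locales (simp_all add: left_cobar_obj left_cobar_hom)
  show ?thesis
    using chain_algebra_hom homology_map_gralg_hom by (simp add: Cotor_l_def Cotor_l_map_def)
qed

lemma Cotor_l_id:
  assumes "CAl_obj X" "x \<in> carrier (Cotor_l X)"
  shows "Cotor_l_map X CA_id x = x"
  using assms left_cobar_map_id unfolding Cotor_l_map_def Cotor_l_def
  by (intro homology_map_id left_cobar_obj; cases X; simp add: CAl_obj_iff)

lemma Cotor_l_comp:
  assumes h: "CAl_hom X X' \<phi>" "CAl_hom X' X'' \<psi>" and x: "x \<in> carrier (Cotor_l X)"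
  shows "Cotor_l_map X'' (CA_comp \<psi> \<phi>) x = Cotor_l_map X'' \<psi> (Cotor_l_map X' \<phi> x)"
  unfolding Cotor_l_map_def
proof (rule homology_map_comp)
  show "chain_algebra (left_cobar X)" "chain_algebra (left_cobar X')" "chain_algebra (left_cobar X'')"
    using CAl_hom_obj[OF h(1)] CAl_hom_obj[OF h(2)] by (simp_all add: left_cobar_obj)
  show "left_cobar_map X'' (CA_comp \<psi> \<phi>) z = left_cobar_map X'' \<psi> (left_cobar_map X' \<phi> z)"
    if "z \<in> carrier (left_cobar X)" for z
    using h that left_cobar_map_comp
    by (cases X; cases X'; cases X''; cases \<phi>; cases \<psi>) (simp add: CAl_hom_iff)
qed (use h x in \<open>simp_all add: left_cobar_hom Cotor_l_def\<close>)

lemma right_cobar_obj: "CAr_obj X \<Longrightarrow> chain_algebra (right_cobar X)"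
  using right_comod.right_cobar_chain_algebra by (cases X) (simp add: CAr_obj_iff)

lemma right_cobar_hom:
  "CAr_hom X X' \<phi> \<Longrightarrow> chain_algebra_hom (right_cobar X) (right_cobar X') (right_cobar_map X' \<phi>)"
  using right_comod_map.right_cobar_map_hom by (cases X; cases X'; cases \<phi>) (simp add: CAr_hom_iff)

lemma Cotor_r_obj:
  assumes "CAr_obj X"
  shows "right_cobar_laws X (right_cobar X) \<and> graded_algebra (Cotor_r X)"
proof -
  interpret chain_alg "right_cobar X"
    using right_cobar_obj[OF assms] by unfold_locales
  show ?thesis
    using assms right_comod.right_cobar_laws homology_graded_algebra
    by (cases X) (simp add: CAr_obj_iff Cotor_r_def)
qed

lemma CAr_hom_obj: "CAr_hom X X' \<phi> \<Longrightarrow> CAr_obj X \<and> CAr_obj X'"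
  by (cases X; cases X'; cases \<phi>; simp add: CAr_hom_def)

lemma Cotor_r_hom:
  assumes "CAr_hom X X' \<phi>"
  shows "chain_algebra_hom (right_cobar X) (right_cobar X') (right_cobar_map X' \<phi>) \<and>
    gralg_hom (Cotor_r X) (Cotor_r X') (Cotor_r_map X' \<phi>)"
proof -
  interpret chain_alg_hom "right_cobar X" "right_cobar X'" "right_cobar_map X' \<phi>"
    using assms CAr_hom_obj[OF assms] by unfold_locales (simp_all add: right_cobar_obj right_cobar_hom)
  show ?thesis
    using chain_algebra_hom homology_map_gralg_hom by (simp add: Cotor_r_def Cotor_r_map_def)
qed

lemma Cotor_r_id:
  assumes "CAr_obj X" "x \<in> carrier (Cotor_r X)"
  shows "Cotor_r_map X CA_id x = x"
  using assms right_cobar_map_id unfolding Cotor_r_map_def Cotor_r_def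
  by (intro homology_map_id right_cobar_obj; cases X; simp add: CAr_obj_iff)

lemma Cotor_r_comp:
  assumes h: "CAr_hom X X' \<phi>" "CAr_hom X' X'' \<psi>" and x: "x \<in> carrier (Cotor_r X)"
  shows "Cotor_r_map X'' (CA_comp \<psi> \<phi>) x = Cotor_r_map X'' \<psi> (Cotor_r_map X' \<phi> x)"
  unfolding Cotor_r_map_def
proof (rule homology_map_comp)
  show "chain_algebra (right_cobar X)" "chain_algebra (right_cobar X')" "chain_algebra (right_cobar X'')"
    using CAr_hom_obj[OF h(1)] CAr_hom_obj[OF h(2)] by (simp_all add: right_cobar_obj)
  show "right_cobar_map X'' (CA_comp \<psi> \<phi>) z = right_cobar_map X'' \<psi> (right_cobar_map X' \<phi> z)"
    if "z \<in> carrier (right_cobar X)" for z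
    using h that right_cobar_map_comp
    by (cases X; cases X'; cases X''; cases \<phi>; cases \<psi>) (simp add: CAr_hom_iff)
qed (use h x in \<open>simp_all add: right_cobar_hom Cotor_r_def\<close>)

text \<open>The functor laws are equations on carriers, since \<open>homology_map\<close> is
  meaningful only on homology classes. Source and target of a morphism have independent type
  variables, so morphisms between objects over different types are included.\<close>

theorem corollary3p8:
  assumes "principal_domain (scalars :: 'r::comm_ring_1 ring)"
  shows
    "(\<forall>X :: ('r, 'h1) chopf \<times> ('r, 'b1, 'h1) lcomodalg.
        CAl_obj X \<longrightarrow> left_cobar_laws X (left_cobar X) \<and> graded_algebra (Cotor_l X)) \<and>
     (\<forall>(X :: ('r, 'h1) chopf \<times> ('r, 'b1, 'h1) lcomodalg)
        (X' :: ('r, 'h2) chopf \<times> ('r, 'b2, 'h2) lcomodalg) \<phi>.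
        CAl_hom X X' \<phi> \<longrightarrow>
          chain_algebra_hom (left_cobar X) (left_cobar X') (left_cobar_map X' \<phi>) \<and>
          gralg_hom (Cotor_l X) (Cotor_l X') (Cotor_l_map X' \<phi>)) \<and>
     (\<forall>X :: ('r, 'h1) chopf \<times> ('r, 'b1, 'h1) lcomodalg.
        CAl_obj X \<longrightarrow> (\<forall>x\<in>carrier (Cotor_l X). Cotor_l_map X CA_id x = x)) \<and>
     (\<forall>(X :: ('r, 'h1) chopf \<times> ('r, 'b1, 'h1) lcomodalg)
        (X' :: ('r, 'h2) chopf \<times> ('r, 'b2, 'h2) lcomodalg)
        (X'' :: ('r, 'h3) chopf \<times> ('r, 'b3, 'h3) lcomodalg) \<phi> \<psi>.
        CAl_hom X X' \<phi> \<and> CAl_hom X' X'' \<psi> \<longrightarrow>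
          (\<forall>x\<in>carrier (Cotor_l X).
             Cotor_l_map X'' (CA_comp \<psi> \<phi>) x = Cotor_l_map X'' \<psi> (Cotor_l_map X' \<phi> x))) \<and>
     (\<forall>X :: ('r, 'h1) chopf \<times> ('r, 'b1, 'h1) rcomodalg.
        CAr_obj X \<longrightarrow> right_cobar_laws X (right_cobar X) \<and> graded_algebra (Cotor_r X)) \<and>
     (\<forall>(X :: ('r, 'h1) chopf \<times> ('r, 'b1, 'h1) rcomodalg)
        (X' :: ('r, 'h2) chopf \<times> ('r, 'b2, 'h2) rcomodalg) \<phi>.
        CAr_hom X X' \<phi> \<longrightarrow>
          chain_algebra_hom (right_cobar X) (right_cobar X') (right_cobar_map X' \<phi>) \<and>
          gralg_hom (Cotor_r X) (Cotor_r X') (Cotor_r_map X' \<phi>)) \<and>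
     (\<forall>X :: ('r, 'h1) chopf \<times> ('r, 'b1, 'h1) rcomodalg.
        CAr_obj X \<longrightarrow> (\<forall>x\<in>carrier (Cotor_r X). Cotor_r_map X CA_id x = x)) \<and>
     (\<forall>(X :: ('r, 'h1) chopf \<times> ('r, 'b1, 'h1) rcomodalg)
        (X' :: ('r, 'h2) chopf \<times> ('r, 'b2, 'h2) rcomodalg)
        (X'' :: ('r, 'h3) chopf \<times> ('r, 'b3, 'h3) rcomodalg) \<phi> \<psi>.
        CAr_hom X X' \<phi> \<and> CAr_hom X' X'' \<psi> \<longrightarrow>
          (\<forall>x\<in>carrier (Cotor_r X).
             Cotor_r_map X'' (CA_comp \<psi> \<phi>) x = Cotor_r_map X'' \<psi> (Cotor_r_map X' \<phi> x)))"
  by (intro conjI allI impI ballI; (elim conjE)?;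
    (rule Cotor_l_obj[THEN conjunct1] Cotor_l_obj[THEN conjunct2]
      Cotor_l_hom[THEN conjunct1] Cotor_l_hom[THEN conjunct2] Cotor_l_id Cotor_l_comp
      Cotor_r_obj[THEN conjunct1] Cotor_r_obj[THEN conjunct2]
      Cotor_r_hom[THEN conjunct1] Cotor_r_hom[THEN conjunct2] Cotor_r_id Cotor_r_comp; assumption))

end
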